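(* Let $0<\beta<\alpha<1$, $\lambda>0$, and let $V_\beta(\lambda)=(V_{k,\beta}(\lambda))$ have law $$\int_0^\infty\mathrm{PD}(\beta|t)\,\frac{e^{-\lambda t^{-\beta}}}{\mathrm{E}_{\beta,1}(-\lambda)}f_\beta(t)\,dt.$$ Let $\mathrm{FRAG}_{\alpha,-\beta}$ be a $\mathrm{PD}(\alpha,-\beta)$ fragmentation operator independent of $V_\beta(\lambda)$. (i) $\tilde V_\alpha(\lambda)=\mathrm{FRAG}_{\alpha,-\beta}(V_\beta(\lambda))\sim\mathrm{PK}_\alpha(\tilde h_{\beta/\alpha}\cdot f_\alpha)$, where $$\tilde h_{\beta/\alpha}(v)=\frac{\mathrm{E}_{\frac{\beta}{\alpha},1}(-\lambda v^{-\beta})}{\mathrm{E}_{\beta,1}(-\lambda)}.$$ (ii) Let $L_{1,\alpha}(\lambda)$ denote the corresponding local time at $1$/$\alpha$-diversity of $\tilde V_\alpha(\lambda)$, with density $\mathrm{E}_{\frac{\beta}{\alpha},1}(-\lambda s^{\beta/\alpha})g_\alpha(s)/\mathrm{E}_{\beta,1}(-\lambda)$. Then $$L_{1,\alpha}(\lambda)\overset{d}{=}\sum_{j=1}^\infty[V_{j,\beta}(\lambda)]^\alpha Z^{(j)}_{\alpha,-\beta},$$ where $(Z^{(j)}_{\alpha,-\beta})_{j\ge1}$ are iid $\mathrm{ML}(\alpha,-\beta)$, independent of $V_\beta(\lambda)$.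
   Context: $\mathcal P_\infty=\{(s_1,s_2,\ldots): s_1\ge s_2\ge\cdots\ge 0,\ \sum_k s_k=1\}$. For $\gamma\in(0,1)$ let $J_1>J_2>\cdots$ be the ranked points of a Poisson process on $(0,\infty)$ with intensity $\frac{\gamma}{\Gamma(1-\gamma)}x^{-\gamma-1}dx$ and $T_\gamma=\sum_i J_i$, a positive $\gamma$-stable variable with $\mathbb{E}[e^{-\lambda T_\gamma}]=e^{-\lambda^\gamma}$ and density $f_\gamma$; $g_\gamma(s)=f_\gamma(s^{-1/\gamma})s^{-1/\gamma-1}/\gamma$ is the density of $T_\gamma^{-\gamma}$. $\mathrm{PD}(\gamma,0)$ is the law of $(J_i/T_\gamma)_i$, $\mathrm{PD}(\gamma|t)$ its regular conditional law given $T_\gamma=t$, and for $h\ge0$ with $\mathbb{E}[h(T_\gamma)]=1$, $\mathrm{PK}_\gamma(h\cdot f_\gamma)=\int_0^\infty \mathrm{PD}(\gamma|t)h(t)f_\gamma(t)\,dt$. For $0\le\gamma<1$, $\theta>-\gamma$, $\mathrm{PD}(\gamma,\theta)$ is the law of the decreasing rearrangement of $(R_k\prod_{j<k}(1-R_j))_{k\ge1}$ with $R_k\sim\mathrm{Beta}(1-\gamma,\theta+k\gamma)$ independent. $\mathrm{FRAG}_{\alpha,-\beta}((P_i))$ is the decreasing rearrangement of all masses $P_i\hat Q^{(i)}_\ell$, $i,\ell\ge1$, where $\hat Q^{(i)}=(\hat Q^{(i)}_\ell)_\ell$ are iid $\mathrm{PD}(\alpha,-\beta)$, independent of $(P_i)$.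 $\mathrm{E}_{\gamma,1}(z)=\sum_{\ell\ge0}z^\ell/\Gamma(\gamma\ell+1)$ is the Mittag-Leffler function; $\mathrm{E}_{\gamma,1}(-\lambda)=\mathbb{E}[e^{-\lambda T_\gamma^{-\gamma}}]$. $\mathrm{ML}(\alpha,\theta)$, $\theta>-\alpha$, has density $s^{\theta/\alpha}g_\alpha(s)/\mathbb{E}[T_\alpha^{-\theta}]$. The $\alpha$-diversity of a random mass partition $P$ is the a.s. limit of $n^{-\alpha}K_n$, where $K_n$ is the number of distinct values among $n$ indices sampled iid, given $P$, from the probabilities $P_i$; for $\alpha$-stable Poisson-Kingman laws it coincides with the local time at $1$, i.e. with $T_\alpha^{-\alpha}$ under $\mathrm{PD}(\alpha,0)$. *)

theory Defs
  imports "HOL-Probability.Probability"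
begin

text \<open>
  Sequences are indexed from 0, so \<open>x k\<close> stands for the \<open>(k+1)\<close>-st term of the usual
  \<open>(x\<^sub>1, x\<^sub>2, \<dots>)\<close>.  Random mass partitions are random elements of the full sequence
  space with its product sigma-algebra; the laws below charge only the set of decreasing
  nonnegative sequences with sum 1, but only almost surely, which is why the space is not
  restricted to that set.
\<close>

abbreviation seq_space :: "(nat \<Rightarrow> real) measure" where
  "seq_space \<equiv> PiM UNIV (\<lambda>_. borel)"

definition point_count :: "('i \<Rightarrow> real) \<Rightarrow> real set \<Rightarrow> ennreal" where
  "point_count x A = emeasure (count_space UNIV) {i. x i \<in> A}"

text \<open>
  The \<open>n\<close>-th largest value (from 0, counted with multiplicity) of a bounded nonnegative
  family with infinite index set.
\<close>

definition ranked :: "('i \<Rightarrow> real) \<Rightarrow> nat \<Rightarrow> real" where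
  "ranked x n = Sup {s. of_nat n < point_count x {s..}}"

lemma ranked_rearrangement:
  fixes y :: "nat \<Rightarrow> real" and e :: "'i \<Rightarrow> nat"
  assumes "decseq y" "bij e"
  shows "ranked (\<lambda>i. y (e i)) = y"
proof
  fix n
  have cnt: "point_count (\<lambda>i. y (e i)) A = point_count y A" for A
  proof -
    have img: "{k. y k \<in> A} = e ` {i. y (e i) \<in> A}"
      using assms(2) by (auto simp: bij_def image_iff)
    have inj: "inj_on e {i. y (e i) \<in> A}"
      using assms(2) by (auto simp: bij_def inj_on_def)
    show ?thesis
      unfolding point_count_def img
      using inj by (simp add: emeasure_count_space finite_image_iff card_image)
  qed
  have "of_nat n < point_count y {s..} \<longleftrightarrow> s \<le> y n" for s
  proof
    assume "s \<le> y n"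
    then have "{..n} \<subseteq> {k. y k \<in> {s..}}"
      using assms(1) by (auto simp: decseq_def intro: order_trans)
    then have "emeasure (count_space UNIV) {..n} \<le> point_count y {s..}"
      unfolding point_count_def by (intro emeasure_mono) auto
    moreover have "emeasure (count_space UNIV) {..n} = of_nat (Suc n)"
      by (simp add: emeasure_count_space)
    moreover have "(of_nat n :: ennreal) < of_nat (Suc n)"
      by (simp only: of_nat_less_iff)
    ultimately show "of_nat n < point_count y {s..}"
      by (metis order_less_le_trans)
  next
    assume *: "of_nat n < point_count y {s..}"
    show "s \<le> y n"
    proof (rule ccontr)
      assume "\<not> s \<le> y n"
      then have "{k. y k \<in> {s..}} \<subseteq> {..<n}"
        using assms(1) by (force simp: decseq_def not_le[symmetric])
      then have "point_count y {s..} \<le> emeasure (count_space UNIV) {..<n}"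
        unfolding point_count_def by (intro emeasure_mono) auto
      also have "\<dots> = of_nat n"
        by (simp add: emeasure_count_space)
      finally show False
        using * by simp
    qed
  qed
  then have "{s. of_nat n < point_count (\<lambda>i. y (e i)) {s..}} = {..y n}"
    unfolding cnt by auto
  then show "ranked (\<lambda>i. y (e i)) n = y n"
    unfolding ranked_def by (simp add: cSup_atMost)
qed

text \<open>
  \<open>X\<close> lists the points (with multiplicity) of a Poisson process with intensity \<open>\<nu>\<close>.
  Taking \<open>A = {..0}\<close>, where the intensity below vanishes, the points are
  almost surely in \<open>(0,\<infinity>)\<close>.
\<close>

definition poisson_process :: "'w measure \<Rightarrow> real measure \<Rightarrow> (nat \<Rightarrow> 'w \<Rightarrow> real) \<Rightarrow> bool" where
  "poisson_process N \<nu> X \<longleftrightarrow>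
     prob_space N \<and>
     (\<forall>i. X i \<in> borel_measurable N) \<and>
     (\<forall>A \<in> sets borel. emeasure \<nu> A < \<infinity> \<longrightarrow>
        (\<forall>k::nat. measure N {\<omega> \<in> space N. point_count (\<lambda>i. X i \<omega>) A = of_nat k}
                   = exp (- measure \<nu> A) * measure \<nu> A ^ k / fact k)) \<and>
     (\<forall>A \<in> sets borel. emeasure \<nu> A = \<infinity> \<longrightarrow>
        (AE \<omega> in N. point_count (\<lambda>i. X i \<omega>) A = \<infinity>)) \<and>
     (\<forall>A :: nat \<Rightarrow> real set. range A \<subseteq> sets borel \<longrightarrow> disjoint_family A \<longrightarrow>
        prob_space.indep_vars N (\<lambda>_. borel) (\<lambda>n \<omega>. point_count (\<lambda>i. X i \<omega>) (A n)) UNIV)"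

definition stable_intensity :: "real \<Rightarrow> real measure" where
  "stable_intensity \<gamma> =
     density lborel (\<lambda>x. ennreal (indicator {0<..} x * (\<gamma> / Gamma (1 - \<gamma>) * x powr (- \<gamma> - 1))))"

definition ranked_stable_points :: "real \<Rightarrow> 'w measure \<Rightarrow> (nat \<Rightarrow> 'w \<Rightarrow> real) \<Rightarrow> bool" where
  "ranked_stable_points \<gamma> N J \<longleftrightarrow>
     poisson_process N (stable_intensity \<gamma>) J \<and> (AE \<omega> in N. \<forall>i. J (Suc i) \<omega> < J i \<omega>)"

definition total_mass :: "(nat \<Rightarrow> 'w \<Rightarrow> real) \<Rightarrow> 'w \<Rightarrow> real" where
  "total_mass J \<omega> = (\<Sum>i. J i \<omega>)"

definition normalized :: "(nat \<Rightarrow> 'w \<Rightarrow> real) \<Rightarrow> 'w \<Rightarrow> nat \<Rightarrow> real" where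
  "normalized J \<omega> = (\<lambda>i. J i \<omega> / total_mass J \<omega>)"

text \<open>\<open>f\<close> is a version of the density \<open>f\<^sub>\<gamma>\<close> of the stable variable \<open>T\<^sub>\<gamma> = total_mass J\<close>.\<close>

definition density_of_total_mass :: "'w measure \<Rightarrow> (nat \<Rightarrow> 'w \<Rightarrow> real) \<Rightarrow> (real \<Rightarrow> real) \<Rightarrow> bool" where
  "density_of_total_mass N J f \<longleftrightarrow>
     (\<forall>t. 0 \<le> f t) \<and> distributed N lborel (total_mass J) (\<lambda>t. ennreal (f t))"

text \<open>
  \<open>K\<close> is a version of the regular conditional law \<open>t \<mapsto> PD(\<gamma>|t)\<close> of the normalized
  points given that their sum equals \<open>t\<close>.
\<close>

definition regular_conditional_PD ::
    "'w measure \<Rightarrow> (nat \<Rightarrow> 'w \<Rightarrow> real) \<Rightarrow> (real \<Rightarrow> (nat \<Rightarrow> real) measure) \<Rightarrow> bool" where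
  "regular_conditional_PD N J K \<longleftrightarrow>
     K \<in> measurable borel (prob_algebra seq_space) \<and>
     (\<forall>A \<in> sets seq_space. \<forall>B \<in> sets borel.
        emeasure N {\<omega> \<in> space N. normalized J \<omega> \<in> A \<and> total_mass J \<omega> \<in> B}
          = (\<integral>\<^sup>+ t. emeasure (K t) A * indicator B t \<partial>distr N borel (total_mass J)))"

text \<open>
  The Poisson-Kingman law \<open>\<integral>\<^sub>0\<^sup>\<infinity> PD(\<gamma>|t) h(t) f\<^sub>\<gamma>(t) dt\<close>, where \<open>K t\<close> is
  \<open>PD(\<gamma>|t)\<close> and \<open>f\<close> is \<open>f\<^sub>\<gamma>\<close>.
\<close>

definition PK ::
    "(real \<Rightarrow> (nat \<Rightarrow> real) measure) \<Rightarrow> (real \<Rightarrow> real) \<Rightarrow> (real \<Rightarrow> real) \<Rightarrow> (nat \<Rightarrow> real) measure" where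
  "PK K f h = bind (density lborel (\<lambda>t. ennreal (indicator {0<..} t * (h t * f t)))) K"

text \<open>The function \<open>E\<^sub>\<gamma>\<^sub>,\<^sub>1\<close>.\<close>

definition mittag_leffler :: "real \<Rightarrow> real \<Rightarrow> real" where
  "mittag_leffler \<gamma> z = (\<Sum>l. z ^ l / Gamma (\<gamma> * real l + 1))"

text \<open>
  The density \<open>g\<^sub>\<gamma>\<close> of \<open>T\<^sub>\<gamma>\<^sup>-\<^sup>\<gamma>\<close> on \<open>(0,\<infinity>)\<close>, and the density of
  \<open>ML(\<gamma>,\<theta>)\<close>, in terms of \<open>f = f\<^sub>\<gamma>\<close>; the denominator of the latter is the expectation of
  \<open>T\<^sub>\<gamma>\<^sup>-\<^sup>\<theta>\<close>.
\<close>

definition g_dens :: "real \<Rightarrow> (real \<Rightarrow> real) \<Rightarrow> real \<Rightarrow> real" where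
  "g_dens \<gamma> f s = indicator {0<..} s * (f (s powr (- 1 / \<gamma>)) * s powr (- 1 / \<gamma> - 1) / \<gamma>)"

definition mittag_leffler_dens :: "real \<Rightarrow> real \<Rightarrow> (real \<Rightarrow> real) \<Rightarrow> real \<Rightarrow> real" where
  "mittag_leffler_dens \<gamma> \<theta> f s =
     s powr (\<theta> / \<gamma>) * g_dens \<gamma> f s / (LBINT t:{0<..}. t powr (- \<theta>) * f t)"

definition beta_law :: "real \<Rightarrow> real \<Rightarrow> real measure" where
  "beta_law a b =
     density lborel (\<lambda>x. ennreal (indicator {0<..<1} x
        * (x powr (a - 1) * (1 - x) powr (b - 1) / Beta a b)))"

definition PD :: "real \<Rightarrow> real \<Rightarrow> (nat \<Rightarrow> real) measure" where
  "PD \<gamma> \<theta> =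
     distr (PiM UNIV (\<lambda>k. beta_law (1 - \<gamma>) (\<theta> + real (Suc k) * \<gamma>))) seq_space
       (\<lambda>r. ranked (\<lambda>k. r k * (\<Prod>j<k. 1 - r j)))"

text \<open>Fragmentation of the mass partition \<open>p\<close> by the mass partitions \<open>q 0, q 1, \<dots>\<close>.\<close>

definition frag :: "(nat \<Rightarrow> real) \<Rightarrow> (nat \<Rightarrow> nat \<Rightarrow> real) \<Rightarrow> nat \<Rightarrow> real" where
  "frag p q = ranked (\<lambda>(i, l). p i * q i l)"

text \<open>
  The random partitions \<open>Q 0, Q 1, \<dots>\<close> are iid \<open>PD(\<alpha>,\<theta>)\<close> and jointly independent of \<open>V\<close>, so that
  \<open>frag (V \<omega>) (\<lambda>i. Q i \<omega>)\<close> is the value at \<open>V\<close> of a \<open>PD(\<alpha>,\<theta>)\<close> fragmentation operator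
  independent of \<open>V\<close>.
\<close>

definition frag_operator_indep ::
    "'w measure \<Rightarrow> real \<Rightarrow> real \<Rightarrow> ('w \<Rightarrow> nat \<Rightarrow> real) \<Rightarrow> (nat \<Rightarrow> 'w \<Rightarrow> nat \<Rightarrow> real) \<Rightarrow> bool" where
  "frag_operator_indep M \<alpha> \<theta> V Q \<longleftrightarrow>
     (\<forall>i. distr M seq_space (Q i) = PD \<alpha> \<theta>) \<and>
     prob_space.indep_vars M (\<lambda>_. seq_space) (case_option V Q) UNIV"

definition index_law :: "(nat \<Rightarrow> real) \<Rightarrow> nat measure" where
  "index_law p = density (count_space UNIV) (\<lambda>i. ennreal (p i))"

text \<open>
  \<open>L\<close> is the \<open>\<alpha>\<close>-diversity of the random mass partition \<open>P\<close>: for almost every realization of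
  \<open>P\<close>, if \<open>x 0, x 1, \<dots>\<close> are sampled iid from \<open>P\<close>, then the number \<open>card (x ` {..<n})\<close> of
  distinct values among the first \<open>n\<close> samples, divided by \<open>n\<^sup>\<alpha>\<close>, converges almost surely to
  \<open>L\<close>.
\<close>

definition diversity ::
    "'w measure \<Rightarrow> real \<Rightarrow> ('w \<Rightarrow> nat \<Rightarrow> real) \<Rightarrow> ('w \<Rightarrow> real) \<Rightarrow> bool" where
  "diversity M \<alpha> P L \<longleftrightarrow>
     L \<in> borel_measurable M \<and>
     (AE \<omega> in M. AE x in PiM UNIV (\<lambda>_::nat. index_law (P \<omega>)).
        (\<lambda>n. real n powr (- \<alpha>) * real (card (x ` {..<n}))) \<longlonglongrightarrow> L \<omega>)"

end

theory Submission
  imports Defs "HOL-Real_Asymp.Real_Asymp"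
begin

text \<open>
  Let \<open>J\<^sub>j\<close> be the \<open>\<beta>\<close>-stable points and attach to each an independent copy \<open>y\<^sub>j\<close> of the
  \<open>\<alpha>\<close>-stable points, tilted by the power \<open>\<beta>\<close> of its total mass \<open>T\<^sub>j\<close>; then \<open>y\<^sub>j / T\<^sub>j\<close> is a
  \<open>PD(\<alpha>,-\<beta>)\<close> sequence and \<open>T\<^sub>j\<close> to the power \<open>-\<alpha>\<close> is an \<open>ML(\<alpha>,-\<beta>)\<close> variable.  The marked points
  form a Poisson process, and under the tilting the fragments \<open>J\<^sub>j y\<^sub>j / T\<^sub>j\<close>, all together, are the
  jumps of an \<open>\<alpha>\<close>-stable subordinator run up to the independent \<open>\<beta>/\<alpha>\<close>-stable time
  \<open>S = \<Sum>\<^sub>j (J\<^sub>j / T\<^sub>j) powr \<alpha>\<close>.  Hence, jointly with \<open>S\<close>, the ranked fragments are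
  \<open>S powr (1/\<alpha>)\<close> times ranked \<open>\<alpha>\<close>-stable points independent of \<open>S\<close>.  Normalizing cancels the scale, the
  tilting function of the \<open>\<beta>\<close>-stable mass becomes its expectation over \<open>S\<close>, which is the
  Mittag-Leffler function of index \<open>\<beta>/\<alpha>\<close>, and \<open>S\<close> divided by the power \<open>\<alpha>\<close> of the mass is at once the
  \<open>\<alpha>\<close>-diversity of the fragments and the series of part (ii).

  Two classical facts are needed on the way: the stick-breaking law \<open>PD(\<gamma>,\<theta>)\<close> agrees with the tilted
  normalized stable points, by size-biased picking, and the number of distinct values in a sample is
  governed by the number of atoms above small levels, by Karlin's theorem.
\<close>

section \<open>Laplace transforms and substitutions\<close>

text \<open>The exponents come from one cancellation. Writing the size of a \<beta>-point as
  \<open>u * T\<close>, with \<open>T\<close> the total of its mark, multiplies the \<beta>-stable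
  intensity by \<open>T powr (- \<beta>)\<close>; the tilt \<open>T powr \<beta>\<close> of the mark
  removes exactly this factor, which is why the parameter is \<open>- \<beta>\<close>. Fragmentation
  preserves the total mass, so the \<beta>-stable mass is \<open>S powr (1 / \<alpha>)\<close> times
  an \<alpha>-stable mass \<open>v\<close>, and its power \<open>- \<beta>\<close> is
  \<open>S powr (- \<beta> / \<alpha>) * v powr (- \<beta>)\<close>: hence the index and the
  argument of the Mittag-Leffler function. Equality of laws is not shown by rearranging or coupling
  points. Laplace functionals are read as mixed moments of \<open>[0,1]\<close>-valued variables,
  which determine laws by polynomial approximation. Since \<open>V\<close> and the fragmentation
  operator live on an arbitrary space, only their joint law is available there; the marked points
  are an auxiliary model carrying that law, up to a reweighting by a function of the \<beta>-stable
  mass.\<close>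

text \<open>The function \<open>exp (- z)\<close> extended by 0 at infinity, so that Laplace
  functionals make sense for divergent sums as well and divergence is detected by the value
  0.\<close>

definition nexp :: "ennreal \<Rightarrow> real" where
  "nexp z = (if z = \<top> then 0 else exp (- enn2real z))"

lemma nexp_nonneg [simp]: "0 \<le> nexp z"
  and nexp_le_1 [simp]: "nexp z \<le> 1"
  and nexp_0 [simp]: "nexp 0 = 1"
  and nexp_top [simp]: "nexp \<top> = 0"
  by (simp_all add: nexp_def)

lemma nexp_ennreal [simp]: "0 \<le> x \<Longrightarrow> nexp (ennreal x) = exp (- x)"
  by (simp add: nexp_def)

lemma nexp_eq_0_iff [simp]: "nexp z = 0 \<longleftrightarrow> z = \<top>"
  by (simp add: nexp_def)

lemma nexp_add: "nexp (a + b) = nexp a * nexp b"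
  by (cases a; cases b) (auto simp: nexp_def exp_add[symmetric] simp flip: ennreal_plus)

lemma nexp_sum: "nexp (\<Sum>i\<in>I. f i) = (\<Prod>i\<in>I. nexp (f i))"
  by (induction I rule: infinite_finite_induct) (auto simp: nexp_add)

lemma nexp_mult_of_nat: "nexp (of_nat k * z) = nexp z ^ k"
  by (induction k) (auto simp: nexp_add distrib_right)

lemma nexp_inj: "nexp a = nexp b \<Longrightarrow> a = b"
  by (cases a; cases b) (auto simp: nexp_def)

lemma nexp_measurable [measurable]: "nexp \<in> borel_measurable borel"
  unfolding nexp_def[abs_def] by measurable

text \<open>Continuity includes the point at infinity, so truncated sums can be passed to the limit
  whether or not they stay bounded. There, once \<open>f x\<close> exceeds
  \<open>\<bar>ln a\<bar>\<close>, its image is below \<open>a\<close>.\<close>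

lemma tendsto_nexp [tendsto_intros]:
  assumes "(f \<longlongrightarrow> L) F"
  shows "((\<lambda>x. nexp (f x)) \<longlongrightarrow> nexp L) F"
proof (cases "L = \<top>")
  case False
  have ev: "eventually (\<lambda>x. f x < \<top>) F"
    using order_tendstoD(2)[OF assms] False by (auto simp: top.not_eq_extremum)
  have "((\<lambda>x. exp (- enn2real (f x))) \<longlongrightarrow> exp (- enn2real L)) F"
    using assms False by (intro tendsto_intros tendsto_enn2real) (auto simp: ennreal_enn2real_if)
  then show ?thesis
    using ev False
    by (subst tendsto_cong[where g = "\<lambda>x. exp (- enn2real (f x))"])
       (auto simp: nexp_def elim!: eventually_mono)
next
  case True
  show ?thesis unfolding True nexp_top
  proof (rule order_tendstoI)
    fix a :: real assume "a < 0"
    then show "eventually (\<lambda>x. a < nexp (f x)) F"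
      by (intro always_eventually allI) (meson less_le_trans nexp_nonneg)
  next
    fix a :: real assume a: "0 < a"
    have "eventually (\<lambda>x. ennreal \<bar>ln a\<bar> < f x) F"
      using order_tendstoD(1)[OF assms] True by auto
    then show "eventually (\<lambda>x. nexp (f x) < a) F"
    proof eventually_elim
      fix x assume *: "ennreal \<bar>ln a\<bar> < f x"
      show "nexp (f x) < a"
      proof (cases "f x")
        case (real r)
        then have "\<bar>ln a\<bar> < r" using * by (simp add: ennreal_less_iff)
        then have "exp (- r) < exp (ln a)" by (subst exp_less_cancel_iff) linarith
        then show ?thesis using real a by simp
      qed (use a in auto)
    qed
  qed
qed

lemma nexp_suminf: "(\<lambda>n. \<Prod>i<n. nexp (f i)) \<longlonglongrightarrow> nexp (\<Sum>i. f i)"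
  unfolding nexp_sum[symmetric] by (intro tendsto_nexp summable_LIMSEQ summableI)

text \<open>A right inverse of \<open>nexp\<close> on the unit interval, infinite at 0. It turns the
  average over a mark back into an exponent, so that a product over points becomes
  \<open>nexp\<close> of a sum, to which the Laplace functional applies.\<close>

definition nln :: "real \<Rightarrow> ennreal" where
  "nln u = (if u \<le> 0 then \<top> else ennreal (- ln u))"

lemma nexp_nln [simp]: "0 \<le> u \<Longrightarrow> u \<le> 1 \<Longrightarrow> nexp (nln u) = u"
  by (auto simp: nln_def)

lemma nln_measurable [measurable]: "nln \<in> borel_measurable borel"
  unfolding nln_def[abs_def] by measurable

text \<open>The compact substitution rule for indicators on the increasing intervals
  \<open>{a n..b n}\<close> passes to the limit by monotone convergence. Phrasing the outcome as
  equality of two measures extends it at once to every nonnegative measurable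
  \<open>F\<close>.\<close>

lemma nn_integral_monotone_substitution:
  fixes g g' :: "real \<Rightarrow> real" and F :: "real \<Rightarrow> ennreal" and a b :: "nat \<Rightarrow> real"
  assumes [measurable]: "F \<in> borel_measurable borel" "g \<in> borel_measurable borel" "g' \<in> borel_measurable borel"
  assumes ab: "decseq a" "incseq b" "\<And>n. a n \<le> b n"
  assumes S: "S = (\<Union>n. {a n..b n})" and S': "S' = (\<Union>n. {g (a n)..g (b n)})"
  assumes deriv: "\<And>x. x \<in> S \<Longrightarrow> (g has_real_derivative g' x) (at x)"
  assumes cont: "continuous_on S g'" and nonneg: "\<And>x. x \<in> S \<Longrightarrow> 0 \<le> g' x"
  shows "(\<integral>\<^sup>+x. F x * indicator S' x \<partial>lborel) = (\<integral>\<^sup>+x. F (g x) * (ennreal (g' x) * indicator S x) \<partial>lborel)"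
proof -
  have [measurable]: "S \<in> sets borel" "S' \<in> sets borel" unfolding S S' by auto
  have sub: "{a n..b n} \<subseteq> S" for n using S by auto
  have le: "g (a m) \<le> g (a n)" "g (b n) \<le> g (b m)" "g (a n) \<le> g (b n)" if "n \<le> m" for n m
  proof -
    have "a m \<le> a n" "b n \<le> b m" "a n \<le> b n"
      using ab that by (auto simp: decseq_def incseq_def)
    then show "g (a m) \<le> g (a n)" "g (b n) \<le> g (b m)" "g (a n) \<le> g (b n)"
      using deriv nonneg sub[of m] by (auto intro!: deriv_nonneg_imp_mono[where g=g and g'=g'] simp: subset_eq)
  qed
  have ind: "indicator (\<Union>n. A n) x = (SUP n. indicator (A n) x :: ennreal)" for A :: "nat \<Rightarrow> real set" and x
    by (rule antisym) (auto simp: indicator_def intro!: SUP_least SUP_upper2)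
  have incs: "incseq (\<lambda>n x. indicator {g (a n)..g (b n)} x :: ennreal)" "incseq (\<lambda>n x. indicator {a n..b n} x :: ennreal)"
    using le(1,2) ab by (fastforce simp: incseq_def le_fun_def indicator_def decseq_def)+
  have eq: "density lborel (indicator S') = distr (density lborel (\<lambda>x. ennreal (g' x) * indicator S x)) borel g"
  proof (rule measure_eqI)
    fix A :: "real set" assume "A \<in> sets (density lborel (indicator S'))"
    then have [measurable]: "A \<in> sets borel" by simp
    have "emeasure (density lborel (indicator S')) A = (\<integral>\<^sup>+x. (SUP n. indicator A x * indicator {g (a n)..g (b n)} x) \<partial>lborel)"
      by (simp add: emeasure_density mult.commute S' ind SUP_mult_left_ennreal)
    also have "\<dots> = (SUP n. \<integral>\<^sup>+x. indicator A x * indicator {g (a n)..g (b n)} x \<partial>lborel)"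
      using incs(1) by (intro nn_integral_monotone_convergence_SUP) (auto simp: incseq_def le_fun_def intro!: mult_left_mono)
    also have "\<dots> = (SUP n. \<integral>\<^sup>+x. (indicator A (g x) * ennreal (g' x)) * indicator {a n..b n} x \<partial>lborel)"
    proof (intro SUP_cong refl)
      fix n
      have "(\<integral>\<^sup>+x. ennreal (indicator A x) * indicator {g (a n)..g (b n)} x \<partial>lborel)
            = (\<integral>\<^sup>+x. ennreal (indicator A (g x) * g' x) * indicator {a n..b n} x \<partial>lborel)"
        using nn_integral_substitution[of "g" "a n" "b n" "indicator A" g'] deriv nonneg sub[of n] ab(3)[of n]
        by (simp add: set_borel_measurable_def continuous_on_subset[OF cont] subset_eq nn_integral_set_ennreal)
      then show "(\<integral>\<^sup>+x. indicator A x * indicator {g (a n)..g (b n)} x \<partial>lborel)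
            = (\<integral>\<^sup>+x. (indicator A (g x) * ennreal (g' x)) * indicator {a n..b n} x \<partial>lborel)"
        by (simp add: ennreal_mult'' ennreal_indicator ennreal_mult')
    qed
    also have "\<dots> = (\<integral>\<^sup>+x. (SUP n. (indicator A (g x) * ennreal (g' x)) * indicator {a n..b n} x) \<partial>lborel)"
      using incs(2) by (intro nn_integral_monotone_convergence_SUP[symmetric]) (auto simp: incseq_def le_fun_def intro!: mult_left_mono)
    also have "\<dots> = (\<integral>\<^sup>+x. (ennreal (g' x) * indicator S x) * indicator (g -` A) x \<partial>lborel)"
      unfolding S ind SUP_mult_left_ennreal[symmetric] by (simp add: mult_ac indicator_vimage)
    also have "\<dots> = emeasure (distr (density lborel (\<lambda>x. ennreal (g' x) * indicator S x)) borel g) A"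
      using measurable_sets_borel[of g borel A] by (simp add: emeasure_distr emeasure_density)
    finally show "emeasure (density lborel (indicator S')) A = emeasure (distr (density lborel (\<lambda>x. ennreal (g' x) * indicator S x)) borel g) A" .
  qed simp
  have "(\<integral>\<^sup>+x. F x * indicator S' x \<partial>lborel) = (\<integral>\<^sup>+x. F x \<partial>density lborel (indicator S'))"
    by (simp add: nn_integral_density mult.commute)
  also have "\<dots> = (\<integral>\<^sup>+x. F (g x) * (ennreal (g' x) * indicator S x) \<partial>lborel)"
    unfolding eq by (subst nn_integral_distr) (auto simp: nn_integral_density mult.commute)
  finally show ?thesis .
qed

lemma nn_integral_powr_substitution:
  fixes F :: "real \<Rightarrow> ennreal" and r :: real
  assumes [measurable]: "F \<in> borel_measurable borel" and r: "r \<noteq> 0"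
  shows "(\<integral>\<^sup>+x. F x * indicator {0<..} x \<partial>lborel)
       = (\<integral>\<^sup>+x. F (x powr r) * (ennreal (\<bar>r\<bar> * x powr (r - 1)) * indicator {0<..} x) \<partial>lborel)"
proof (cases "0 < r")
  case True
  define a b where "a n = 1 / real (Suc n)" and "b n = real (Suc n)" for n
  have 1: "{0<..} = (\<Union>n. {a n..b n})"
  proof safe
    fix x :: real assume "0 < x"
    then obtain n where "1 / real (Suc n) < x" using nat_approx_posE[of x] by auto
    moreover obtain m where "x < real m" using reals_Archimedean2[of x] by blast
    moreover have "1 / real (Suc (max n m)) \<le> 1 / real (Suc n)" by (simp add: field_simps)
    ultimately have "x \<in> {a (max n m)..b (max n m)}" unfolding a_def b_def by (auto simp: le_max_iff_disj)
    then show "x \<in> (\<Union>n. {a n..b n})" by blast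
  qed (auto simp: a_def b_def intro: less_le_trans[rotated])
  have 2: "{0<..} = (\<Union>n. {a n powr r..b n powr r})"
  proof safe
    fix x :: real assume x: "0 < x"
    then have "x powr (1/r) \<in> (\<Union>n. {a n..b n})" unfolding 1[symmetric] by simp
    then obtain n where n: "a n \<le> x powr (1/r)" "x powr (1/r) \<le> b n" by auto
    have "a n powr r \<le> (x powr (1/r)) powr r" "(x powr (1/r)) powr r \<le> b n powr r"
      using n True by (auto intro!: powr_mono2 simp: a_def)
    then show "x \<in> (\<Union>n. {a n powr r..b n powr r})" using x True by (auto simp: powr_powr)
  next
    fix x n assume "x \<in> {a n powr r..b n powr r}"
    moreover have "0 < a n powr r" by (simp add: a_def)
    ultimately show "0 < x" by (meson atLeastAtMost_iff less_le_trans)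
  qed
  show ?thesis
    by (rule nn_integral_monotone_substitution[OF _ _ _ _ _ _ 1 2])
       (use True in \<open>auto simp: decseq_def incseq_def a_def b_def field_simps
         intro!: derivative_eq_intros continuous_intros\<close>)
next
  case False
  then have r: "r < 0" using r by auto
  \<comment> \<open>For \<open>r < 0\<close> the map decreases on the positive half-line. After
    reflection, \<open>x \<mapsto> (- x) powr r\<close> increases on the negative half-line, where
    the monotone rule applies; an affine substitution reflects back.\<close>
  define a b where "a n = - real (Suc n)" and "b n = - (1 / real (Suc n))" for n
  have 1: "{..<0} = (\<Union>n. {a n..b n})"
  proof safe
    fix x :: real assume "x < 0"
    then obtain n where "1 / real (Suc n) < -x" using nat_approx_posE[of "-x"] by auto
    moreover obtain m where "-x < real m" using reals_Archimedean2[of "-x"] by blast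
    moreover have "1 / real (Suc (max n m)) \<le> 1 / real (Suc n)" by (simp add: field_simps)
    moreover have "real m \<le> real (Suc (max n m))" by simp
    ultimately have "- real (Suc (max n m)) \<le> x \<and> x \<le> - (1 / real (Suc (max n m)))" by linarith
    then have "x \<in> {a (max n m)..b (max n m)}" unfolding a_def b_def by auto
    then show "x \<in> (\<Union>n. {a n..b n})" by blast
  next
    fix x n assume "x \<in> {a n..b n}"
    moreover have "b n < 0" by (simp add: b_def)
    ultimately show "x < 0" by auto
  qed
  have 2: "{0<..} = (\<Union>n. {(- a n) powr r..(- b n) powr r})"
  proof safe
    fix x :: real assume x: "0 < x"
    then have "- (x powr (1/r)) \<in> (\<Union>n. {a n..b n})" unfolding 1[symmetric] by simp
    then obtain n where "- (x powr (1/r)) \<in> {a n..b n}" by blast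
    then have n: "x powr (1/r) \<le> - a n" "- b n \<le> x powr (1/r)" by auto
    have "(- a n) powr r \<le> (x powr (1/r)) powr r" "(x powr (1/r)) powr r \<le> (- b n) powr r"
      using n r x by (auto intro!: powr_mono2' simp: b_def)
    then show "x \<in> (\<Union>n. {(- a n) powr r..(- b n) powr r})" using x r by (auto simp: powr_powr)
  next
    fix x n assume "x \<in> {(- a n) powr r..(- b n) powr r}"
    moreover have "0 < (- a n) powr r" by (simp add: a_def)
    ultimately show "0 < x" by (meson atLeastAtMost_iff less_le_trans)
  qed
  have "(\<integral>\<^sup>+x. F x * indicator {0<..} x \<partial>lborel)
      = (\<integral>\<^sup>+x. F ((- x) powr r) * (ennreal (\<bar>r\<bar> * (- x) powr (r - 1)) * indicator {..<0} x) \<partial>lborel)"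
    by (rule nn_integral_monotone_substitution[OF _ _ _ _ _ _ 1 2])
       (use r in \<open>auto simp: decseq_def incseq_def a_def b_def field_simps mult_le_0_iff
         intro!: derivative_eq_intros continuous_intros\<close>)
  also have "\<dots> = (\<integral>\<^sup>+x. F (x powr r) * (ennreal (\<bar>r\<bar> * x powr (r - 1)) * indicator {..<0} (- x)) \<partial>lborel)"
    by (subst nn_integral_real_affine[where c = "-1" and t = 0]) auto
  finally show ?thesis
    by (simp add: indicator_def)
qed

text \<open>The odds map \<open>x / (1 - x)\<close> inverts \<open>y \<mapsto> y / (1 + y)\<close>;
  it converts an integral over the size of a removed point into one over its fraction of the
  total.\<close>

lemma nn_integral_odds_substitution:
  fixes F :: "real \<Rightarrow> ennreal"
  assumes [measurable]: "F \<in> borel_measurable borel"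
  shows "(\<integral>\<^sup>+x. F x * indicator {0<..} x \<partial>lborel)
       = (\<integral>\<^sup>+x. F (x / (1 - x)) * (ennreal (1 / (1 - x)\<^sup>2) * indicator {0<..<1} x) \<partial>lborel)"
proof -
  define a b :: "nat \<Rightarrow> real" where "a n = 1 / (real n + 2)" and "b n = 1 - 1 / (real n + 2)" for n
  have bnd: "a n > 0" "b n < 1" for n by (auto simp: a_def b_def field_simps)
  have 1: "{0<..<1} = (\<Union>n. {a n..b n})"
  proof safe
    fix x :: real assume "x \<in> {0<..<1}"
    then have "0 < x" "0 < 1 - x" by auto
    then obtain n m where nm: "1 / real (Suc n) < x" "1 / real (Suc m) < 1 - x"
      using nat_approx_posE by metis
    have "1 / (real (max n m) + 2) \<le> 1 / real (Suc n)" "1 / (real (max n m) + 2) \<le> 1 / real (Suc m)"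
      by (simp_all add: field_simps)
    with nm have "x \<in> {a (max n m)..b (max n m)}" unfolding a_def b_def by auto
    then show "x \<in> (\<Union>n. {a n..b n})" by blast
  next
    fix x n assume "x \<in> {a n..b n}"
    then show "x \<in> {0<..<1}" using bnd[of n] by auto
  qed
  have odds: "a n / (1 - a n) = 1 / (real n + 1)" "b n / (1 - b n) = real n + 1" for n
    unfolding a_def b_def by (simp_all add: field_simps add_divide_distrib[symmetric])
  have 2: "{0<..} = (\<Union>n. {a n / (1 - a n)..b n / (1 - b n)})" unfolding odds
  proof safe
    fix x :: real assume "0 < x"
    then obtain n where n: "1 / real (Suc n) < x" using nat_approx_posE[of x] by auto
    moreover obtain m where m: "x < real m" using reals_Archimedean2[of x] by blast
    moreover have "1 / (real (max n m) + 1) \<le> 1 / real (Suc n)" by (simp add: field_simps)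
    moreover have "real m \<le> real (max n m) + 1" by simp
    ultimately have "x \<in> {1 / (real (max n m) + 1)..real (max n m) + 1}" by auto
    then show "x \<in> (\<Union>n. {1 / (real n + 1)..real n + 1})" by blast
  next
    fix x :: real and n :: nat assume "x \<in> {1 / (real n + 1)..real n + 1}"
    moreover have "0 < 1 / (real n + 1)" by simp
    ultimately show "0 < x" by (meson atLeastAtMost_iff less_le_trans)
  qed
  have deriv: "((\<lambda>x. x / (1 - x)) has_real_derivative 1 / (1 - x)\<^sup>2) (at x)" if "x < 1" for x :: real
    using that by (auto intro!: derivative_eq_intros simp: power2_eq_square)
  show ?thesis
    by (rule nn_integral_monotone_substitution[OF _ _ _ _ _ _ 1 2])
       (auto simp: decseq_def incseq_def a_def b_def field_simps intro!: deriv continuous_intros)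
qed

section \<open>Measures determined by moments\<close>

text \<open>Equal moments give equal integrals of polynomials, hence by Bernstein approximation of
  continuous functions, hence by ramp functions equal masses of the half-lines
  \<open>{a<..}\<close>, which determine a finite Borel measure.\<close>

lemma moments_determine_measure:
  fixes P Q :: "real measure"
  assumes "finite_measure P" "finite_measure Q" and sets_P [measurable_cong]: "sets P = sets borel"
    and sets_Q [measurable_cong]: "sets Q = sets borel"
    and P01: "AE x in P. x \<in> {0..1}" and Q01: "AE x in Q. x \<in> {0..1}"
    and moments: "\<And>k. (\<integral>\<^sup>+x. ennreal x ^ k \<partial>P) = (\<integral>\<^sup>+x. ennreal x ^ k \<partial>Q)"
  shows "P = Q"
proof -
  interpret P: finite_measure P by fact
  interpret Q: finite_measure Q by fact
  have "AE x in P. norm (x ^ k) \<le> 1" for k :: nat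
    using P01 by eventually_elim (simp add: power_le_one)
  then have int_pow_P: "integrable P (\<lambda>x. x ^ k)" for k :: nat
    by (rule P.integrable_const_bound) simp
  have "AE x in Q. norm (x ^ k) \<le> 1" for k :: nat
    using Q01 by eventually_elim (simp add: power_le_one)
  then have int_pow_Q: "integrable Q (\<lambda>x. x ^ k)" for k :: nat
    by (rule Q.integrable_const_bound) simp
  note int_pow = int_pow_P int_pow_Q
  have "(\<integral>x. x ^ k \<partial>P) = enn2real (\<integral>\<^sup>+x. ennreal x ^ k \<partial>P)"
       "(\<integral>x. x ^ k \<partial>Q) = enn2real (\<integral>\<^sup>+x. ennreal x ^ k \<partial>Q)" for k :: nat
    by (subst integral_eq_nn_integral,
        insert P01 Q01, auto intro!: arg_cong[where f=enn2real] nn_integral_cong_AE simp: ennreal_power elim!: eventually_mono)+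
  with moments have mom: "(\<integral>x. x ^ k \<partial>P) = (\<integral>x. x ^ k \<partial>Q)" for k :: nat by simp
  have poly: "(\<integral>x. (\<Sum>k\<in>K. c k * x ^ k) \<partial>P) = (\<integral>x. (\<Sum>k\<in>K. c k * x ^ k) \<partial>Q)" for K :: "nat set" and c
    using int_pow by (simp add: mom)
  \<comment> \<open>The Bernstein sum is passed through the type of polynomials to obtain its
    coefficients in the monomial basis, where the integrals are known to agree.\<close>
  have bern: "\<exists>c. \<forall>x. (\<Sum>k\<le>n. f (k/n) * Bernstein n k x) = (\<Sum>k\<le>n. c k * x ^ k)" for f :: "real \<Rightarrow> real" and n
  proof -
    have "\<exists>p. degree p \<le> n \<and> (\<forall>x. Bernstein n k x = poly p x)" if "k \<le> n" for k
    proof (intro exI conjI allI)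
      let ?p = "smult (of_nat (n choose k)) (monom 1 k * [:1, -1:] ^ (n - k)) :: real poly"
      have "degree ?p \<le> degree (monom 1 k :: real poly) + degree ([:1, -1:] ^ (n - k) :: real poly)"
        by (rule order_trans[OF degree_smult_le degree_mult_le])
      also have "\<dots> \<le> k + (n - k)"
        by (intro add_mono degree_monom_le order_trans[OF degree_power_le]) auto
      finally show "degree ?p \<le> n" using that by simp
      show "Bernstein n k x = poly ?p x" for x
        by (simp add: Bernstein_def poly_monom)
    qed
    then obtain p where p: "\<And>k. k \<le> n \<Longrightarrow> degree (p k) \<le> n" "\<And>k x. k \<le> n \<Longrightarrow> Bernstein n k x = poly (p k) x"
      by metis
    let ?q = "\<Sum>k\<le>n. smult (f (k/n)) (p k)"
    have deg: "degree ?q \<le> n"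
      using p(1) by (intro degree_sum_le) (auto intro: order_trans[OF degree_smult_le])
    have "(\<Sum>k\<le>n. f (k/n) * Bernstein n k x) = (\<Sum>k\<le>n. coeff ?q k * x ^ k)" for x
    proof -
      have "(\<Sum>k\<le>n. f (k/n) * Bernstein n k x) = poly ?q x"
        using p(2) by (simp add: poly_sum)
      also have "\<dots> = (\<Sum>k\<le>n. coeff ?q k * x ^ k)"
        unfolding poly_altdef by (rule sum.mono_neutral_left) (use deg in \<open>auto simp: coeff_eq_0\<close>)
      finally show ?thesis .
    qed
    then show ?thesis by blast
  qed
  have cont: "(\<integral>x. f x \<partial>P) = (\<integral>x. f x \<partial>Q)" if f: "continuous_on UNIV f" "\<And>x. \<bar>f x\<bar> \<le> 1" for f :: "real \<Rightarrow> real"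
  proof -
    have [measurable]: "f \<in> borel_measurable borel" by (rule borel_measurable_continuous_onI[OF f(1)])
    have int: "integrable P f" "integrable Q f"
      by (rule P.integrable_const_bound[where B = 1] Q.integrable_const_bound[where B = 1], use f(2) in auto)+
    \<comment> \<open>The approximation error is \<open>e\<close> times the two total masses; the
      summand 1 keeps this factor positive even when both measures vanish.\<close>
    have "dist (\<integral>x. f x \<partial>P) (\<integral>x. f x \<partial>Q) < e * (measure P (space P) + measure Q (space Q) + 1)" if e: "0 < e" for e
    proof -
      obtain N where N: "\<And>n x. N \<le> n \<Longrightarrow> x \<in> {0..1} \<Longrightarrow> \<bar>f x - (\<Sum>k\<le>n. f(k/n) * Bernstein n k x)\<bar> < e"
        using Bernstein_Weierstrass[OF continuous_on_subset[OF f(1)] e] by blast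
      obtain c where c: "\<And>x. (\<Sum>k\<le>N. f(k/N) * Bernstein N k x) = (\<Sum>k\<le>N. c k * x ^ k)"
        using bern[of f N] by blast
      let ?b = "\<lambda>x. \<Sum>k\<le>N. c k * x ^ k"
      have b: "\<bar>f x - ?b x\<bar> \<le> e" if "x \<in> {0..1}" for x
        using N[OF order_refl that] c[of x] by linarith
      have ib: "integrable P ?b" "integrable Q ?b" using int_pow by auto
      have *: "\<bar>(\<integral>x. f x \<partial>R) - (\<integral>x. ?b x \<partial>R)\<bar> \<le> e * measure R (space R)"
        if "finite_measure R" "integrable R f" "integrable R ?b" "AE x in R. x \<in> {0..1}" for R
      proof -
        interpret R: finite_measure R by fact
        have "\<bar>(\<integral>x. f x \<partial>R) - (\<integral>x. ?b x \<partial>R)\<bar> = \<bar>\<integral>x. f x - ?b x \<partial>R\<bar>"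
          using that by (subst Bochner_Integration.integral_diff) auto
        also have "\<dots> \<le> (\<integral>x. \<bar>f x - ?b x\<bar> \<partial>R)" by (rule integral_abs_bound)
        also have "\<dots> \<le> (\<integral>x. e \<partial>R)"
        proof (rule integral_mono_AE)
          show "AE x in R. \<bar>f x - ?b x\<bar> \<le> e" using that(4) by eventually_elim (rule b)
        qed (use that(2,3) in auto)
        finally show ?thesis by (simp add: mult.commute)
      qed
      have "dist (\<integral>x. f x \<partial>P) (\<integral>x. f x \<partial>Q) \<le> e * measure P (space P) + e * measure Q (space Q)"
        using *[OF P.finite_measure_axioms int(1) ib(1) P01] *[OF Q.finite_measure_axioms int(2) ib(2) Q01] poly[of c "{..N}"]
        by (simp add: dist_real_def abs_le_iff)
      then show ?thesis using e by (simp add: distrib_left)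
    qed
    note less = this
    show ?thesis
    proof (rule ccontr)
      assume "(\<integral>x. f x \<partial>P) \<noteq> (\<integral>x. f x \<partial>Q)"
      then have "0 < dist (\<integral>x. f x \<partial>P) (\<integral>x. f x \<partial>Q)" by simp
      moreover have pos: "0 < measure P (space P) + measure Q (space Q) + 1" by (auto intro: add_nonneg_pos)
      ultimately have "0 < dist (\<integral>x. f x \<partial>P) (\<integral>x. f x \<partial>Q) / (measure P (space P) + measure Q (space Q) + 1)" by simp
      from less[OF this] pos show False by simp
    qed
  qed
  show ?thesis
  proof (rule measure_eqI_lessThan)
    fix a :: real
    show "emeasure P {a<..} < \<infinity>" by (simp add: less_top[symmetric])
    \<comment> \<open>A ramp rising from 0 at \<open>a\<close> to 1 at \<open>a + 1 / n\<close>; it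
      tends pointwise to the indicator of \<open>{a<..}\<close>.\<close>
    define f where "f n x = min 1 (max 0 (real n * (x - a)))" for n and x :: real
    have lim: "(\<lambda>n. f n x) \<longlonglongrightarrow> indicator {a<..} x" for x
    proof (cases "a < x")
      case True
      then have "eventually (\<lambda>n. 1 / (x - a) \<le> real n) sequentially" by real_asymp
      then have "eventually (\<lambda>n. f n x = 1) sequentially"
        by eventually_elim (use True in \<open>auto simp: f_def field_simps min_def max_def\<close>)
      then show ?thesis using True by (simp add: tendsto_eventually)
    next
      case False
      then have "real n * (x - a) \<le> 0" for n by (simp add: mult_le_0_iff)
      then have "f n x = 0" for n by (simp add: f_def max_absorb1)
      then show ?thesis using False by simp
    qed
    have [measurable]: "f n \<in> borel_measurable borel" for n unfolding f_def[abs_def] by measurable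
    have *: "(\<lambda>n. \<integral>x. f n x \<partial>R) \<longlonglongrightarrow> measure R {a<..}" if "finite_measure R" and [measurable_cong]: "sets R = sets borel" for R
    proof -
      interpret R: finite_measure R by fact
      have "(\<lambda>n. \<integral>x. f n x \<partial>R) \<longlonglongrightarrow> (\<integral>x. indicator {a<..} x \<partial>R)"
        using lim by (intro integral_dominated_convergence[where w = "\<lambda>_. 1"]) (auto simp: f_def)
      moreover have "space R = UNIV" using sets_eq_imp_space_eq[OF that(2)] by simp
      ultimately show ?thesis by simp
    qed
    have "(\<integral>x. f n x \<partial>P) = (\<integral>x. f n x \<partial>Q)" for n
      by (rule cont) (auto simp: f_def[abs_def] intro!: continuous_intros)
    then have "measure P {a<..} = measure Q {a<..}"
      using *[OF P.finite_measure_axioms sets_P] *[OF Q.finite_measure_axioms sets_Q] LIMSEQ_unique by simp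
    then show "emeasure P {a<..} = emeasure Q {a<..}"
      by (simp add: P.emeasure_eq_measure Q.emeasure_eq_measure)
  qed (simp_all add: sets_P sets_Q)
qed

text \<open>Coordinates are converted one at a time from powers to indicators: the factors of the
  other coordinates act as a density, and the one-dimensional moment theorem applies to the chosen
  coordinate under that density. The resulting masses of cylinders determine the law on the product
  space.\<close>

lemma mixed_moments_determine_measure:
  fixes U :: "'i \<Rightarrow> 'a \<Rightarrow> real" and U' :: "'i \<Rightarrow> 'b \<Rightarrow> real"
  assumes "finite_measure A" "finite_measure B"
    and [measurable]: "\<And>i. i \<in> I \<Longrightarrow> U i \<in> borel_measurable A" "\<And>i. i \<in> I \<Longrightarrow> U' i \<in> borel_measurable B"
    and A01: "\<And>i. i \<in> I \<Longrightarrow> AE \<omega> in A. U i \<omega> \<in> {0..1}" and B01: "\<And>i. i \<in> I \<Longrightarrow> AE \<omega> in B. U' i \<omega> \<in> {0..1}"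
    and moments: "\<And>F k. finite F \<Longrightarrow> F \<subseteq> I \<Longrightarrow>
       (\<integral>\<^sup>+\<omega>. (\<Prod>i\<in>F. ennreal (U i \<omega>) ^ k i) \<partial>A) = (\<integral>\<^sup>+\<omega>. (\<Prod>i\<in>F. ennreal (U' i \<omega>) ^ k i) \<partial>B)"
  shows "distr A (PiM I (\<lambda>_. borel)) (\<lambda>\<omega>. \<lambda>i\<in>I. U i \<omega>) = distr B (PiM I (\<lambda>_. borel)) (\<lambda>\<omega>. \<lambda>i\<in>I. U' i \<omega>)"
proof -
  interpret A: finite_measure A by fact
  interpret B: finite_measure B by fact
  \<comment> \<open>\<open>F\<close> and \<open>k\<close> stay general in the induction: the
    \<open>m\<close>-th moment of the new coordinate \<open>j\<close> is the instance with
    \<open>j\<close> added to \<open>F\<close> and given the exponent \<open>m\<close>.\<close>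
  have key: "(\<integral>\<^sup>+\<omega>. (\<Prod>i\<in>G. indicator (C i) (U i \<omega>)) * (\<Prod>i\<in>F. ennreal (U i \<omega>) ^ k i) \<partial>A)
           = (\<integral>\<^sup>+\<omega>. (\<Prod>i\<in>G. indicator (C i) (U' i \<omega>)) * (\<Prod>i\<in>F. ennreal (U' i \<omega>) ^ k i) \<partial>B)"
    if "finite G" "G \<subseteq> I" "finite F" "F \<subseteq> I" "G \<inter> F = {}" "\<And>i. i \<in> G \<Longrightarrow> C i \<in> sets borel" for G F k C
    using that
  proof (induction G arbitrary: F k rule: finite_induct)
    case empty
    then show ?case by (simp add: moments)
  next
    case (insert j G)
    then have j: "j \<in> I" "j \<notin> F" "j \<notin> G" by auto
    have [measurable]: "C i \<in> sets borel" if "i \<in> G" for i using insert that by auto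
    have [measurable]: "C j \<in> sets borel" using insert by auto
    have U_m [measurable]: "U i \<in> borel_measurable A" "U' i \<in> borel_measurable B" if "i \<in> insert j G \<or> i \<in> F" for i
      using insert.prems that assms by auto
    note [measurable] = U_m(1)[of j] U_m(2)[of j]
    \<comment> \<open>The remaining factors become a density. It is almost everywhere at most 1, so
      the weighted laws of the chosen coordinate stay finite.\<close>
    define w where "w \<omega> = (\<Prod>i\<in>G. indicator (C i) (U i \<omega>)) * (\<Prod>i\<in>F. ennreal (U i \<omega>) ^ k i)" for \<omega>
    define w' where "w' \<omega> = (\<Prod>i\<in>G. indicator (C i) (U' i \<omega>)) * (\<Prod>i\<in>F. ennreal (U' i \<omega>) ^ k i)" for \<omega>
    have [measurable]: "w \<in> borel_measurable A" "w' \<in> borel_measurable B"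
      unfolding w_def[abs_def] w'_def[abs_def]
      by (auto intro!: borel_measurable_times_ennreal borel_measurable_prod_ennreal borel_measurable_power_ennreal
            measurable_compose[OF U_m(1)] measurable_compose[OF U_m(2)])
    have le1: "AE \<omega> in A. w \<omega> \<le> 1" "AE \<omega> in B. w' \<omega> \<le> 1"
    proof -
      have *: "(\<Prod>i\<in>G. indicator (C i) (f i)) * (\<Prod>i\<in>F. ennreal (f i) ^ k i) \<le> (1::ennreal)"
        if "\<forall>i\<in>F. f i \<in> {0..1}" for f
      proof -
        have "(\<Prod>i\<in>G. indicator (C i) (f i)) \<le> (1::ennreal)"
          by (intro prod_le_1) (auto simp: indicator_def)
        moreover have "(\<Prod>i\<in>F. ennreal (f i) ^ k i) \<le> 1"
          using that by (intro prod_le_1) (auto intro!: power_le_one)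
        ultimately show ?thesis using mult_mono[of _ "1::ennreal" _ 1] by fastforce
      qed
      have "AE \<omega> in A. \<forall>i\<in>F. U i \<omega> \<in> {0..1}"
        using A01 insert.prems by (intro AE_finite_allI) auto
      then show "AE \<omega> in A. w \<omega> \<le> 1"
        by eventually_elim (auto simp: w_def intro!: *)
      have "AE \<omega> in B. \<forall>i\<in>F. U' i \<omega> \<in> {0..1}"
        using B01 insert.prems by (intro AE_finite_allI) auto
      then show "AE \<omega> in B. w' \<omega> \<le> 1"
        by eventually_elim (auto simp: w'_def intro!: *)
    qed
    let ?P = "distr (density A w) borel (U j)" and ?Q = "distr (density B w') borel (U' j)"
    have "?P = ?Q"
    proof (rule moments_determine_measure)
      have "emeasure ?P (space ?P) \<le> emeasure A (space A)" "emeasure ?Q (space ?Q) \<le> emeasure B (space B)"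
      proof -
        have "(\<integral>\<^sup>+\<omega>. w \<omega> \<partial>A) \<le> (\<integral>\<^sup>+\<omega>. 1 \<partial>A)" "(\<integral>\<^sup>+\<omega>. w' \<omega> \<partial>B) \<le> (\<integral>\<^sup>+\<omega>. 1 \<partial>B)"
          by (rule nn_integral_mono_AE[OF le1(1)] nn_integral_mono_AE[OF le1(2)])+
        moreover have "(\<integral>\<^sup>+\<omega>. w \<omega> * indicator (space A) \<omega> \<partial>A) = (\<integral>\<^sup>+\<omega>. w \<omega> \<partial>A)"
            "(\<integral>\<^sup>+\<omega>. w' \<omega> * indicator (space B) \<omega> \<partial>B) = (\<integral>\<^sup>+\<omega>. w' \<omega> \<partial>B)"
          by (auto intro!: nn_integral_cong)
        ultimately show "emeasure ?P (space ?P) \<le> emeasure A (space A)" "emeasure ?Q (space ?Q) \<le> emeasure B (space B)"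
          by (auto simp: emeasure_distr emeasure_density)
      qed
      then show "finite_measure ?P" "finite_measure ?Q"
        using A.emeasure_finite B.emeasure_finite
        by (auto intro!: finite_measureI simp: top_unique neq_top_trans)
      show "AE x in ?P. x \<in> {0..1}" "AE x in ?Q. x \<in> {0..1}"
        using A01[OF j(1)] B01[OF j(1)] by (auto simp: AE_distr_iff AE_density)
      fix m
      have "(\<Prod>i\<in>F. ennreal (U i \<omega>) ^ k i) * ennreal (U j \<omega>) ^ m = (\<Prod>i\<in>insert j F. ennreal (U i \<omega>) ^ (k(j := m)) i)"
           "(\<Prod>i\<in>F. ennreal (U' i \<omega>') ^ k i) * ennreal (U' j \<omega>') ^ m = (\<Prod>i\<in>insert j F. ennreal (U' i \<omega>') ^ (k(j := m)) i)" for \<omega> \<omega>'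
        using j insert.prems by (auto simp: mult.commute intro!: arg_cong2[where f="(*)"] prod.cong)
      then show "(\<integral>\<^sup>+x. ennreal x ^ m \<partial>?P) = (\<integral>\<^sup>+x. ennreal x ^ m \<partial>?Q)"
        using insert.IH[of "insert j F" "k(j := m)"] insert.prems insert.hyps j
        by (simp add: nn_integral_distr nn_integral_density w_def w'_def mult.assoc)
    qed simp_all
    then have "emeasure ?P (C j) = emeasure ?Q (C j)" by simp
    moreover have "emeasure ?P (C j) = (\<integral>\<^sup>+\<omega>. indicator (C j) (U j \<omega>) * w \<omega> \<partial>A)"
      by (auto simp: emeasure_distr emeasure_density intro!: nn_integral_cong split: split_indicator)
    moreover have "emeasure ?Q (C j) = (\<integral>\<^sup>+\<omega>. indicator (C j) (U' j \<omega>) * w' \<omega> \<partial>B)"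
      by (auto simp: emeasure_distr emeasure_density intro!: nn_integral_cong split: split_indicator)
    ultimately show ?case
      using insert.hyps by (simp add: w_def w'_def mult.assoc)
  qed
  show ?thesis
  proof (rule measure_eqI_PiM_infinite)
    show "finite_measure (distr A (PiM I (\<lambda>_. borel)) (\<lambda>\<omega>. \<lambda>i\<in>I. U i \<omega>))"
      by (rule A.finite_measure_distr) auto
    fix C :: "'i \<Rightarrow> real set" and G assume G: "finite G" "G \<subseteq> I" and C[measurable]: "\<And>i. i \<in> G \<Longrightarrow> C i \<in> sets borel"
    have [measurable]: "prod_emb I (\<lambda>_. borel) G (Pi\<^sub>E G C) \<in> sets (PiM I (\<lambda>_. borel))"
      using G by (auto intro!: sets_PiM_I)
    have *: "emeasure (distr R (PiM I (\<lambda>_. borel)) (\<lambda>\<omega>. \<lambda>i\<in>I. W i \<omega>)) (prod_emb I (\<lambda>_. borel) G (Pi\<^sub>E G C))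
        = (\<integral>\<^sup>+\<omega>. (\<Prod>i\<in>G. indicator (C i) (W i \<omega>)) \<partial>R)"
      if [measurable]: "\<And>i. i \<in> I \<Longrightarrow> W i \<in> borel_measurable R" for R :: "'x measure" and W
    proof -
      have "emeasure (distr R (PiM I (\<lambda>_. borel)) (\<lambda>\<omega>. \<lambda>i\<in>I. W i \<omega>)) (prod_emb I (\<lambda>_. borel) G (Pi\<^sub>E G C))
        = (\<integral>\<^sup>+\<omega>. indicator (prod_emb I (\<lambda>_. borel) G (Pi\<^sub>E G C)) (\<lambda>i\<in>I. W i \<omega>) \<partial>R)"
        by (subst nn_integral_indicator[symmetric], simp, subst nn_integral_distr, auto)
      also have "\<dots> = (\<integral>\<^sup>+\<omega>. (\<Prod>i\<in>G. indicator (C i) (W i \<omega>)) \<partial>R)"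
        using G by (auto intro!: nn_integral_cong simp: prod_emb_def PiE_iff indicator_def prod.If_cases subset_eq)
      finally show ?thesis .
    qed
    show "emeasure (distr A (PiM I (\<lambda>_. borel)) (\<lambda>\<omega>. \<lambda>i\<in>I. U i \<omega>)) (prod_emb I (\<lambda>_. borel) G (Pi\<^sub>E G C))
        = emeasure (distr B (PiM I (\<lambda>_. borel)) (\<lambda>\<omega>. \<lambda>i\<in>I. U' i \<omega>)) (prod_emb I (\<lambda>_. borel) G (Pi\<^sub>E G C))"
      using key[OF G, of "{}" C] C by (simp add: *)
  qed simp_all
qed

section \<open>Ranked families\<close>

lemma point_count_nn_integral: "point_count x A = (\<integral>\<^sup>+i. indicator A (x i) \<partial>count_space UNIV)"
proof -
  have "(\<integral>\<^sup>+i. indicator A (x i) \<partial>count_space UNIV) = (\<integral>\<^sup>+i. indicator {i. x i \<in> A} i \<partial>count_space UNIV)"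
    by (intro nn_integral_cong) (simp add: indicator_def)
  then show ?thesis by (simp add: point_count_def)
qed

lemma point_count_mono: "A \<subseteq> B \<Longrightarrow> point_count x A \<le> point_count x B"
  unfolding point_count_def by (intro emeasure_mono) auto

lemma point_count_less_top_iff: "point_count x A < \<top> \<longleftrightarrow> finite {i. x i \<in> A}"
  by (simp add: point_count_def emeasure_count_space of_nat_less_top)

lemma nn_integral_count_space_measurable [measurable]:
  fixes f :: "'i::countable \<Rightarrow> 'a \<Rightarrow> ennreal"
  assumes [measurable]: "\<And>i. f i \<in> borel_measurable M"
  shows "(\<lambda>\<omega>. \<integral>\<^sup>+i. f i \<omega> \<partial>count_space UNIV) \<in> borel_measurable M"
proof -
  have [simp]: "sigma_finite_measure (count_space (UNIV :: 'i set))"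
    by (intro sigma_finite_measure_count_space_countable) auto
  have "(\<lambda>z. f (snd z) (fst z)) \<in> borel_measurable (M \<Otimes>\<^sub>M count_space UNIV)"
    by (rule measurable_compose_countable[where f = "\<lambda>i z. f i (fst z)" and g = snd]) simp_all
  then show ?thesis
    by (intro sigma_finite_measure.borel_measurable_nn_integral) (simp_all add: split_beta')
qed

lemma point_count_measurable [measurable]:
  fixes X :: "'a \<Rightarrow> 'i::countable \<Rightarrow> real"
  assumes [measurable]: "\<And>i. (\<lambda>\<omega>. X \<omega> i) \<in> borel_measurable M" "A \<in> sets borel"
  shows "(\<lambda>\<omega>. point_count (X \<omega>) A) \<in> borel_measurable M"
  unfolding point_count_nn_integral by measurable

text \<open>The families for which ranking is an honest enumeration: each positive level is reached
  finitely often, while the infinite index set makes every level \<open>s \<le> 0\<close> be reached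
  infinitely often, so all ranks exist and are nonnegative.\<close>

definition tame :: "('i \<Rightarrow> real) \<Rightarrow> bool" where
  "tame x \<longleftrightarrow> infinite (UNIV :: 'i set) \<and> (\<forall>i. 0 \<le> x i) \<and> (\<forall>s>0. finite {i. s \<le> x i})"

lemma tameD: "tame x \<Longrightarrow> 0 \<le> x i" "tame x \<Longrightarrow> 0 < s \<Longrightarrow> point_count x {s..} < \<top>"
  by (auto simp: tame_def point_count_less_top_iff)

text \<open>Markov's inequality for counting measure: \<open>s\<close> times the number of entries
  at or above \<open>s\<close> is at most the sum.\<close>

lemma tameI_sum:
  fixes x :: "'i \<Rightarrow> real"
  assumes inf: "infinite (UNIV :: 'i set)" and nonneg: "\<And>i. 0 \<le> x i"
    and sum: "(\<integral>\<^sup>+i. ennreal (x i) \<partial>count_space UNIV) < \<top>"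
  shows "tame x"
  unfolding tame_def
proof (intro conjI allI impI)
  fix s :: real assume s: "0 < s"
  have "ennreal s * point_count x {s..} = (\<integral>\<^sup>+i. ennreal s * indicator {s..} (x i) \<partial>count_space UNIV)"
    unfolding point_count_nn_integral by (rule nn_integral_cmult[symmetric]) auto
  also have "\<dots> \<le> (\<integral>\<^sup>+i. ennreal (x i) \<partial>count_space UNIV)"
    by (intro nn_integral_mono) (auto simp: indicator_def intro!: ennreal_leI)
  finally have "point_count x {s..} < \<top>"
    using sum s by (auto simp: ennreal_mult_less_top less_top[symmetric] top_unique ennreal_mult_eq_top_iff)
  then show "finite {i. s \<le> x i}" by (simp add: point_count_less_top_iff)
qed (use inf nonneg in auto)

text \<open>Ranking and counting are adjoint. The content is that the supremum defining
  \<open>ranked\<close> is attained: only finitely many entries lie just below a positive level, so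
  the count is constant on a short interval to its left.\<close>

lemma le_ranked_iff:
  assumes "tame x"
  shows "s \<le> ranked x n \<longleftrightarrow> s \<le> 0 \<or> of_nat n < point_count x {s..}"
proof -
  let ?D = "{s. of_nat n < point_count x {s..}}"
  have inf: "infinite (UNIV :: 'a set)" and nonneg: "\<And>i. 0 \<le> x i" and fin: "\<And>s. 0 < s \<Longrightarrow> finite {i. s \<le> x i}"
    using assms by (auto simp: tame_def)
  have neg: "s \<in> ?D" if "s \<le> 0" for s
  proof -
    have "{i. x i \<in> {s..}} = UNIV" using that nonneg by (auto intro: order_trans)
    then show ?thesis using inf by (simp add: point_count_def emeasure_count_space ennreal_of_nat_eq_real_of_nat)
  qed
  have down: "s \<in> ?D" if "t \<in> ?D" "s \<le> t" for s t
    using that point_count_mono[of "{t..}" "{s..}" x] by (auto intro: less_le_trans)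
  obtain m where m: "\<And>s. s \<in> ?D \<Longrightarrow> s \<le> m"
  proof -
    have "s \<le> max 1 (Max (insert 1 (x ` {i. 1 \<le> x i})))" if "s \<in> ?D" for s
    proof (rule ccontr)
      assume "\<not> ?thesis"
      then have s: "1 < s" "Max (insert 1 (x ` {i. 1 \<le> x i})) < s" by auto
      have "x i < s" for i
      proof (cases "1 \<le> x i")
        case True
        then have "x i \<le> Max (insert 1 (x ` {i. 1 \<le> x i}))" using fin[of 1] by (intro Max_ge) auto
        with s show ?thesis by linarith
      qed (use s in auto)
      then have "{i. x i \<in> {s..}} = {}" by (auto simp: not_le)
      then have "point_count x {s..} = 0" unfolding point_count_def by (metis emeasure_empty)
      with that show False by simp
    qed
    then show thesis using that by blast
  qed
  then have bdd: "bdd_above ?D" by (auto simp: bdd_above_def)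
  have ne: "?D \<noteq> {}" using neg[of 0] by auto
  have att: "Sup ?D \<in> ?D"
  proof (cases "0 < Sup ?D")
    case pos: True
    let ?r = "Sup ?D"
    \<comment> \<open>The largest entry in \<open>{?r / 2..<?r}\<close>, with \<open>?r / 2\<close>
      inserted so that the maximum exists; no entry lies strictly between \<open>?m\<close> and
      \<open>?r\<close>.\<close>
    let ?m = "Max (insert (?r/2) (x ` {i. ?r / 2 \<le> x i \<and> x i < ?r}))"
    have fin': "finite (x ` {i. ?r / 2 \<le> x i \<and> x i < ?r})"
      using fin[of "?r/2"] pos by (auto intro: finite_subset)
    then have "?m < ?r" using pos by (auto simp: Max_less_iff)
    then obtain s where s: "?m < s" "s < ?r" using dense by blast
    obtain t where t: "t \<in> ?D" "s < t" using less_cSup_iff[OF ne bdd, of s] s(2) by (elim iffE) metis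
    have "s \<in> ?D" using down[OF t(1)] t(2) by auto
    moreover have "{i. x i \<in> {s..}} \<subseteq> {i. x i \<in> {?r..}}"
    proof safe
      fix i assume i: "s \<le> x i"
      show "?r \<le> x i"
      proof (rule ccontr)
        assume "\<not> ?r \<le> x i"
        moreover have "?r / 2 \<le> ?m" using fin' by (intro Max_ge) auto
        ultimately have "x i \<le> ?m" using s i fin' by (intro Max_ge) auto
        with i s show False by linarith
      qed
    qed
    then have "point_count x {s..} \<le> point_count x {?r..}"
      unfolding point_count_def by (intro emeasure_mono) auto
    ultimately show ?thesis by (auto intro: less_le_trans)
  qed (use neg in auto)
  have D: "s \<in> ?D \<longleftrightarrow> s \<le> ranked x n"
  proof
    assume "s \<in> ?D" then show "s \<le> ranked x n" unfolding ranked_def by (rule cSup_upper[OF _ bdd])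
  next
    assume "s \<le> ranked x n" then show "s \<in> ?D" unfolding ranked_def by (rule down[OF att])
  qed
  show ?thesis using D neg by auto
qed

lemma ranked_nonneg: "tame x \<Longrightarrow> 0 \<le> ranked x n"
  by (simp add: le_ranked_iff)

lemma point_count_ranked:
  assumes "tame x" "0 < s"
  shows "point_count (ranked x) {s..} = point_count x {s..}"
proof -
  obtain k where k: "point_count x {s..} = of_nat k"
    using tameD(2)[OF assms] by (auto simp: point_count_def emeasure_count_space split: if_splits)
  have "{n. ranked x n \<in> {s..}} = {..<k}"
    using assms by (auto simp: le_ranked_iff k)
  then show ?thesis unfolding k by (simp add: point_count_def emeasure_count_space)
qed

lemma tame_ranked:
  assumes "tame x"
  shows "tame (ranked x)"
proof -
  have "finite {n. s \<le> ranked x n}" if "0 < s" for s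
    using point_count_less_top_iff[of "ranked x" "{s..}"] point_count_ranked[OF assms that] tameD(2)[OF assms that]
    by simp
  then show ?thesis using assms by (simp add: tame_def[of "ranked x"] ranked_nonneg)
qed

lemma ranked_cong:
  assumes "tame x" "tame y" "\<And>s. 0 < s \<Longrightarrow> point_count x {s..} = point_count y {s..}"
  shows "ranked x = ranked y"
proof
  fix n
  have "s \<le> ranked x n \<longleftrightarrow> s \<le> ranked y n" for s
    using assms(3)[of s] by (cases "0 < s") (auto simp: le_ranked_iff assms(1,2))
  then show "ranked x n = ranked y n" by (meson antisym order_refl)
qed

lemma ranked_decseq: "decseq y \<Longrightarrow> ranked y = y"
  using ranked_rearrangement[of y id] by simp

lemma ranked_scale:
  assumes x: "tame x" and c: "0 < c"
  shows "ranked (\<lambda>i. c * x i) = (\<lambda>n. c * ranked x n)"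
proof
  fix n
  have t: "tame (\<lambda>i. c * x i)"
    using x c by (auto simp: tame_def pos_divide_le_eq[symmetric] mult.commute[of c])
  have "s \<le> ranked (\<lambda>i. c * x i) n \<longleftrightarrow> s \<le> c * ranked x n" for s
  proof -
    have "{i. c * x i \<in> {s..}} = {i. x i \<in> {s / c..}}"
      using c by (auto simp: field_simps)
    then have "point_count (\<lambda>i. c * x i) {s..} = point_count x {s / c..}"
      by (simp add: point_count_def)
    then have "s \<le> ranked (\<lambda>i. c * x i) n \<longleftrightarrow> s / c \<le> ranked x n"
      using c by (simp add: le_ranked_iff x t divide_le_0_iff)
    then show ?thesis using c by (simp add: pos_divide_le_eq mult.commute)
  qed
  then show "ranked (\<lambda>i. c * x i) n = c * ranked x n" by (meson antisym order_refl)
qed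

text \<open>An entry of \<open>x\<close> at level \<open>s\<close> gives an entry of
  \<open>y\<close> at level \<open>s - \<epsilon>\<close>, so each count dominates the other after a
  shift of the level. Ranking is thus a contraction for the supremum norm, although it may permute
  the two families differently.\<close>

lemma ranked_lipschitz:
  assumes xy: "tame x" "tame y" and d: "\<And>i. \<bar>x i - y i\<bar> \<le> \<epsilon>"
  shows "\<bar>ranked x n - ranked y n\<bar> \<le> \<epsilon>"
proof -
  have *: "ranked x n - \<epsilon> \<le> ranked y n" if xy: "tame x" "tame y" and d: "\<And>i. \<bar>x i - y i\<bar> \<le> \<epsilon>" for x y :: "'a \<Rightarrow> real"
  proof -
    let ?s = "ranked x n"
    have \<epsilon>: "0 \<le> \<epsilon>" using d[of undefined] by linarith
    have "?s \<le> 0 \<or> of_nat n < point_count x {?s..}"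
      using le_ranked_iff[OF xy(1), of ?s n] by simp
    moreover have "{i. x i \<in> {?s..}} \<subseteq> {i. y i \<in> {?s - \<epsilon>..}}"
    proof safe
      fix i assume "?s \<le> x i" then show "?s - \<epsilon> \<le> y i" using d[of i] by linarith
    qed
    then have "point_count x {?s..} \<le> point_count y {?s - \<epsilon>..}"
      unfolding point_count_def by (intro emeasure_mono) auto
    ultimately show ?thesis using \<epsilon> by (auto simp: le_ranked_iff[OF xy(2)] intro: less_le_trans)
  qed
  show ?thesis using *[OF xy d] *[OF xy(2,1)] d by (force simp: abs_le_iff)
qed

lemma measurable_ranked [measurable]:
  fixes X :: "'a \<Rightarrow> 'i::countable \<Rightarrow> real"
  assumes inf: "infinite (UNIV :: 'i set)" and [measurable]: "\<And>i. (\<lambda>\<omega>. X \<omega> i) \<in> borel_measurable M"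
  shows "(\<lambda>\<omega>. ranked (X \<omega>)) \<in> measurable M seq_space"
proof (rule measurable_PiM_single')
  fix n :: nat
  let ?D = "\<lambda>\<omega>. {s. of_nat n < point_count (X \<omega>) {s..}}"
  have down: "s \<in> ?D \<omega>" if "t \<in> ?D \<omega>" "s \<le> t" for s t \<omega>
    using that point_count_mono[of "{t..}" "{s..}" "X \<omega>"] by (auto intro: less_le_trans)
  have ne: "?D \<omega> \<noteq> {}" for \<omega>
  proof -
    obtain I :: "'i set" where I: "finite I" "card I = Suc n"
      using infinite_arbitrarily_large[OF inf] by blast
    let ?s = "Min (X \<omega> ` I)"
    have "I \<subseteq> {i. X \<omega> i \<in> {?s..}}" using I by auto
    then have "emeasure (count_space UNIV) I \<le> point_count (X \<omega>) {?s..}"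
      unfolding point_count_def by (intro emeasure_mono) auto
    moreover have "emeasure (count_space UNIV) I = of_nat (Suc n)" using I by (simp add: emeasure_count_space)
    moreover have "(of_nat n :: ennreal) < of_nat (Suc n)" by (simp only: of_nat_less_iff)
    ultimately show ?thesis by (metis (mono_tags, lifting) empty_iff less_le_trans mem_Collect_eq)
  qed
  \<comment> \<open>For a family that is not tame the set of levels may be all of
    \<open>UNIV\<close>, where \<open>Sup\<close> is an unspecified constant; the case distinction
    isolates this value. Otherwise the set is downward closed and bounded above, and rational levels
    decide the comparison.\<close>
  have eq: "ranked (X \<omega>) n \<in> {a<..} \<longleftrightarrow>
      (if \<forall>k::nat. of_nat n < point_count (X \<omega>) {real k..} then a < Sup (UNIV :: real set)
       else \<exists>q::rat. a < of_rat q \<and> of_nat n < point_count (X \<omega>) {of_rat q..})" for a \<omega>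
  proof (cases "\<forall>k::nat. of_nat n < point_count (X \<omega>) {real k..}")
    case True
    have "?D \<omega> = UNIV"
    proof safe
      fix s :: real
      obtain k where "s \<le> real k" using real_arch_simple by blast
      then show "of_nat n < point_count (X \<omega>) {s..}" using True down[of "real k" \<omega> s] by auto
    qed auto
    then show ?thesis using True unfolding ranked_def by simp
  next
    case False
    then obtain k :: nat where k: "real k \<notin> ?D \<omega>" by auto
    then have "s \<le> real k" if "s \<in> ?D \<omega>" for s using down[OF that] by (meson nle_le)
    then have bdd: "bdd_above (?D \<omega>)" by (auto simp: bdd_above_def)
    have "a < Sup (?D \<omega>) \<longleftrightarrow> (\<exists>s\<in>?D \<omega>. a < s)"
      by (rule less_cSup_iff[OF ne bdd])
    also have "\<dots> \<longleftrightarrow> (\<exists>q\<in>\<rat>. a < q \<and> q \<in> ?D \<omega>)"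
    proof
      assume "\<exists>s\<in>?D \<omega>. a < s"
      then obtain s where s: "s \<in> ?D \<omega>" "a < s" by blast
      then obtain q where "q \<in> \<rat>" "a < q" "q < s" using Rats_dense_in_real by blast
      then show "\<exists>q\<in>\<rat>. a < q \<and> q \<in> ?D \<omega>" using down[OF s(1), of q] by auto
    qed blast
    also have "\<dots> \<longleftrightarrow> (\<exists>q::rat. a < of_rat q \<and> of_rat q \<in> ?D \<omega>)"
      by (auto simp: Rats_def)
    finally show ?thesis unfolding ranked_def using False by (simp only: if_False greaterThan_iff mem_Collect_eq)
  qed
  have "(\<lambda>\<omega>. ranked (X \<omega>) n) \<in> borel_measurable M"
    unfolding borel_measurable_iff_greater
  proof
    fix a
    have "Measurable.pred M (\<lambda>\<omega>. if \<forall>k::nat. of_nat n < point_count (X \<omega>) {real k..} then a < Sup (UNIV :: real set)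
       else \<exists>q::rat. a < of_rat q \<and> of_nat n < point_count (X \<omega>) {of_rat q..})"
    proof -
      have [measurable]: "(\<lambda>\<omega>. point_count (X \<omega>) {q..}) \<in> borel_measurable M" for q
        by (rule point_count_measurable) auto
      show ?thesis by measurable
    qed
    then show "{\<omega> \<in> space M. a < ranked (X \<omega>) n} \<in> sets M"
      unfolding pred_def using eq[of _ a] by (simp add: greaterThan_iff)
  qed
  then show "(\<lambda>\<omega>. ranked (X \<omega>) n) \<in> borel_measurable M" .
qed auto

text \<open>Each positive entry is the length of \<open>{0<..x i}\<close>, and Tonelli exchanges sum
  and integral. Negative entries contribute 0 on both sides.\<close>

lemma nn_integral_layer_cake_count:
  fixes x :: "'i::countable \<Rightarrow> real"
  shows "(\<integral>\<^sup>+i. ennreal (x i) \<partial>count_space UNIV) = (\<integral>\<^sup>+s. point_count x {s..} * indicator {0<..} s \<partial>lborel)"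
proof -
  interpret C: sigma_finite_measure "count_space (UNIV :: 'i set)"
    by (intro sigma_finite_measure_count_space_countable) auto
  interpret pair_sigma_finite "count_space (UNIV :: 'i set)" lborel ..
  have "ennreal (x i) = (\<integral>\<^sup>+s. indicator {s..} (x i) * indicator {0<..} s \<partial>lborel)" for i
  proof -
    have "(\<integral>\<^sup>+s. indicator {s..} (x i) * indicator {0<..} s \<partial>lborel) = (\<integral>\<^sup>+s. indicator {0<..x i} s \<partial>lborel)"
      by (intro nn_integral_cong) (auto simp: indicator_def)
    then show ?thesis by (cases "0 \<le> x i") (auto simp: ennreal_neg)
  qed
  then have "(\<integral>\<^sup>+i. ennreal (x i) \<partial>count_space UNIV) = (\<integral>\<^sup>+i. \<integral>\<^sup>+s. indicator {s..} (x i) * indicator {0<..} s \<partial>lborel \<partial>count_space UNIV)"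
    by simp
  also have "\<dots> = (\<integral>\<^sup>+s. \<integral>\<^sup>+i. indicator {s..} (x i) * indicator {0<..} s \<partial>count_space UNIV \<partial>lborel)"
    by (rule Fubini'[symmetric])
       (auto simp: indicator_def split_beta' intro!: measurable_pair_measure_countable1)
  also have "\<dots> = (\<integral>\<^sup>+s. point_count x {s..} * indicator {0<..} s \<partial>lborel)"
    by (simp add: point_count_nn_integral nn_integral_multc)
  finally show ?thesis .
qed

text \<open>By the layer-cake formula both sums depend only on the counts above positive levels, and
  these agree. This avoids any bijection between the indices and is insensitive to zero
  entries.\<close>

lemma sum_ranked:
  fixes x :: "'i::countable \<Rightarrow> real"
  assumes "tame x"
  shows "(\<Sum>n. ennreal (ranked x n)) = (\<integral>\<^sup>+i. ennreal (x i) \<partial>count_space UNIV)"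
proof -
  have "(\<Sum>n. ennreal (ranked x n)) = (\<integral>\<^sup>+n. ennreal (ranked x n) \<partial>count_space UNIV)"
    by (simp add: nn_integral_count_space_nat)
  also have "\<dots> = (\<integral>\<^sup>+s. point_count (ranked x) {s..} * indicator {0<..} s \<partial>lborel)"
    by (rule nn_integral_layer_cake_count)
  also have "\<dots> = (\<integral>\<^sup>+s. point_count x {s..} * indicator {0<..} s \<partial>lborel)"
    by (intro nn_integral_cong) (auto simp: indicator_def point_count_ranked[OF assms])
  also have "\<dots> = (\<integral>\<^sup>+i. ennreal (x i) \<partial>count_space UNIV)"
    by (rule nn_integral_layer_cake_count[symmetric])
  finally show ?thesis .
qed

lemma of_nat_less_iff_nexp: "of_nat n < z \<longleftrightarrow> nexp z < exp (- real n)"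
  by (cases z) (auto simp: ennreal_of_nat_eq_real_of_nat ennreal_less_iff)

text \<open>Reconstructs the ranked sequence from the transformed counts \<open>u q\<close> at
  positive rational levels: \<open>u q < exp (- n)\<close> says that the count exceeds
  \<open>n\<close>. Ranking becomes a measurable function of countably many
  \<open>[0,1]\<close>-valued variables; the default 0 in the supremum serves the ranks for which no
  level qualifies.\<close>

definition ranked_of_counts :: "(real \<Rightarrow> real) \<Rightarrow> nat \<Rightarrow> real" where
  "ranked_of_counts u n = enn2real (SUP q\<in>{q\<in>\<rat>. 0 < q}. if u q < exp (- real n) then ennreal q else 0)"

lemma ranked_of_counts:
  assumes "tame x" and u: "\<And>q. q \<in> \<rat> \<Longrightarrow> 0 < q \<Longrightarrow> u q = nexp (point_count x {q..})"
  shows "ranked_of_counts u = ranked x"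
proof
  fix n
  have "(SUP q\<in>{q\<in>\<rat>. 0 < q}. if u q < exp (- real n) then ennreal q else 0) = ennreal (ranked x n)" (is "?S = _")
  proof (rule antisym)
    show "?S \<le> ennreal (ranked x n)"
      by (intro SUP_least) (auto simp: u of_nat_less_iff_nexp[symmetric] intro!: ennreal_leI le_ranked_iff[OF assms(1), THEN iffD2])
    show "ennreal (ranked x n) \<le> ?S"
    proof (rule dense_le)
      fix z assume z: "z < ennreal (ranked x n)"
      then obtain r where r: "z = ennreal r" "0 \<le> r" by (cases z) auto
      then have "r < ranked x n" using z by (simp add: ennreal_less_iff)
      then obtain q where q: "q \<in> \<rat>" "r < q" "q < ranked x n" using Rats_dense_in_real by blast
      then have "0 < q" using r by auto
      have "of_nat n < point_count x {q..}" using le_ranked_iff[OF assms(1), of q n] q \<open>0 < q\<close> by auto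
      then have "ennreal q \<le> ?S"
        using q \<open>0 < q\<close> by (intro SUP_upper2[of q]) (auto simp: u of_nat_less_iff_nexp)
      moreover have "z \<le> ennreal q" unfolding r(1) using q by (intro ennreal_leI) simp
      ultimately show "z \<le> ?S" by (rule order_trans[rotated])
    qed
  qed
  then show "ranked_of_counts u n = ranked x n"
    unfolding ranked_of_counts_def by (simp add: ranked_nonneg[OF assms(1)])
qed

text \<open>Taking for \<open>g\<close> a combination of indicators of \<open>{s..}\<close> with
  natural coefficients turns the hypothesis into equality of all mixed moments of \<open>e\<close>
  and of the transformed counts at rational levels. These determine a joint law, and ranking is a
  function of the counts. Test functions vanishing near 0 suffice, so the accumulation of small
  points is harmless.\<close>

lemma ranked_law_eqI:
  fixes X :: "'a \<Rightarrow> 'i::countable \<Rightarrow> real" and Y :: "'b \<Rightarrow> 'j::countable \<Rightarrow> real"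
  assumes fin: "finite_measure A" "finite_measure B"
    and [measurable]: "\<And>i. (\<lambda>\<omega>. X \<omega> i) \<in> borel_measurable A" "\<And>j. (\<lambda>\<omega>. Y \<omega> j) \<in> borel_measurable B"
      "e \<in> borel_measurable A" "e' \<in> borel_measurable B"
    and e01: "AE \<omega> in A. e \<omega> \<in> {0..1}" "AE \<omega> in B. e' \<omega> \<in> {0..1}"
    and tame: "AE \<omega> in A. tame (X \<omega>)" "AE \<omega> in B. tame (Y \<omega>)"
    and inf: "infinite (UNIV :: 'i set)" "infinite (UNIV :: 'j set)"
    and eq: "\<And>(g :: real \<Rightarrow> real) m s. g \<in> borel_measurable borel \<Longrightarrow> (\<And>x. 0 \<le> g x) \<Longrightarrow> 0 < s \<Longrightarrow> (\<And>x. x < s \<Longrightarrow> g x = 0) \<Longrightarrow>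
       (\<integral>\<^sup>+\<omega>. ennreal (e \<omega>) ^ m * ennreal (nexp (\<integral>\<^sup>+i. ennreal (g (X \<omega> i)) \<partial>count_space UNIV)) \<partial>A)
       = (\<integral>\<^sup>+\<omega>. ennreal (e' \<omega>) ^ m * ennreal (nexp (\<integral>\<^sup>+j. ennreal (g (Y \<omega> j)) \<partial>count_space UNIV)) \<partial>B)"
  shows "distr A (borel \<Otimes>\<^sub>M seq_space) (\<lambda>\<omega>. (e \<omega>, ranked (X \<omega>)))
       = distr B (borel \<Otimes>\<^sub>M seq_space) (\<lambda>\<omega>. (e' \<omega>, ranked (Y \<omega>)))"
proof -
  \<comment> \<open>Index 0 is reserved for \<open>e\<close>; the other indices are the levels at
    which points are counted.\<close>
  define I :: "real set" where "I = insert 0 {q\<in>\<rat>. 0 < q}"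
  define U where "U s \<omega> = (if s = 0 then e \<omega> else nexp (point_count (X \<omega>) {s..}))" for s \<omega>
  define V where "V s \<omega> = (if s = 0 then e' \<omega> else nexp (point_count (Y \<omega>) {s..}))" for s \<omega>
  have [measurable]: "U s \<in> borel_measurable A" "V s \<in> borel_measurable B" for s
    unfolding U_def[abs_def] V_def[abs_def] by (cases "s = 0"; simp)+
  have prod: "(\<Prod>s\<in>F. ennreal (if s = 0 then c else nexp (point_count x {s..})) ^ k s)
     = ennreal c ^ (if 0 \<in> F then k 0 else 0) *
       ennreal (nexp (\<integral>\<^sup>+i. ennreal ((\<Sum>s\<in>F - {0}. real (k s) * indicator {s..} (x i))) \<partial>count_space UNIV))"
    if F: "finite F" for F c and x :: "'k::countable \<Rightarrow> real" and k :: "real \<Rightarrow> nat"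
  proof -
    have "(\<integral>\<^sup>+i. ennreal ((\<Sum>s\<in>F - {0}. real (k s) * indicator {s..} (x i))) \<partial>count_space UNIV)
      = (\<integral>\<^sup>+i. (\<Sum>s\<in>F - {0}. of_nat (k s) * indicator {s..} (x i)) \<partial>count_space UNIV)"
      by (intro nn_integral_cong) (simp add: sum_ennreal[symmetric] ennreal_mult ennreal_of_nat_eq_real_of_nat ennreal_indicator)
    also have "\<dots> = (\<Sum>s\<in>F - {0}. of_nat (k s) * point_count x {s..})"
      by (simp add: nn_integral_sum nn_integral_cmult point_count_nn_integral)
    finally have "ennreal (nexp (\<integral>\<^sup>+i. ennreal ((\<Sum>s\<in>F - {0}. real (k s) * indicator {s..} (x i))) \<partial>count_space UNIV))
      = (\<Prod>s\<in>F - {0}. ennreal (nexp (point_count x {s..})) ^ k s)"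
      by (simp add: nexp_sum nexp_mult_of_nat ennreal_power prod_ennreal)
    moreover have "(\<Prod>s\<in>F. ennreal (if s = 0 then c else nexp (point_count x {s..})) ^ k s)
      = ennreal c ^ (if 0 \<in> F then k 0 else 0) * (\<Prod>s\<in>F - {0}. ennreal (nexp (point_count x {s..})) ^ k s)"
    proof (cases "0 \<in> F")
      case True
      then show ?thesis using F by (subst prod.remove[of F 0]) (auto intro!: arg_cong2[where f = "(*)"] prod.cong)
    qed (auto intro!: prod.cong)
    ultimately show ?thesis by simp
  qed
  have D: "distr A (PiM I (\<lambda>_. borel)) (\<lambda>\<omega>. \<lambda>s\<in>I. U s \<omega>) = distr B (PiM I (\<lambda>_. borel)) (\<lambda>\<omega>. \<lambda>s\<in>I. V s \<omega>)"
  proof (rule mixed_moments_determine_measure[OF fin])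
    show "AE \<omega> in A. U i \<omega> \<in> {0..1}" "AE \<omega> in B. V i \<omega> \<in> {0..1}" for i
      using e01 by (auto simp: U_def V_def)
    fix F k assume F: "finite F" "F \<subseteq> I"
    let ?g = "\<lambda>x. \<Sum>s\<in>F - {0}. real (k s) * indicator {s..} x"
    \<comment> \<open>No level in use lies below \<open>s\<close>; the inserted 1 serves the case
      without levels.\<close>
    obtain s where s: "0 < s" "\<And>r. r \<in> F - {0} \<Longrightarrow> s \<le> r"
    proof
      show "0 < Min (insert 1 (F - {0}))" using F by (auto simp: I_def Min_gr_iff)
      show "Min (insert 1 (F - {0})) \<le> r" if "r \<in> F - {0}" for r using F that by (intro Min_le) auto
    qed
    have "?g x = 0" if "x < s" for x
      using s(2) that by (intro sum.neutral) (force simp: indicator_def)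
    from eq[of ?g s "if 0 \<in> F then k 0 else 0", OF _ _ s(1) this]
    show "(\<integral>\<^sup>+\<omega>. (\<Prod>i\<in>F. ennreal (U i \<omega>) ^ k i) \<partial>A) = (\<integral>\<^sup>+\<omega>. (\<Prod>i\<in>F. ennreal (V i \<omega>) ^ k i) \<partial>B)"
      unfolding U_def V_def prod[OF F(1)] by (simp add: sum_nonneg)
  qed simp_all
  define \<Psi> :: "(real \<Rightarrow> real) \<Rightarrow> real \<times> (nat \<Rightarrow> real)" where "\<Psi> w = (w 0, ranked_of_counts w)" for w
  have [measurable]: "(\<lambda>w. w s) \<in> borel_measurable (PiM I (\<lambda>_. borel :: real measure))" if "s \<in> I" for s
    using that by measurable
  have [measurable]: "ranked_of_counts \<in> measurable (PiM I (\<lambda>_. borel)) seq_space"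
  proof (rule measurable_PiM_single')
    fix n
    have "countable {q\<in>\<rat>. (0::real) < q}" using countable_rat by (rule countable_subset[rotated]) auto
    then show "(\<lambda>w. ranked_of_counts w n) \<in> borel_measurable (PiM I (\<lambda>_. borel))"
      unfolding ranked_of_counts_def
      by (intro borel_measurable_enn2real borel_measurable_SUP) (auto simp: I_def)
  qed auto
  have [measurable]: "\<Psi> \<in> measurable (PiM I (\<lambda>_. borel)) (borel \<Otimes>\<^sub>M seq_space)"
    unfolding \<Psi>_def[abs_def] by (intro measurable_Pair) (auto intro!: measurable_component_singleton simp: I_def[symmetric], simp add: I_def)
  have "distr A (borel \<Otimes>\<^sub>M seq_space) (\<lambda>\<omega>. (e \<omega>, ranked (X \<omega>)))
      = distr A (borel \<Otimes>\<^sub>M seq_space) (\<Psi> \<circ> (\<lambda>\<omega>. \<lambda>s\<in>I. U s \<omega>))"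
  proof (rule distr_cong_AE[OF refl])
    show "AE \<omega> in A. (e \<omega>, ranked (X \<omega>)) = (\<Psi> \<circ> (\<lambda>\<omega>. \<lambda>s\<in>I. U s \<omega>)) \<omega>"
      using tame(1) by eventually_elim (auto simp: \<Psi>_def I_def U_def intro!: ranked_of_counts[symmetric])
  qed (use inf in simp_all)
  also have "\<dots> = distr (distr A (PiM I (\<lambda>_. borel)) (\<lambda>\<omega>. \<lambda>s\<in>I. U s \<omega>)) (borel \<Otimes>\<^sub>M seq_space) \<Psi>"
    by (subst distr_distr) simp_all
  also have "\<dots> = distr B (borel \<Otimes>\<^sub>M seq_space) (\<Psi> \<circ> (\<lambda>\<omega>. \<lambda>s\<in>I. V s \<omega>))"
    unfolding D by (subst distr_distr) simp_all
  also have "\<dots> = distr B (borel \<Otimes>\<^sub>M seq_space) (\<lambda>\<omega>. (e' \<omega>, ranked (Y \<omega>)))"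
  proof (rule distr_cong_AE[OF refl])
    show "AE \<omega> in B. (\<Psi> \<circ> (\<lambda>\<omega>. \<lambda>s\<in>I. V s \<omega>)) \<omega> = (e' \<omega>, ranked (Y \<omega>))"
      using tame(2) by eventually_elim (auto simp: \<Psi>_def I_def V_def intro!: ranked_of_counts)
  qed (use inf in simp_all)
  finally show ?thesis .
qed

section \<open>Poisson processes and stable intensities\<close>

lemma poisson_process_point_count_measurable [measurable]:
  assumes "poisson_process N \<nu> X" "A \<in> sets borel"
  shows "(\<lambda>\<omega>. point_count (\<lambda>i. X i \<omega>) A) \<in> borel_measurable N"
  using assms by (intro point_count_measurable) (auto simp: poisson_process_def)

text \<open>The generating function of the Poisson law, evaluated at
  \<open>exp (- y)\<close>.\<close>

lemma poisson_process_laplace_count: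
  assumes pp: "poisson_process N \<nu> X" and A: "A \<in> sets borel" "emeasure \<nu> A < \<infinity>" and y: "0 \<le> y"
  shows "(\<integral>\<^sup>+\<omega>. ennreal (nexp (ennreal y * point_count (\<lambda>i. X i \<omega>) A)) \<partial>N) = ennreal (exp (- measure \<nu> A * (1 - exp (- y))))"
proof -
  interpret prob_space N using pp by (simp add: poisson_process_def)
  let ?c = "\<lambda>\<omega>. point_count (\<lambda>i. X i \<omega>) A"
  let ?E = "\<lambda>k::nat. {\<omega> \<in> space N. ?c \<omega> = of_nat k}"
  define m where "m = measure \<nu> A"
  have m: "0 \<le> m" by (simp add: m_def)
  have [measurable]: "?c \<in> borel_measurable N" by (rule poisson_process_point_count_measurable[OF pp A(1)])
  have P: "emeasure N (?E k) = ennreal (exp (- m) * m ^ k / fact k)" for k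
    using pp A by (auto simp: poisson_process_def m_def emeasure_eq_measure)
  have exp_sum: "(\<Sum>k. ennreal (exp (- m) * z ^ k / fact k)) = ennreal (exp (- m) * exp z)" if "0 \<le> z" for z
  proof -
    have s: "(\<lambda>k. z ^ k / fact k) sums exp z"
      using exp_converges[of z] by (simp add: field_simps scaleR_conv_of_real)
    show ?thesis
      using sums_mult[OF s, of "exp (- m)"] that by (intro suminf_ennreal_eq) auto
  qed
  have disj: "disjoint_family ?E"
    by (auto simp: disjoint_family_on_def)
  \<comment> \<open>The Poisson weights sum to 1, so the count is almost surely a natural number and
    the events \<open>?E k\<close> exhaust the space up to a null set.\<close>
  have "emeasure N (\<Union>k. ?E k) = 1"
    using exp_sum[OF m] by (subst suminf_emeasure[symmetric]) (auto simp: P disj exp_add[symmetric])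
  then have "AE \<omega> in N. \<omega> \<in> (\<Union>k. ?E k)"
    by (intro AE_prob_1) (auto simp: emeasure_eq_measure)
  then have "(\<integral>\<^sup>+\<omega>. ennreal (nexp (ennreal y * ?c \<omega>)) \<partial>N) = (\<integral>\<^sup>+\<omega>. (\<Sum>k. ennreal (exp (- y * k)) * indicator (?E k) \<omega>) \<partial>N)"
  proof (intro nn_integral_cong_AE, eventually_elim)
    fix \<omega> assume "\<omega> \<in> (\<Union>k. ?E k)"
    then obtain k :: nat where k: "\<omega> \<in> space N" "?c \<omega> = of_nat k" by auto
    have "(\<Sum>j. ennreal (exp (- y * j)) * indicator (?E j) \<omega>) = (\<Sum>j\<in>{k}. ennreal (exp (- y * j)) * indicator (?E j) \<omega>)"
      by (rule suminf_finite) (auto simp: k)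
    then show "ennreal (nexp (ennreal y * ?c \<omega>)) = (\<Sum>j. ennreal (exp (- y * j)) * indicator (?E j) \<omega>)"
      using k y by (simp add: ennreal_of_nat_eq_real_of_nat ennreal_mult[symmetric])
  qed
  also have "\<dots> = (\<Sum>k. ennreal (exp (- y * k)) * emeasure N (?E k))"
    by (simp add: nn_integral_suminf nn_integral_cmult)
  also have "\<dots> = (\<Sum>k. ennreal (exp (- m) * (m * exp (- y)) ^ k / fact k))"
    using m by (intro arg_cong[where f=suminf] ext)
      (simp add: P ennreal_mult[symmetric] power_mult_distrib exp_of_nat_mult[symmetric] mult_ac)
  also have "\<dots> = ennreal (exp (- m * (1 - exp (- y))))"
    using m by (subst exp_sum) (auto simp: exp_add[symmetric] algebra_simps)
  finally show ?thesis by (simp add: m_def)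
qed

text \<open>The level sets of \<open>h\<close> are disjoint, so the counts on them are independent
  and the expectation factors into Poisson transforms.\<close>

lemma poisson_process_laplace_simple:
  assumes pp: "poisson_process N \<nu> X" and sets_\<nu>: "sets \<nu> = sets borel"
    and h: "h \<in> borel_measurable borel" "finite (range h)" "\<And>x. h x < \<top>"
    and S: "S \<in> sets borel" "emeasure \<nu> S < \<infinity>" "\<And>x. x \<notin> S \<Longrightarrow> h x = 0"
  shows "(\<integral>\<^sup>+\<omega>. ennreal (nexp (\<integral>\<^sup>+i. h (X i \<omega>) \<partial>count_space UNIV)) \<partial>N)
       = ennreal (nexp (\<integral>\<^sup>+x. ennreal (1 - nexp (h x)) \<partial>\<nu>))"
proof -
  interpret prob_space N using pp by (simp add: poisson_process_def)
  note [measurable_cong] = sets_\<nu>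
  note [measurable] = h(1)
  obtain m and e :: "nat \<Rightarrow> ennreal" where e: "bij_betw e {..<m} (range h - {0})"
    using ex_bij_betw_nat_finite[of "range h - {0}"] h(2) by (auto simp: atLeast0LessThan)
  \<comment> \<open>Beyond the \<open>m\<close> nonzero values of \<open>h\<close> the sets are
    empty, because the Poisson axioms give independence along infinite disjoint sequences.\<close>
  define A where "A k = (if k < m then h -` {e k} else {})" for k
  have A [measurable]: "A k \<in> sets borel" for k
    unfolding A_def using measurable_sets_borel[OF h(1), of "{e k}"] by simp
  have ek: "e k \<noteq> 0" "e k < \<top>" "e k = ennreal (enn2real (e k))" if "k < m" for k
  proof -
    have "e k \<in> range h - {0}" using e that by (auto simp: bij_betw_def)
    then show "e k \<noteq> 0" "e k < \<top>" using h(3) by auto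
    then show "e k = ennreal (enn2real (e k))" by simp
  qed
  have finA: "emeasure \<nu> (A k) < \<infinity>" for k
  proof (cases "k < m")
    case True
    then have "A k \<subseteq> S" using S(3) ek[OF True] by (fastforce simp: A_def)
    then have "emeasure \<nu> (A k) \<le> emeasure \<nu> S" using S(1) by (intro emeasure_mono) (auto simp: sets_\<nu>)
    then show ?thesis using S(2) by (rule le_less_trans)
  qed (simp add: A_def)
  \<comment> \<open>Stated for any \<open>f\<close> vanishing at 0: the identity yields the sum over
    the points, and \<open>1 - nexp\<close> yields the exponent.\<close>
  have h_sum: "f (h x) = (\<Sum>k<m. f (e k) * indicator (A k) x)" if f0: "f 0 = 0" for f :: "ennreal \<Rightarrow> ennreal" and x
  proof (cases "h x = 0")
    case True
    then show ?thesis using ek f0 by (intro trans[OF _ sum.neutral[symmetric]]) (auto simp: A_def indicator_def)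
  next
    case False
    then have "h x \<in> e ` {..<m}" using e by (auto simp: bij_betw_def)
    then obtain k where k: "k < m" "e k = h x" by auto
    have "(\<Sum>j<m. f (e j) * indicator (A j) x) = (\<Sum>j\<in>{k}. f (e j) * indicator (A j) x)"
      using k e by (intro sum.mono_neutral_right) (auto simp: A_def indicator_def bij_betw_def inj_on_def)
    then show ?thesis using k by (simp add: A_def)
  qed
  have disj: "disjoint_family A"
    using e by (auto simp: disjoint_family_on_def A_def bij_betw_def inj_on_def)
  have "indep_vars (\<lambda>_. borel) (\<lambda>n \<omega>. point_count (\<lambda>i. X i \<omega>) (A n)) UNIV"
    using pp disj A unfolding poisson_process_def by blast
  then have "indep_vars (\<lambda>_. borel) (\<lambda>n \<omega>. point_count (\<lambda>i. X i \<omega>) (A n)) {..<m}"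
    by (rule indep_vars_subset) auto
  then have ind: "indep_vars (\<lambda>_. borel) (\<lambda>k \<omega>. ennreal (nexp (e k * point_count (\<lambda>i. X i \<omega>) (A k)))) {..<m}"
    by (rule indep_vars_compose2) auto
  have "(\<integral>\<^sup>+i. h (X i \<omega>) \<partial>count_space UNIV) = (\<Sum>k<m. e k * point_count (\<lambda>i. X i \<omega>) (A k))" for \<omega>
    unfolding h_sum[of "\<lambda>x. x", OF refl] point_count_nn_integral
    by (subst nn_integral_sum) (simp_all only: measurable_count_space_eq1 UNIV_I Pi_UNIV space_borel nn_integral_cmult)
  then have "(\<integral>\<^sup>+\<omega>. ennreal (nexp (\<integral>\<^sup>+i. h (X i \<omega>) \<partial>count_space UNIV)) \<partial>N)
    = (\<integral>\<^sup>+\<omega>. (\<Prod>k<m. ennreal (nexp (e k * point_count (\<lambda>i. X i \<omega>) (A k)))) \<partial>N)"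
    by (simp add: nexp_sum prod_ennreal)
  also have "\<dots> = (\<Prod>k<m. \<integral>\<^sup>+\<omega>. ennreal (nexp (e k * point_count (\<lambda>i. X i \<omega>) (A k))) \<partial>N)"
    by (rule indep_vars_nn_integral[OF _ ind]) auto
  also have "\<dots> = (\<Prod>k<m. ennreal (exp (- measure \<nu> (A k) * (1 - nexp (e k)))))"
  proof (intro prod.cong refl)
    fix k assume "k \<in> {..<m}"
    then have k: "k < m" by simp
    have "nexp (e k) = exp (- enn2real (e k))"
      by (subst ek(3)[OF k]) simp
    then show "(\<integral>\<^sup>+\<omega>. ennreal (nexp (e k * point_count (\<lambda>i. X i \<omega>) (A k))) \<partial>N) = ennreal (exp (- measure \<nu> (A k) * (1 - nexp (e k))))"
      using poisson_process_laplace_count[OF pp A finA, of "enn2real (e k)" k] ek(3)[OF k] by simp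
  qed
  also have "\<dots> = ennreal (nexp (ennreal (\<Sum>k<m. measure \<nu> (A k) * (1 - nexp (e k)))))"
    by (simp add: prod_ennreal exp_sum[symmetric] sum_nonneg sum_negf)
  also have "ennreal (\<Sum>k<m. measure \<nu> (A k) * (1 - nexp (e k))) = (\<Sum>k<m. ennreal (1 - nexp (e k)) * emeasure \<nu> (A k))"
    using finA by (subst sum_ennreal[symmetric])
      (auto simp: ennreal_mult emeasure_eq_ennreal_measure less_top mult.commute intro!: sum.cong)
  also have "\<dots> = (\<integral>\<^sup>+x. ennreal (1 - nexp (h x)) \<partial>\<nu>)"
  proof -
    have "(\<integral>\<^sup>+x. ennreal (1 - nexp (h x)) \<partial>\<nu>) = (\<integral>\<^sup>+x. (\<Sum>k<m. ennreal (1 - nexp (e k)) * indicator (A k) x) \<partial>\<nu>)"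
      by (intro nn_integral_cong h_sum) simp
    also have "\<dots> = (\<Sum>k<m. \<integral>\<^sup>+x. ennreal (1 - nexp (e k)) * indicator (A k) x \<partial>\<nu>)"
      by (rule nn_integral_sum) simp
    also have "\<dots> = (\<Sum>k<m. ennreal (1 - nexp (e k)) * emeasure \<nu> (A k))"
      by (intro sum.cong refl nn_integral_cmult_indicator) (simp add: sets_\<nu>)
    finally show ?thesis ..
  qed
  finally show ?thesis .
qed

text \<open>Simple functions cut off to the sets \<open>S n\<close> of finite intensity increase to
  \<open>g\<close>. The sum over the points and the exponent both converge monotonically, and
  boundedness of \<open>nexp\<close> carries the first limit through the expectation.\<close>

theorem poisson_process_laplace_functional:
  assumes pp: "poisson_process N \<nu> X" and sets_\<nu>: "sets \<nu> = sets borel"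
    and S: "incseq S" "(\<Union>n. S n) = UNIV" "\<And>n::nat. S n \<in> sets borel" "\<And>n. emeasure \<nu> (S n) < \<infinity>"
    and g [measurable]: "g \<in> borel_measurable borel"
  shows "(\<integral>\<^sup>+\<omega>. ennreal (nexp (\<integral>\<^sup>+i. g (X i \<omega>) \<partial>count_space UNIV)) \<partial>N)
       = ennreal (nexp (\<integral>\<^sup>+x. ennreal (1 - nexp (g x)) \<partial>\<nu>))"
proof -
  interpret prob_space N using pp by (simp add: poisson_process_def)
  note [measurable_cong] = sets_\<nu>
  note [measurable] = S(3)
  have [measurable]: "X i \<in> borel_measurable N" for i using pp by (simp add: poisson_process_def)
  obtain f :: "nat \<Rightarrow> real \<Rightarrow> ennreal" where f: "\<And>i. simple_function borel (f i)" "incseq f" "\<And>i x. f i x < \<top>" "\<And>x. (SUP i. f i x) = g x"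
    using borel_measurable_implies_simple_function_sequence'[OF g] by metis
  have fm [measurable]: "f n \<in> borel_measurable borel" for n using f(1) by (rule borel_measurable_simple_function)
  define h where "h n x = f n x * indicator (S n) x" for n x
  have hm [measurable]: "h n \<in> borel_measurable borel" for n unfolding h_def[abs_def] by measurable
  have fin: "finite (range (h n))" for n
  proof -
    have "range (h n) \<subseteq> insert 0 (range (f n))" by (auto simp: h_def indicator_def)
    then show ?thesis using f(1)[of n] by (auto simp: simple_function_def intro: finite_subset)
  qed
  have incf: "f m x \<le> f n x" if "m \<le> n" for m n x using f(2) that by (auto simp: incseq_def le_fun_def)
  have inch: "incseq (\<lambda>n. h n x)" for x
    using S(1) by (fastforce simp: incseq_def h_def indicator_def intro: incf)
  have limh: "(\<lambda>n. h n x) \<longlonglongrightarrow> g x" for x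
  proof -
    obtain k where k: "x \<in> S k" using S(2) by blast
    have "eventually (\<lambda>n. h n x = f n x) sequentially"
      using eventually_ge_at_top[of k]
    proof eventually_elim
      case (elim n)
      then have "S k \<subseteq> S n" using S(1) by (simp add: incseq_def)
      then show ?case using k by (auto simp: h_def)
    qed
    moreover have "(\<lambda>n. f n x) \<longlonglongrightarrow> g x"
      unfolding f(4)[symmetric] by (rule LIMSEQ_SUP) (auto simp: incseq_def intro: incf)
    ultimately show ?thesis by (simp add: tendsto_cong)
  qed
  have "(\<lambda>n. \<integral>\<^sup>+\<omega>. ennreal (nexp (\<integral>\<^sup>+i. h n (X i \<omega>) \<partial>count_space UNIV)) \<partial>N)
      \<longlonglongrightarrow> (\<integral>\<^sup>+\<omega>. ennreal (nexp (\<integral>\<^sup>+i. g (X i \<omega>) \<partial>count_space UNIV)) \<partial>N)"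
  proof (rule nn_integral_dominated_convergence[where w = "\<lambda>_. 1"])
    show "AE \<omega> in N. (\<lambda>n. ennreal (nexp (\<integral>\<^sup>+i. h n (X i \<omega>) \<partial>count_space UNIV)))
      \<longlonglongrightarrow> ennreal (nexp (\<integral>\<^sup>+i. g (X i \<omega>) \<partial>count_space UNIV))"
    proof (intro AE_I2 tendsto_ennrealI tendsto_nexp)
      fix \<omega>
      show "(\<lambda>n. \<integral>\<^sup>+i. h n (X i \<omega>) \<partial>count_space UNIV) \<longlonglongrightarrow> (\<integral>\<^sup>+i. g (X i \<omega>) \<partial>count_space UNIV)"
        using inch by (intro nn_integral_LIMSEQ limh) (auto simp: incseq_def le_fun_def)
    qed
  qed (auto simp: emeasure_space_1)
  moreover have "(\<lambda>n. ennreal (nexp (\<integral>\<^sup>+x. ennreal (1 - nexp (h n x)) \<partial>\<nu>))) \<longlonglongrightarrow> ennreal (nexp (\<integral>\<^sup>+x. ennreal (1 - nexp (g x)) \<partial>\<nu>))"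
  proof (intro tendsto_ennrealI tendsto_nexp nn_integral_LIMSEQ tendsto_diff tendsto_const limh)
    have "nexp b \<le> nexp a" if "a \<le> b" for a b
      using that by (cases a; cases b) (auto simp: nexp_def top_unique)
    then show "incseq (\<lambda>i x. ennreal (1 - nexp (h i x)))"
      using inch by (auto simp: incseq_def le_fun_def intro!: ennreal_leI)
  qed auto
  moreover have "(\<integral>\<^sup>+\<omega>. ennreal (nexp (\<integral>\<^sup>+i. h n (X i \<omega>) \<partial>count_space UNIV)) \<partial>N)
      = ennreal (nexp (\<integral>\<^sup>+x. ennreal (1 - nexp (h n x)) \<partial>\<nu>))" for n
    by (rule poisson_process_laplace_simple[OF pp sets_\<nu> hm fin _ S(3,4)])
       (use f(3) in \<open>auto simp: h_def indicator_def\<close>)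
  ultimately show ?thesis by (simp add: LIMSEQ_unique)
qed

section \<open>The stable intensity: scaling, tails and Laplace exponent\<close>

lemma sets_stable_intensity [measurable_cong, simp]: "sets (stable_intensity \<gamma>) = sets borel"
  by (simp add: stable_intensity_def)

lemma nn_integral_stable_intensity:
  assumes [measurable]: "f \<in> borel_measurable borel"
  shows "(\<integral>\<^sup>+x. f x \<partial>stable_intensity \<gamma>)
    = (\<integral>\<^sup>+x. ennreal (\<gamma> / Gamma (1 - \<gamma>) * x powr (- \<gamma> - 1)) * f x * indicator {0<..} x \<partial>lborel)"
  unfolding stable_intensity_def
  by (subst nn_integral_density) (auto intro!: nn_integral_cong simp: indicator_def)

text \<open>Self-similarity: the substitution \<open>x \<mapsto> c * x\<close> contributes
  \<open>c powr (- \<gamma> - 1)\<close> from the density and \<open>c\<close> from the line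
  element. The exponents of the stable laws below come from this scaling.\<close>

lemma nn_integral_stable_intensity_scale:
  assumes [measurable]: "f \<in> borel_measurable borel" and \<gamma>: "0 < \<gamma>" "\<gamma> < 1" and c: "0 < c"
  shows "(\<integral>\<^sup>+x. f (c * x) \<partial>stable_intensity \<gamma>) = ennreal (c powr \<gamma>) * (\<integral>\<^sup>+x. f x \<partial>stable_intensity \<gamma>)"
proof -
  let ?k = "\<gamma> / Gamma (1 - \<gamma>)"
  have k: "0 < ?k" using \<gamma> by (simp add: Gamma_real_pos)
  have "(\<integral>\<^sup>+x. f x \<partial>stable_intensity \<gamma>)
    = ennreal c * (\<integral>\<^sup>+x. ennreal (?k * (c * x) powr (- \<gamma> - 1)) * f (c * x) * indicator {0<..} x \<partial>lborel)"
    unfolding nn_integral_stable_intensity[OF assms(1)]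
    using c by (subst nn_integral_real_affine[where c = c and t = 0]) (auto simp: indicator_def zero_less_mult_iff)
  then have "ennreal (c powr \<gamma>) * (\<integral>\<^sup>+x. f x \<partial>stable_intensity \<gamma>)
    = (\<integral>\<^sup>+x. ennreal (c powr \<gamma> * c) * (ennreal (?k * (c * x) powr (- \<gamma> - 1)) * f (c * x) * indicator {0<..} x) \<partial>lborel)"
    using c by (simp add: nn_integral_cmult ennreal_mult mult.assoc)
  also have "\<dots> = (\<integral>\<^sup>+x. ennreal (?k * x powr (- \<gamma> - 1)) * f (c * x) * indicator {0<..} x \<partial>lborel)"
  proof (intro nn_integral_cong)
    fix x :: real
    have "c powr \<gamma> * c * (?k * (c * x) powr (- \<gamma> - 1)) = ?k * x powr (- \<gamma> - 1)" if "0 < x"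
    proof -
      have "c powr \<gamma> * c * c powr (- \<gamma> - 1) = 1"
        using c by (simp add: mult.assoc powr_mult_base powr_add[symmetric])
      then show ?thesis using c that by (simp add: powr_mult mult_ac)
    qed
    then show "ennreal (c powr \<gamma> * c) * (ennreal (?k * (c * x) powr (- \<gamma> - 1)) * f (c * x) * indicator {0<..} x)
      = ennreal (?k * x powr (- \<gamma> - 1)) * f (c * x) * indicator {0<..} x"
      using k c by (cases "0 < x") (auto simp: mult.assoc[symmetric] ennreal_mult'[symmetric] simp del: times_divide_eq_left)
  qed
  also have "\<dots> = (\<integral>\<^sup>+x. f (c * x) \<partial>stable_intensity \<gamma>)"
    by (rule nn_integral_stable_intensity[symmetric]) simp
  finally show ?thesis ..
qed

lemma emeasure_stable_intensity_atLeast: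
  assumes \<gamma>: "0 < \<gamma>" "\<gamma> < 1" and s: "0 < s"
  shows "emeasure (stable_intensity \<gamma>) {s..} = ennreal (s powr (- \<gamma>) / Gamma (1 - \<gamma>))"
proof -
  have G: "0 < Gamma (1 - \<gamma>)" using \<gamma> by (simp add: Gamma_real_pos)
  have "emeasure (stable_intensity \<gamma>) {s..} = (\<integral>\<^sup>+x. indicator {s..} x \<partial>stable_intensity \<gamma>)" by simp
  also have "\<dots> = (\<integral>\<^sup>+x. ennreal (\<gamma> / Gamma (1 - \<gamma>) * x powr (- \<gamma> - 1)) * indicator {s..} x \<partial>lborel)"
    using s by (subst nn_integral_stable_intensity) (auto intro!: nn_integral_cong simp: indicator_def)
  also have "\<dots> = ennreal (0 - (- (s powr (- \<gamma>) / Gamma (1 - \<gamma>))))"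
  proof (rule nn_integral_FTC_atLeast)
    fix x assume "s \<le> x"
    then show "((\<lambda>x. - (x powr (- \<gamma>) / Gamma (1 - \<gamma>))) has_real_derivative \<gamma> / Gamma (1 - \<gamma>) * x powr (- \<gamma> - 1)) (at x)"
      using s G by (auto intro!: derivative_eq_intros simp: field_simps)
    show "0 \<le> \<gamma> / Gamma (1 - \<gamma>) * x powr (- \<gamma> - 1)" using \<gamma> G by simp
  next
    have "((\<lambda>x::real. x powr (- \<gamma>)) \<longlongrightarrow> 0) at_top"
      using \<gamma> by (intro tendsto_neg_powr filterlim_ident) auto
    then show "((\<lambda>x. - (x powr (- \<gamma>) / Gamma (1 - \<gamma>))) \<longlongrightarrow> 0) at_top"
      using tendsto_minus[OF tendsto_divide[OF _ tendsto_const]] G by fastforce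
  qed simp
  finally show ?thesis by simp
qed

text \<open>Write \<open>1 - exp (- x)\<close> as the integral of \<open>exp (- u)\<close> over
  \<open>{0..x}\<close> and exchange the integrals: the tail of the intensity leaves the integral
  for \<open>Gamma (1 - \<gamma>)\<close>, which the normalizing constant cancels. Scaling extends
  the case \<open>a = 1\<close> to all \<open>a\<close>.\<close>

lemma nn_integral_stable_intensity_one_minus_exp:
  assumes \<gamma>: "0 < \<gamma>" "\<gamma> < 1" and a: "0 \<le> a"
  shows "(\<integral>\<^sup>+x. ennreal (1 - exp (- (a * x))) \<partial>stable_intensity \<gamma>) = ennreal (a powr \<gamma>)"
proof (cases "a = 0")
  case False
  then have a: "0 < a" using a by simp
  have G: "0 < Gamma (1 - \<gamma>)" using \<gamma> by (simp add: Gamma_real_pos)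
  have sf: "sigma_finite_measure (stable_intensity \<gamma>)"
    unfolding stable_intensity_def by (subst sigma_finite_measure.sigma_finite_iff_density_finite[OF sigma_finite_lborel]) auto
  interpret S: sigma_finite_measure "stable_intensity \<gamma>" by (rule sf)
  interpret P: pair_sigma_finite "stable_intensity \<gamma>" lborel ..
  have AEpos: "AE x in stable_intensity \<gamma>. 0 < x"
    unfolding stable_intensity_def by (subst AE_density) (auto simp: indicator_def)
  have "ennreal (1 - exp (- x)) = (\<integral>\<^sup>+u. ennreal (exp (- u)) * indicator {0..x} u \<partial>lborel)" if "0 < x" for x
    using that by (subst nn_integral_FTC_Icc[where F = "\<lambda>u. - exp (- u)"]) (auto intro!: derivative_eq_intros)
  then have "(\<integral>\<^sup>+x. ennreal (1 - exp (- x)) \<partial>stable_intensity \<gamma>)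
     = (\<integral>\<^sup>+x. \<integral>\<^sup>+u. ennreal (exp (- u)) * indicator {0..x} u \<partial>lborel \<partial>stable_intensity \<gamma>)"
    using AEpos by (intro nn_integral_cong_AE) auto
  also have "\<dots> = (\<integral>\<^sup>+u. \<integral>\<^sup>+x. ennreal (exp (- u)) * indicator {0..x} u \<partial>stable_intensity \<gamma> \<partial>lborel)"
    by (rule P.Fubini'[symmetric]) (auto simp: indicator_def)
  also have "\<dots> = (\<integral>\<^sup>+u. ennreal (u powr ((1 - \<gamma>) - 1) / exp u) * indicator {0..} u / ennreal (Gamma (1 - \<gamma>)) \<partial>lborel)"
  proof (intro nn_integral_cong_AE)
    have "AE u in lborel. u \<noteq> (0::real)" by (rule AE_lborel_singleton)
    then show "AE u in lborel. (\<integral>\<^sup>+x. ennreal (exp (- u)) * indicator {0..x} u \<partial>stable_intensity \<gamma>)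
        = ennreal (u powr ((1 - \<gamma>) - 1) / exp u) * indicator {0..} u / ennreal (Gamma (1 - \<gamma>))"
    proof eventually_elim
      case (elim u)
      show ?case
      proof (cases "0 < u")
        case True
        have "(\<integral>\<^sup>+x. ennreal (exp (- u)) * indicator {0..x} u \<partial>stable_intensity \<gamma>)
          = (\<integral>\<^sup>+x. ennreal (exp (- u)) * indicator {u..} x \<partial>stable_intensity \<gamma>)"
          using True by (intro nn_integral_cong) (auto simp: indicator_def)
        also have "\<dots> = ennreal (exp (- u)) * ennreal (u powr (- \<gamma>) / Gamma (1 - \<gamma>))"
          by (simp add: nn_integral_cmult emeasure_stable_intensity_atLeast[OF \<gamma> True])
        also have "\<dots> = ennreal (u powr ((1 - \<gamma>) - 1) / exp u) / ennreal (Gamma (1 - \<gamma>))"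
          using G by (simp add: ennreal_mult[symmetric] divide_ennreal exp_minus field_simps)
        finally show ?thesis using True by simp
      qed (use elim in auto)
    qed
  qed
  also have "\<dots> = ennreal (Gamma (1 - \<gamma>)) / ennreal (Gamma (1 - \<gamma>))"
  proof -
    have "(\<integral>\<^sup>+u. ennreal (u powr ((1 - \<gamma>) - 1) / exp u) * indicator {0..} u \<partial>lborel) = ennreal (Gamma (1 - \<gamma>))"
      using \<gamma> by (subst Gamma_conv_nn_integral_real) (auto intro!: nn_integral_cong simp: indicator_def)
    then show ?thesis by (subst nn_integral_divide) auto
  qed
  also have "\<dots> = 1" using G by (simp add: divide_ennreal)
  finally have 1: "(\<integral>\<^sup>+x. ennreal (1 - exp (- x)) \<partial>stable_intensity \<gamma>) = 1" .
  show ?thesis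
    using nn_integral_stable_intensity_scale[OF _ \<gamma> a, of "\<lambda>x. ennreal (1 - exp (- x))"] 1 by simp
qed simp

lemma measurable_stable_intensity [simp]: "measurable (stable_intensity \<gamma>) N = measurable borel N"
  by (rule measurable_cong_sets) simp_all

lemma space_stable_intensity [simp]: "space (stable_intensity \<gamma>) = UNIV"
  by (simp add: stable_intensity_def)

section \<open>Stable points\<close>

definition regular_seq :: "(nat \<Rightarrow> real) \<Rightarrow> bool" where
  "regular_seq x \<longleftrightarrow> (\<forall>i. 0 < x i) \<and> decseq x \<and> summable x"

lemma regular_seqD:
  assumes "regular_seq x"
  shows "0 < x i" "decseq x" "summable x" "0 < suminf x" "(\<Sum>i. ennreal (x i)) = ennreal (suminf x)" "tame x" "ranked x = x"
proof -
  show 1: "0 < x i" "decseq x" "summable x" for i using assms by (auto simp: regular_seq_def)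
  show "0 < suminf x" using 1 by (intro suminf_pos) auto
  show s: "(\<Sum>i. ennreal (x i)) = ennreal (suminf x)"
    using 1 by (intro suminf_ennreal2) (auto intro: less_imp_le)
  show "tame x" using 1(1) by (intro tameI_sum) (auto simp: nn_integral_count_space_nat s intro: less_imp_le)
  show "ranked x = x" using 1 by (intro ranked_decseq)
qed

text \<open>The power \<open>x powr (- p)\<close> is \<open>1 / Gamma p\<close> times the integral
  of \<open>s powr (p - 1) * exp (- (s * x))\<close> over the positive half-line. Tonelli reduces
  the moment to the Laplace transform, and replacing \<open>s\<close> by
  \<open>s powr (1 / \<delta>)\<close> turns what is left into a second Gamma integral.\<close>

lemma negative_moment_of_laplace:
  assumes "prob_space M" and [measurable]: "X \<in> borel_measurable M" and pos: "AE \<omega> in M. 0 < X \<omega>"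
    and lap: "\<And>s. 0 \<le> s \<Longrightarrow> (\<integral>\<^sup>+\<omega>. ennreal (exp (- (s * X \<omega>))) \<partial>M) = ennreal (exp (- (s powr \<delta>)))"
    and \<delta>: "0 < \<delta>" and p: "0 < p"
  shows "(\<integral>\<^sup>+\<omega>. ennreal (X \<omega> powr (- p)) \<partial>M) = ennreal (Gamma (p / \<delta>) / (\<delta> * Gamma p))"
proof -
  interpret prob_space M by fact
  interpret P: pair_sigma_finite M lborel ..
  have G: "0 < Gamma p" "0 < Gamma (p / \<delta>)" using p \<delta> by (auto intro!: Gamma_real_pos)
  have Gam: "(\<integral>\<^sup>+s. ennreal (s powr (q - 1) * exp (- s)) * indicator {0<..} s \<partial>lborel) = ennreal (Gamma q)" if q: "0 < q" for q
    using AE_lborel_singleton[of 0] unfolding Gamma_conv_nn_integral_real[OF q]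
    by (intro nn_integral_cong_AE) (auto elim!: eventually_mono simp: indicator_def exp_minus divide_inverse)
  have "(\<integral>\<^sup>+s. ennreal (s powr (p - 1) * exp (- (s * x))) * indicator {0<..} s \<partial>lborel) = ennreal (Gamma p) * ennreal (x powr (- p))" if x: "0 < x" for x
  proof -
    have "ennreal (Gamma p) = ennreal x * (\<integral>\<^sup>+s. ennreal ((x * s) powr (p - 1) * exp (- (x * s))) * indicator {0<..} s \<partial>lborel)"
      unfolding Gam[OF p, symmetric] using x
      by (subst nn_integral_real_affine[where c = x and t = 0]) (auto simp: indicator_def zero_less_mult_iff)
    also have "(\<integral>\<^sup>+s. ennreal ((x * s) powr (p - 1) * exp (- (x * s))) * indicator {0<..} s \<partial>lborel)
      = (\<integral>\<^sup>+s. ennreal (x powr (p - 1)) * (ennreal (s powr (p - 1) * exp (- (s * x))) * indicator {0<..} s) \<partial>lborel)"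
      using x by (intro nn_integral_cong) (auto simp: indicator_def powr_mult ennreal_mult[symmetric] mult_ac)
    also have "\<dots> = ennreal (x powr (p - 1)) * (\<integral>\<^sup>+s. (ennreal (s powr (p - 1) * exp (- (s * x))) * indicator {0<..} s) \<partial>lborel)"
      by (rule nn_integral_cmult) simp
    finally have "ennreal (Gamma p) * ennreal (x powr (- p)) = ennreal (x powr (- p) * (x * x powr (p - 1))) *
       (\<integral>\<^sup>+s. (ennreal (s powr (p - 1) * exp (- (s * x))) * indicator {0<..} s) \<partial>lborel)"
      using x by (simp add: ennreal_mult mult_ac)
    also have "x powr (- p) * (x * x powr (p - 1)) = 1"
      using x by (simp add: powr_mult_base powr_add[symmetric])
    finally show ?thesis by simp
  qed
  then have "ennreal (Gamma p) * (\<integral>\<^sup>+\<omega>. ennreal (X \<omega> powr (- p)) \<partial>M)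
    = (\<integral>\<^sup>+\<omega>. \<integral>\<^sup>+s. ennreal (s powr (p - 1) * exp (- (s * X \<omega>))) * indicator {0<..} s \<partial>lborel \<partial>M)"
    by (subst nn_integral_cmult[symmetric], simp) (rule nn_integral_cong_AE, use pos in eventually_elim, simp)
  also have "\<dots> = (\<integral>\<^sup>+s. \<integral>\<^sup>+\<omega>. ennreal (s powr (p - 1) * exp (- (s * X \<omega>))) * indicator {0<..} s \<partial>M \<partial>lborel)"
    by (rule P.Fubini'[symmetric]) simp
  also have "\<dots> = (\<integral>\<^sup>+s. ennreal (s powr (p - 1) * exp (- (s powr \<delta>))) * indicator {0<..} s \<partial>lborel)"
    by (intro nn_integral_cong)
       (auto simp: ennreal_mult nn_integral_multc nn_integral_cmult lap indicator_def)
  also have "\<dots> = (\<integral>\<^sup>+s. ennreal ((s powr (1/\<delta>)) powr (p - 1) * exp (- ((s powr (1/\<delta>)) powr \<delta>))) * (ennreal (\<bar>1/\<delta>\<bar> * s powr (1/\<delta> - 1)) * indicator {0<..} s) \<partial>lborel)"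
    using \<delta> by (intro nn_integral_powr_substitution) auto
  also have "\<dots> = (\<integral>\<^sup>+s. ennreal (1/\<delta>) * (ennreal (s powr (p/\<delta> - 1) * exp (- s)) * indicator {0<..} s) \<partial>lborel)"
  proof (intro nn_integral_cong)
    fix s :: real
    have "s powr ((p - 1) / \<delta>) * s powr (1/\<delta> - 1) = s powr (p/\<delta> - 1)"
      by (simp add: powr_add[symmetric] diff_divide_distrib)
    then show "ennreal ((s powr (1/\<delta>)) powr (p - 1) * exp (- ((s powr (1/\<delta>)) powr \<delta>))) * (ennreal (\<bar>1/\<delta>\<bar> * s powr (1/\<delta> - 1)) * indicator {0<..} s)
      = ennreal (1/\<delta>) * (ennreal (s powr (p/\<delta> - 1) * exp (- s)) * indicator {0<..} s)"
      using \<delta> by (auto simp: indicator_def powr_powr ennreal_mult[symmetric] mult_ac)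
  qed
  also have "\<dots> = ennreal (1 / \<delta>) * ennreal (Gamma (p / \<delta>))"
    using p \<delta> by (simp add: nn_integral_cmult Gam)
  finally have *: "ennreal (Gamma p) * (\<integral>\<^sup>+\<omega>. ennreal (X \<omega> powr (- p)) \<partial>M) = ennreal (Gamma (p / \<delta>) / \<delta>)"
    using \<delta> G by (simp add: ennreal_mult[symmetric])
  have "(\<integral>\<^sup>+\<omega>. ennreal (X \<omega> powr (- p)) \<partial>M) = ennreal (1 / Gamma p) * (ennreal (Gamma p) * (\<integral>\<^sup>+\<omega>. ennreal (X \<omega> powr (- p)) \<partial>M))"
    using G by (simp add: mult.assoc[symmetric] ennreal_mult[symmetric])
  also have "\<dots> = ennreal (Gamma (p / \<delta>) / (\<delta> * Gamma p))"
    unfolding * using G \<delta> by (simp add: ennreal_mult[symmetric])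
  finally show ?thesis .
qed

text \<open>The law of the ranked \<gamma>-stable points as a measure on sequences. The Laplace
  functional stands in for the Poisson axioms and for the underlying probability space;
  \<open>g\<close> may take the value infinity.\<close>

locale stable_law =
  fixes \<gamma> :: real and \<mu> :: "(nat \<Rightarrow> real) measure"
  assumes index: "0 < \<gamma>" "\<gamma> < 1" and prob: "prob_space \<mu>" and sets_\<mu> [measurable_cong, simp]: "sets \<mu> = sets seq_space"
    and AE_pos: "AE x in \<mu>. \<forall>i. 0 < x i" and AE_decseq: "AE x in \<mu>. decseq x"
    and laplace: "\<And>g. g \<in> borel_measurable borel \<Longrightarrow>
      (\<integral>\<^sup>+x. ennreal (nexp (\<Sum>i. g (x i))) \<partial>\<mu>) = ennreal (nexp (\<integral>\<^sup>+y. ennreal (1 - nexp (g y)) \<partial>stable_intensity \<gamma>))"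
begin

sublocale prob_space \<mu> by (rule prob)

sublocale \<nu>: sigma_finite_measure "stable_intensity \<gamma>"
  unfolding stable_intensity_def by (subst sigma_finite_measure.sigma_finite_iff_density_finite[OF sigma_finite_lborel]) auto

lemma space_\<mu> [simp]: "space \<mu> = UNIV"
  using sets_eq_imp_space_eq[OF sets_\<mu>] by (simp add: space_PiM)

lemma AE_intensity_pos: "AE y in stable_intensity \<gamma>. 0 < y"
  unfolding stable_intensity_def by (subst AE_density) (auto simp: indicator_def)

lemma component_measurable [measurable]: "(\<lambda>x. x i) \<in> borel_measurable \<mu>"
  by (simp cong: measurable_cong_sets)

lemma laplace_total:
  assumes a: "0 \<le> a"
  shows "(\<integral>\<^sup>+x. ennreal (nexp (\<Sum>i. ennreal (a * x i))) \<partial>\<mu>) = ennreal (exp (- (a powr \<gamma>)))"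
proof -
  have "(\<integral>\<^sup>+y. ennreal (1 - nexp (ennreal (a * y))) \<partial>stable_intensity \<gamma>) = ennreal (a powr \<gamma>)"
    unfolding nn_integral_stable_intensity_one_minus_exp[OF index a, symmetric]
    by (intro nn_integral_cong_AE) (use AE_intensity_pos a in \<open>auto elim!: eventually_mono\<close>)
  then show ?thesis by (subst laplace) auto
qed

text \<open>Summability is extracted from the Laplace transform: for every \<open>a > 0\<close> the
  value \<open>exp (- (a powr \<gamma>))\<close> is at most the probability of a finite total, and
  it tends to 1 as \<open>a\<close> decreases to 0.\<close>

lemma AE_regular: "AE x in \<mu>. regular_seq x"
proof -
  let ?S = "{x \<in> space \<mu>. (\<Sum>i. ennreal (x i)) < \<top>}"
  have [measurable]: "?S \<in> sets \<mu>" by measurable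
  have "exp (- (a powr \<gamma>)) \<le> prob ?S" if a: "0 < a" for a
  proof -
    have "ennreal (exp (- (a powr \<gamma>))) \<le> (\<integral>\<^sup>+x. indicator ?S x \<partial>\<mu>)"
      unfolding laplace_total[OF less_imp_le[OF a], symmetric]
    proof (rule nn_integral_mono)
      fix x
      show "ennreal (nexp (\<Sum>i. ennreal (a * x i))) \<le> indicator ?S x"
      proof (cases "x \<in> ?S")
        case True
        then show ?thesis by (simp add: ennreal_le_1)
      next
        case False
        have "(\<Sum>i. ennreal (a * x i)) = ennreal a * (\<Sum>i. ennreal (x i))"
          using a by (simp add: ennreal_mult' ennreal_suminf_cmult)
        then show ?thesis using False a by (simp add: top.not_eq_extremum[symmetric] ennreal_mult_top)
      qed
    qed
    also have "\<dots> = emeasure \<mu> ?S" by (rule nn_integral_indicator) fact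
    finally show ?thesis by (simp add: emeasure_eq_measure)
  qed
  moreover have "((\<lambda>a. exp (- (a powr \<gamma>))) \<longlongrightarrow> exp (- (0 powr \<gamma>))) (at_right 0)"
    using index by (intro tendsto_intros tendsto_powr'[of _ 0]) (auto intro: eventually_at_right_less eventually_mono simp: eventually_at_right_field)
  ultimately have "1 \<le> prob ?S"
    by (intro tendsto_upperbound[of _ _ "at_right 0"]) (auto intro: eventually_mono[OF eventually_at_right_less])
  then have "prob ?S = 1" using prob_le_1[of ?S] by linarith
  then have "AE x in \<mu>. (\<Sum>i. ennreal (x i)) < \<top>"
    using AE_prob_1[of ?S] by simp
  with AE_pos AE_decseq show ?thesis
  proof eventually_elim
    case (elim x)
    then show ?case unfolding regular_seq_def
      by (auto intro!: summable_suminf_not_top simp: less_top intro: less_imp_le)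
  qed
qed

lemma laplace_suminf:
  assumes "0 \<le> s"
  shows "(\<integral>\<^sup>+x. ennreal (exp (- (s * suminf x))) \<partial>\<mu>) = ennreal (exp (- (s powr \<gamma>)))"
  unfolding laplace_total[OF assms, symmetric]
proof (rule nn_integral_cong_AE)
  show "AE x in \<mu>. ennreal (exp (- (s * suminf x))) = ennreal (nexp (\<Sum>i. ennreal (s * x i)))"
    using AE_regular
  proof eventually_elim
    case (elim x)
    have "(\<Sum>i. ennreal (s * x i)) = ennreal s * (\<Sum>i. ennreal (x i))"
      using assms by (simp add: ennreal_mult' ennreal_suminf_cmult)
    then show ?case
      using assms regular_seqD[OF elim] by (simp add: ennreal_mult[symmetric] less_imp_le)
  qed
qed

lemma negative_moment:
  assumes "0 < p"
  shows "(\<integral>\<^sup>+x. ennreal (suminf x powr (- p)) \<partial>\<mu>) = ennreal (Gamma (p / \<gamma>) / (\<gamma> * Gamma p))"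
  using AE_regular regular_seqD(4)
  by (intro negative_moment_of_laplace[OF prob _ _ laplace_suminf index(1) assms]) (auto elim!: eventually_mono)

lemma integrable_intensity_exp: "integrable (stable_intensity \<gamma>) (\<lambda>y. y * exp (- y))"
proof (rule Bochner_Integration.integrable_bound)
  show "integrable (stable_intensity \<gamma>) (\<lambda>y. 1 - exp (- y))"
  proof (rule integrableI_nonneg)
    show "AE y in stable_intensity \<gamma>. 0 \<le> 1 - exp (- y)" using AE_intensity_pos by eventually_elim simp
    show "(\<integral>\<^sup>+y. ennreal (1 - exp (- y)) \<partial>stable_intensity \<gamma>) < \<infinity>"
      using nn_integral_stable_intensity_one_minus_exp[OF index, of 1] by simp
  qed simp
  show "AE y in stable_intensity \<gamma>. norm (y * exp (- y)) \<le> norm (1 - exp (- y))"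
    using AE_intensity_pos
  proof eventually_elim
    case (elim y)
    have "y * exp (- y) \<le> (exp y - 1) * exp (- y)"
      using exp_ge_add_one_self[of y] by (intro mult_right_mono) (linarith, simp)
    then show ?case using elim by (simp add: algebra_simps exp_add[symmetric])
  qed
qed simp

text \<open>Squeezed by \<open>u / (1 + u) \<le> 1 - exp (- u) \<le> u\<close> with
  \<open>u = h n * d n\<close>. Letting \<open>d\<close> vary with \<open>n\<close> covers
  increments of a Laplace exponent and not only a fixed rate.\<close>

lemma one_minus_exp_quotient_tendsto:
  fixes h d :: "nat \<Rightarrow> real"
  assumes h: "\<And>n. 0 < h n" "h \<longlonglongrightarrow> 0" and d: "\<And>n. 0 \<le> d n" "d \<longlonglongrightarrow> D"
  shows "(\<lambda>n. (1 - exp (- (h n * d n))) / h n) \<longlonglongrightarrow> D"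
proof (rule tendsto_sandwich)
  have "(\<lambda>n. d n / (1 + h n * d n)) \<longlonglongrightarrow> D / (1 + 0 * D)"
    using h d by (intro tendsto_intros) auto
  then show "(\<lambda>n. d n / (1 + h n * d n)) \<longlonglongrightarrow> D" by simp
  show "d \<longlonglongrightarrow> D" by fact
  show "\<forall>\<^sub>F n in sequentially. d n / (1 + h n * d n) \<le> (1 - exp (- (h n * d n))) / h n"
  proof (intro always_eventually allI)
    fix n
    have u: "0 \<le> h n * d n" using h(1)[of n] d(1)[of n] by (intro mult_nonneg_nonneg) auto
    have "1 + h n * d n \<le> exp (h n * d n)" by (rule exp_ge_add_one_self)
    then have "exp (- (h n * d n)) \<le> 1 / (1 + h n * d n)"
      using u by (simp add: exp_minus field_simps)
    then have "h n * d n / (1 + h n * d n) \<le> 1 - exp (- (h n * d n))"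
      using u by (simp add: field_simps)
    then show "d n / (1 + h n * d n) \<le> (1 - exp (- (h n * d n))) / h n"
      using h(1)[of n] by (simp add: pos_le_divide_eq mult.commute)
  qed
  show "\<forall>\<^sub>F n in sequentially. (1 - exp (- (h n * d n))) / h n \<le> d n"
  proof (intro always_eventually allI)
    fix n
    show "(1 - exp (- (h n * d n))) / h n \<le> d n"
      using exp_ge_add_one_self[of "- (h n * d n)"] h(1)[of n] by (simp add: pos_divide_le_eq mult.commute)
  qed
qed

text \<open>Differentiate the Laplace functional of \<open>y \<mapsto> a y + g y\<close> in \<open>a\<close> at \<open>a = 1\<close>.\<close>

lemma laplace_total_weighted:
  fixes g :: "real \<Rightarrow> real"
  assumes [measurable]: "g \<in> borel_measurable borel" and g: "\<And>y. 0 \<le> g y" "0 < s" "\<And>y. y < s \<Longrightarrow> g y = 0"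
  shows "(\<integral>x. suminf x * exp (- suminf x) * nexp (\<Sum>i. ennreal (g (x i))) \<partial>\<mu>)
       = (\<integral>y. y * exp (- y) * exp (- g y) \<partial>stable_intensity \<gamma>) * (\<integral>x. exp (- suminf x) * nexp (\<Sum>i. ennreal (g (x i))) \<partial>\<mu>)"
proof -
  let ?\<nu> = "stable_intensity \<gamma>"
  define W where "W x = nexp (\<Sum>i. ennreal (g (x i)))" for x
  have W [measurable]: "W \<in> borel_measurable \<mu>" and W01: "0 \<le> W x" "W x \<le> 1" for x
    unfolding W_def by auto
  define \<Phi> where "\<Phi> a = (\<integral>x. exp (- (a * suminf x)) * W x \<partial>\<mu>)" for a
  define \<psi> where "\<psi> a = (\<integral>y. 1 - exp (- (a * y + g y)) \<partial>?\<nu>)" for a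
  have int\<Phi>: "integrable \<mu> (\<lambda>x. exp (- (a * suminf x)) * W x)" if "0 \<le> a" for a
  proof (rule integrable_const_bound[where B = 1])
    show "AE x in \<mu>. norm (exp (- (a * suminf x)) * W x) \<le> 1"
      using AE_regular
    proof eventually_elim
      case (elim x)
      then show ?case using that W01[of x] regular_seqD(4)[OF elim] by (auto intro!: mult_le_one)
    qed
  qed simp
  \<comment> \<open>Below \<open>s\<close> the function \<open>g\<close> vanishes and only
    \<open>1 - exp (- (a * y))\<close> remains; from \<open>s\<close> on the integrand is at most 1
    on a set of finite intensity.\<close>
  have fin: "(\<integral>\<^sup>+y. ennreal (1 - exp (- (a * y + g y))) \<partial>?\<nu>) < \<infinity>" if a: "0 \<le> a" for a
  proof -
    have "(\<integral>\<^sup>+y. ennreal (1 - exp (- (a * y + g y))) \<partial>?\<nu>) \<le> (\<integral>\<^sup>+y. ennreal (1 - exp (- (a * y))) + indicator {s..} y \<partial>?\<nu>)"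
    proof (rule nn_integral_mono_AE)
      show "AE y in ?\<nu>. ennreal (1 - exp (- (a * y + g y))) \<le> ennreal (1 - exp (- (a * y))) + indicator {s..} y"
        using AE_intensity_pos
      proof eventually_elim
        case (elim y)
        show ?case
        proof (cases "s \<le> y")
          case True
          have "ennreal (1 - exp (- (a * y + g y))) \<le> ennreal 1" by (intro ennreal_leI) simp
          also have "\<dots> \<le> ennreal (1 - exp (- (a * y))) + indicator {s..} y" using True by simp
          finally show ?thesis .
        qed (use g in auto)
      qed
    qed
    also have "\<dots> = ennreal (a powr \<gamma>) + ennreal (s powr (- \<gamma>) / Gamma (1 - \<gamma>))"
      by (subst nn_integral_add) (auto simp: nn_integral_stable_intensity_one_minus_exp[OF index a] emeasure_stable_intensity_atLeast[OF index g(2)])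
    finally show ?thesis by (auto intro: le_less_trans)
  qed
  have ayg: "- (a * y) \<le> g y" if "0 < y" "0 \<le> a" for a y :: real
    using mult_nonneg_nonneg[OF that(2) less_imp_le[OF that(1)]] g(1)[of y] by linarith
  have int\<psi>: "integrable ?\<nu> (\<lambda>y. 1 - exp (- (a * y + g y)))" if a: "0 \<le> a" for a
  proof (rule integrableI_nonneg[OF _ _ fin[OF a]])
    show "AE y in ?\<nu>. 0 \<le> 1 - exp (- (a * y + g y))"
      using AE_intensity_pos by eventually_elim (use a ayg in auto)
  qed simp
  have \<Phi>: "\<Phi> a = exp (- \<psi> a)" if a: "0 \<le> a" for a
  proof -
    have "ennreal (\<Phi> a) = (\<integral>\<^sup>+x. ennreal (exp (- (a * suminf x)) * W x) \<partial>\<mu>)"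
      unfolding \<Phi>_def by (rule nn_integral_eq_integral[symmetric, OF int\<Phi>[OF a]]) (simp add: W01)
    also have "\<dots> = (\<integral>\<^sup>+x. ennreal (nexp (\<Sum>i. ennreal (a * x i + g (x i)))) \<partial>\<mu>)"
    proof (rule nn_integral_cong_AE)
      show "AE x in \<mu>. ennreal (exp (- (a * suminf x)) * W x) = ennreal (nexp (\<Sum>i. ennreal (a * x i + g (x i))))"
        using AE_regular
      proof eventually_elim
        case (elim x)
        have "(\<Sum>i. ennreal (a * x i + g (x i))) = (\<Sum>i. ennreal (a * x i) + ennreal (g (x i)))"
          using a g regular_seqD(1)[OF elim] by (simp add: ennreal_plus less_imp_le)
        also have "\<dots> = (\<Sum>i. ennreal (a * x i)) + (\<Sum>i. ennreal (g (x i)))"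
          by (rule suminf_add[symmetric]) auto
        also have "(\<Sum>i. ennreal (a * x i)) = ennreal (a * suminf x)"
          using a regular_seqD[OF elim] by (simp add: ennreal_mult' ennreal_suminf_cmult)
        finally show ?case
          using a regular_seqD(4)[OF elim] by (simp add: nexp_add W_def less_imp_le)
      qed
    qed
    also have "\<dots> = ennreal (nexp (\<integral>\<^sup>+y. ennreal (1 - exp (- (a * y + g y))) \<partial>?\<nu>))"
    proof (subst laplace)
      have "(\<integral>\<^sup>+y. ennreal (1 - nexp (ennreal (a * y + g y))) \<partial>?\<nu>) = (\<integral>\<^sup>+y. ennreal (1 - exp (- (a * y + g y))) \<partial>?\<nu>)"
      proof (rule nn_integral_cong_AE)
        show "AE y in ?\<nu>. ennreal (1 - nexp (ennreal (a * y + g y))) = ennreal (1 - exp (- (a * y + g y)))"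
          using AE_intensity_pos
        proof eventually_elim
          case (elim y)
          then have "0 \<le> a * y + g y" using ayg[OF elim a] by linarith
          then show ?case by (simp only: nexp_ennreal)
        qed
      qed
      then show "ennreal (nexp (\<integral>\<^sup>+y. ennreal (1 - nexp (ennreal (a * y + g y))) \<partial>?\<nu>)) = ennreal (nexp (\<integral>\<^sup>+y. ennreal (1 - exp (- (a * y + g y))) \<partial>?\<nu>))"
        by simp
    qed simp
    also have "(\<integral>\<^sup>+y. ennreal (1 - exp (- (a * y + g y))) \<partial>?\<nu>) = ennreal (\<psi> a)"
      unfolding \<psi>_def
      by (rule nn_integral_eq_integral[OF int\<psi>[OF a]]) (use AE_intensity_pos a g(1) ayg in \<open>auto elim!: eventually_mono\<close>)
    moreover have "0 \<le> \<psi> a"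
      unfolding \<psi>_def by (rule integral_nonneg_AE) (use AE_intensity_pos a g(1) ayg in \<open>auto elim!: eventually_mono\<close>)
    moreover have "0 \<le> \<Phi> a" unfolding \<Phi>_def by (auto intro!: integral_nonneg_AE simp: W01)
    ultimately show ?thesis by simp
  qed
  \<comment> \<open>Difference quotients are taken to the right of \<open>a = 1\<close>; the factor
    \<open>exp (- suminf x)\<close> present there dominates their linear growth in the
    total.\<close>
  define h where "h n = 1 / real (Suc n)" for n
  have h: "0 < h n" "h \<longlonglongrightarrow> 0" for n unfolding h_def by (simp, rule LIMSEQ_Suc[OF lim_1_over_n])
  have lim_q: "(\<lambda>n. (1 - exp (- (h n * t))) / h n) \<longlonglongrightarrow> t" if "0 \<le> t" for t
    using that h by (intro one_minus_exp_quotient_tendsto) auto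
  have q_bnd: "0 \<le> (1 - exp (- (h n * t))) / h n" "(1 - exp (- (h n * t))) / h n \<le> t" if "0 \<le> t" for n t
    using that h(1)[of n] exp_ge_add_one_self[of "- (h n * t)"]
    by (auto simp: pos_divide_le_eq mult.commute)
  let ?T = "\<lambda>x. suminf x * exp (- suminf x) * W x"
  have "(\<lambda>n. (\<Phi> 1 - \<Phi> (1 + h n)) / h n) \<longlonglongrightarrow> (\<integral>x. ?T x \<partial>\<mu>)"
  proof -
    have "(\<Phi> 1 - \<Phi> (1 + h n)) / h n = (\<integral>x. exp (- suminf x) * W x * ((1 - exp (- (h n * suminf x))) / h n) \<partial>\<mu>)" for n
    proof -
      have "\<Phi> 1 - \<Phi> (1 + h n) = (\<integral>x. exp (- (1 * suminf x)) * W x - exp (- ((1 + h n) * suminf x)) * W x \<partial>\<mu>)"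
        unfolding \<Phi>_def using h(1)[of n] by (intro Bochner_Integration.integral_diff[symmetric] int\<Phi>) auto
      then have "(\<Phi> 1 - \<Phi> (1 + h n)) / h n = (\<integral>x. (exp (- (1 * suminf x)) * W x - exp (- ((1 + h n) * suminf x)) * W x) / h n \<partial>\<mu>)"
        by simp
      also have "\<dots> = (\<integral>x. exp (- suminf x) * W x * ((1 - exp (- (h n * suminf x))) / h n) \<partial>\<mu>)"
        using h(1)[of n] by (intro Bochner_Integration.integral_cong refl) (simp add: field_simps exp_add exp_diff exp_minus_inverse)
      finally show ?thesis .
    qed
    moreover have "(\<lambda>n. (\<integral>x. exp (- suminf x) * W x * ((1 - exp (- (h n * suminf x))) / h n) \<partial>\<mu>)) \<longlonglongrightarrow> (\<integral>x. ?T x \<partial>\<mu>)"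
    proof (rule integral_dominated_convergence[where w = "\<lambda>_. 1"])
      show "AE x in \<mu>. (\<lambda>n. exp (- suminf x) * W x * ((1 - exp (- (h n * suminf x))) / h n)) \<longlonglongrightarrow> ?T x"
        using AE_regular
      proof eventually_elim
        case (elim x)
        then show ?case
          using tendsto_mult_left[OF lim_q[of "suminf x"], of "exp (- suminf x) * W x"] regular_seqD(4)[OF elim]
          by (simp add: mult_ac)
      qed
      show "AE x in \<mu>. norm (exp (- suminf x) * W x * ((1 - exp (- (h n * suminf x))) / h n)) \<le> 1" for n
        using AE_regular
      proof eventually_elim
        case (elim x)
        have T: "0 < suminf x" by (rule regular_seqD(4)[OF elim])
        have "exp (- suminf x) * W x * ((1 - exp (- (h n * suminf x))) / h n) \<le> exp (- suminf x) * 1 * suminf x"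
          using T W01[of x] q_bnd[of "suminf x" n] by (intro mult_mono) auto
        also have "\<dots> \<le> 1"
          using order_trans[OF _ exp_ge_add_one_self, of "suminf x" "suminf x"] by (simp add: exp_minus field_simps)
        finally show ?case
          using T W01[of x] q_bnd(1)[of "suminf x" n] by (simp only: real_norm_def abs_of_nonneg mult_nonneg_nonneg exp_ge_zero less_imp_le)
      qed
    qed auto
    ultimately show ?thesis by (simp only:)
  qed
  \<comment> \<open>The same quotient, now computed from the exponent \<open>\<psi>\<close>:
    \<open>\<Phi> (1 + h n)\<close> is \<open>\<Phi> 1\<close> times the exponential of minus the
    increment \<open>h n * d n\<close>, and the rate \<open>d n\<close> converges under the
    integral.\<close>
  moreover have "(\<lambda>n. (\<Phi> 1 - \<Phi> (1 + h n)) / h n) \<longlonglongrightarrow> \<Phi> 1 * (\<integral>y. y * exp (- y) * exp (- g y) \<partial>?\<nu>)"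
  proof -
    define d where "d n = (\<integral>y. exp (- y) * exp (- g y) * ((1 - exp (- (h n * y))) / h n) \<partial>?\<nu>)" for n
    have diff: "\<psi> (1 + h n) - \<psi> 1 = h n * d n" for n
    proof -
      have "\<psi> (1 + h n) - \<psi> 1 = (\<integral>y. (1 - exp (- ((1 + h n) * y + g y))) - (1 - exp (- (1 * y + g y))) \<partial>?\<nu>)"
        unfolding \<psi>_def using h(1)[of n] by (intro Bochner_Integration.integral_diff[symmetric] int\<psi>) auto
      also have "\<dots> = (\<integral>y. h n * (exp (- y) * exp (- g y) * ((1 - exp (- (h n * y))) / h n)) \<partial>?\<nu>)"
        using h(1)[of n] by (intro Bochner_Integration.integral_cong refl) (simp add: field_simps exp_add exp_diff exp_minus)
      also have "\<dots> = h n * d n" unfolding d_def by (rule integral_mult_right_zero)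
      finally show ?thesis .
    qed
    have "d \<longlonglongrightarrow> (\<integral>y. y * exp (- y) * exp (- g y) \<partial>?\<nu>)"
      unfolding d_def
    proof (rule integral_dominated_convergence[where w = "\<lambda>y. y * exp (- y)"])
      show "AE y in ?\<nu>. (\<lambda>n. exp (- y) * exp (- g y) * ((1 - exp (- (h n * y))) / h n)) \<longlonglongrightarrow> y * exp (- y) * exp (- g y)"
        using AE_intensity_pos
      proof eventually_elim
        case (elim y)
        then show ?case
          using tendsto_mult_left[OF lim_q[of y], of "exp (- y) * exp (- g y)"] by (simp add: mult_ac)
      qed
      show "AE y in ?\<nu>. norm (exp (- y) * exp (- g y) * ((1 - exp (- (h n * y))) / h n)) \<le> y * exp (- y)" for n
        using AE_intensity_pos
      proof eventually_elim
        case (elim y)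
        have "exp (- y) * exp (- g y) * ((1 - exp (- (h n * y))) / h n) \<le> exp (- y) * 1 * y"
          using elim g(1)[of y] q_bnd[of y n] by (intro mult_mono) auto
        then show ?case
          using elim q_bnd(1)[of y n] by (simp only: real_norm_def abs_of_nonneg mult_nonneg_nonneg exp_ge_zero less_imp_le mult.commute[of y] mult_1_right)
      qed
    qed (auto intro: integrable_intensity_exp)
    moreover have "0 \<le> d n" for n
      unfolding d_def
    proof (rule integral_nonneg_AE)
      show "AE y in ?\<nu>. 0 \<le> exp (- y) * exp (- g y) * ((1 - exp (- (h n * y))) / h n)"
        using AE_intensity_pos
        by eventually_elim (use q_bnd(1) in \<open>simp only: mult_nonneg_nonneg exp_ge_zero less_imp_le\<close>)
    qed
    ultimately have "(\<lambda>n. (1 - exp (- (h n * d n))) / h n) \<longlonglongrightarrow> (\<integral>y. y * exp (- y) * exp (- g y) \<partial>?\<nu>)"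
      by (intro one_minus_exp_quotient_tendsto h) auto
    from tendsto_mult_left[OF this, of "\<Phi> 1"]
    have "(\<lambda>n. \<Phi> 1 * ((1 - exp (- (\<psi> (1 + h n) - \<psi> 1))) / h n)) \<longlonglongrightarrow> \<Phi> 1 * (\<integral>y. y * exp (- y) * exp (- g y) \<partial>?\<nu>)"
      by (simp add: diff)
    moreover have "\<Phi> 1 * ((1 - exp (- (\<psi> (1 + h n) - \<psi> 1))) / h n) = (\<Phi> 1 - \<Phi> (1 + h n)) / h n" for n
    proof -
      have "\<Phi> (1 + h n) = \<Phi> 1 * exp (- (\<psi> (1 + h n) - \<psi> 1))"
        using h(1)[of n] by (simp add: \<Phi> exp_add[symmetric])
      then show ?thesis by (simp add: field_simps)
    qed
    ultimately show ?thesis by (simp only:)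
  qed
  ultimately have "(\<integral>x. ?T x \<partial>\<mu>) = \<Phi> 1 * (\<integral>y. y * exp (- y) * exp (- g y) \<partial>?\<nu>)"
    by (rule LIMSEQ_unique)
  then show ?thesis by (simp add: \<Phi>_def W_def mult.commute)
qed

end

section \<open>Adding a point: the Mecke formula for stable points\<close>

lemma suminf_case_nat:
  fixes f :: "'a \<Rightarrow> ennreal"
  shows "(\<Sum>i. f (case_nat y x i)) = f y + (\<Sum>i. f (x i))"
  using suminf_offset[of "\<lambda>i. f (case_nat y x i)" 1] by (simp add: add.commute)

lemma UNIV_in_sets_seq_space [simp]: "UNIV \<in> sets seq_space"
  using sets.top[of seq_space] by (simp add: space_PiM)

lemma measurable_ranked_nat [measurable]:
  fixes X :: "'a \<Rightarrow> nat \<Rightarrow> real"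
  assumes "\<And>i. (\<lambda>\<omega>. X \<omega> i) \<in> borel_measurable M"
  shows "(\<lambda>\<omega>. ranked (X \<omega>)) \<in> measurable M seq_space"
  using assms by (intro measurable_ranked) auto

lemma measurable_ranked_nat_id [measurable]: "ranked \<in> measurable seq_space seq_space"
  using measurable_ranked_nat[of "\<lambda>x. x" seq_space] by simp

lemma pred_regular_seq [measurable]: "Measurable.pred seq_space regular_seq"
proof -
  have "Measurable.pred seq_space (\<lambda>x::nat \<Rightarrow> real. Cauchy (\<lambda>n. \<Sum>i<n. x i))"
    unfolding pred_def by (rule sets_Collect_Cauchy) simp
  then have [measurable]: "Measurable.pred seq_space (\<lambda>x::nat \<Rightarrow> real. summable x)"
    by (simp add: summable_iff_convergent Cauchy_convergent_iff)
  have [measurable]: "Measurable.pred seq_space (\<lambda>x::nat \<Rightarrow> real. decseq x)"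
    unfolding decseq_Suc_iff by (intro pred_intros_countable) (simp add: pred_def borel_measurable_le)
  have [measurable]: "Measurable.pred seq_space (\<lambda>x::nat \<Rightarrow> real. \<forall>i. 0 < x i)"
    by (intro pred_intros_countable) (simp add: pred_def borel_measurable_less)
  show ?thesis unfolding regular_seq_def[abs_def] by measurable
qed

lemma case_nat_tame:
  assumes x: "regular_seq x" and y: "0 < y"
  shows "tame (case_nat y x)" "suminf (ranked (case_nat y x)) = y + suminf x"
proof -
  have s: "(\<Sum>i. ennreal (case_nat y x i)) = ennreal (y + suminf x)"
    using regular_seqD(4,5)[OF x] y by (simp add: suminf_case_nat ennreal_plus)
  have nn: "0 \<le> case_nat y x i" for i
    using regular_seqD(1)[OF x] y by (cases i) (auto intro: less_imp_le)
  show t: "tame (case_nat y x)"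
    using s nn by (intro tameI_sum) (auto simp: nn_integral_count_space_nat)
  have "(\<Sum>i. ennreal (ranked (case_nat y x) i)) = ennreal (y + suminf x)"
    using sum_ranked[OF t] s by (simp add: nn_integral_count_space_nat)
  moreover have "0 \<le> ranked (case_nat y x) i" for i by (rule ranked_nonneg[OF t])
  ultimately show "suminf (ranked (case_nat y x)) = y + suminf x"
    using regular_seqD(4)[OF x] y
    by (metis add_pos_pos ennreal_inj ennreal_neq_top less_imp_le suminf_ennreal2 suminf_nonneg summable_suminf_not_top)
qed

definition normalize_seq :: "(nat \<Rightarrow> real) \<Rightarrow> nat \<Rightarrow> real" where
  "normalize_seq x = (\<lambda>i. x i / suminf x)"

lemma normalize_seq_measurable [measurable]: "normalize_seq \<in> measurable seq_space seq_space"
  unfolding normalize_seq_def[abs_def] by (rule measurable_PiM_single') auto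

lemma normalize_seq_regular:
  assumes "regular_seq x"
  shows "regular_seq (normalize_seq x)" "suminf (normalize_seq x) = 1"
proof -
  note x = regular_seqD[OF assms]
  show "regular_seq (normalize_seq x)"
    using x(1-4) by (auto simp: regular_seq_def normalize_seq_def decseq_def divide_right_mono summable_divide)
  show "suminf (normalize_seq x) = 1"
    unfolding normalize_seq_def using x(3,4) by (subst suminf_divide) auto
qed

context stable_law
begin

lemma measurable_\<mu> [simp]: "measurable \<mu> N = measurable seq_space N"
  by (rule measurable_cong_sets) simp_all

lemma emeasure_UNIV [simp]: "emeasure \<mu> UNIV = 1"
  using emeasure_space_1 by simp

text \<open>Mecke's formula with each point weighted by its size: singling out a point of size
  \<open>y\<close> leaves the others with their original law. Both sides are damped by
  \<open>exp\<close> of minus the total to become finite measures, then compared through the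
  weighted Laplace functional.\<close>

lemma mecke:
  assumes [measurable]: "F \<in> borel_measurable seq_space"
  shows "(\<integral>\<^sup>+x. F x * ennreal (suminf x) \<partial>\<mu>)
    = (\<integral>\<^sup>+y. ennreal y * (\<integral>\<^sup>+x. F (ranked (case_nat y x)) \<partial>\<mu>) \<partial>stable_intensity \<gamma>)"
proof -
  let ?\<nu> = "stable_intensity \<gamma>"
  interpret P: pair_sigma_finite ?\<nu> \<mu> ..
  \<comment> \<open>The densities of the two sides with the damping included. On the right the total
    is \<open>y + suminf x\<close>, so the damping splits into two factors.\<close>
  define wA where "wA x = suminf x * exp (- suminf x)" for x :: "nat \<Rightarrow> real"
  define wB where "wB z = fst z * exp (- fst z) * exp (- suminf (snd z))" for z :: "real \<times> (nat \<Rightarrow> real)"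
  have [measurable]: "wA \<in> borel_measurable seq_space" "wB \<in> borel_measurable (borel \<Otimes>\<^sub>M seq_space)"
    unfolding wA_def[abs_def] wB_def[abs_def] by measurable
  have pair_cong: "measurable (?\<nu> \<Otimes>\<^sub>M \<mu>) N = measurable (borel \<Otimes>\<^sub>M seq_space) N" for N :: "'z measure"
    by (intro measurable_cong_sets sets_pair_measure_cong) auto
  let ?A = "density \<mu> (\<lambda>x. ennreal (wA x))" and ?B = "density (?\<nu> \<Otimes>\<^sub>M \<mu>) (\<lambda>z. ennreal (wB z))"
  have wA01: "AE x in \<mu>. wA x \<in> {0..1}"
    using AE_regular
  proof eventually_elim
    case (elim x)
    then show ?case
      using order_trans[OF _ exp_ge_add_one_self, of "suminf x" "suminf x"] regular_seqD(4)[OF elim]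
      by (auto simp: wA_def exp_minus field_simps)
  qed
  have AEB: "AE z in ?\<nu> \<Otimes>\<^sub>M \<mu>. 0 < fst z \<and> regular_seq (snd z)"
  proof -
    have "AE y in ?\<nu>. AE x in \<mu>. 0 < fst (y, x) \<and> regular_seq (snd (y, x))"
      using AE_intensity_pos by eventually_elim (use AE_regular in \<open>auto elim!: eventually_mono\<close>)
    then show ?thesis
    proof (rule P.AE_pair_measure[rotated])
      have "{z \<in> space (borel \<Otimes>\<^sub>M seq_space). (0::real) < fst z \<and> regular_seq (snd z)} \<in> sets (borel \<Otimes>\<^sub>M (seq_space :: (nat \<Rightarrow> real) measure))"
        by measurable
      then show "{z \<in> space (?\<nu> \<Otimes>\<^sub>M \<mu>). 0 < fst z \<and> regular_seq (snd z)} \<in> sets (?\<nu> \<Otimes>\<^sub>M \<mu>)"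
        by (simp add: space_pair_measure sets_pair_measure_cong[OF sets_stable_intensity sets_\<mu>] space_PiM)
    qed
  qed
  have nnB: "(\<integral>\<^sup>+z. G z \<partial>?B) = (\<integral>\<^sup>+y. ennreal (y * exp (- y)) * (\<integral>\<^sup>+x. ennreal (exp (- suminf x)) * G (y, x) \<partial>\<mu>) \<partial>?\<nu>)"
    if [measurable]: "G \<in> borel_measurable (borel \<Otimes>\<^sub>M seq_space)" for G
  proof -
    have "(\<integral>\<^sup>+z. G z \<partial>?B) = (\<integral>\<^sup>+y. \<integral>\<^sup>+x. ennreal (wB (y, x)) * G (y, x) \<partial>\<mu> \<partial>?\<nu>)"
      by (subst nn_integral_density) (auto simp: pair_cong nn_integral_fst[symmetric] measurable_compose[OF measurable_Pair1'])
    also have "\<dots> = (\<integral>\<^sup>+y. \<integral>\<^sup>+x. ennreal (y * exp (- y)) * (ennreal (exp (- suminf x)) * G (y, x)) \<partial>\<mu> \<partial>?\<nu>)"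
    proof (rule nn_integral_cong_AE)
      show "AE y in ?\<nu>. (\<integral>\<^sup>+x. ennreal (wB (y, x)) * G (y, x) \<partial>\<mu>) = (\<integral>\<^sup>+x. ennreal (y * exp (- y)) * (ennreal (exp (- suminf x)) * G (y, x)) \<partial>\<mu>)"
        using AE_intensity_pos
        by eventually_elim (auto intro!: nn_integral_cong simp: wB_def ennreal_mult mult.assoc)
    qed
    finally show ?thesis by (simp add: nn_integral_cmult)
  qed
  \<comment> \<open>The criterion for ranked laws carries an extra \<open>[0,1]\<close>-valued
    variable; here it is the constant 1.\<close>
  have "distr ?A (borel \<Otimes>\<^sub>M seq_space) (\<lambda>x. (1::real, ranked x)) = distr ?B (borel \<Otimes>\<^sub>M seq_space) (\<lambda>z. (1, ranked (case_nat (fst z) (snd z))))"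
  proof (rule ranked_law_eqI)
    have "emeasure ?A (space ?A) = (\<integral>\<^sup>+x. ennreal (wA x) \<partial>\<mu>)"
      by (subst emeasure_density) auto
    also have "\<dots> \<le> (\<integral>\<^sup>+x. 1 \<partial>\<mu>)"
      by (rule nn_integral_mono_AE) (use wA01 in eventually_elim, auto)
    finally show "finite_measure ?A" by (intro finite_measureI) (auto simp: emeasure_space_1 top_unique)
    have "emeasure ?B (space ?B) = (\<integral>\<^sup>+z. 1 \<partial>?B)" by simp
    also have "\<dots> \<le> (\<integral>\<^sup>+y. ennreal (y * exp (- y)) * (\<integral>\<^sup>+x. 1 \<partial>\<mu>) \<partial>?\<nu>)"
    proof -
      have "(\<integral>\<^sup>+x. ennreal (exp (- suminf x)) * 1 \<partial>\<mu>) \<le> (\<integral>\<^sup>+x. 1 \<partial>\<mu>)"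
        by (rule nn_integral_mono_AE) (use AE_regular in eventually_elim, auto dest: regular_seqD(4))
      then show ?thesis by (subst nnB) (auto intro!: nn_integral_mono mult_left_mono simp del: mult_1_right emeasure_UNIV nn_integral_const)
    qed
    also have "\<dots> = (\<integral>\<^sup>+y. ennreal (y * exp (- y)) \<partial>?\<nu>)" by simp
    also have "\<dots> < \<infinity>"
      by (subst nn_integral_eq_integral[OF integrable_intensity_exp]) (use AE_intensity_pos in \<open>auto elim!: eventually_mono\<close>)
    finally show "finite_measure ?B" by (intro finite_measureI) auto
    show "AE x in ?A. tame x"
      by (subst AE_density, simp) (use AE_regular in eventually_elim, auto dest: regular_seqD(6))
    show "AE z in ?B. tame (case_nat (fst z) (snd z))"
      by (subst AE_density, simp add: pair_cong) (use AEB in eventually_elim, auto intro: case_nat_tame(1))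
  next
    fix g :: "real \<Rightarrow> real" and m s
    assume g [measurable]: "g \<in> borel_measurable borel" and g': "\<And>x. 0 \<le> g x" "0 < s" "\<And>x. x < s \<Longrightarrow> g x = 0"
    define W where "W x = nexp (\<Sum>i. ennreal (g (x i)))" for x
    have W [measurable]: "W \<in> borel_measurable seq_space" and W01: "0 \<le> W x" "W x \<le> 1" for x
      unfolding W_def by auto
    have intA: "integrable \<mu> (\<lambda>x. wA x * W x)"
      by (rule integrable_const_bound[where B = 1]) (use wA01 in eventually_elim, use W01 in \<open>auto simp: abs_mult intro!: mult_le_one\<close>)
    have intE: "integrable \<mu> (\<lambda>x. exp (- suminf x) * W x)"
      by (rule integrable_const_bound[where B = 1])
         (use AE_regular in eventually_elim, use W01 in \<open>auto simp: abs_mult dest!: regular_seqD(4) intro!: mult_le_one\<close>)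
    have int\<nu>: "integrable ?\<nu> (\<lambda>y. y * exp (- y) * exp (- g y))"
      by (rule Bochner_Integration.integrable_bound[OF integrable_intensity_exp])
         (use AE_intensity_pos g'(1) in \<open>auto elim!: eventually_mono simp: abs_mult mult_le_cancel_left1\<close>)
    have "(\<integral>\<^sup>+x. ennreal 1 ^ m * ennreal (nexp (\<integral>\<^sup>+i. ennreal (g (x i)) \<partial>count_space UNIV)) \<partial>?A)
      = (\<integral>\<^sup>+x. ennreal (wA x * W x) \<partial>\<mu>)"
      by (subst nn_integral_density) (auto simp: nn_integral_count_space_nat W_def ennreal_mult'')
    also have "\<dots> = ennreal (\<integral>x. wA x * W x \<partial>\<mu>)"
      by (rule nn_integral_eq_integral[OF intA]) (use wA01 in eventually_elim, use W01 in auto)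
    also have "(\<integral>x. wA x * W x \<partial>\<mu>) = (\<integral>y. y * exp (- y) * exp (- g y) \<partial>?\<nu>) * (\<integral>x. exp (- suminf x) * W x \<partial>\<mu>)"
      unfolding W_def wA_def by (rule laplace_total_weighted[OF g g'])
    also have "ennreal \<dots> = ennreal (\<integral>y. y * exp (- y) * exp (- g y) \<partial>?\<nu>) * ennreal (\<integral>x. exp (- suminf x) * W x \<partial>\<mu>)"
      by (rule ennreal_mult'') (auto intro!: integral_nonneg_AE simp: W01)
    also have "\<dots> = (\<integral>\<^sup>+y. ennreal (y * exp (- y) * exp (- g y)) \<partial>?\<nu>) * (\<integral>\<^sup>+x. ennreal (exp (- suminf x) * W x) \<partial>\<mu>)"
      by (subst nn_integral_eq_integral[OF int\<nu>], use AE_intensity_pos in \<open>auto elim!: eventually_mono\<close>,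
          subst nn_integral_eq_integral[OF intE], auto simp: W01)
    also have "\<dots> = (\<integral>\<^sup>+y. ennreal (y * exp (- y)) * (\<integral>\<^sup>+x. ennreal (exp (- suminf x)) * ennreal (nexp (\<integral>\<^sup>+i. ennreal (g (case_nat y x i)) \<partial>count_space UNIV)) \<partial>\<mu>) \<partial>?\<nu>)"
    proof -
      have "(\<integral>\<^sup>+x. ennreal (exp (- suminf x)) * ennreal (nexp (\<integral>\<^sup>+i. ennreal (g (case_nat y x i)) \<partial>count_space UNIV)) \<partial>\<mu>)
         = ennreal (exp (- g y)) * (\<integral>\<^sup>+x. ennreal (exp (- suminf x) * W x) \<partial>\<mu>)" for y
      proof -
        have "(\<integral>\<^sup>+i. ennreal (g (case_nat y x i)) \<partial>count_space UNIV) = ennreal (g y) + (\<Sum>i. ennreal (g (x i)))" for x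
          using suminf_case_nat[of "\<lambda>t. ennreal (g t)"] by (simp add: nn_integral_count_space_nat)
        then show ?thesis
          by (subst nn_integral_cmult[symmetric])
             (auto intro!: nn_integral_cong simp: nexp_add g'(1) W_def ennreal_mult mult_ac)
      qed
      then show ?thesis
        by (subst nn_integral_multc[symmetric]) (auto intro!: nn_integral_cong simp: ennreal_mult'' mult.assoc)
    qed
    also have "\<dots> = (\<integral>\<^sup>+z. ennreal 1 ^ m * ennreal (nexp (\<integral>\<^sup>+i. ennreal (g (case_nat (fst z) (snd z) i)) \<partial>count_space UNIV)) \<partial>?B)"
      by (subst nnB, measurable) (simp only: fst_conv snd_conv ennreal_1 power_one mult_1_left)
    finally show "(\<integral>\<^sup>+x. ennreal 1 ^ m * ennreal (nexp (\<integral>\<^sup>+i. ennreal (g (x i)) \<partial>count_space UNIV)) \<partial>?A)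
      = (\<integral>\<^sup>+z. ennreal 1 ^ m * ennreal (nexp (\<integral>\<^sup>+i. ennreal (g (case_nat (fst z) (snd z) i)) \<partial>count_space UNIV)) \<partial>?B)" .
  qed (auto simp: pair_cong)
  \<comment> \<open>Testing against \<open>F\<close> times \<open>exp\<close> of the total undoes
    the damping.\<close>
  then have "(\<integral>\<^sup>+z. F (snd z) * ennreal (exp (suminf (snd z))) \<partial>distr ?A (borel \<Otimes>\<^sub>M seq_space) (\<lambda>x. (1::real, ranked x)))
    = (\<integral>\<^sup>+z. F (snd z) * ennreal (exp (suminf (snd z))) \<partial>distr ?B (borel \<Otimes>\<^sub>M seq_space) (\<lambda>z. (1::real, ranked (case_nat (fst z) (snd z)))))"
    by simp
  then have "(\<integral>\<^sup>+x. F (ranked x) * ennreal (exp (suminf (ranked x))) \<partial>?A)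
    = (\<integral>\<^sup>+z. F (ranked (case_nat (fst z) (snd z))) * ennreal (exp (suminf (ranked (case_nat (fst z) (snd z))))) \<partial>?B)"
    by (subst (asm) (1 2) nn_integral_distr) (auto simp: pair_cong)
  moreover have "(\<integral>\<^sup>+x. F (ranked x) * ennreal (exp (suminf (ranked x))) \<partial>?A) = (\<integral>\<^sup>+x. F x * ennreal (suminf x) \<partial>\<mu>)"
  proof -
    have "(\<integral>\<^sup>+x. F (ranked x) * ennreal (exp (suminf (ranked x))) \<partial>?A)
       = (\<integral>\<^sup>+x. ennreal (wA x) * (F (ranked x) * ennreal (exp (suminf (ranked x)))) \<partial>\<mu>)"
      by (subst nn_integral_density) auto
    also have "\<dots> = (\<integral>\<^sup>+x. F x * ennreal (suminf x) \<partial>\<mu>)"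
    proof (rule nn_integral_cong_AE)
      show "AE x in \<mu>. ennreal (wA x) * (F (ranked x) * ennreal (exp (suminf (ranked x)))) = F x * ennreal (suminf x)"
        using AE_regular
      proof eventually_elim
        case (elim x)
        have "wA x * exp (suminf x) = suminf x" by (simp add: wA_def mult.assoc exp_add[symmetric])
        then have "ennreal (wA x) * ennreal (exp (suminf x)) = ennreal (suminf x)"
          by (simp add: ennreal_mult''[symmetric])
        then show ?case using regular_seqD(7)[OF elim] by (simp add: mult_ac)
      qed
    qed
    finally show ?thesis .
  qed
  moreover have "(\<integral>\<^sup>+z. F (ranked (case_nat (fst z) (snd z))) * ennreal (exp (suminf (ranked (case_nat (fst z) (snd z))))) \<partial>?B)
    = (\<integral>\<^sup>+y. ennreal y * (\<integral>\<^sup>+x. F (ranked (case_nat y x)) \<partial>\<mu>) \<partial>?\<nu>)"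
  proof (subst nnB, simp, rule nn_integral_cong_AE)
    show "AE y in ?\<nu>. ennreal (y * exp (- y)) * (\<integral>\<^sup>+x. ennreal (exp (- suminf x)) * (F (ranked (case_nat (fst (y, x)) (snd (y, x)))) *
         ennreal (exp (suminf (ranked (case_nat (fst (y, x)) (snd (y, x))))))) \<partial>\<mu>) = ennreal y * (\<integral>\<^sup>+x. F (ranked (case_nat y x)) \<partial>\<mu>)"
      unfolding fst_conv snd_conv using AE_intensity_pos
    proof eventually_elim
      case (elim y)
      have "(\<integral>\<^sup>+x. ennreal (exp (- suminf x)) * (F (ranked (case_nat y x)) * ennreal (exp (suminf (ranked (case_nat y x))))) \<partial>\<mu>)
        = (\<integral>\<^sup>+x. ennreal (exp y) * F (ranked (case_nat y x)) \<partial>\<mu>)"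
      proof (rule nn_integral_cong_AE)
        show "AE x in \<mu>. ennreal (exp (- suminf x)) * (F (ranked (case_nat y x)) * ennreal (exp (suminf (ranked (case_nat y x))))) = ennreal (exp y) * F (ranked (case_nat y x))"
          using AE_regular
        proof eventually_elim
          case (elim x)
          have "ennreal (exp (- suminf x)) * ennreal (exp (y + suminf x)) = ennreal (exp y)"
            by (simp add: ennreal_mult[symmetric] exp_add[symmetric])
          then show ?case unfolding case_nat_tame(2)[OF elim \<open>0 < y\<close>] by (metis mult.assoc mult.commute)
        qed
      qed
      also have "\<dots> = ennreal (exp y) * (\<integral>\<^sup>+x. F (ranked (case_nat y x)) \<partial>\<mu>)"
        by (rule nn_integral_cmult) simp
      finally show ?case
        using elim by (simp add: mult.assoc[symmetric] ennreal_mult[symmetric]) (simp add: mult.assoc exp_add[symmetric])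
    qed
  qed
  ultimately show ?thesis by simp
qed

end

section \<open>Size-biased picking\<close>

text \<open>With \<open>T\<close> the total of the other points,
  \<open>y = T * (r / (1 - r))\<close> says that the point \<open>y\<close> is the fraction
  \<open>r\<close> of the enlarged total \<open>y + T\<close>.\<close>

lemma nn_integral_scaled_odds_substitution:
  fixes F :: "real \<Rightarrow> ennreal"
  assumes [measurable]: "F \<in> borel_measurable borel" and T: "0 < T"
  shows "(\<integral>\<^sup>+y. F y * indicator {0<..} y \<partial>lborel)
       = (\<integral>\<^sup>+r. F (T * (r / (1 - r))) * (ennreal (T / (1 - r)\<^sup>2) * indicator {0<..<1} r) \<partial>lborel)"
proof -
  have "(\<integral>\<^sup>+y. F y * indicator {0<..} y \<partial>lborel) = ennreal T * (\<integral>\<^sup>+y. F (T * y) * indicator {0<..} y \<partial>lborel)"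
    using T by (subst nn_integral_real_affine[where c = T and t = 0]) (auto simp: indicator_def zero_less_mult_iff)
  also have "\<dots> = (\<integral>\<^sup>+r. ennreal T * (F (T * (r / (1 - r))) * (ennreal (1 / (1 - r)\<^sup>2) * indicator {0<..<1} r)) \<partial>lborel)"
    by (subst nn_integral_odds_substitution) (auto simp: nn_integral_cmult)
  also have "\<dots> = (\<integral>\<^sup>+r. F (T * (r / (1 - r))) * (ennreal (T / (1 - r)\<^sup>2) * indicator {0<..<1} r) \<partial>lborel)"
  proof (rule nn_integral_cong)
    fix r :: real
    have "ennreal (T / (1 - r)\<^sup>2) = ennreal T * ennreal (1 / (1 - r)\<^sup>2)"
      using T by (simp add: ennreal_mult'[symmetric])
    then show "ennreal T * (F (T * (r / (1 - r))) * (ennreal (1 / (1 - r)\<^sup>2) * indicator {0<..<1} r))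
      = F (T * (r / (1 - r))) * (ennreal (T / (1 - r)\<^sup>2) * indicator {0<..<1} r)"
      by (simp only: mult_ac)
  qed
  finally show ?thesis .
qed

section \<open>Beta integrals and beta laws\<close>

lemma nn_integral_Beta:
  assumes "0 < a" "0 < b"
  shows "(\<integral>\<^sup>+r. ennreal (r powr (a - 1) * (1 - r) powr (b - 1)) * indicator {0<..<1} r \<partial>lborel) = ennreal (Beta a b)"
proof -
  have "((\<lambda>r. r powr (a - 1) * (1 - r) powr (b - 1)) has_integral Beta a b) {0<..<1}"
    using has_integral_Beta_real[OF assms] by (simp add: has_integral_Icc_iff_Ioo)
  from nn_integral_has_integral_lebesgue[OF _ this]
  show ?thesis by (simp add: mult.commute[of _ "indicator _ _"] ennreal_mult' ennreal_indicator)
qed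

lemma Beta_real_pos: "0 < a \<Longrightarrow> 0 < b \<Longrightarrow> 0 < Beta a (b :: real)"
  by (simp add: Beta_def Gamma_real_pos)

lemma sets_beta_law [measurable_cong, simp]: "sets (beta_law a b) = sets borel"
  and space_beta_law [simp]: "space (beta_law a b) = UNIV"
  by (simp_all add: beta_law_def)

lemma measurable_beta_law [simp]: "measurable (beta_law a b) N = measurable borel N"
  by (rule measurable_cong_sets) simp_all

lemma nn_integral_beta_law:
  assumes [measurable]: "f \<in> borel_measurable borel" and ab: "0 < a" "0 < b"
  shows "(\<integral>\<^sup>+r. f r \<partial>beta_law a b)
    = (\<integral>\<^sup>+r. ennreal (r powr (a - 1) * (1 - r) powr (b - 1)) * f r * indicator {0<..<1} r \<partial>lborel) / ennreal (Beta a b)"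
proof -
  have B: "0 < Beta a b" using ab by (rule Beta_real_pos)
  have "(\<integral>\<^sup>+r. f r \<partial>beta_law a b) = (\<integral>\<^sup>+r. ennreal (r powr (a - 1) * (1 - r) powr (b - 1)) * f r * indicator {0<..<1} r / ennreal (Beta a b) \<partial>lborel)"
    unfolding beta_law_def using B
    by (subst nn_integral_density) (auto intro!: nn_integral_cong simp: indicator_def divide_ennreal[symmetric] ennreal_times_divide mult.commute)
  then show ?thesis by (simp add: nn_integral_divide)
qed

lemma prob_space_beta_law:
  assumes "0 < a" "0 < b"
  shows "prob_space (beta_law a b)"
proof (rule prob_spaceI)
  have "emeasure (beta_law a b) (space (beta_law a b)) = (\<integral>\<^sup>+r. 1 \<partial>beta_law a b)" by simp
  also have "\<dots> = ennreal (Beta a b) / ennreal (Beta a b)"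
    using assms by (subst nn_integral_beta_law) (auto simp: nn_integral_Beta)
  also have "\<dots> = 1" using Beta_real_pos[OF assms] by (simp add: divide_ennreal)
  finally show "emeasure (beta_law a b) (space (beta_law a b)) = 1" .
qed

lemma AE_beta_law: "AE r in beta_law a b. 0 < r \<and> r < 1"
  unfolding beta_law_def by (subst AE_density) (auto simp: indicator_def)

lemma beta_law_mean_complement:
  assumes ab: "0 < a" "0 < b"
  shows "(\<integral>\<^sup>+r. ennreal (1 - r) \<partial>beta_law a b) = ennreal (b / (a + b))"
proof -
  have "(\<integral>\<^sup>+r. ennreal (1 - r) \<partial>beta_law a b)
    = (\<integral>\<^sup>+r. ennreal (r powr (a - 1) * (1 - r) powr ((b + 1) - 1)) * indicator {0<..<1} r \<partial>lborel) / ennreal (Beta a b)"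
    unfolding nn_integral_beta_law[OF _ ab, of "\<lambda>r. ennreal (1 - r)", simplified]
    by (intro arg_cong2[where f = "(/)"] nn_integral_cong refl)
       (auto simp: indicator_def ennreal_mult[symmetric] mult.assoc powr_mult_base mult.commute)
  also have "\<dots> = ennreal (Beta a (b + 1) / Beta a b)"
    using ab by (subst nn_integral_Beta) (auto simp: divide_ennreal Beta_real_pos less_imp_le)
  also have "Beta a (b + 1) / Beta a b = b / (a + b)"
  proof -
    have "b \<notin> \<int>\<^sub>\<le>\<^sub>0" using ab by (auto elim!: nonpos_Ints_cases)
    then show ?thesis using Beta_plus1_right[of b a] ab Beta_real_pos[OF ab] by (simp add: field_simps)
  qed
  finally show ?thesis .
qed

context stable_law
begin

lemma normalize_seq_ranked_case_nat:
  assumes x: "regular_seq x" and y: "0 < y"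
  shows "normalize_seq (ranked (case_nat y x)) = ranked (case_nat (y / (y + suminf x)) (\<lambda>i. x i / (y + suminf x)))"
proof -
  let ?c = "1 / (y + suminf x)"
  have c: "0 < ?c" using regular_seqD(4)[OF x] y by simp
  have "normalize_seq (ranked (case_nat y x)) = (\<lambda>i. ?c * ranked (case_nat y x) i)"
    unfolding normalize_seq_def case_nat_tame(2)[OF x y] by simp
  also have "\<dots> = ranked (\<lambda>i. ?c * case_nat y x i)"
    by (rule ranked_scale[OF case_nat_tame(1)[OF x y] c, symmetric])
  also have "(\<lambda>i. ?c * case_nat y x i) = case_nat (y / (y + suminf x)) (\<lambda>i. x i / (y + suminf x))"
    by (auto simp: fun_eq_iff split: nat.split)
  finally show ?thesis .
qed

text \<open>
  Removing a size-biased pick from the points, tilted by \<open>T powr (- \<theta>)\<close>, leaves the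
  points tilted by \<open>T powr (- (\<theta> + \<gamma>))\<close>, independent of the relative size of the pick.
\<close>

lemma size_biased_pick:
  fixes \<theta> :: real
  assumes [measurable]: "F \<in> borel_measurable seq_space"
  shows "(\<integral>\<^sup>+x. ennreal (suminf x powr (- \<theta>)) * F (normalize_seq x) \<partial>\<mu>)
    = (\<integral>\<^sup>+r. ennreal (\<gamma> / Gamma (1 - \<gamma>) * (r powr (- \<gamma>) * (1 - r) powr (\<theta> + \<gamma> - 1))) *
         (\<integral>\<^sup>+x. ennreal (suminf x powr (- (\<theta> + \<gamma>))) * F (ranked (case_nat r (\<lambda>i. (1 - r) * normalize_seq x i))) \<partial>\<mu>)
         * indicator {0<..<1} r \<partial>lborel)"
proof -
  interpret P: pair_sigma_finite lborel \<mu> ..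
  define k where "k = \<gamma> / Gamma (1 - \<gamma>)"
  have k: "0 < k" using index by (simp add: Gamma_real_pos k_def)
  \<comment> \<open>One power of the total is set aside, since the Mecke formula supplies the weight
    \<open>suminf x\<close>; hence the exponent \<open>- \<theta> - 1\<close>.\<close>
  define F0 where "F0 x = ennreal (suminf x powr (- \<theta> - 1)) * F (normalize_seq x)" for x
  have [measurable]: "F0 \<in> borel_measurable seq_space" unfolding F0_def[abs_def] by measurable
  define H where "H y x = ennreal ((y + suminf x) powr (- \<theta> - 1)) * F (ranked (case_nat (y / (y + suminf x)) (\<lambda>i. x i / (y + suminf x))))" for y x
  have [measurable]: "(\<lambda>(y, x). H y x) \<in> borel_measurable (borel \<Otimes>\<^sub>M seq_space)"
    unfolding H_def by measurable
  have pair_cong: "measurable (lborel \<Otimes>\<^sub>M \<mu>) N = measurable (borel \<Otimes>\<^sub>M seq_space) N" for N :: "'z measure"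
    by (intro measurable_cong_sets sets_pair_measure_cong) auto
  have "(\<integral>\<^sup>+x. ennreal (suminf x powr (- \<theta>)) * F (normalize_seq x) \<partial>\<mu>) = (\<integral>\<^sup>+x. F0 x * ennreal (suminf x) \<partial>\<mu>)"
  proof (rule nn_integral_cong_AE)
    show "AE x in \<mu>. ennreal (suminf x powr (- \<theta>)) * F (normalize_seq x) = F0 x * ennreal (suminf x)"
      using AE_regular
    proof eventually_elim
      case (elim x)
      have "suminf x powr (- \<theta> - 1) * suminf x = suminf x powr (- \<theta>)"
        using regular_seqD(4)[OF elim] by (simp add: mult.commute[of _ "suminf x"] powr_mult_base)
      then have "ennreal (suminf x powr (- \<theta> - 1)) * ennreal (suminf x) = ennreal (suminf x powr (- \<theta>))"
        by (simp add: ennreal_mult'[symmetric])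
      then show ?case unfolding F0_def by (metis mult.assoc mult.commute)
    qed
  qed
  also have "\<dots> = (\<integral>\<^sup>+y. ennreal y * (\<integral>\<^sup>+x. F0 (ranked (case_nat y x)) \<partial>\<mu>) \<partial>stable_intensity \<gamma>)"
    by (rule mecke) simp
  also have "\<dots> = (\<integral>\<^sup>+y. ennreal y * (\<integral>\<^sup>+x. H y x \<partial>\<mu>) \<partial>stable_intensity \<gamma>)"
  proof (rule nn_integral_cong_AE)
    show "AE y in stable_intensity \<gamma>. ennreal y * (\<integral>\<^sup>+x. F0 (ranked (case_nat y x)) \<partial>\<mu>) = ennreal y * (\<integral>\<^sup>+x. H y x \<partial>\<mu>)"
      using AE_intensity_pos
    proof eventually_elim
      case (elim y)
      have "(\<integral>\<^sup>+x. F0 (ranked (case_nat y x)) \<partial>\<mu>) = (\<integral>\<^sup>+x. H y x \<partial>\<mu>)"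
      proof (rule nn_integral_cong_AE)
        show "AE x in \<mu>. F0 (ranked (case_nat y x)) = H y x"
          using AE_regular
          by eventually_elim (simp only: F0_def H_def normalize_seq_ranked_case_nat[OF _ elim] case_nat_tame(2)[OF _ elim])
      qed
      then show ?case by simp
    qed
  qed
  also have "\<dots> = (\<integral>\<^sup>+y. \<integral>\<^sup>+x. ennreal (k * y powr (- \<gamma>)) * H y x * indicator {0<..} y \<partial>\<mu> \<partial>lborel)"
  proof (subst nn_integral_stable_intensity, measurable, fold k_def, rule nn_integral_cong)
    fix y :: real
    show "ennreal (k * y powr (- \<gamma> - 1)) * (ennreal y * (\<integral>\<^sup>+x. H y x \<partial>\<mu>)) * indicator {0<..} y
      = (\<integral>\<^sup>+x. ennreal (k * y powr (- \<gamma>)) * H y x * indicator {0<..} y \<partial>\<mu>)"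
    proof (cases "0 < y")
      case True
      have "k * y powr (- \<gamma> - 1) * y = k * y powr (- \<gamma>)"
        using True by (simp add: mult.commute[of _ y] powr_mult_base)
      then have "ennreal (k * y powr (- \<gamma> - 1)) * ennreal y = ennreal (k * y powr (- \<gamma>))"
        using k by (simp add: ennreal_mult''[symmetric] True less_imp_le)
      then show ?thesis using True by (simp add: nn_integral_cmult mult.assoc[symmetric])
    qed simp
  qed
  also have "\<dots> = (\<integral>\<^sup>+x. \<integral>\<^sup>+y. ennreal (k * y powr (- \<gamma>)) * H y x * indicator {0<..} y \<partial>lborel \<partial>\<mu>)"
    by (rule P.Fubini'[symmetric]) (simp add: pair_cong)
  also have "\<dots> = (\<integral>\<^sup>+x. \<integral>\<^sup>+r. ennreal (k * (r powr (- \<gamma>) * (1 - r) powr (\<theta> + \<gamma> - 1))) *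
         (ennreal (suminf x powr (- (\<theta> + \<gamma>))) * F (ranked (case_nat r (\<lambda>i. (1 - r) * normalize_seq x i)))) * indicator {0<..<1} r \<partial>lborel \<partial>\<mu>)"
  proof (rule nn_integral_cong_AE)
    show "AE x in \<mu>. (\<integral>\<^sup>+y. ennreal (k * y powr (- \<gamma>)) * H y x * indicator {0<..} y \<partial>lborel)
       = (\<integral>\<^sup>+r. ennreal (k * (r powr (- \<gamma>) * (1 - r) powr (\<theta> + \<gamma> - 1))) *
         (ennreal (suminf x powr (- (\<theta> + \<gamma>))) * F (ranked (case_nat r (\<lambda>i. (1 - r) * normalize_seq x i)))) * indicator {0<..<1} r \<partial>lborel)"
      using AE_regular
    proof eventually_elim
      case (elim x)
      let ?T = "suminf x"
      have T: "0 < ?T" by (rule regular_seqD(4)[OF elim])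
      have [measurable]: "(\<lambda>y. H y x) \<in> borel_measurable borel"
        unfolding H_def by measurable
      have "(\<integral>\<^sup>+y. ennreal (k * y powr (- \<gamma>)) * H y x * indicator {0<..} y \<partial>lborel)
        = (\<integral>\<^sup>+r. ennreal (k * (?T * (r / (1 - r))) powr (- \<gamma>)) * H (?T * (r / (1 - r))) x * (ennreal (?T / (1 - r)\<^sup>2) * indicator {0<..<1} r) \<partial>lborel)"
        by (rule nn_integral_scaled_odds_substitution[OF _ T]) simp
      also have "\<dots> = (\<integral>\<^sup>+r. ennreal (k * (r powr (- \<gamma>) * (1 - r) powr (\<theta> + \<gamma> - 1))) *
         (ennreal (suminf x powr (- (\<theta> + \<gamma>))) * F (ranked (case_nat r (\<lambda>i. (1 - r) * normalize_seq x i)))) * indicator {0<..<1} r \<partial>lborel)"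
      proof (rule nn_integral_cong)
        fix r :: real
        show "ennreal (k * (?T * (r / (1 - r))) powr (- \<gamma>)) * H (?T * (r / (1 - r))) x * (ennreal (?T / (1 - r)\<^sup>2) * indicator {0<..<1} r)
          = ennreal (k * (r powr (- \<gamma>) * (1 - r) powr (\<theta> + \<gamma> - 1))) *
         (ennreal (suminf x powr (- (\<theta> + \<gamma>))) * F (ranked (case_nat r (\<lambda>i. (1 - r) * normalize_seq x i)))) * indicator {0<..<1} r"
        proof (cases "0 < r \<and> r < 1")
          case True
          let ?q = "1 - r"
          have q: "0 < ?q" using True by simp
          have s: "?T * (r / ?q) + ?T = ?T / ?q" using q by (simp add: field_simps)
          have "?T * (r / ?q) / (?T / ?q) = r" "x i / (?T / ?q) = ?q * normalize_seq x i" for i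
            using q T by (simp_all add: normalize_seq_def)
          then have H: "H (?T * (r / ?q)) x = ennreal ((?T / ?q) powr (- \<theta> - 1)) * F (ranked (case_nat r (\<lambda>i. ?q * normalize_seq x i)))"
            unfolding H_def s by simp
          \<comment> \<open>The powers are collected: the total receives
            \<open>- \<gamma> - (\<theta> + 1) + 1\<close> and \<open>1 - r\<close> receives
            \<open>\<gamma> + (\<theta> + 1) - 2\<close>, the exponents of the new tilt and of the
            beta density.\<close>
          have T2: "?T powr (- \<gamma>) * ?T powr (- \<theta> - 1) * ?T = ?T powr (- (\<theta> + \<gamma>))"
            using T by (simp add: powr_add[symmetric] mult.commute[of _ ?T] powr_mult_base)
          have q2: "?q powr \<gamma> * ?q powr (\<theta> + 1) / ?q\<^sup>2 = ?q powr (\<theta> + \<gamma> - 1)"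
          proof -
            have "?q powr (\<theta> + \<gamma> - 1) = ?q powr (\<gamma> + (\<theta> + 1) - 2)" by (simp add: algebra_simps)
            also have "\<dots> = ?q powr (\<gamma> + (\<theta> + 1)) / ?q powr 2" by (rule powr_diff)
            also have "?q powr 2 = ?q\<^sup>2" using q by (simp add: powr_numeral)
            finally show ?thesis by (simp add: powr_add)
          qed
          have "k * (?T * (r / ?q)) powr (- \<gamma>) * (?T / ?q) powr (- \<theta> - 1) * (?T / ?q\<^sup>2)
            = k * r powr (- \<gamma>) * (?T powr (- \<gamma>) * ?T powr (- \<theta> - 1) * ?T) * (?q powr \<gamma> * ?q powr (\<theta> + 1) / ?q\<^sup>2)"
          proof -
            have "(?T * (r / ?q)) powr (- \<gamma>) = ?T powr (- \<gamma>) * r powr (- \<gamma>) * ?q powr \<gamma>"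
              using True q T by (simp add: powr_mult powr_divide powr_minus field_simps)
            moreover have "(?T / ?q) powr (- \<theta> - 1) = ?T powr (- \<theta> - 1) * ?q powr (\<theta> + 1)"
            proof -
              have "- \<theta> - 1 = - (\<theta> + 1)" by simp
              then have "?q powr (- \<theta> - 1) * ?q powr (\<theta> + 1) = 1" using q by (simp add: powr_add[symmetric])
              then have "1 / ?q powr (- \<theta> - 1) = ?q powr (\<theta> + 1)" by (metis mult.commute nonzero_eq_divide_eq mult_zero_right zero_neq_one)
              moreover have "(?T / ?q) powr (- \<theta> - 1) = ?T powr (- \<theta> - 1) * (1 / ?q powr (- \<theta> - 1))"
                using q T by (simp add: powr_divide)
              ultimately show ?thesis by simp
            qed
            ultimately show ?thesis by simp
          qed
          also have "\<dots> = k * (r powr (- \<gamma>) * ?q powr (\<theta> + \<gamma> - 1)) * ?T powr (- (\<theta> + \<gamma>))"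
            unfolding T2 q2 by simp
          finally have E: "ennreal (k * (?T * (r / ?q)) powr (- \<gamma>)) * ennreal ((?T / ?q) powr (- \<theta> - 1)) * ennreal (?T / ?q\<^sup>2)
            = ennreal (k * (r powr (- \<gamma>) * ?q powr (\<theta> + \<gamma> - 1))) * ennreal (?T powr (- (\<theta> + \<gamma>)))"
            using k T by (simp add: ennreal_mult[symmetric] less_imp_le)
          show ?thesis
            using True arg_cong[OF E, of "\<lambda>z. z * F (ranked (case_nat r (\<lambda>i. ?q * normalize_seq x i)))"]
            unfolding H by (simp add: mult_ac)
        qed auto
      qed
      finally show ?case .
    qed
  qed
  also have "\<dots> = (\<integral>\<^sup>+r. \<integral>\<^sup>+x. ennreal (k * (r powr (- \<gamma>) * (1 - r) powr (\<theta> + \<gamma> - 1))) *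
         (ennreal (suminf x powr (- (\<theta> + \<gamma>))) * F (ranked (case_nat r (\<lambda>i. (1 - r) * normalize_seq x i)))) * indicator {0<..<1} r \<partial>\<mu> \<partial>lborel)"
    by (rule P.Fubini') (simp add: pair_cong)
  finally show ?thesis
    by (simp add: nn_integral_cmult nn_integral_multc k_def)
qed

section \<open>Moments of the total and tilted laws\<close>

definition moment :: "real \<Rightarrow> ennreal" where
  "moment \<theta> = (\<integral>\<^sup>+x. ennreal (suminf x powr (- \<theta>)) \<partial>\<mu>)"

lemma moment_pos: "0 < moment \<theta>"
proof (rule ccontr)
  assume "\<not> 0 < moment \<theta>"
  then have "AE x in \<mu>. ennreal (suminf x powr (- \<theta>)) = 0"
    unfolding moment_def by (subst (asm) not_gr_zero) (subst (asm) nn_integral_0_iff_AE, auto)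
  with AE_regular have "AE x in \<mu>. False"
    by eventually_elim (auto dest: regular_seqD(4))
  then show False by simp
qed

text \<open>Size-biased picking with \<open>F = 1\<close>; the fraction \<open>r\<close> integrates
  to a Beta value because \<open>\<theta> + \<gamma> > 0\<close>.\<close>

lemma moment_rec:
  assumes "- \<gamma> < \<theta>"
  shows "moment \<theta> = ennreal (\<gamma> / Gamma (1 - \<gamma>) * Beta (1 - \<gamma>) (\<theta> + \<gamma>)) * moment (\<theta> + \<gamma>)"
proof -
  define k where "k = \<gamma> / Gamma (1 - \<gamma>)"
  have k: "0 < k" using index by (simp add: Gamma_real_pos k_def)
  have "moment \<theta> = (\<integral>\<^sup>+r. ennreal (k * (r powr (- \<gamma>) * (1 - r) powr (\<theta> + \<gamma> - 1))) * moment (\<theta> + \<gamma>) * indicator {0<..<1} r \<partial>lborel)"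
    using size_biased_pick[of "\<lambda>_. 1" \<theta>] by (simp add: moment_def k_def)
  also have "\<dots> = (\<integral>\<^sup>+r. ennreal k * (ennreal (r powr ((1 - \<gamma>) - 1) * (1 - r) powr ((\<theta> + \<gamma>) - 1)) * indicator {0<..<1} r) * moment (\<theta> + \<gamma>) \<partial>lborel)"
    using k by (intro nn_integral_cong) (simp add: ennreal_mult' mult_ac)
  also have "\<dots> = ennreal k * ennreal (Beta (1 - \<gamma>) (\<theta> + \<gamma>)) * moment (\<theta> + \<gamma>)"
    using assms index by (simp add: nn_integral_multc nn_integral_cmult nn_integral_Beta[symmetric])
  finally show ?thesis using k assms index by (simp add: ennreal_mult Beta_real_pos less_imp_le flip: k_def)
qed

text \<open>For \<open>\<theta> < 0\<close> this is a positive moment of a heavy-tailed variable.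
  The recursion shifts the order by \<gamma> to a strictly negative power of the total, where the
  explicit moment formula applies.\<close>

lemma moment_finite:
  assumes "- \<gamma> < \<theta>"
  shows "moment \<theta> < \<top>"
proof -
  have "moment (\<theta> + \<gamma>) < \<top>"
    unfolding moment_def using assms by (subst negative_moment) auto
  then show ?thesis unfolding moment_rec[OF assms] by (simp add: ennreal_mult_less_top)
qed

text \<open>The candidate for \<open>PD \<gamma> \<theta>\<close>: the normalized points under the
  density proportional to \<open>T powr (- \<theta>)\<close>, with \<open>T\<close> their
  total.\<close>

definition tilted :: "real \<Rightarrow> (nat \<Rightarrow> real) measure" where
  "tilted \<theta> = distr (density \<mu> (\<lambda>x. ennreal (suminf x powr (- \<theta>)) / moment \<theta>)) seq_space normalize_seq"

lemma sets_tilted [measurable_cong, simp]: "sets (tilted \<theta>) = sets seq_space"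
  and space_tilted [simp]: "space (tilted \<theta>) = UNIV"
  by (simp_all add: tilted_def space_PiM)

lemma measurable_tilted [simp]: "measurable (tilted \<theta>) N = measurable seq_space N"
  by (rule measurable_cong_sets) simp_all

lemma nn_integral_tilted:
  assumes [measurable]: "F \<in> borel_measurable seq_space"
  shows "(\<integral>\<^sup>+p. F p \<partial>tilted \<theta>) = (\<integral>\<^sup>+x. ennreal (suminf x powr (- \<theta>)) * F (normalize_seq x) \<partial>\<mu>) / moment \<theta>"
  unfolding tilted_def
  by (subst nn_integral_distr, simp, simp, subst nn_integral_density)
     (auto simp: nn_integral_divide[symmetric] ennreal_times_divide mult.commute intro!: nn_integral_cong)

lemma prob_space_tilted:
  assumes "- \<gamma> < \<theta>"
  shows "prob_space (tilted \<theta>)"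
proof (rule prob_spaceI)
  have "emeasure (tilted \<theta>) (space (tilted \<theta>)) = (\<integral>\<^sup>+p. 1 \<partial>tilted \<theta>)" by simp
  also have "\<dots> = moment \<theta> / moment \<theta>"
    by (subst nn_integral_tilted) (auto simp: moment_def)
  also have "\<dots> = 1" using moment_pos[of \<theta>] moment_finite[OF assms] by (intro ennreal_divide_self) auto
  finally show "emeasure (tilted \<theta>) (space (tilted \<theta>)) = 1" .
qed

lemma AE_tilted: "AE p in tilted \<theta>. regular_seq p \<and> suminf p = 1"
  unfolding tilted_def
proof (subst AE_distr_iff)
  show "AE x in density \<mu> (\<lambda>x. ennreal (suminf x powr (- \<theta>)) / moment \<theta>). regular_seq (normalize_seq x) \<and> suminf (normalize_seq x) = 1"
    by (subst AE_density, simp) (use AE_regular in eventually_elim, auto simp: normalize_seq_regular)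
qed measurable

text \<open>One size-biased pick replaces the parameter \<theta> by
  \<open>\<theta> + \<gamma>\<close>. The recursion between the two normalizing moments is what
  makes the remaining constant that of the beta density.\<close>

lemma nn_integral_tilted_rec:
  assumes [measurable]: "F \<in> borel_measurable seq_space" and \<theta>: "- \<gamma> < \<theta>"
  shows "(\<integral>\<^sup>+p. F p \<partial>tilted \<theta>) = (\<integral>\<^sup>+r. \<integral>\<^sup>+p. F (ranked (case_nat r (\<lambda>i. (1 - r) * p i))) \<partial>tilted (\<theta> + \<gamma>) \<partial>beta_law (1 - \<gamma>) (\<theta> + \<gamma>))"
proof -
  define k where "k = \<gamma> / Gamma (1 - \<gamma>)"
  let ?B = "Beta (1 - \<gamma>) (\<theta> + \<gamma>)" and ?m = "moment (\<theta> + \<gamma>)"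
  have k: "0 < k" using index by (simp add: Gamma_real_pos k_def)
  have B: "0 < ?B" using index \<theta> by (intro Beta_real_pos) auto
  have m: "0 < ?m" "?m < \<top>" using moment_pos moment_finite[of "\<theta> + \<gamma>"] index \<theta> by auto
  define G where "G r = (\<integral>\<^sup>+x. ennreal (suminf x powr (- (\<theta> + \<gamma>))) * F (ranked (case_nat r (\<lambda>i. (1 - r) * normalize_seq x i))) \<partial>\<mu>)" for r
  have pair_cong: "measurable (borel \<Otimes>\<^sub>M \<mu>) N = measurable (borel \<Otimes>\<^sub>M seq_space) N" for N :: "'z measure"
    by (intro measurable_cong_sets sets_pair_measure_cong) auto
  have [measurable]: "G \<in> borel_measurable borel"
    unfolding G_def[abs_def] by (rule borel_measurable_nn_integral) (simp add: split_beta' pair_cong)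
  have "(\<integral>\<^sup>+p. F p \<partial>tilted \<theta>) = (\<integral>\<^sup>+r. ennreal (k * (r powr (- \<gamma>) * (1 - r) powr (\<theta> + \<gamma> - 1))) * G r * indicator {0<..<1} r \<partial>lborel) / moment \<theta>"
    unfolding G_def k_def by (subst nn_integral_tilted, simp, subst size_biased_pick) auto
  also have "\<dots> = ennreal k * (\<integral>\<^sup>+r. ennreal (r powr ((1 - \<gamma>) - 1) * (1 - r) powr ((\<theta> + \<gamma>) - 1)) * G r * indicator {0<..<1} r \<partial>lborel) / moment \<theta>"
    using k by (subst nn_integral_cmult[symmetric]) (auto simp: ennreal_mult' mult.assoc)
  also have "\<dots> = (\<integral>\<^sup>+r. ennreal (r powr ((1 - \<gamma>) - 1) * (1 - r) powr ((\<theta> + \<gamma>) - 1)) * G r * indicator {0<..<1} r \<partial>lborel) / ennreal ?B / ?m"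
  proof -
    \<comment> \<open>The cancellation in \<open>ennreal\<close> is checked separately for an
      infinite \<open>I\<close>; the moment and the Beta value are finite and positive.\<close>
    have "ennreal k * I / (ennreal (k * ?B) * ?m) = I / ennreal ?B / ?m" for I
    proof -
      obtain m' where m': "?m = ennreal m'" "0 < m'" using m by (cases ?m) auto
      show ?thesis
      proof (cases I)
        case (real i)
        then show ?thesis unfolding m' using k B m' by (simp add: ennreal_mult[symmetric] divide_ennreal less_imp_le field_simps)
      next
        case top
        then show ?thesis unfolding m' using k B m' by (simp add: ennreal_mult[symmetric] ennreal_top_divide ennreal_mult_top)
      qed
    qed
    then show ?thesis unfolding moment_rec[OF \<theta>] by (simp flip: k_def)
  qed
  also have "\<dots> = (\<integral>\<^sup>+r. G r / ?m \<partial>beta_law (1 - \<gamma>) (\<theta> + \<gamma>))"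
    using index \<theta> by (simp add: nn_integral_divide nn_integral_beta_law)
  also have "\<dots> = (\<integral>\<^sup>+r. \<integral>\<^sup>+p. F (ranked (case_nat r (\<lambda>i. (1 - r) * p i))) \<partial>tilted (\<theta> + \<gamma>) \<partial>beta_law (1 - \<gamma>) (\<theta> + \<gamma>))"
    by (intro nn_integral_cong, subst nn_integral_tilted) (auto simp: G_def)
  finally show ?thesis .
qed

end

section \<open>Stick-breaking\<close>

text \<open>Resampling one coordinate from its own law leaves a product law unchanged, so the
  breaking of a single stick can be integrated while all other variables are kept.\<close>

lemma nn_integral_PiM_update:
  assumes M: "\<And>i. prob_space (M i)" and [measurable]: "H \<in> borel_measurable (PiM UNIV M)"
  shows "(\<integral>\<^sup>+r. \<integral>\<^sup>+x. H (r(n := x)) \<partial>M n \<partial>PiM UNIV M) = (\<integral>\<^sup>+r. H r \<partial>PiM UNIV M)"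
proof -
  interpret A: prob_space "M n" by (rule M)
  interpret B: prob_space "PiM UNIV M" by (rule prob_space_PiM) (rule M)
  interpret P: pair_sigma_finite "M n" "PiM UNIV M" ..
  have upd [measurable]: "(\<lambda>z. (snd z)(n := fst z)) \<in> measurable (M n \<Otimes>\<^sub>M PiM UNIV M) (PiM UNIV M)"
  proof (rule measurable_PiM_single')
    fix i
    show "(\<lambda>z. ((snd z)(n := fst z)) i) \<in> measurable (M n \<Otimes>\<^sub>M PiM UNIV M) (M i)"
      by (cases "i = n") (simp_all add: measurable_compose[OF measurable_snd measurable_component_singleton])
  next
    show "(\<lambda>z. (snd z)(n := fst z)) \<in> space (M n \<Otimes>\<^sub>M PiM UNIV M) \<rightarrow> (\<Pi>\<^sub>E i\<in>UNIV. space (M i))"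
      by (auto simp: space_pair_measure space_PiM PiE_iff)
  qed
  have "(\<integral>\<^sup>+r. H r \<partial>PiM UNIV M) = (\<integral>\<^sup>+r. H r \<partial>distr (M n \<Otimes>\<^sub>M PiM UNIV M) (PiM UNIV M) (\<lambda>(x, X). X(n := x)))"
    using distr_pair_PiM_eq_PiM[of UNIV M n] M by simp
  also have "\<dots> = (\<integral>\<^sup>+z. H ((snd z)(n := fst z)) \<partial>(M n \<Otimes>\<^sub>M PiM UNIV M))"
    by (subst nn_integral_distr) (auto simp: split_beta')
  also have "\<dots> = (\<integral>\<^sup>+r. \<integral>\<^sup>+x. H (r(n := x)) \<partial>M n \<partial>PiM UNIV M)"
    by (subst P.nn_integral_snd[symmetric]) (auto intro!: measurable_compose[OF upd assms(2)])
  finally show ?thesis ..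
qed

definition rest :: "(nat \<Rightarrow> real) \<Rightarrow> nat \<Rightarrow> real" where
  "rest r n = (\<Prod>j<n. 1 - r j)"

definition stick :: "(nat \<Rightarrow> real) \<Rightarrow> nat \<Rightarrow> real" where
  "stick r k = r k * rest r k"

text \<open>Interpolates between the partition \<open>p\<close>, at \<open>n = 0\<close>, and pure
  stick-breaking: after \<open>n\<close> breaks the remaining length is divided in the proportions
  \<open>p\<close>.\<close>

definition stick_upto :: "nat \<Rightarrow> (nat \<Rightarrow> real) \<Rightarrow> (nat \<Rightarrow> real) \<Rightarrow> nat \<Rightarrow> real" where
  "stick_upto n r p k = (if k < n then stick r k else rest r n * p (k - n))"

lemma rest_measurable [measurable]: "(\<lambda>r. rest r n) \<in> borel_measurable seq_space"
  and stick_measurable [measurable]: "(\<lambda>r. stick r n) \<in> borel_measurable seq_space"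
  unfolding stick_def rest_def by measurable

lemma rest_Suc: "rest r (Suc n) = rest r n * (1 - r n)"
  by (simp add: rest_def)

lemma sum_stick: "(\<Sum>k<n. stick r k) + rest r n = 1"
  by (induction n) (simp_all add: rest_Suc stick_def algebra_simps rest_def)

lemma stick_fun_upd: "k < n \<Longrightarrow> stick (r(n := x)) k = stick r k"
  and rest_fun_upd: "k \<le> n \<Longrightarrow> rest (r(n := x)) k = rest r k"
  by (auto simp: stick_def rest_def intro!: prod.cong arg_cong2[where f = "(*)"])

lemma stick_upto_0: "stick_upto 0 r p = p"
  by (simp add: fun_eq_iff stick_upto_def rest_def)

text \<open>Splitting off the fraction \<open>x\<close> of what remains is one further break;
  recording it as \<open>r(n := x)\<close> matches the resampling of coordinate
  \<open>n\<close>.\<close>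

lemma stick_upto_case_nat:
  "stick_upto n r (case_nat x (\<lambda>i. (1 - x) * p i)) = stick_upto (Suc n) (r(n := x)) p"
proof
  fix k
  consider "k < n" | "k = n" | i where "k = Suc n + i" by (metis add_Suc less_imp_Suc_add linorder_cases add.commute)
  then show "stick_upto n r (case_nat x (\<lambda>i. (1 - x) * p i)) k = stick_upto (Suc n) (r(n := x)) p k"
    by cases (auto simp: stick_upto_def stick_fun_upd rest_fun_upd rest_Suc stick_def Suc_diff_le mult_ac)
qed

definition unit_seq :: "(nat \<Rightarrow> real) \<Rightarrow> bool" where
  "unit_seq r \<longleftrightarrow> (\<forall>k. 0 < r k \<and> r k < 1)"

lemma rest_bounds:
  assumes "unit_seq r"
  shows "0 < rest r n" "rest r n \<le> 1" "n \<le> m \<Longrightarrow> rest r m \<le> rest r n" "0 < stick r n" "stick r n \<le> rest r n"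
proof -
  have r: "0 < r k" "r k < 1" for k using assms by (auto simp: unit_seq_def)
  show 0: "0 < rest r n" for n unfolding rest_def using r by (intro prod_pos) auto
  show "rest r n \<le> 1" unfolding rest_def using r by (intro prod_le_1) (auto intro: less_imp_le)
  show "rest r m \<le> rest r n" if "n \<le> m"
    using that
  proof (induction rule: dec_induct)
    case (step k)
    have "rest r (Suc k) \<le> rest r k * 1" unfolding rest_Suc using r[of k] 0[of k] by (intro mult_left_mono) auto
    then show ?case using step by simp
  qed simp
  show "0 < stick r n" unfolding stick_def using r 0 by simp
  show "stick r n \<le> rest r n" unfolding stick_def using r[of n] 0[of n] by (simp add: mult_le_cancel_right1)
qed

text \<open>Partial sums of the sticks fall short of 1 by the remaining length, which is positive;
  so the total is finite.\<close>

lemma tame_stick: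
  assumes "unit_seq r"
  shows "tame (stick r)"
proof (rule tameI_sum)
  have "(\<Sum>k<n. ennreal (stick r k)) \<le> 1" for n
  proof -
    have "(\<Sum>k<n. ennreal (stick r k)) = ennreal (\<Sum>k<n. stick r k)"
      using rest_bounds(4)[OF assms] by (intro sum_ennreal) (auto intro: less_imp_le)
    also have "\<dots> \<le> ennreal 1"
      using sum_stick[of r n] rest_bounds(1)[OF assms, of n] by (intro ennreal_leI) linarith
    finally show ?thesis by simp
  qed
  then have "(\<Sum>k. ennreal (stick r k)) \<le> 1"
    unfolding suminf_eq_SUP by (rule SUP_least)
  then show "(\<integral>\<^sup>+k. ennreal (stick r k) \<partial>count_space UNIV) < \<top>"
    by (simp add: nn_integral_count_space_nat le_less_trans)
qed (use rest_bounds(4)[OF assms] in \<open>auto intro: less_imp_le\<close>)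

lemma tame_stick_upto:
  assumes r: "unit_seq r" and p: "tame p"
  shows "tame (stick_upto n r p)"
  unfolding tame_def
proof (intro conjI allI impI)
  note b = rest_bounds[OF r]
  show "0 \<le> stick_upto n r p i" for i
    using b(4)[of i] b(1)[of n] tameD(1)[OF p] by (auto simp: stick_upto_def intro: less_imp_le)
  fix s :: real assume s: "0 < s"
  have "{k. s \<le> stick_upto n r p k} \<subseteq> {..<n} \<union> (\<lambda>i. i + n) ` {i. s / rest r n \<le> p i}"
  proof safe
    fix k assume k: "s \<le> stick_upto n r p k" "k \<notin> (\<lambda>i. i + n) ` {i. s / rest r n \<le> p i}"
    show "k < n"
    proof (rule ccontr)
      assume "\<not> k < n"
      then have "s / rest r n \<le> p (k - n)" "k = (k - n) + n"
        using k(1) b(1)[of n] by (auto simp: stick_upto_def pos_divide_le_eq mult.commute)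
      then show False using k(2) by blast
    qed
  qed
  moreover have "finite {i. s / rest r n \<le> p i}" using p b(1)[of n] s by (simp add: tame_def)
  ultimately show "finite {k. s \<le> stick_upto n r p k}" by (auto intro: finite_subset)
qed auto

text \<open>A count above a positive level sees the tail only through its own counts. The inner
  ranking produced by each pick is therefore absorbed by the outer one.\<close>

lemma ranked_stick_upto_ranked:
  assumes r: "unit_seq r" and q: "tame q"
  shows "ranked (stick_upto n r (ranked q)) = ranked (stick_upto n r q)"
proof (rule ranked_cong)
  show "tame (stick_upto n r (ranked q))" "tame (stick_upto n r q)"
    using r q by (auto intro: tame_stick_upto tame_ranked)
  fix s :: real assume s: "0 < s"
  have c: "0 < rest r n" by (rule rest_bounds(1)[OF r])
  have "point_count (stick_upto n r p) {s..} = point_count p {s / rest r n..} + (\<Sum>k<n. indicator {s..} (stick r k))" for p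
  proof -
    have "(\<Sum>k. indicator {s..} (stick_upto n r p k)) = (\<Sum>k. indicator {s..} (stick_upto n r p (k + n))) + (\<Sum>k<n. indicator {s..} (stick_upto n r p k) :: ennreal)"
      by (rule suminf_offset) auto
    also have "(\<Sum>k. indicator {s..} (stick_upto n r p (k + n))) = (\<Sum>k. indicator {s / rest r n..} (p k) :: ennreal)"
      using c by (intro arg_cong[where f = suminf] ext) (auto simp: stick_upto_def indicator_def pos_divide_le_eq mult.commute)
    also have "(\<Sum>k<n. indicator {s..} (stick_upto n r p k) :: ennreal) = (\<Sum>k<n. indicator {s..} (stick r k))"
      by (intro sum.cong) (auto simp: stick_upto_def)
    finally show ?thesis by (simp only: point_count_nn_integral nn_integral_count_space_nat)
  qed
  moreover have "0 < s / rest r n" using c s by simp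
  ultimately show "point_count (stick_upto n r (ranked q)) {s..} = point_count (stick_upto n r q) {s..}"
    using point_count_ranked[OF q] by simp
qed

context stable_law
begin

text \<open>Iterating the pick \<open>n\<close> times writes the tilted partition as
  \<open>n\<close> sticks followed by a tilted remainder. Pure stick-breaking differs from this in
  each entry by at most the remaining length, whose mean tends to 0, so in the limit all mixed
  moments of the ranked sequences agree.\<close>

lemma PD_eq_tilted:
  assumes \<theta>: "- \<gamma> < \<theta>"
  shows "PD \<gamma> \<theta> = tilted \<theta>"
proof -
  define b where "b k = \<theta> + real (Suc k) * \<gamma>" for k
  have b0: "0 < b k" for k
  proof -
    have "0 \<le> real k * \<gamma>" using index by simp
    then show ?thesis using \<theta> by (simp add: b_def distrib_right)
  qed
  define M where "M k = beta_law (1 - \<gamma>) (b k)" for k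
  define R where "R = PiM UNIV M"
  have M: "prob_space (M k)" for k unfolding M_def using b0 index by (intro prob_space_beta_law) auto
  interpret R: prob_space R unfolding R_def by (rule prob_space_PiM) (rule M)
  have sets_R [measurable_cong, simp]: "sets R = sets seq_space"
    unfolding R_def by (intro sets_PiM_cong) (auto simp: M_def)
  have meas_R: "measurable R N = measurable seq_space N" for N :: "'z measure"
    by (rule measurable_cong_sets) simp_all
  have AE_unit: "AE r in R. unit_seq r"
  proof -
    have "AE x in M k. 0 < x \<and> x < 1" for k unfolding M_def by (rule AE_beta_law)
    then have "AE r in R. 0 < r k \<and> r k < 1" for k
      unfolding R_def by (intro AE_PiM_component M) simp_all
    then show ?thesis unfolding unit_seq_def by (simp add: AE_all_countable)
  qed
  have \<theta>n: "- \<gamma> < \<theta> + real n * \<gamma>" for n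
    using \<theta> index by (metis add.right_neutral add_mono_thms_linordered_field(3) less_imp_le mult_nonneg_nonneg of_nat_0_le_iff)
  have upto_meas [measurable]: "(\<lambda>z. stick_upto n (fst z) (snd z) k) \<in> borel_measurable (seq_space \<Otimes>\<^sub>M seq_space)" for n k
    unfolding stick_upto_def by (cases "k < n") simp_all
  \<comment> \<open>The remainder after \<open>n\<close> picks has parameter
    \<open>\<theta> + n * \<gamma>\<close>, and the beta variable of the next pick has the law of
    coordinate \<open>n\<close> of the stick variables.\<close>
  have iter: "(\<integral>\<^sup>+p. F p \<partial>tilted \<theta>) = (\<integral>\<^sup>+r. \<integral>\<^sup>+p. F (ranked (stick_upto n r p)) \<partial>tilted (\<theta> + real n * \<gamma>) \<partial>R)"
    if [measurable]: "F \<in> borel_measurable seq_space" for F n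
  proof (induction n)
    case 0
    have "(\<integral>\<^sup>+p. F p \<partial>tilted \<theta>) = (\<integral>\<^sup>+p. F (ranked (stick_upto 0 r p)) \<partial>tilted \<theta>)" for r
    proof (rule nn_integral_cong_AE)
      show "AE p in tilted \<theta>. F p = F (ranked (stick_upto 0 r p))"
        using AE_tilted by eventually_elim (simp add: stick_upto_0 regular_seqD(7))
    qed
    then show ?case by (simp add: R.emeasure_space_1)
  next
    case (Suc n)
    interpret TS: prob_space "tilted (\<theta> + real (Suc n) * \<gamma>)" by (rule prob_space_tilted[OF \<theta>n])
    have pcong: "measurable (seq_space \<Otimes>\<^sub>M tilted (\<theta> + real (Suc n) * \<gamma>)) N = measurable (seq_space \<Otimes>\<^sub>M seq_space) N" for N :: "'z measure"
      by (intro measurable_cong_sets sets_pair_measure_cong) auto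
    define H where "H r = (\<integral>\<^sup>+p. F (ranked (stick_upto (Suc n) r p)) \<partial>tilted (\<theta> + real (Suc n) * \<gamma>))" for r
    have [measurable]: "H \<in> borel_measurable seq_space"
      unfolding H_def[abs_def] by (rule TS.borel_measurable_nn_integral) (simp add: split_beta' pcong)
    have "(\<integral>\<^sup>+p. F (ranked (stick_upto n r p)) \<partial>tilted (\<theta> + real n * \<gamma>)) = (\<integral>\<^sup>+x. H (r(n := x)) \<partial>M n)" if r: "unit_seq r" for r
    proof -
      have [measurable]: "(\<lambda>p. F (ranked (stick_upto n r p))) \<in> borel_measurable seq_space"
        by (rule measurable_compose[OF measurable_ranked_nat]) (auto simp: stick_upto_def)
      have "(\<integral>\<^sup>+p. F (ranked (stick_upto n r p)) \<partial>tilted (\<theta> + real n * \<gamma>))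
        = (\<integral>\<^sup>+x. \<integral>\<^sup>+p. F (ranked (stick_upto n r (ranked (case_nat x (\<lambda>i. (1 - x) * p i))))) \<partial>tilted (\<theta> + real n * \<gamma> + \<gamma>) \<partial>beta_law (1 - \<gamma>) (\<theta> + real n * \<gamma> + \<gamma>))"
        by (rule nn_integral_tilted_rec[OF _ \<theta>n]) measurable
      also have "\<theta> + real n * \<gamma> + \<gamma> = \<theta> + real (Suc n) * \<gamma>" by (simp add: algebra_simps)
      also have "(\<integral>\<^sup>+x. \<integral>\<^sup>+p. F (ranked (stick_upto n r (ranked (case_nat x (\<lambda>i. (1 - x) * p i))))) \<partial>tilted (\<theta> + real (Suc n) * \<gamma>) \<partial>beta_law (1 - \<gamma>) (\<theta> + real (Suc n) * \<gamma>))
        = (\<integral>\<^sup>+x. H (r(n := x)) \<partial>beta_law (1 - \<gamma>) (\<theta> + real (Suc n) * \<gamma>))"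
      proof (rule nn_integral_cong_AE)
        show "AE x in beta_law (1 - \<gamma>) (\<theta> + real (Suc n) * \<gamma>). (\<integral>\<^sup>+p. F (ranked (stick_upto n r (ranked (case_nat x (\<lambda>i. (1 - x) * p i))))) \<partial>tilted (\<theta> + real (Suc n) * \<gamma>)) = H (r(n := x))"
          using AE_beta_law
        proof eventually_elim
          case (elim x)
          show ?case unfolding H_def
          proof (rule nn_integral_cong_AE)
            show "AE p in tilted (\<theta> + real (Suc n) * \<gamma>). F (ranked (stick_upto n r (ranked (case_nat x (\<lambda>i. (1 - x) * p i))))) = F (ranked (stick_upto (Suc n) (r(n := x)) p))"
              using AE_tilted
            proof eventually_elim
              case (elim p)
              have "regular_seq (\<lambda>i. (1 - x) * p i)"
                using elim \<open>0 < x \<and> x < 1\<close> by (auto simp: regular_seq_def decseq_def)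
              then have "tame (case_nat x (\<lambda>i. (1 - x) * p i))"
                using \<open>0 < x \<and> x < 1\<close> by (intro case_nat_tame(1)) auto
              then show ?case by (simp only: ranked_stick_upto_ranked[OF r] stick_upto_case_nat)
            qed
          qed
        qed
      qed
      finally show ?thesis by (simp add: M_def b_def)
    qed
    then have "(\<integral>\<^sup>+p. F p \<partial>tilted \<theta>) = (\<integral>\<^sup>+r. \<integral>\<^sup>+x. H (r(n := x)) \<partial>M n \<partial>R)"
      unfolding Suc.IH by (intro nn_integral_cong_AE) (use AE_unit in eventually_elim, simp)
    also have "\<dots> = (\<integral>\<^sup>+r. H r \<partial>R)"
      unfolding R_def by (rule nn_integral_PiM_update[OF M]) (simp add: meas_R flip: R_def)
    finally show ?case by (simp add: H_def)
  qed
  define e where "e n = (\<integral>\<^sup>+r. ennreal (rest r n) \<partial>R)" for n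
  have e_Suc: "e (Suc n) = e n * ennreal (b n / (1 - \<gamma> + b n))" for n
  proof -
    have "e (Suc n) = (\<integral>\<^sup>+r. \<integral>\<^sup>+x. ennreal (rest (r(n := x)) (Suc n)) \<partial>M n \<partial>R)"
      unfolding e_def R_def by (rule nn_integral_PiM_update[OF M, symmetric]) (simp add: meas_R flip: R_def)
    also have "\<dots> = (\<integral>\<^sup>+r. ennreal (rest r n) * (\<integral>\<^sup>+x. ennreal (1 - x) \<partial>M n) \<partial>R)"
    proof (rule nn_integral_cong_AE)
      show "AE r in R. (\<integral>\<^sup>+x. ennreal (rest (r(n := x)) (Suc n)) \<partial>M n) = ennreal (rest r n) * (\<integral>\<^sup>+x. ennreal (1 - x) \<partial>M n)"
        using AE_unit
      proof eventually_elim
        case (elim r)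
        then show ?case using rest_bounds(1)[OF elim, of n]
          by (subst nn_integral_cmult[symmetric]) (auto simp: M_def rest_Suc rest_fun_upd ennreal_mult' less_imp_le)
      qed
    qed
    also have "\<dots> = e n * ennreal (b n / (1 - \<gamma> + b n))"
      using index b0[of n] by (subst nn_integral_multc) (auto simp: e_def M_def beta_law_mean_complement meas_R)
    finally show ?thesis .
  qed
  \<comment> \<open>Chosen so that
    \<open>1 - \<gamma> + b n \<le> (1 - \<gamma>) * (n + 1) / C\<close>; the mean factor kept by
    each break is then at most \<open>1 - C / (n + 1)\<close>.\<close>
  define C where "C = (1 - \<gamma>) / (1 + \<bar>\<theta>\<bar> + \<gamma>)"
  have C: "0 < C" using index by (simp add: C_def)
  have e_le: "e n \<le> ennreal (exp (- (C * (\<Sum>k<n. 1 / real (Suc k)))))" for n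
  proof (induction n)
    case 0
    then show ?case by (simp add: e_def rest_def R.emeasure_space_1)
  next
    case (Suc n)
    have "b n / (1 - \<gamma> + b n) \<le> exp (- (C * (1 / real (Suc n))))"
    proof -
      have "1 - \<gamma> + b n \<le> (1 + \<bar>\<theta>\<bar> + \<gamma>) * real (Suc n)"
      proof -
        have "1 + \<bar>\<theta>\<bar> \<le> (1 + \<bar>\<theta>\<bar>) * real (Suc n)" by (simp add: mult_le_cancel_left1)
        moreover have "b n = \<theta> + real n * \<gamma> + \<gamma>"
          by (simp add: b_def algebra_simps)
        moreover have "(1 + \<bar>\<theta>\<bar> + \<gamma>) * real (Suc n) = (1 + \<bar>\<theta>\<bar>) * real (Suc n) + real n * \<gamma> + \<gamma>"
          by (simp add: algebra_simps)
        ultimately show ?thesis using index abs_ge_self[of \<theta>] by linarith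
      qed
      then have "(1 - \<gamma>) / ((1 + \<bar>\<theta>\<bar> + \<gamma>) * real (Suc n)) \<le> (1 - \<gamma>) / (1 - \<gamma> + b n)"
        using index b0[of n] by (intro divide_left_mono mult_pos_pos) auto
      moreover have "b n / (1 - \<gamma> + b n) = 1 - (1 - \<gamma>) / (1 - \<gamma> + b n)"
        using index b0[of n] by (simp add: field_simps)
      moreover have "1 + - (C * (1 / real (Suc n))) \<le> exp (- (C * (1 / real (Suc n))))"
        by (rule exp_ge_add_one_self)
      ultimately show ?thesis by (simp add: C_def)
    qed
    then have "e (Suc n) \<le> ennreal (exp (- (C * (\<Sum>k<n. 1 / real (Suc k))))) * ennreal (exp (- (C * (1 / real (Suc n)))))"
      unfolding e_Suc by (intro mult_mono Suc.IH ennreal_leI) auto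
    then show ?case by (simp add: ennreal_mult[symmetric] exp_add[symmetric] algebra_simps)
  qed
  have e_lim: "e \<longlonglongrightarrow> 0"
  proof (rule tendsto_sandwich[OF _ _ tendsto_const])
    \<comment> \<open>The beta parameters grow only linearly in \<open>n\<close>, so divergence of
      the harmonic series is just enough to drive the mean remaining length to 0.\<close>
    have "\<not> summable (\<lambda>k. 1 / real (Suc k))"
      using not_summable_harmonic[where 'a = real] summable_Suc_iff[of "\<lambda>k. 1 / real k"] by (simp only: inverse_eq_divide not_False_eq_True)
    then have unbdd: "\<exists>n. Z < (\<Sum>k<n. 1 / real (Suc k))" for Z
      using summableI_nonneg_bounded[of "\<lambda>k. 1 / real (Suc k)" Z] by (auto simp: not_less[symmetric])
    have "filterlim (\<lambda>n. \<Sum>k<n. 1 / real (Suc k)) at_top sequentially"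
      unfolding filterlim_at_top
    proof
      fix Z :: real
      obtain n where n: "Z < (\<Sum>k<n. 1 / real (Suc k))" using unbdd by blast
      have "Z \<le> (\<Sum>k<m. 1 / real (Suc k))" if "n \<le> m" for m
        using n sum_mono2[of "{..<m}" "{..<n}" "\<lambda>k. 1 / real (Suc k)"] that by auto
      then show "eventually (\<lambda>m. Z \<le> (\<Sum>k<m. 1 / real (Suc k))) sequentially"
        by (auto simp: eventually_sequentially)
    qed
    then have "filterlim (\<lambda>n. C * (\<Sum>k<n. 1 / real (Suc k))) at_top sequentially"
      using C by (intro filterlim_tendsto_pos_mult_at_top[OF tendsto_const])
    then have "(\<lambda>n. exp (- (C * (\<Sum>k<n. 1 / real (Suc k))))) \<longlonglongrightarrow> 0"
      by (intro filterlim_compose[OF exp_at_bot]) (simp add: filterlim_uminus_at_bot)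
    then show "(\<lambda>n. ennreal (exp (- (C * (\<Sum>k<n. 1 / real (Suc k)))))) \<longlonglongrightarrow> 0"
      using tendsto_ennrealI by fastforce
  qed (use e_le in auto)
  have stick_tame_ae: "AE r in R. tame (stick r)" using AE_unit by eventually_elim (rule tame_stick)
  have [measurable]: "(\<lambda>r. ranked (stick r)) \<in> measurable seq_space seq_space"
    by (rule measurable_ranked_nat) simp
  have "distr (tilted \<theta>) (PiM UNIV (\<lambda>_. borel)) (\<lambda>p. \<lambda>i\<in>UNIV. p i) = distr R (PiM UNIV (\<lambda>_. borel)) (\<lambda>r. \<lambda>i\<in>UNIV. ranked (stick r) i)"
  proof (rule mixed_moments_determine_measure)
    show "finite_measure (tilted \<theta>)" using prob_space_tilted[OF \<theta>] by (rule prob_space.finite_measure)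
    show "finite_measure R" by unfold_locales
    show "AE p in tilted \<theta>. p i \<in> {0..1}" for i
      using AE_tilted
    proof eventually_elim
      case (elim p)
      then have "p i \<le> 1" using sum_le_suminf[of p "{i}"] regular_seqD(1,3)[of p] by (auto intro: less_imp_le)
      then show ?case using elim regular_seqD(1)[of p i] by auto
    qed
    have ranked01: "ranked x i \<in> {0..1}" if "tame x" "\<And>k. x k \<le> 1" for x :: "nat \<Rightarrow> real" and i
    proof -
      have "\<not> of_nat i < point_count x {s..}" if "1 < s" for s
      proof -
        have "{k. x k \<in> {s..}} = {}" using that \<open>\<And>k. x k \<le> 1\<close> by (auto simp: not_le intro: le_less_trans)
        then show ?thesis unfolding point_count_def by simp
      qed
      then have "\<not> 1 < ranked x i" using le_ranked_iff[OF that(1), of "ranked x i" i] by auto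
      then show ?thesis using ranked_nonneg[OF that(1)] by auto
    qed
    have stick1: "stick r k \<le> 1" if "unit_seq r" for r k
      using rest_bounds(2,5)[OF that] by (meson order_trans)
    show "AE r in R. ranked (stick r) i \<in> {0..1}" for i
      using AE_unit by eventually_elim (auto intro!: ranked01 tame_stick stick1 simp del: atLeastAtMost_iff)
    fix F :: "nat set" and k :: "nat \<Rightarrow> nat" assume F: "finite F"
    \<comment> \<open>A monomial of total degree \<open>K\<close>; on the unit cube it is Lipschitz
      with constant \<open>K\<close> for the supremum norm.\<close>
    define G where "G p = (\<Prod>i\<in>F. p i ^ k i)" for p :: "nat \<Rightarrow> real"
    define K where "K = real (\<Sum>i\<in>F. k i)"
    have K: "0 \<le> K" unfolding K_def by (rule of_nat_0_le_iff)
    have [measurable]: "G \<in> borel_measurable seq_space" unfolding G_def[abs_def] by measurable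
    define A where "A = (\<integral>\<^sup>+p. (\<Prod>i\<in>F. ennreal (p i) ^ k i) \<partial>tilted \<theta>)"
    define B where "B = (\<integral>\<^sup>+r. (\<Prod>i\<in>F. ennreal (ranked (stick r) i) ^ k i) \<partial>R)"
    have prodE: "(\<Prod>i\<in>F. ennreal (x i) ^ k i) = ennreal (G x)" if "\<And>i. x i \<in> {0..1}" for x
      using that by (auto simp: G_def prod_ennreal[symmetric] ennreal_power)
    have close: "\<bar>G x - G y\<bar> \<le> K * \<epsilon>" if "\<And>i. x i \<in> {0..1}" "\<And>i. y i \<in> {0..1}" "\<And>i. \<bar>x i - y i\<bar> \<le> \<epsilon>" for x y \<epsilon>
    proof -
      have "norm (G x - G y) \<le> (\<Sum>i\<in>F. norm (x i ^ k i - y i ^ k i))"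
        unfolding G_def using that by (intro norm_prod_diff) (auto simp: norm_power intro!: power_le_one)
      also have "\<dots> \<le> (\<Sum>i\<in>F. real (k i) * \<epsilon>)"
      proof (rule sum_mono)
        fix i
        have "norm (x i ^ k i - y i ^ k i) \<le> k i * norm (x i - y i)"
          using that by (intro norm_power_diff) auto
        also have "\<dots> \<le> real (k i) * \<epsilon>" using that(3)[of i] by (intro mult_left_mono) auto
        finally show "norm (x i ^ k i - y i ^ k i) \<le> real (k i) * \<epsilon>" .
      qed
      finally show ?thesis by (simp add: K_def sum_distrib_right)
    qed
    have B_eq: "B = (\<integral>\<^sup>+r. ennreal (G (ranked (stick r))) \<partial>R)"
      unfolding B_def by (rule nn_integral_cong_AE, use AE_unit in eventually_elim) (intro prodE ranked01 tame_stick stick1)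
    have pw: "AE r in R. AE p in tilted (\<theta> + real n * \<gamma>). (\<Prod>i\<in>F. ennreal (ranked (stick_upto n r p) i) ^ k i) \<le> ennreal (G (ranked (stick r))) + ennreal K * ennreal (rest r n)
         \<and> ennreal (G (ranked (stick r))) \<le> (\<Prod>i\<in>F. ennreal (ranked (stick_upto n r p) i) ^ k i) + ennreal K * ennreal (rest r n)" for n
      using AE_unit
    proof eventually_elim
      case (elim r)
      note r = \<open>unit_seq r\<close>
      show ?case using AE_tilted
      proof eventually_elim
        case (elim p)
        then have p: "regular_seq p" "suminf p = 1" by auto
        have p1: "0 \<le> p i" "p i \<le> 1" for i
          using sum_le_suminf[of p "{i}"] regular_seqD(1,3)[OF p(1)] p(2) by (auto intro: less_imp_le)
        note b = rest_bounds[OF r]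
        \<comment> \<open>Past index \<open>n\<close> both entries lie between 0 and
          \<open>rest r n\<close>, since the proportions \<open>p\<close> are at most 1.\<close>
        have d: "\<bar>stick_upto n r p i - stick r i\<bar> \<le> rest r n" for i
        proof (cases "i < n")
          case False
          then have "stick r i \<le> rest r n" using b(5)[of i] b(3)[of n i] by linarith
          moreover have "rest r n * p (i - n) \<le> rest r n"
            using mult_left_mono[OF p1(2)[of "i - n"], of "rest r n"] b(1)[of n] by simp
          moreover have "0 \<le> rest r n * p (i - n)" using b(1)[of n] p1(1)[of "i - n"] by simp
          moreover have "stick_upto n r p i = rest r n * p (i - n)" using False by (simp add: stick_upto_def)
          ultimately show ?thesis using b(4)[of i] by linarith
        qed (use b(1)[of n] in \<open>auto simp: stick_upto_def\<close>)
        have t: "tame (stick_upto n r p)" "tame (stick r)"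
          using tame_stick_upto[OF r] tame_stick[OF r] regular_seqD(6)[OF p(1)] by auto
        have upto1: "stick_upto n r p i \<le> 1" for i
        proof (cases "i < n")
          case False
          have "rest r n * p (i - n) \<le> 1 * 1" using b(1)[of n] b(2)[of n] p1 by (intro mult_mono) auto
          then show ?thesis using False by (simp add: stick_upto_def)
        qed (use stick1[OF r] in \<open>auto simp: stick_upto_def\<close>)
        have x01: "ranked (stick_upto n r p) i \<in> {0..1}" "ranked (stick r) i \<in> {0..1}" for i
          by (intro ranked01 t upto1 stick1[OF r])+
        have c: "\<bar>G (ranked (stick_upto n r p)) - G (ranked (stick r))\<bar> \<le> K * rest r n"
          by (rule close[OF x01]) (rule ranked_lipschitz[OF t d])
        have G0: "0 \<le> G (ranked (stick_upto n r p))" "0 \<le> G (ranked (stick r))"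
          unfolding G_def using x01 by (auto intro!: prod_nonneg)
        show ?case
          unfolding prodE[OF x01(1)] using c K b(1)[of n] G0
          by (auto simp: ennreal_mult[symmetric] ennreal_plus[symmetric] less_imp_le abs_le_iff simp del: ennreal_plus intro!: ennreal_leI)
      qed
    qed
    have A_eq: "A = (\<integral>\<^sup>+r. \<integral>\<^sup>+p. (\<Prod>i\<in>F. ennreal (ranked (stick_upto n r p) i) ^ k i) \<partial>tilted (\<theta> + real n * \<gamma>) \<partial>R)" for n
      unfolding A_def by (rule iter) measurable
    have AB: "A \<le> B + ennreal K * e n" "B \<le> A + ennreal K * e n" for n
    proof -
      interpret TN: prob_space "tilted (\<theta> + real n * \<gamma>)" by (rule prob_space_tilted[OF \<theta>n])
      have em: "emeasure (tilted (\<theta> + real n * \<gamma>)) UNIV = 1" using TN.emeasure_space_1 by simp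
      have const: "(\<integral>\<^sup>+p. c \<partial>tilted (\<theta> + real n * \<gamma>)) = c" for c by (simp add: em)
      have Bn: "(\<integral>\<^sup>+r. ennreal (G (ranked (stick r))) + ennreal K * ennreal (rest r n) \<partial>R) = B + ennreal K * e n"
        unfolding B_eq e_def by (subst nn_integral_add) (auto simp: nn_integral_cmult meas_R)
      have "A \<le> (\<integral>\<^sup>+r. \<integral>\<^sup>+p. ennreal (G (ranked (stick r))) + ennreal K * ennreal (rest r n) \<partial>tilted (\<theta> + real n * \<gamma>) \<partial>R)"
        unfolding A_eq[of n]
      proof (rule nn_integral_mono_AE, use pw[of n] in eventually_elim)
        case (elim r)
        then show ?case by (intro nn_integral_mono_AE) (auto elim!: eventually_mono)
      qed
      then show "A \<le> B + ennreal K * e n" unfolding const Bn .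
      have pcong: "measurable (seq_space \<Otimes>\<^sub>M tilted (\<theta> + real n * \<gamma>)) N = measurable (seq_space \<Otimes>\<^sub>M seq_space) N" for N :: "'z measure"
        by (intro measurable_cong_sets sets_pair_measure_cong) auto
      define I where "I r = (\<integral>\<^sup>+p. (\<Prod>i\<in>F. ennreal (ranked (stick_upto n r p) i) ^ k i) \<partial>tilted (\<theta> + real n * \<gamma>))" for r
      have I [measurable]: "I \<in> borel_measurable seq_space"
        unfolding I_def[abs_def] by (rule TN.borel_measurable_nn_integral) (simp add: split_beta' pcong)
      have "B \<le> (\<integral>\<^sup>+r. I r + ennreal K * ennreal (rest r n) \<partial>R)"
        unfolding B_eq
      proof (rule nn_integral_mono_AE, use pw[of n] in eventually_elim)
        case (elim r)
        have [measurable]: "(\<lambda>p. ranked (stick_upto n r p)) \<in> measurable seq_space seq_space"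
          by (rule measurable_ranked_nat) (auto simp: stick_upto_def)
        have "ennreal (G (ranked (stick r))) = (\<integral>\<^sup>+p. ennreal (G (ranked (stick r))) \<partial>tilted (\<theta> + real n * \<gamma>))"
          by (rule const[symmetric])
        also have "\<dots> \<le> (\<integral>\<^sup>+p. (\<Prod>i\<in>F. ennreal (ranked (stick_upto n r p) i) ^ k i) + ennreal K * ennreal (rest r n) \<partial>tilted (\<theta> + real n * \<gamma>))"
          by (rule nn_integral_mono_AE, use elim in eventually_elim, simp)
        also have "\<dots> = I r + ennreal K * ennreal (rest r n)"
          unfolding I_def by (subst nn_integral_add) (auto simp: em)
        finally show ?case .
      qed
      also have "\<dots> = A + ennreal K * e n"
        unfolding A_eq[of n] e_def I_def[symmetric] by (subst nn_integral_add) (auto simp: nn_integral_cmult meas_R)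
      finally show "B \<le> A + ennreal K * e n" .
    qed
    have lim: "(\<lambda>n. c + ennreal K * e n) \<longlonglongrightarrow> c" for c
    proof -
      have "(\<lambda>n. ennreal K * e n) \<longlonglongrightarrow> ennreal K * 0"
        by (rule ennreal_tendsto_cmult[OF _ e_lim]) simp
      then show ?thesis using tendsto_add[OF tendsto_const, of _ 0 sequentially c] by simp
    qed
    have "A \<le> B" by (rule tendsto_lowerbound[OF lim]) (use AB in auto)
    moreover have "B \<le> A" by (rule tendsto_lowerbound[OF lim]) (use AB in auto)
    ultimately show "(\<integral>\<^sup>+p. (\<Prod>i\<in>F. ennreal (p i) ^ k i) \<partial>tilted \<theta>) = (\<integral>\<^sup>+r. (\<Prod>i\<in>F. ennreal (ranked (stick r) i) ^ k i) \<partial>R)"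
      unfolding A_def[symmetric] B_def[symmetric] by (rule antisym)
  qed (simp_all add: meas_R)
  then have "tilted \<theta> = distr R seq_space (\<lambda>r. ranked (stick r))"
    by (simp only: restrict_UNIV distr_id2[OF sets_tilted[symmetric]])
  also have "\<dots> = PD \<gamma> \<theta>"
    unfolding PD_def R_def M_def b_def stick_def[abs_def] rest_def by simp
  finally show ?thesis ..
qed

end

section \<open>Marked stable points\<close>

lemma nn_integral_PiM_prod:
  fixes M :: "nat \<Rightarrow> 'a measure"
  assumes M: "\<And>i. prob_space (M i)" and [measurable]: "\<And>i. h i \<in> borel_measurable (M i)"
  shows "(\<integral>\<^sup>+y. (\<Prod>j<n. h j (y j)) \<partial>PiM UNIV M) = (\<Prod>j<n. \<integral>\<^sup>+z. h j z \<partial>M j)"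
proof (induction n)
  case 0
  interpret prob_space "PiM UNIV M" by (rule prob_space_PiM) (rule M)
  show ?case by (simp add: emeasure_space_1)
next
  case (Suc n)
  have [measurable]: "(\<lambda>y. h j (y j)) \<in> borel_measurable (PiM UNIV M)" for j
    by (rule measurable_compose[OF measurable_component_singleton]) simp_all
  have "(\<integral>\<^sup>+y. (\<Prod>j<Suc n. h j (y j)) \<partial>PiM UNIV M) = (\<integral>\<^sup>+y. \<integral>\<^sup>+z. (\<Prod>j<Suc n. h j ((y(n := z)) j)) \<partial>M n \<partial>PiM UNIV M)"
    by (rule nn_integral_PiM_update[OF M, symmetric]) simp
  also have "\<dots> = (\<integral>\<^sup>+y. (\<Prod>j<n. h j (y j)) * (\<integral>\<^sup>+z. h n z \<partial>M n) \<partial>PiM UNIV M)"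
    by (intro nn_integral_cong) (simp add: nn_integral_cmult)
  finally show ?case by (simp add: nn_integral_multc Suc.IH)
qed

text \<open>Independence makes the expectation an infinite product. Each factor is rewritten as
  \<open>nexp\<close> of its own \<open>nln\<close>, so that the product is again
  \<open>nexp\<close> of a sum, the form which the Laplace functional of the unmarked points
  accepts.\<close>

lemma nn_integral_PiM_nexp_suminf:
  assumes M: "\<And>i. prob_space (M i)" and [measurable]: "\<And>i. h i \<in> borel_measurable (M i)"
  shows "(\<integral>\<^sup>+y. ennreal (nexp (\<Sum>j. h j (y j))) \<partial>PiM UNIV M)
       = ennreal (nexp (\<Sum>j. nln (enn2real (\<integral>\<^sup>+z. ennreal (nexp (h j z)) \<partial>M j))))"
proof -
  interpret prob_space "PiM UNIV M" by (rule prob_space_PiM) (rule M)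
  have [measurable]: "(\<lambda>y. h j (y j)) \<in> borel_measurable (PiM UNIV M)" for j
    by (rule measurable_compose[OF measurable_component_singleton]) simp_all
  define f where "f j = (\<integral>\<^sup>+z. ennreal (nexp (h j z)) \<partial>M j)" for j
  have f1: "f j \<le> 1" for j
  proof -
    interpret Mj: prob_space "M j" by (rule M)
    have "f j \<le> (\<integral>\<^sup>+z. 1 \<partial>M j)" unfolding f_def by (intro nn_integral_mono) simp
    then show ?thesis by (simp add: Mj.emeasure_space_1)
  qed
  have fr: "f j = ennreal (enn2real (f j))" "enn2real (f j) \<le> 1" for j
  proof -
    have "f j < \<top>" using f1[of j] by (rule le_less_trans) simp
    then show "f j = ennreal (enn2real (f j))" by simp
    show "enn2real (f j) \<le> 1" using f1[of j] by (intro enn2real_leI) auto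
  qed
  have "(\<lambda>n. \<integral>\<^sup>+y. ennreal (\<Prod>j<n. nexp (h j (y j))) \<partial>PiM UNIV M) \<longlonglongrightarrow> (\<integral>\<^sup>+y. ennreal (nexp (\<Sum>j. h j (y j))) \<partial>PiM UNIV M)"
  proof (rule nn_integral_dominated_convergence[where w = "\<lambda>_. 1"])
    show "AE y in PiM UNIV M. (\<lambda>n. ennreal (\<Prod>j<n. nexp (h j (y j)))) \<longlonglongrightarrow> ennreal (nexp (\<Sum>j. h j (y j)))"
      by (intro AE_I2 tendsto_ennrealI nexp_suminf)
    show "AE y in PiM UNIV M. ennreal (\<Prod>j<n. nexp (h j (y j))) \<le> 1" for n
      by (intro AE_I2) (simp add: prod_le_1)
  qed (auto simp: emeasure_space_1)
  moreover have "(\<integral>\<^sup>+y. ennreal (\<Prod>j<n. nexp (h j (y j))) \<partial>PiM UNIV M) = ennreal (\<Prod>j<n. nexp (nln (enn2real (f j))))" for n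
  proof -
    have "(\<integral>\<^sup>+y. ennreal (\<Prod>j<n. nexp (h j (y j))) \<partial>PiM UNIV M) = (\<integral>\<^sup>+y. (\<Prod>j<n. ennreal (nexp (h j (y j)))) \<partial>PiM UNIV M)"
      by (simp add: prod_ennreal)
    also have "\<dots> = (\<Prod>j<n. f j)"
      unfolding f_def by (rule nn_integral_PiM_prod[OF M]) simp
    also have "\<dots> = (\<Prod>j<n. ennreal (nexp (nln (enn2real (f j)))))"
      by (intro prod.cong refl) (subst fr(1), simp add: fr(2))
    finally show ?thesis by (simp add: prod_ennreal)
  qed
  moreover have "(\<lambda>n. ennreal (\<Prod>j<n. nexp (nln (enn2real (f j))))) \<longlonglongrightarrow> ennreal (nexp (\<Sum>j. nln (enn2real (f j))))"
    by (intro tendsto_ennrealI nexp_suminf)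
  ultimately show ?thesis unfolding f_def by (simp add: LIMSEQ_unique)
qed

locale fragmentation = A: stable_law \<alpha> \<mu>\<^sub>\<alpha> + B: stable_law \<beta> \<mu>\<^sub>\<beta>
  for \<alpha> \<beta> :: real and \<mu>\<^sub>\<alpha> \<mu>\<^sub>\<beta> :: "(nat \<Rightarrow> real) measure" +
  assumes \<beta>_less_\<alpha>: "\<beta> < \<alpha>"
begin

lemma indices: "0 < \<beta>" "\<beta> < \<alpha>" "\<alpha> < 1" "0 < \<alpha>" "\<beta> < 1" "0 < \<beta> / \<alpha>" "\<beta> / \<alpha> < 1"
  using A.index B.index \<beta>_less_\<alpha> by auto

text \<open>Tilting parameter \<open>- \<beta>\<close> in the convention of \<open>tilted\<close>,
  but without normalizing the points: both the proportions and the total of a mark are used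
  later.\<close>

definition mark_law :: "(nat \<Rightarrow> real) measure" where
  "mark_law = density \<mu>\<^sub>\<alpha> (\<lambda>y. ennreal (suminf y powr \<beta>) / A.moment (- \<beta>))"

lemma sets_mark_law [measurable_cong, simp]: "sets mark_law = sets seq_space"
  and space_mark_law [simp]: "space mark_law = UNIV"
  by (simp_all add: mark_law_def space_PiM)

lemma measurable_mark_law [simp]: "measurable mark_law N = measurable seq_space N"
  by (rule measurable_cong_sets) simp_all

lemma moment_bounds: "0 < A.moment (- \<beta>)" "A.moment (- \<beta>) < \<top>"
  using A.moment_pos A.moment_finite[of "- \<beta>"] indices by auto

lemma nn_integral_mark_law:
  assumes [measurable]: "f \<in> borel_measurable seq_space"
  shows "(\<integral>\<^sup>+y. f y \<partial>mark_law) = (\<integral>\<^sup>+y. ennreal (suminf y powr \<beta>) * f y \<partial>\<mu>\<^sub>\<alpha>) / A.moment (- \<beta>)"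
  unfolding mark_law_def
  by (subst nn_integral_density)
     (auto simp: nn_integral_divide[symmetric] ennreal_times_divide mult.commute intro!: nn_integral_cong)

lemma prob_space_mark_law: "prob_space mark_law"
proof (rule prob_spaceI)
  have "emeasure mark_law (space mark_law) = (\<integral>\<^sup>+y. 1 \<partial>mark_law)" by simp
  also have "\<dots> = A.moment (- \<beta>) / A.moment (- \<beta>)"
    by (subst nn_integral_mark_law) (auto simp: A.moment_def)
  also have "\<dots> = 1" using moment_bounds by (intro ennreal_divide_self) auto
  finally show "emeasure mark_law (space mark_law) = 1" .
qed

lemma AE_mark_law: "AE y in mark_law. regular_seq y"
  unfolding mark_law_def by (subst AE_density, simp) (use A.AE_regular in eventually_elim, simp)

lemma distr_mark_law: "distr mark_law seq_space normalize_seq = PD \<alpha> (- \<beta>)"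
  using indices by (subst A.PD_eq_tilted) (auto simp: A.tilted_def mark_law_def)

definition marks :: "(nat \<Rightarrow> nat \<Rightarrow> real) measure" where
  "marks = PiM UNIV (\<lambda>_. mark_law)"

definition marked :: "((nat \<Rightarrow> real) \<times> (nat \<Rightarrow> nat \<Rightarrow> real)) measure" where
  "marked = \<mu>\<^sub>\<beta> \<Otimes>\<^sub>M marks"

lemma sets_marks [measurable_cong, simp]: "sets marks = sets (PiM UNIV (\<lambda>_. seq_space))"
  unfolding marks_def by (intro sets_PiM_cong) auto

lemma sets_marked [measurable_cong, simp]: "sets marked = sets (seq_space \<Otimes>\<^sub>M PiM UNIV (\<lambda>_. seq_space))"
  unfolding marked_def by (intro sets_pair_measure_cong) auto

lemma measurable_marks [simp]: "measurable marks N = measurable (PiM UNIV (\<lambda>_. seq_space)) N"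
  and measurable_marked [simp]: "measurable marked N = measurable (seq_space \<Otimes>\<^sub>M PiM UNIV (\<lambda>_. seq_space)) N"
  by (rule measurable_cong_sets; simp)+

lemma space_marks [simp]: "space marks = UNIV"
  and space_marked [simp]: "space marked = UNIV"
  by (simp_all add: marks_def marked_def space_PiM space_pair_measure)

lemma prob_space_marks: "prob_space marks"
  unfolding marks_def by (rule prob_space_PiM) (rule prob_space_mark_law)

sublocale marks: prob_space marks by (rule prob_space_marks)

sublocale base_marks: pair_prob_space \<mu>\<^sub>\<beta> marks ..

sublocale marked: prob_space marked
  unfolding marked_def by unfold_locales

lemma AE_marked: "AE \<omega> in marked. regular_seq (fst \<omega>) \<and> (\<forall>j. regular_seq (snd \<omega> j))"
proof -
  have "AE y in marks. regular_seq (y j)" for j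
    unfolding marks_def by (rule AE_PiM_component) (auto intro: prob_space_mark_law AE_mark_law)
  then have "AE y in marks. \<forall>j. regular_seq (y j)" by (simp add: AE_all_countable)
  then have "AE x in \<mu>\<^sub>\<beta>. AE y in marks. regular_seq (fst (x, y)) \<and> (\<forall>j. regular_seq (snd (x, y) j))"
    using B.AE_regular by (auto elim!: eventually_mono)
  then show ?thesis unfolding marked_def
  proof (rule base_marks.AE_pair_measure[rotated])
    have "{\<omega> \<in> space (seq_space \<Otimes>\<^sub>M PiM UNIV (\<lambda>_. seq_space)). regular_seq (fst \<omega>) \<and> (\<forall>j. regular_seq (snd \<omega> j))} \<in> sets (seq_space \<Otimes>\<^sub>M PiM UNIV (\<lambda>_::nat. seq_space))"
      by measurable
    then show "{\<omega> \<in> space (\<mu>\<^sub>\<beta> \<Otimes>\<^sub>M marks). regular_seq (fst \<omega>) \<and> (\<forall>j. regular_seq (snd \<omega> j))} \<in> sets (\<mu>\<^sub>\<beta> \<Otimes>\<^sub>M marks)"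
      by (simp flip: marked_def add: space_pair_measure space_PiM)
  qed
qed

definition frag_points :: "(nat \<Rightarrow> real) \<times> (nat \<Rightarrow> nat \<Rightarrow> real) \<Rightarrow> nat \<times> nat \<Rightarrow> real" where
  "frag_points \<omega> k = fst \<omega> (fst k) * normalize_seq (snd \<omega> (fst k)) (snd k)"

text \<open>The time \<open>S\<close> of the overview, kept in \<open>ennreal\<close> because its
  finiteness is derived only afterwards, from its Laplace transform.\<close>

definition clock :: "(nat \<Rightarrow> real) \<times> (nat \<Rightarrow> nat \<Rightarrow> real) \<Rightarrow> ennreal" where
  "clock \<omega> = (\<Sum>j. ennreal ((fst \<omega> j / suminf (snd \<omega> j)) powr \<alpha>))"

lemma marked_measurable [measurable]:
  "(\<lambda>\<omega>. fst \<omega> j) \<in> borel_measurable (seq_space \<Otimes>\<^sub>M PiM UNIV (\<lambda>_::nat. seq_space))"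
  "(\<lambda>\<omega>. snd \<omega> j) \<in> measurable (seq_space \<Otimes>\<^sub>M PiM UNIV (\<lambda>_::nat. seq_space)) seq_space"
  "(\<lambda>\<omega>. frag_points \<omega> k) \<in> borel_measurable (seq_space \<Otimes>\<^sub>M PiM UNIV (\<lambda>_::nat. seq_space))"
  "clock \<in> borel_measurable (seq_space \<Otimes>\<^sub>M PiM UNIV (\<lambda>_::nat. seq_space))"
proof -
  show 1 [measurable]: "(\<lambda>\<omega>. fst \<omega> j) \<in> borel_measurable (seq_space \<Otimes>\<^sub>M PiM UNIV (\<lambda>_::nat. seq_space))" for j
    by (rule measurable_compose[OF measurable_fst measurable_component_singleton]) simp
  show 2 [measurable]: "(\<lambda>\<omega>. snd \<omega> j) \<in> measurable (seq_space \<Otimes>\<^sub>M PiM UNIV (\<lambda>_::nat. seq_space)) seq_space" for j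
    by (rule measurable_compose[OF measurable_snd measurable_component_singleton]) simp
  have [measurable]: "(\<lambda>\<omega>. normalize_seq (snd \<omega> j) i) \<in> borel_measurable (seq_space \<Otimes>\<^sub>M PiM UNIV (\<lambda>_::nat. seq_space))" for i j
    by (rule measurable_compose[OF measurable_compose[OF 2 normalize_seq_measurable] measurable_component_singleton]) simp
  show "(\<lambda>\<omega>. frag_points \<omega> k) \<in> borel_measurable (seq_space \<Otimes>\<^sub>M PiM UNIV (\<lambda>_::nat. seq_space))"
    unfolding frag_points_def by measurable
  show "clock \<in> borel_measurable (seq_space \<Otimes>\<^sub>M PiM UNIV (\<lambda>_::nat. seq_space))"
    unfolding clock_def[abs_def] by measurable
qed

text \<open>The Laplace exponent of the clock; it is found to be
  \<open>z powr (\<beta> / \<alpha>)\<close> without evaluating the moment in the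
  denominator.\<close>

definition bernstein_fn :: "ennreal \<Rightarrow> ennreal" where
  "bernstein_fn z = (\<integral>\<^sup>+u. ennreal (1 - nexp (ennreal (u powr \<alpha>) * z)) \<partial>stable_intensity \<beta>) / A.moment (- \<beta>)"

text \<open>
  The points \<open>fst \<omega> j\<close> with the marks \<open>snd \<omega> j\<close> form a Poisson process.  In the
  coordinates \<open>u = fst \<omega> j / suminf (snd \<omega> j)\<close> its intensity becomes a product, so that the
  clocks \<open>u powr \<alpha>\<close> are the jumps of a \<open>\<beta>/\<alpha>\<close>-stable subordinator and the fragments are the
  jumps of an \<open>\<alpha>\<close>-stable subordinator run along these clocks.
\<close>

lemma marked_laplace:
  assumes [measurable]: "g \<in> borel_measurable borel" and m: "0 \<le> m"
  shows "(\<integral>\<^sup>+\<omega>. ennreal (nexp ((\<Sum>j. \<Sum>i. g (frag_points \<omega> (j, i))) + ennreal m * clock \<omega>)) \<partial>marked)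
    = ennreal (nexp (bernstein_fn ((\<integral>\<^sup>+y. ennreal (1 - nexp (g y)) \<partial>stable_intensity \<alpha>) + ennreal m)))"
proof -
  interpret MM: prob_space mark_law by (rule prob_space_mark_law)
  interpret BM: pair_sigma_finite "stable_intensity \<beta>" mark_law ..
  interpret BA: pair_sigma_finite "stable_intensity \<beta>" \<mu>\<^sub>\<alpha> ..
  let ?\<nu> = "stable_intensity \<beta>"
  have pair_cong: "measurable (?\<nu> \<Otimes>\<^sub>M mark_law) N = measurable (borel \<Otimes>\<^sub>M seq_space) N"
      "measurable (?\<nu> \<Otimes>\<^sub>M \<mu>\<^sub>\<alpha>) N = measurable (borel \<Otimes>\<^sub>M seq_space) N"
      "measurable (borel \<Otimes>\<^sub>M mark_law) N = measurable (borel \<Otimes>\<^sub>M seq_space) N" for N :: "'z measure"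
    by (intro measurable_cong_sets sets_pair_measure_cong; simp)+
  define \<Psi> where "\<Psi> = (\<integral>\<^sup>+y. ennreal (1 - nexp (g y)) \<partial>stable_intensity \<alpha>)"
  \<comment> \<open>The contribution of one \<beta>-point of size \<open>x\<close> with mark
    \<open>y\<close>, so that the whole exponent becomes a single sum over marked points.\<close>
  define G where "G x y = (\<Sum>i. g (x * normalize_seq y i)) + ennreal m * ennreal ((x / suminf y) powr \<alpha>)" for x y
  have [measurable]: "(\<lambda>(x, y). G x y) \<in> borel_measurable (borel \<Otimes>\<^sub>M seq_space)"
    unfolding G_def normalize_seq_def by measurable
  have G2 [measurable]: "G x \<in> borel_measurable seq_space" for x
    unfolding G_def[abs_def] normalize_seq_def by measurable
  define \<phi> where "\<phi> x = enn2real (\<integral>\<^sup>+y. ennreal (nexp (G x y)) \<partial>mark_law)" for x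
  have [measurable]: "\<phi> \<in> borel_measurable borel"
    unfolding \<phi>_def[abs_def] by (intro borel_measurable_enn2real MM.borel_measurable_nn_integral) (simp add: split_beta' pair_cong)
  have nle: "(\<integral>\<^sup>+y. ennreal (nexp (G x y)) \<partial>mark_law) \<le> 1" for x
  proof -
    have "(\<integral>\<^sup>+y. ennreal (nexp (G x y)) \<partial>mark_law) \<le> (\<integral>\<^sup>+y. 1 \<partial>mark_law)" by (intro nn_integral_mono) simp
    then show ?thesis using MM.emeasure_space_1 by simp
  qed
  have \<phi>1: "0 \<le> \<phi> x" "\<phi> x \<le> 1" for x
    using nle[of x] by (auto simp: \<phi>_def enn2real_leI)
  have \<phi>_compl: "ennreal (1 - \<phi> x) = (\<integral>\<^sup>+y. ennreal (1 - nexp (G x y)) \<partial>mark_law)" for x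
  proof -
    have int: "integrable mark_law (\<lambda>y. nexp (G x y))"
      by (rule MM.integrable_const_bound[where B = 1]) auto
    have "(\<integral>\<^sup>+y. ennreal (1 - nexp (G x y)) \<partial>mark_law) = ennreal (\<integral>y. 1 - nexp (G x y) \<partial>mark_law)"
      using int by (intro nn_integral_eq_integral) auto
    also have "(\<integral>y. 1 - nexp (G x y) \<partial>mark_law) = 1 - (\<integral>y. nexp (G x y) \<partial>mark_law)"
      using int MM.prob_space by (subst Bochner_Integration.integral_diff) auto
    also have "(\<integral>y. nexp (G x y) \<partial>mark_law) = \<phi> x"
      unfolding \<phi>_def by (rule integral_eq_nn_integral) auto
    finally show ?thesis ..
  qed
  have sum_eq: "(\<Sum>j. \<Sum>i. g (frag_points \<omega> (j, i))) + ennreal m * clock \<omega> = (\<Sum>j. G (fst \<omega> j) (snd \<omega> j))" for \<omega>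
    unfolding G_def clock_def frag_points_def by (simp add: suminf_add[symmetric] del: suminf_add)
  have mG: "(\<lambda>\<omega>. G (fst \<omega> j) (snd \<omega> j)) \<in> borel_measurable (seq_space \<Otimes>\<^sub>M PiM UNIV (\<lambda>_. seq_space))" for j
    by (rule measurable_compose[where f = "\<lambda>\<omega>. (fst \<omega> j, snd \<omega> j)" and g = "\<lambda>(x, y). G x y", simplified]) measurable
  have "(\<integral>\<^sup>+\<omega>. ennreal (nexp (\<Sum>j. G (fst \<omega> j) (snd \<omega> j))) \<partial>marked)
    = (\<integral>\<^sup>+x. \<integral>\<^sup>+y. ennreal (nexp (\<Sum>j. G (x j) (y j))) \<partial>marks \<partial>\<mu>\<^sub>\<beta>)"
    unfolding marked_def
    by (subst marks.nn_integral_fst[symmetric]) (simp_all add: mG flip: marked_def)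
  \<comment> \<open>The marks are averaged out first. What remains is a functional of the
    \<beta>-points alone with the function \<open>nln\<close> of \<open>\<phi>\<close>, and
    \<open>1 - nexp (nln (\<phi> x))\<close> is \<open>1 - \<phi> x\<close>.\<close>
  also have "\<dots> = (\<integral>\<^sup>+x. ennreal (nexp (\<Sum>j. nln (\<phi> (x j)))) \<partial>\<mu>\<^sub>\<beta>)"
    unfolding marks_def \<phi>_def
    by (intro nn_integral_cong, subst nn_integral_PiM_nexp_suminf) (auto intro: prob_space_mark_law)
  also have "\<dots> = ennreal (nexp (\<integral>\<^sup>+x. ennreal (1 - \<phi> x) \<partial>?\<nu>))"
    by (subst B.laplace) (auto simp: \<phi>1)
  also have "(\<integral>\<^sup>+x. ennreal (1 - \<phi> x) \<partial>?\<nu>) = (\<integral>\<^sup>+y. \<integral>\<^sup>+x. ennreal (1 - nexp (G x y)) \<partial>?\<nu> \<partial>mark_law)"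
    unfolding \<phi>_compl by (rule BM.Fubini'[symmetric]) (simp add: pair_cong split_beta')
  \<comment> \<open>For a fixed mark, \<open>x = u * suminf y\<close> removes the total of the mark
    from the fragments and from the clock, at the price of the factor
    \<open>suminf y powr (- \<beta>)\<close>.\<close>
  also have "\<dots> = (\<integral>\<^sup>+y. ennreal (suminf y powr (- \<beta>)) * (\<integral>\<^sup>+u. ennreal (1 - nexp ((\<Sum>i. g (u * y i)) + ennreal m * ennreal (u powr \<alpha>))) \<partial>?\<nu>) \<partial>mark_law)"
  proof (rule nn_integral_cong_AE)
    show "AE y in mark_law. (\<integral>\<^sup>+x. ennreal (1 - nexp (G x y)) \<partial>?\<nu>)
      = ennreal (suminf y powr (- \<beta>)) * (\<integral>\<^sup>+u. ennreal (1 - nexp ((\<Sum>i. g (u * y i)) + ennreal m * ennreal (u powr \<alpha>))) \<partial>?\<nu>)"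
      using AE_mark_law
    proof eventually_elim
      case (elim y)
      define F where "F u = ennreal (1 - nexp ((\<Sum>i. g (u * y i)) + ennreal m * ennreal (u powr \<alpha>)))" for u
      have [measurable]: "F \<in> borel_measurable borel" unfolding F_def[abs_def] by measurable
      have T: "0 < suminf y" by (rule regular_seqD(4)[OF elim])
      have "ennreal (1 - nexp (G x y)) = F ((1 / suminf y) * x)" for x
        unfolding F_def G_def normalize_seq_def by (simp add: mult_ac)
      then have "(\<integral>\<^sup>+x. ennreal (1 - nexp (G x y)) \<partial>?\<nu>) = (\<integral>\<^sup>+x. F ((1 / suminf y) * x) \<partial>?\<nu>)" by simp
      also have "\<dots> = ennreal ((1 / suminf y) powr \<beta>) * (\<integral>\<^sup>+u. F u \<partial>?\<nu>)"
        using T indices by (intro nn_integral_stable_intensity_scale) auto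
      also have "(1 / suminf y) powr \<beta> = suminf y powr (- \<beta>)"
        using T by (simp add: powr_divide powr_minus_divide)
      finally show ?case by (simp add: F_def)
    qed
  qed
  also have "\<dots> = (\<integral>\<^sup>+y. ennreal (suminf y powr \<beta>) * (ennreal (suminf y powr (- \<beta>)) * (\<integral>\<^sup>+u. ennreal (1 - nexp ((\<Sum>i. g (u * y i)) + ennreal m * ennreal (u powr \<alpha>))) \<partial>?\<nu>)) \<partial>\<mu>\<^sub>\<alpha>) / A.moment (- \<beta>)"
  proof (rule nn_integral_mark_law)
    have "(\<lambda>y. \<integral>\<^sup>+u. ennreal (1 - nexp ((\<Sum>i. g (u * y i)) + ennreal m * ennreal (u powr \<alpha>))) \<partial>?\<nu>) \<in> borel_measurable seq_space"
      by (rule B.\<nu>.borel_measurable_nn_integral)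
         (simp add: split_beta' cong: measurable_cong_sets sets_pair_measure_cong)
    then show "(\<lambda>y. ennreal (suminf y powr (- \<beta>)) * (\<integral>\<^sup>+u. ennreal (1 - nexp ((\<Sum>i. g (u * y i)) + ennreal m * ennreal (u powr \<alpha>))) \<partial>?\<nu>)) \<in> borel_measurable seq_space"
      by measurable
  qed
  \<comment> \<open>The density of the mark law cancels this factor, leaving untilted
    \<alpha>-stable points \<open>y\<close> and a product with the intensity of
    \<open>u\<close>.\<close>
  also have "(\<integral>\<^sup>+y. ennreal (suminf y powr \<beta>) * (ennreal (suminf y powr (- \<beta>)) * (\<integral>\<^sup>+u. ennreal (1 - nexp ((\<Sum>i. g (u * y i)) + ennreal m * ennreal (u powr \<alpha>))) \<partial>?\<nu>)) \<partial>\<mu>\<^sub>\<alpha>)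
     = (\<integral>\<^sup>+y. \<integral>\<^sup>+u. ennreal (1 - nexp ((\<Sum>i. g (u * y i)) + ennreal m * ennreal (u powr \<alpha>))) \<partial>?\<nu> \<partial>\<mu>\<^sub>\<alpha>)"
  proof (rule nn_integral_cong_AE, use A.AE_regular in eventually_elim)
    case (elim y)
    have "ennreal (suminf y powr \<beta>) * ennreal (suminf y powr (- \<beta>)) = 1"
      using regular_seqD(4)[OF elim] by (simp add: ennreal_mult[symmetric] powr_add[symmetric])
    then show ?case by (simp add: mult.assoc[symmetric])
  qed
  also have "\<dots> = (\<integral>\<^sup>+u. \<integral>\<^sup>+y. ennreal (1 - nexp ((\<Sum>i. g (u * y i)) + ennreal m * ennreal (u powr \<alpha>))) \<partial>\<mu>\<^sub>\<alpha> \<partial>?\<nu>)"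
    by (rule BA.Fubini') (simp add: pair_cong split_beta')
  \<comment> \<open>For fixed \<open>u\<close> the points \<open>u * y i\<close> have
    \<open>u powr \<alpha>\<close> times the \<alpha>-stable intensity:
    \<open>u powr \<alpha>\<close> acts as elapsed time of the subordinator.\<close>
  also have "\<dots> = (\<integral>\<^sup>+u. ennreal (1 - nexp (ennreal (u powr \<alpha>) * (\<Psi> + ennreal m))) \<partial>?\<nu>)"
  proof (rule nn_integral_cong_AE, use B.AE_intensity_pos in eventually_elim)
    case (elim u)
    let ?c = "nexp (ennreal m * ennreal (u powr \<alpha>))"
    have int: "integrable \<mu>\<^sub>\<alpha> (\<lambda>y. nexp (\<Sum>i. g (u * y i)) * ?c)"
      by (rule A.integrable_const_bound[where B = 1]) (auto simp: abs_mult intro!: mult_le_one)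
    have sc: "(\<integral>\<^sup>+z. ennreal (1 - nexp (g (u * z))) \<partial>stable_intensity \<alpha>) = ennreal (u powr \<alpha>) * \<Psi>"
      unfolding \<Psi>_def using elim indices by (intro nn_integral_stable_intensity_scale) auto
    have "ennreal (\<integral>y. nexp (\<Sum>i. g (u * y i)) \<partial>\<mu>\<^sub>\<alpha>) = (\<integral>\<^sup>+y. ennreal (nexp (\<Sum>i. g (u * y i))) \<partial>\<mu>\<^sub>\<alpha>)"
      by (rule nn_integral_eq_integral[symmetric]) (auto intro!: A.integrable_const_bound[where B = 1])
    also have "\<dots> = ennreal (nexp (ennreal (u powr \<alpha>) * \<Psi>))"
      unfolding sc[symmetric] by (rule A.laplace) simp
    finally have I: "(\<integral>y. nexp (\<Sum>i. g (u * y i)) \<partial>\<mu>\<^sub>\<alpha>) = nexp (ennreal (u powr \<alpha>) * \<Psi>)"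
      by (subst (asm) ennreal_inj) (auto intro!: integral_nonneg_AE)
    have "(\<integral>\<^sup>+y. ennreal (1 - nexp ((\<Sum>i. g (u * y i)) + ennreal m * ennreal (u powr \<alpha>))) \<partial>\<mu>\<^sub>\<alpha>)
      = (\<integral>\<^sup>+y. ennreal (1 - nexp (\<Sum>i. g (u * y i)) * ?c) \<partial>\<mu>\<^sub>\<alpha>)"
      by (simp add: nexp_add)
    also have "\<dots> = ennreal (\<integral>y. 1 - nexp (\<Sum>i. g (u * y i)) * ?c \<partial>\<mu>\<^sub>\<alpha>)"
      using int by (intro nn_integral_eq_integral) (auto intro!: mult_le_one)
    also have "(\<integral>y. 1 - nexp (\<Sum>i. g (u * y i)) * ?c \<partial>\<mu>\<^sub>\<alpha>) = 1 - nexp (ennreal (u powr \<alpha>) * \<Psi>) * ?c"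
      using int A.prob_space by (subst Bochner_Integration.integral_diff) (auto simp: I)
    also have "\<dots> = 1 - nexp (ennreal (u powr \<alpha>) * (\<Psi> + ennreal m))"
      by (simp add: nexp_add distrib_left mult.commute)
    finally show ?case .
  qed
  finally show ?thesis
    unfolding sum_eq bernstein_fn_def \<Psi>_def .
qed

end

section \<open>The exponent of the clock and its joint law with the fragments\<close>

lemma suminf_regular_mono_cmult:
  assumes "regular_seq x" "0 < c"
  shows "regular_seq (\<lambda>i. c * x i)" "suminf (\<lambda>i. c * x i) = c * suminf x" "normalize_seq (\<lambda>i. c * x i) = normalize_seq x"
proof -
  show 1: "regular_seq (\<lambda>i. c * x i)"
    using assms by (auto simp: regular_seq_def decseq_def intro: summable_mult)
  show 2: "suminf (\<lambda>i. c * x i) = c * suminf x"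
    using regular_seqD(3)[OF assms(1)] by (rule suminf_mult)
  show "normalize_seq (\<lambda>i. c * x i) = normalize_seq x"
    unfolding normalize_seq_def 2 using assms by auto
qed

context fragmentation
begin

lemma sum_frag_points:
  assumes "regular_seq (fst \<omega>)" "\<And>j. regular_seq (snd \<omega> j)"
  shows "(\<Sum>j. \<Sum>i. ennreal (frag_points \<omega> (j, i))) = ennreal (suminf (fst \<omega>))"
proof -
  have "(\<Sum>i. ennreal (frag_points \<omega> (j, i))) = ennreal (fst \<omega> j)" for j
  proof -
    have "(\<Sum>i. ennreal (frag_points \<omega> (j, i))) = ennreal (fst \<omega> j) * (\<Sum>i. ennreal (normalize_seq (snd \<omega> j) i))"
      using regular_seqD(1)[OF assms(1)]
      by (simp add: frag_points_def ennreal_mult' less_imp_le)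
    also have "(\<Sum>i. ennreal (normalize_seq (snd \<omega> j) i)) = ennreal 1"
      using regular_seqD(5)[OF normalize_seq_regular(1)[OF assms(2)[of j]]] normalize_seq_regular(2)[OF assms(2)[of j]] by simp
    finally show ?thesis by simp
  qed
  then show ?thesis using regular_seqD(5)[OF assms(1)] by simp
qed

lemma nn_integral_frag_points:
  "(\<integral>\<^sup>+k. f (frag_points \<omega> k) \<partial>count_space UNIV) = (\<Sum>j. \<Sum>i. f (frag_points \<omega> (j, i)))"
  by (simp add: nn_integral_fst_count_space[symmetric] nn_integral_count_space_nat)

text \<open>All fragments add up to the \<beta>-stable total, whose Laplace transform at 1 is
  \<open>exp (- 1)\<close>. Comparison with the marked functional for \<open>g y = y\<close> and
  \<open>m = 0\<close>, where the \<alpha>-stable exponent is 1, fixes the constant.\<close>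

lemma bernstein_fn_1: "bernstein_fn 1 = 1"
proof -
  have 1: "(\<integral>\<^sup>+y. ennreal (1 - nexp (ennreal y)) \<partial>stable_intensity \<alpha>) = 1"
  proof -
    have "(\<integral>\<^sup>+y. ennreal (1 - nexp (ennreal y)) \<partial>stable_intensity \<alpha>) = (\<integral>\<^sup>+y. ennreal (1 - exp (- (1 * y))) \<partial>stable_intensity \<alpha>)"
      by (rule nn_integral_cong_AE, use A.AE_intensity_pos in eventually_elim) simp
    then show ?thesis using nn_integral_stable_intensity_one_minus_exp[of \<alpha> 1] indices by simp
  qed
  have "ennreal (nexp (bernstein_fn 1)) = (\<integral>\<^sup>+\<omega>. ennreal (nexp ((\<Sum>j. \<Sum>i. ennreal (frag_points \<omega> (j, i))) + ennreal 0 * clock \<omega>)) \<partial>marked)"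
    by (subst marked_laplace) (simp_all add: 1)
  also have "\<dots> = (\<integral>\<^sup>+\<omega>. ennreal (nexp (ennreal (suminf (fst \<omega>)))) \<partial>marked)"
    by (rule nn_integral_cong_AE, use AE_marked in eventually_elim) (simp add: sum_frag_points)
  also have "\<dots> = (\<integral>\<^sup>+x. ennreal (nexp (ennreal (suminf x))) \<partial>\<mu>\<^sub>\<beta>)"
    unfolding marked_def
    by (subst marks.nn_integral_fst[symmetric]) (simp_all add: marks.emeasure_space_1[simplified] flip: marked_def)
  also have "\<dots> = (\<integral>\<^sup>+x. ennreal (exp (- (1 * suminf x))) \<partial>\<mu>\<^sub>\<beta>)"
    by (rule nn_integral_cong_AE, use B.AE_regular in eventually_elim) (simp add: regular_seqD(4) less_imp_le)
  also have "\<dots> = ennreal (nexp 1)"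
    using B.laplace_suminf[of 1] nexp_ennreal[of 1] by simp
  finally have "nexp (bernstein_fn 1) = nexp 1" by simp
  then show ?thesis by (rule nexp_inj)
qed

text \<open>Scaling \<open>u\<close> by \<open>z powr (1 / \<alpha>)\<close> absorbs
  \<open>z\<close> into the power \<alpha>, and self-similarity returns the factor
  \<open>z powr (\<beta> / \<alpha>)\<close>.\<close>

lemma bernstein_fn_ennreal:
  assumes "0 \<le> z"
  shows "bernstein_fn (ennreal z) = ennreal (z powr (\<beta> / \<alpha>))"
proof (cases "z = 0")
  case False
  then have z: "0 < z" using assms by simp
  define c where "c = z powr (1 / \<alpha>)"
  have c: "0 < c" using z by (simp add: c_def)
  have "(\<integral>\<^sup>+u. ennreal (1 - nexp (ennreal (u powr \<alpha>) * ennreal z)) \<partial>stable_intensity \<beta>)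
      = (\<integral>\<^sup>+u. ennreal (1 - nexp (ennreal ((c * u) powr \<alpha>) * 1)) \<partial>stable_intensity \<beta>)"
  proof (rule nn_integral_cong_AE, use B.AE_intensity_pos in eventually_elim)
    case (elim u)
    have "(c * u) powr \<alpha> = u powr \<alpha> * z"
      using elim z indices by (simp add: c_def powr_mult powr_powr)
    then show ?case using z by (simp add: ennreal_mult)
  qed
  also have "\<dots> = ennreal (c powr \<beta>) * (\<integral>\<^sup>+u. ennreal (1 - nexp (ennreal (u powr \<alpha>) * 1)) \<partial>stable_intensity \<beta>)"
    using indices c by (intro nn_integral_stable_intensity_scale) auto
  finally have "bernstein_fn (ennreal z) = ennreal (c powr \<beta>) * bernstein_fn 1"
    by (simp add: bernstein_fn_def ennreal_times_divide)
  then show ?thesis by (simp add: bernstein_fn_1 c_def powr_powr)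
qed (simp add: bernstein_fn_def)

lemma clock_laplace:
  assumes "0 \<le> s"
  shows "(\<integral>\<^sup>+\<omega>. ennreal (nexp (ennreal s * clock \<omega>)) \<partial>marked) = ennreal (exp (- (s powr (\<beta> / \<alpha>))))"
  using marked_laplace[of "\<lambda>_. 0" s] assms by (simp add: bernstein_fn_ennreal)

text \<open>Finiteness comes from the Laplace transform at small arguments, as for the stable total;
  positivity comes from the first term.\<close>

lemma AE_clock: "AE \<omega> in marked. 0 < clock \<omega> \<and> clock \<omega> < \<top>"
proof -
  let ?S = "{\<omega> \<in> space marked. clock \<omega> < \<top>}"
  have [measurable]: "?S \<in> sets marked" by measurable
  have "exp (- (a powr (\<beta> / \<alpha>))) \<le> marked.prob ?S" if a: "0 < a" for a
  proof -
    have "ennreal (exp (- (a powr (\<beta> / \<alpha>)))) \<le> (\<integral>\<^sup>+x. indicator ?S x \<partial>marked)"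
      unfolding clock_laplace[OF less_imp_le[OF a], symmetric]
      using a by (intro nn_integral_mono) (auto simp: indicator_def ennreal_le_1 ennreal_mult_top not_less top_unique)
    also have "\<dots> = emeasure marked ?S" by (rule nn_integral_indicator) fact
    finally show ?thesis by (simp add: marked.emeasure_eq_measure)
  qed
  moreover have "((\<lambda>a. exp (- (a powr (\<beta> / \<alpha>)))) \<longlongrightarrow> exp (- (0 powr (\<beta> / \<alpha>)))) (at_right 0)"
    using indices by (intro tendsto_intros tendsto_powr'[of _ 0]) (auto intro: eventually_at_right_less eventually_mono simp: eventually_at_right_field)
  ultimately have "1 \<le> marked.prob ?S"
    by (intro tendsto_upperbound[of _ _ "at_right 0"]) (auto intro: eventually_mono[OF eventually_at_right_less])
  then have "marked.prob ?S = 1" using marked.prob_le_1[of ?S] by linarith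
  then have "AE \<omega> in marked. clock \<omega> < \<top>"
    using marked.AE_prob_1[of ?S] by simp
  then show ?thesis using AE_marked
  proof eventually_elim
    case (elim \<omega>)
    define u where "u j = ennreal ((fst \<omega> j / suminf (snd \<omega> j)) powr \<alpha>)" for j
    have "clock \<omega> = (\<Sum>j. u (j + 1)) + (\<Sum>j<1. u j)"
      unfolding clock_def u_def[symmetric] by (rule suminf_offset) simp
    moreover have "0 < fst \<omega> 0" "0 < suminf (snd \<omega> 0)"
      using elim by (simp_all add: regular_seqD)
    then have "0 < u 0" by (simp add: u_def)
    ultimately have "0 < clock \<omega>" by (simp add: add_nonneg_pos)
    then show ?case using elim by simp
  qed
qed

definition time :: "(nat \<Rightarrow> real) \<times> (nat \<Rightarrow> nat \<Rightarrow> real) \<Rightarrow> real" where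
  "time \<omega> = enn2real (clock \<omega>)"

lemma time_measurable [measurable]: "time \<in> borel_measurable (seq_space \<Otimes>\<^sub>M PiM UNIV (\<lambda>_::nat. seq_space))"
  unfolding time_def[abs_def] by measurable

lemma AE_time: "AE \<omega> in marked. 0 < time \<omega> \<and> clock \<omega> = ennreal (time \<omega>)"
  using AE_clock by eventually_elim (auto simp: time_def enn2real_positive_iff)

lemma time_laplace:
  assumes "0 \<le> s"
  shows "(\<integral>\<^sup>+\<omega>. ennreal (exp (- (s * time \<omega>))) \<partial>marked) = ennreal (exp (- (s powr (\<beta> / \<alpha>))))"
  unfolding clock_laplace[OF assms, symmetric]
  by (rule nn_integral_cong_AE, use AE_time in eventually_elim)
     (use assms in \<open>auto simp: ennreal_mult[symmetric]\<close>)

text \<open>Given the time, \<alpha>-stable points scaled by its power \<open>1 / \<alpha>\<close>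
  have the \<alpha>-stable intensity multiplied by the time. Both sides therefore have the transform
  \<open>exp (- ((r + m) powr (\<beta> / \<alpha>)))\<close>, where \<open>r\<close> is the
  \<alpha>-stable exponent of \<open>g\<close> and \<open>m\<close> is the power of
  \<open>nexp (clock \<omega>)\<close>.\<close>

lemma joint_law:
  "distr marked (borel \<Otimes>\<^sub>M seq_space) (\<lambda>\<omega>. (nexp (clock \<omega>), ranked (frag_points \<omega>)))
   = distr (marked \<Otimes>\<^sub>M \<mu>\<^sub>\<alpha>) (borel \<Otimes>\<^sub>M seq_space)
       (\<lambda>z. (nexp (clock (fst z)), ranked (\<lambda>i. time (fst z) powr (1 / \<alpha>) * snd z i)))"
proof (rule ranked_law_eqI)
  interpret P: pair_prob_space marked \<mu>\<^sub>\<alpha> ..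
  have pcong: "measurable (marked \<Otimes>\<^sub>M \<mu>\<^sub>\<alpha>) N = measurable ((seq_space \<Otimes>\<^sub>M PiM UNIV (\<lambda>_. seq_space)) \<Otimes>\<^sub>M seq_space) N" for N :: "'z measure"
    by (intro measurable_cong_sets sets_pair_measure_cong) auto
  show "finite_measure marked" by unfold_locales
  show "finite_measure (marked \<Otimes>\<^sub>M \<mu>\<^sub>\<alpha>)" by unfold_locales
  show "(\<lambda>\<omega>. frag_points \<omega> i) \<in> borel_measurable marked" for i by simp
  show "(\<lambda>z. time (fst z) powr (1 / \<alpha>) * snd z i) \<in> borel_measurable (marked \<Otimes>\<^sub>M \<mu>\<^sub>\<alpha>)" for i
    unfolding pcong by measurable
  show "(\<lambda>z. nexp (clock (fst z))) \<in> borel_measurable (marked \<Otimes>\<^sub>M \<mu>\<^sub>\<alpha>)"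
    unfolding pcong by measurable
  show "AE \<omega> in marked. tame (frag_points \<omega>)"
    using AE_marked
  proof eventually_elim
    case (elim \<omega>)
    have "0 \<le> frag_points \<omega> k" for k
      using elim regular_seqD(1)[of "fst \<omega>"] regular_seqD(1)[OF normalize_seq_regular(1)[of "snd \<omega> (fst k)"]]
      by (auto simp: frag_points_def intro!: mult_nonneg_nonneg less_imp_le)
    moreover have "(\<integral>\<^sup>+k. ennreal (frag_points \<omega> k) \<partial>count_space UNIV) < \<top>"
      using nn_integral_frag_points[of ennreal \<omega>] sum_frag_points[of \<omega>] elim by simp
    ultimately show ?case by (intro tameI_sum) (simp_all add: finite_prod)
  qed
  show "AE z in marked \<Otimes>\<^sub>M \<mu>\<^sub>\<alpha>. tame (\<lambda>i. time (fst z) powr (1 / \<alpha>) * snd z i)"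
  proof -
    have "AE z in marked \<Otimes>\<^sub>M \<mu>\<^sub>\<alpha>. regular_seq (snd z) \<and> 0 < time (fst z)"
    proof (rule P.AE_pair_measure)
      have "{z \<in> space ((seq_space \<Otimes>\<^sub>M PiM UNIV (\<lambda>_. seq_space)) \<Otimes>\<^sub>M seq_space). regular_seq (snd z) \<and> 0 < time (fst z)}
         \<in> sets ((seq_space \<Otimes>\<^sub>M PiM UNIV (\<lambda>_::nat. seq_space)) \<Otimes>\<^sub>M seq_space)" by measurable
      then show "{z \<in> space (marked \<Otimes>\<^sub>M \<mu>\<^sub>\<alpha>). regular_seq (snd z) \<and> 0 < time (fst z)} \<in> sets (marked \<Otimes>\<^sub>M \<mu>\<^sub>\<alpha>)"
        by (simp add: space_pair_measure space_PiM sets_pair_measure_cong[OF sets_marked A.sets_\<mu>])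
      show "AE \<omega> in marked. AE x in \<mu>\<^sub>\<alpha>. regular_seq (snd (\<omega>, x)) \<and> 0 < time (fst (\<omega>, x))"
        using AE_time by eventually_elim (use A.AE_regular in \<open>auto elim!: eventually_mono\<close>)
    qed
    then show ?thesis
      by eventually_elim (auto intro!: regular_seqD(6) suminf_regular_mono_cmult)
  qed
  show "infinite (UNIV :: (nat \<times> nat) set)" "infinite (UNIV :: nat set)" by (simp_all add: finite_prod)
  fix g :: "real \<Rightarrow> real" and m :: nat and s
  assume g [measurable]: "g \<in> borel_measurable borel" and g': "\<And>x. 0 \<le> g x" "0 < s" "\<And>x. x < s \<Longrightarrow> g x = 0"
  \<comment> \<open>\<open>g\<close> vanishes below \<open>s\<close>, so its exponent is at most the
    finite intensity of \<open>{s..}\<close>.\<close>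
  define \<Psi> where "\<Psi> = (\<integral>\<^sup>+y. ennreal (1 - nexp (ennreal (g y))) \<partial>stable_intensity \<alpha>)"
  have "\<Psi> \<le> (\<integral>\<^sup>+y. indicator {s..} y \<partial>stable_intensity \<alpha>)"
    unfolding \<Psi>_def using g' by (intro nn_integral_mono) (auto simp: indicator_def ennreal_le_1)
  also have "\<dots> < \<top>" using emeasure_stable_intensity_atLeast[of \<alpha> s] indices g'(2) by simp
  finally obtain r where r: "\<Psi> = ennreal r" "0 \<le> r" by (cases \<Psi>) auto
  have "(\<integral>\<^sup>+\<omega>. ennreal (nexp (clock \<omega>)) ^ m * ennreal (nexp (\<integral>\<^sup>+i. ennreal (g (frag_points \<omega> i)) \<partial>count_space UNIV)) \<partial>marked)
    = (\<integral>\<^sup>+\<omega>. ennreal (nexp ((\<Sum>j. \<Sum>i. ennreal (g (frag_points \<omega> (j, i)))) + ennreal m * clock \<omega>)) \<partial>marked)"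
    by (intro nn_integral_cong)
       (simp add: nn_integral_frag_points[of "\<lambda>z. ennreal (g z)"] nexp_add nexp_mult_of_nat ennreal_power ennreal_mult mult.commute flip: ennreal_of_nat_eq_real_of_nat)
  also have "\<dots> = ennreal (exp (- ((r + m) powr (\<beta> / \<alpha>))))"
    using r by (subst marked_laplace) (auto simp: \<Psi>_def[symmetric] bernstein_fn_ennreal simp flip: ennreal_plus)
  also have "\<dots> = (\<integral>\<^sup>+\<omega>. ennreal (exp (- ((r + m) * time \<omega>))) \<partial>marked)"
    using r by (intro time_laplace[symmetric]) auto
  also have "\<dots> = (\<integral>\<^sup>+\<omega>. \<integral>\<^sup>+x. ennreal (nexp (clock \<omega>)) ^ m * ennreal (nexp (\<integral>\<^sup>+i. ennreal (g (time \<omega> powr (1 / \<alpha>) * x i)) \<partial>count_space UNIV)) \<partial>\<mu>\<^sub>\<alpha> \<partial>marked)"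
  proof (rule nn_integral_cong_AE, use AE_time in eventually_elim)
    case (elim \<omega>)
    let ?c = "time \<omega> powr (1 / \<alpha>)"
    have c: "0 < ?c" "?c powr \<alpha> = time \<omega>" using elim indices by (auto simp: powr_powr)
    have "(\<integral>\<^sup>+x. ennreal (nexp (\<integral>\<^sup>+i. ennreal (g (?c * x i)) \<partial>count_space UNIV)) \<partial>\<mu>\<^sub>\<alpha>)
      = ennreal (nexp (\<integral>\<^sup>+y. ennreal (1 - nexp (ennreal (g (?c * y)))) \<partial>stable_intensity \<alpha>))"
      unfolding nn_integral_count_space_nat by (rule A.laplace) simp
    also have "(\<integral>\<^sup>+y. ennreal (1 - nexp (ennreal (g (?c * y)))) \<partial>stable_intensity \<alpha>) = ennreal (?c powr \<alpha>) * \<Psi>"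
      unfolding \<Psi>_def using c indices by (intro nn_integral_stable_intensity_scale) auto
    also have "ennreal (nexp \<dots>) = ennreal (exp (- (r * time \<omega>)))"
      using elim r by (simp add: c(2) ennreal_mult[symmetric] mult.commute)
    finally have "(\<integral>\<^sup>+x. ennreal (nexp (clock \<omega>)) ^ m * ennreal (nexp (\<integral>\<^sup>+i. ennreal (g (?c * x i)) \<partial>count_space UNIV)) \<partial>\<mu>\<^sub>\<alpha>)
      = ennreal (nexp (clock \<omega>)) ^ m * ennreal (exp (- (r * time \<omega>)))"
      by (subst nn_integral_cmult) auto
    also have "\<dots> = ennreal (exp (- ((r + m) * time \<omega>)))"
      using elim by (simp add: ennreal_power ennreal_mult[symmetric] exp_of_nat_mult[symmetric] exp_add[symmetric] algebra_simps)
    finally show ?case ..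
  qed
  also have "\<dots> = (\<integral>\<^sup>+z. ennreal (nexp (clock (fst z))) ^ m * ennreal (nexp (\<integral>\<^sup>+i. ennreal (g (time (fst z) powr (1 / \<alpha>) * snd z i)) \<partial>count_space UNIV)) \<partial>(marked \<Otimes>\<^sub>M \<mu>\<^sub>\<alpha>))"
    by (subst A.nn_integral_fst[symmetric]) (simp_all add: pcong)
  finally show "(\<integral>\<^sup>+\<omega>. ennreal (nexp (clock \<omega>)) ^ m * ennreal (nexp (\<integral>\<^sup>+i. ennreal (g (frag_points \<omega> i)) \<partial>count_space UNIV)) \<partial>marked)
    = (\<integral>\<^sup>+z. ennreal (nexp (clock (fst z))) ^ m * ennreal (nexp (\<integral>\<^sup>+j. ennreal (g (time (fst z) powr (1 / \<alpha>) * snd z j)) \<partial>count_space UNIV)) \<partial>(marked \<Otimes>\<^sub>M \<mu>\<^sub>\<alpha>))" .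
qed simp_all

section \<open>The local time as a ratio of clock and mass\<close>

definition local_time_sum :: "(nat \<Rightarrow> real) \<times> (nat \<Rightarrow> nat \<Rightarrow> real) \<Rightarrow> real" where
  "local_time_sum \<omega> = (\<Sum>j. normalize_seq (fst \<omega>) j powr \<alpha> * suminf (snd \<omega> j) powr (- \<alpha>))"

text \<open>Each term is a summand of the clock divided by the power \<alpha> of the \<beta>-stable
  total, so finiteness of the clock gives both summability and the value.\<close>

lemma AE_local_time_sum:
  "AE \<omega> in marked. summable (\<lambda>j. normalize_seq (fst \<omega>) j powr \<alpha> * suminf (snd \<omega> j) powr (- \<alpha>))
     \<and> local_time_sum \<omega> = time \<omega> / suminf (fst \<omega>) powr \<alpha>"
  using AE_marked AE_time
proof eventually_elim
  case (elim \<omega>)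
  let ?u = "\<lambda>j. (fst \<omega> j / suminf (snd \<omega> j)) powr \<alpha>" and ?S = "suminf (fst \<omega>)"
  have S: "0 < ?S" using elim regular_seqD(4) by auto
  have T: "0 < suminf (snd \<omega> j)" "0 < fst \<omega> j" for j using elim regular_seqD(4)[of "snd \<omega> j"] regular_seqD(1) by auto
  have sm: "summable ?u"
    using elim unfolding clock_def by (intro summable_suminf_not_top) auto
  have "ennreal (suminf ?u) = ennreal (time \<omega>)"
    using elim unfolding clock_def by (subst suminf_ennreal2[symmetric]) (auto simp: sm)
  then have time: "suminf ?u = time \<omega>"
    using elim by (subst (asm) ennreal_inj) (auto intro!: suminf_nonneg sm)
  have eq: "normalize_seq (fst \<omega>) j powr \<alpha> * suminf (snd \<omega> j) powr (- \<alpha>) = ?u j / ?S powr \<alpha>" for j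
    using S T[of j] by (simp add: normalize_seq_def powr_divide powr_minus_divide)
  show ?case
    unfolding local_time_sum_def eq using sm time by (simp add: summable_divide suminf_divide)
qed

text \<open>The common source of both parts of the result. The time cancels from the normalized
  fragments and from the local time; it survives only in the total mass, where it is averaged inside
  \<open>H\<close>.\<close>

theorem frag_local_time_law:
  fixes H :: "real \<Rightarrow> ennreal" and \<Phi> :: "(nat \<Rightarrow> real) \<times> real \<Rightarrow> ennreal"
  assumes [measurable]: "H \<in> borel_measurable borel" "\<Phi> \<in> borel_measurable (seq_space \<Otimes>\<^sub>M borel)"
  shows "(\<integral>\<^sup>+\<omega>. H (suminf (fst \<omega>)) * \<Phi> (frag (normalize_seq (fst \<omega>)) (\<lambda>j. normalize_seq (snd \<omega> j)), local_time_sum \<omega>) \<partial>marked)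
    = (\<integral>\<^sup>+x. (\<integral>\<^sup>+\<omega>. H (time \<omega> powr (1 / \<alpha>) * suminf x) \<partial>marked) * \<Phi> (normalize_seq x, suminf x powr (- \<alpha>)) \<partial>\<mu>\<^sub>\<alpha>)"
proof -
  interpret P: pair_prob_space marked \<mu>\<^sub>\<alpha> ..
  have pcong: "measurable (marked \<Otimes>\<^sub>M \<mu>\<^sub>\<alpha>) N = measurable ((seq_space \<Otimes>\<^sub>M PiM UNIV (\<lambda>_. seq_space)) \<Otimes>\<^sub>M seq_space) N" for N :: "'z measure"
    by (intro measurable_cong_sets sets_pair_measure_cong) auto
  \<comment> \<open>The clock enters the joint law as \<open>nexp (clock \<omega>)\<close>; minus
    its logarithm recovers the time, and division by the power \<alpha> of the total gives the local
    time.\<close>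
  define F where "F z = H (suminf (snd z)) * \<Phi> (normalize_seq (snd z), - ln (fst z) / suminf (snd z) powr \<alpha>)" for z :: "real \<times> (nat \<Rightarrow> real)"
  have [measurable]: "F \<in> borel_measurable (borel \<Otimes>\<^sub>M seq_space)" unfolding F_def[abs_def] by measurable
  have m1 [measurable]: "(\<lambda>\<omega>. ranked (frag_points \<omega>)) \<in> measurable (seq_space \<Otimes>\<^sub>M PiM UNIV (\<lambda>_::nat. seq_space)) seq_space"
    by (rule measurable_ranked) (simp_all add: finite_prod)
  have "(\<integral>\<^sup>+\<omega>. H (suminf (fst \<omega>)) * \<Phi> (frag (normalize_seq (fst \<omega>)) (\<lambda>j. normalize_seq (snd \<omega> j)), local_time_sum \<omega>) \<partial>marked)
    = (\<integral>\<^sup>+\<omega>. F (nexp (clock \<omega>), ranked (frag_points \<omega>)) \<partial>marked)"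
  proof (rule nn_integral_cong_AE, use AE_marked AE_time AE_local_time_sum in eventually_elim)
    case (elim \<omega>)
    let ?S = "suminf (fst \<omega>)"
    have S: "0 < ?S" using elim regular_seqD(4) by auto
    have nn: "0 \<le> frag_points \<omega> k" for k
      using elim regular_seqD(1)[of "fst \<omega>"] regular_seqD(1)[OF normalize_seq_regular(1)[of "snd \<omega> (fst k)"]]
      by (auto simp: frag_points_def intro!: mult_nonneg_nonneg less_imp_le)
    have sum: "(\<integral>\<^sup>+k. ennreal (frag_points \<omega> k) \<partial>count_space UNIV) = ennreal ?S"
      using nn_integral_frag_points[of ennreal \<omega>] sum_frag_points[of \<omega>] elim by simp
    then have t: "tame (frag_points \<omega>)"
      by (intro tameI_sum nn) (simp_all add: finite_prod)
    have "(\<Sum>n. ennreal (ranked (frag_points \<omega>) n)) = ennreal ?S"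
      using sum_ranked[OF t] sum by simp
    \<comment> \<open>Ranking preserves the sum, so the ranked fragments still carry the
      \<beta>-stable total.\<close>
    then have R: "suminf (ranked (frag_points \<omega>)) = ?S"
      using S ranked_nonneg[OF t]
      by (metis ennreal_inj ennreal_neq_top less_imp_le suminf_ennreal2 suminf_nonneg summable_suminf_not_top)
    have "normalize_seq (ranked (frag_points \<omega>)) = (\<lambda>i. (1 / ?S) * ranked (frag_points \<omega>) i)"
      unfolding normalize_seq_def R by simp
    also have "\<dots> = ranked (\<lambda>k. (1 / ?S) * frag_points \<omega> k)"
      using S by (intro ranked_scale[OF t, symmetric]) simp
    also have "\<dots> = frag (normalize_seq (fst \<omega>)) (\<lambda>j. normalize_seq (snd \<omega> j))"
      unfolding frag_def by (intro arg_cong[where f = ranked] ext) (auto simp: frag_points_def normalize_seq_def split: prod.split)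
    finally have N: "normalize_seq (ranked (frag_points \<omega>)) = frag (normalize_seq (fst \<omega>)) (\<lambda>j. normalize_seq (snd \<omega> j))" .
    show ?case
      unfolding F_def fst_conv snd_conv R N using elim by simp
  qed
  also have "\<dots> = (\<integral>\<^sup>+z. F z \<partial>distr marked (borel \<Otimes>\<^sub>M seq_space) (\<lambda>\<omega>. (nexp (clock \<omega>), ranked (frag_points \<omega>))))"
    by (subst nn_integral_distr) simp_all
  also have "\<dots> = (\<integral>\<^sup>+z. F (nexp (clock (fst z)), ranked (\<lambda>i. time (fst z) powr (1 / \<alpha>) * snd z i)) \<partial>(marked \<Otimes>\<^sub>M \<mu>\<^sub>\<alpha>))"
    unfolding joint_law by (subst nn_integral_distr) (simp_all add: pcong)
  also have "\<dots> = (\<integral>\<^sup>+x. \<integral>\<^sup>+\<omega>. F (nexp (clock \<omega>), ranked (\<lambda>i. time \<omega> powr (1 / \<alpha>) * x i)) \<partial>marked \<partial>\<mu>\<^sub>\<alpha>)"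
    by (subst P.nn_integral_snd[symmetric]) (simp_all add: pcong)
  also have "\<dots> = (\<integral>\<^sup>+x. \<integral>\<^sup>+\<omega>. H (time \<omega> powr (1 / \<alpha>) * suminf x) * \<Phi> (normalize_seq x, suminf x powr (- \<alpha>)) \<partial>marked \<partial>\<mu>\<^sub>\<alpha>)"
  proof (rule nn_integral_cong_AE, use A.AE_regular in eventually_elim)
    case (elim x)
    note x = \<open>regular_seq x\<close>
    show ?case
    proof (rule nn_integral_cong_AE, use AE_time in eventually_elim)
      case (elim \<omega>)
      let ?c = "time \<omega> powr (1 / \<alpha>)"
      have c: "0 < ?c" using elim by simp
      note s = suminf_regular_mono_cmult[OF x c]
      \<comment> \<open>Scaling by \<open>?c\<close> multiplies the power \<alpha> of the total by
        the time itself, so the ratio no longer depends on the time.\<close>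
      have "(?c * suminf x) powr \<alpha> = time \<omega> * suminf x powr \<alpha>"
        using elim regular_seqD(4)[OF x] indices by (simp add: powr_mult powr_powr)
      then have "time \<omega> / (?c * suminf x) powr \<alpha> = suminf x powr (- \<alpha>)"
        using elim by (simp add: powr_minus divide_inverse)
      then show ?case
        unfolding F_def fst_conv snd_conv regular_seqD(7)[OF s(1)] s(2,3) using elim by simp
    qed
  qed
  also have "\<dots> = (\<integral>\<^sup>+x. (\<integral>\<^sup>+\<omega>. H (time \<omega> powr (1 / \<alpha>) * suminf x) \<partial>marked) * \<Phi> (normalize_seq x, suminf x powr (- \<alpha>)) \<partial>\<mu>\<^sub>\<alpha>)"
    by (simp add: nn_integral_multc)
  finally show ?thesis .
qed

end

section \<open>Small stable points\<close>

text \<open>Between consecutive members of the sequence the decreasing \<open>N\<close> is enclosed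
  by its values there, and exchanging the factor \<open>s powr \<alpha>\<close> costs only a power
  of their ratio, which tends to 1.\<close>

lemma regular_variation_from_sequence:
  fixes N :: "real \<Rightarrow> real" and a :: "nat \<Rightarrow> real"
  assumes N: "\<And>s t. 0 < s \<Longrightarrow> s \<le> t \<Longrightarrow> N t \<le> N s" "\<And>s. 0 < s \<Longrightarrow> 0 \<le> N s"
    and a: "\<And>k. 0 < a k" "decseq a" "a \<longlonglongrightarrow> 0" and ratio: "(\<lambda>k. a (Suc k) / a k) \<longlonglongrightarrow> 1"
    and lim: "(\<lambda>k. a k powr \<alpha> * N (a k)) \<longlonglongrightarrow> c" and \<alpha>: "0 \<le> \<alpha>"
  shows "((\<lambda>s. s powr \<alpha> * N s) \<longlongrightarrow> c) (at_right 0)"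
proof -
  define \<rho> where "\<rho> k = (a (Suc k) / a k) powr \<alpha>" for k
  define u where "u k = a k powr \<alpha> * N (a k)" for k
  have \<rho>: "\<rho> \<longlonglongrightarrow> 1" "0 < \<rho> k" for k
  proof -
    have "\<rho> \<longlonglongrightarrow> 1 powr \<alpha>" unfolding \<rho>_def using ratio by (intro tendsto_powr) auto
    then show "\<rho> \<longlonglongrightarrow> 1" by simp
    show "0 < \<rho> k" using a(1)[of k] a(1)[of "Suc k"] by (simp add: \<rho>_def)
  qed
  have u: "u \<longlonglongrightarrow> c" using lim by (simp add: u_def[abs_def])
  have 1: "(\<lambda>k. \<rho> k * u k) \<longlonglongrightarrow> 1 * c" by (intro tendsto_mult \<rho> u)
  have 2: "(\<lambda>k. u (Suc k) / \<rho> k) \<longlonglongrightarrow> c / 1" by (intro tendsto_divide \<rho> LIMSEQ_Suc[OF u]) simp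
  have bnd: "\<exists>k. K < k \<and> \<rho> k * u k \<le> s powr \<alpha> * N s \<and> s powr \<alpha> * N s \<le> u (Suc k) / \<rho> k"
    if s: "0 < s" "s < a (Suc K)" for s K
  proof -
    have "\<exists>k. a (Suc k) \<le> s"
    proof -
      have "eventually (\<lambda>k. a (Suc k) < s) sequentially"
        using LIMSEQ_Suc[OF a(3)] s(1) by (rule order_tendstoD)
      then show ?thesis by (auto simp: eventually_sequentially intro: less_imp_le)
    qed
    \<comment> \<open>The first index with \<open>a (k + 1) \<le> s\<close>, so that
      \<open>s\<close> lies between \<open>a (k + 1)\<close> and \<open>a k\<close>. The bound on
      \<open>s\<close> forces \<open>k > K\<close>, which also excludes the boundary case
      \<open>k = 0\<close>.\<close>
    define k where "k = (LEAST k. a (Suc k) \<le> s)"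
    have k1: "a (Suc k) \<le> s" unfolding k_def by (rule LeastI_ex) fact
    have Kk: "K < k"
    proof (rule ccontr)
      assume "\<not> K < k"
      then have "a (Suc K) \<le> a (Suc k)" using a(2) by (auto simp: decseq_def)
      then show False using k1 s by linarith
    qed
    have k2: "s \<le> a k"
    proof -
      have "\<not> a (Suc (k - 1)) \<le> s"
        unfolding k_def by (rule not_less_Least) (use Kk in \<open>simp add: k_def\<close>)
      then show ?thesis using Kk by simp
    qed
    have "\<rho> k * u k = a (Suc k) powr \<alpha> * N (a k)"
      using a(1)[of k] a(1)[of "Suc k"] by (simp add: \<rho>_def u_def powr_divide)
    also have "\<dots> \<le> s powr \<alpha> * N s"
      using k1 k2 s(1) \<alpha> a(1)[of k] a(1)[of "Suc k"] N by (intro mult_mono powr_mono2) (auto intro: less_imp_le)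
    finally have A: "\<rho> k * u k \<le> s powr \<alpha> * N s" .
    have "s powr \<alpha> * N s \<le> a k powr \<alpha> * N (a (Suc k))"
      using k1 k2 s(1) \<alpha> a(1)[of k] a(1)[of "Suc k"] N by (intro mult_mono powr_mono2) (auto intro: less_imp_le)
    also have "\<dots> = u (Suc k) / \<rho> k"
      using a(1)[of k] a(1)[of "Suc k"] by (simp add: \<rho>_def u_def powr_divide)
    finally show ?thesis using A Kk by blast
  qed
  show ?thesis
  proof (rule order_tendstoI)
    fix l assume "l < c"
    then have "eventually (\<lambda>k. l < \<rho> k * u k) sequentially" using order_tendstoD(1)[OF 1, of l] by simp
    then obtain K where K: "\<And>k. K \<le> k \<Longrightarrow> l < \<rho> k * u k" by (auto simp: eventually_sequentially)
    have "l < s powr \<alpha> * N s" if "0 < s" "s < a (Suc K)" for s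
      using bnd[OF that] K by (meson less_imp_le less_le_trans)
    then show "eventually (\<lambda>s. l < s powr \<alpha> * N s) (at_right 0)"
      using a(1)[of "Suc K"] by (auto simp: eventually_at_right_field)
  next
    fix l assume "c < l"
    then have "eventually (\<lambda>k. u (Suc k) / \<rho> k < l) sequentially" using order_tendstoD(2)[OF 2, of l] by simp
    then obtain K where K: "\<And>k. K \<le> k \<Longrightarrow> u (Suc k) / \<rho> k < l" by (auto simp: eventually_sequentially)
    have "s powr \<alpha> * N s < l" if "0 < s" "s < a (Suc K)" for s
      using bnd[OF that] K by (meson less_imp_le le_less_trans)
    then show "eventually (\<lambda>s. s powr \<alpha> * N s < l) (at_right 0)"
      using a(1)[of "Suc K"] by (auto simp: eventually_at_right_field)
  qed
qed

text \<open>Summable second moments make the series of squares finite almost everywhere, so its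
  terms tend to 0.\<close>

lemma AE_tendsto_0_of_square_summable:
  fixes X :: "nat \<Rightarrow> 'a \<Rightarrow> real"
  assumes [measurable]: "\<And>n. X n \<in> borel_measurable M"
    and fin: "(\<Sum>n. \<integral>\<^sup>+\<omega>. ennreal ((X n \<omega>)\<^sup>2) \<partial>M) < \<top>"
  shows "AE \<omega> in M. (\<lambda>n. X n \<omega>) \<longlonglongrightarrow> 0"
proof -
  have "(\<integral>\<^sup>+\<omega>. (\<Sum>n. ennreal ((X n \<omega>)\<^sup>2)) \<partial>M) < \<top>"
    using fin by (subst nn_integral_suminf) auto
  then have "AE \<omega> in M. (\<Sum>n. ennreal ((X n \<omega>)\<^sup>2)) \<noteq> \<infinity>"
    by (intro nn_integral_PInf_AE) auto
  then show ?thesis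
  proof eventually_elim
    case (elim \<omega>)
    then have "summable (\<lambda>n. (X n \<omega>)\<^sup>2)" by (intro summable_suminf_not_top) auto
    then have "(\<lambda>n. (X n \<omega>)\<^sup>2) \<longlonglongrightarrow> 0" by (rule summable_LIMSEQ_zero)
    then have "(\<lambda>n. sqrt ((X n \<omega>)\<^sup>2)) \<longlonglongrightarrow> sqrt 0" by (rule tendsto_real_sqrt)
    then show ?case by (simp add: tendsto_rabs_zero_iff)
  qed
qed

definition tail_count :: "(nat \<Rightarrow> real) \<Rightarrow> real \<Rightarrow> real" where
  "tail_count x s = enn2real (point_count x {s..})"

lemma tail_count_nonneg: "0 \<le> tail_count x s"
  by (simp add: tail_count_def)

lemma tail_count_antimono: "tame x \<Longrightarrow> 0 < s \<Longrightarrow> s \<le> t \<Longrightarrow> tail_count x t \<le> tail_count x s"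
  unfolding tail_count_def by (intro enn2real_mono point_count_mono tameD) auto

lemma point_count_eq_tail_count: "tame x \<Longrightarrow> 0 < s \<Longrightarrow> point_count x {s..} = ennreal (tail_count x s)"
  unfolding tail_count_def using tameD(2)[of x s] by simp

lemma tail_count_measurable [measurable]: "(\<lambda>x. tail_count x s) \<in> borel_measurable seq_space"
  unfolding tail_count_def by (intro borel_measurable_enn2real point_count_measurable) auto

text \<open>A strong law for the counts, obtained from the Laplace functional alone: along levels of
  intensity \<open>(k + 1)^2\<close> the bounded variables \<open>exp (- count / (k + 1)^2)\<close>
  have summable mean square distance from \<open>exp (- 1)\<close>. Monotonicity of the count fills
  the gaps between the levels.\<close>

lemma (in stable_law) AE_tail_count:
  "AE x in \<mu>. ((\<lambda>s. s powr \<gamma> * tail_count x s) \<longlongrightarrow> 1 / Gamma (1 - \<gamma>)) (at_right 0)"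
proof -
  define C where "C = 1 / Gamma (1 - \<gamma>)"
  have C: "0 < C" using index by (simp add: C_def Gamma_real_pos)
  \<comment> \<open>Levels at which the tail of the intensity is exactly \<open>(k + 1)^2\<close>;
    their consecutive ratios tend to 1.\<close>
  define a where "a k = (C / (real (Suc k))\<^sup>2) powr (1 / \<gamma>)" for k
  have a: "0 < a k" "a k powr \<gamma> = C / (real (Suc k))\<^sup>2" for k
    using C index by (auto simp: a_def powr_powr)
  have \<nu>a: "emeasure (stable_intensity \<gamma>) {a k..} = ennreal ((real (Suc k))\<^sup>2)" for k
  proof -
    have "a k powr (- \<gamma>) / Gamma (1 - \<gamma>) = (real (Suc k))\<^sup>2"
      using C by (simp add: powr_minus_divide a(2)) (simp add: C_def)
    then show ?thesis by (simp add: emeasure_stable_intensity_atLeast[OF index a(1)])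
  qed
  define Z where "Z k x = nexp (ennreal (1 / (real (Suc k))\<^sup>2) * point_count x {a k..})" for k and x :: "nat \<Rightarrow> real"
  have [measurable]: "Z k \<in> borel_measurable seq_space" for k unfolding Z_def[abs_def] by measurable
  have Zmom: "(\<integral>x. Z k x ^ i \<partial>\<mu>) = exp (- ((real (Suc k))\<^sup>2 * (1 - exp (- (real i / (real (Suc k))\<^sup>2)))))" for k i
  proof -
    let ?r = "real i / (real (Suc k))\<^sup>2"
    have "Z k x ^ i = nexp (\<Sum>j. ennreal ?r * indicator {a k..} (x j))" for x
    proof -
      have "Z k x ^ i = nexp (of_nat i * (ennreal (1 / (real (Suc k))\<^sup>2) * point_count x {a k..}))"
        unfolding Z_def by (rule nexp_mult_of_nat[symmetric])
      also have "of_nat i * (ennreal (1 / (real (Suc k))\<^sup>2) * point_count x {a k..}) = ennreal ?r * point_count x {a k..}"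
        by (simp add: mult.assoc[symmetric] ennreal_of_nat_eq_real_of_nat ennreal_mult[symmetric])
      also have "\<dots> = (\<Sum>j. ennreal ?r * indicator {a k..} (x j))"
        by (simp add: point_count_nn_integral nn_integral_count_space_nat)
      finally show ?thesis .
    qed
    then have "ennreal (\<integral>x. Z k x ^ i \<partial>\<mu>) = (\<integral>\<^sup>+x. ennreal (nexp (\<Sum>j. ennreal ?r * indicator {a k..} (x j))) \<partial>\<mu>)"
      by (subst nn_integral_eq_integral[symmetric]) (auto intro!: integrable_const_bound[where B = 1])
    also have "\<dots> = ennreal (nexp (\<integral>\<^sup>+y. ennreal (1 - nexp (ennreal ?r * indicator {a k..} y)) \<partial>stable_intensity \<gamma>))"
      by (rule laplace) simp
    also have "(\<integral>\<^sup>+y. ennreal (1 - nexp (ennreal ?r * indicator {a k..} y)) \<partial>stable_intensity \<gamma>)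
        = (\<integral>\<^sup>+y. ennreal (1 - exp (- ?r)) * indicator {a k..} y \<partial>stable_intensity \<gamma>)"
      by (intro nn_integral_cong) (auto simp: indicator_def)
    also have "\<dots> = ennreal ((real (Suc k))\<^sup>2 * (1 - exp (- ?r)))"
      by (subst nn_integral_cmult_indicator) (simp_all add: \<nu>a ennreal_mult mult.commute del: of_nat_Suc)
    finally show ?thesis
      by (subst (asm) nexp_ennreal) (auto simp: Z_def integral_nonneg_AE)
  qed
  define v where "v k = exp (- ((real (Suc k))\<^sup>2 * (1 - exp (- (2 / (real (Suc k))\<^sup>2)))))
      - 2 * exp (- 1) * exp (- ((real (Suc k))\<^sup>2 * (1 - exp (- (1 / (real (Suc k))\<^sup>2))))) + (exp (- 1))\<^sup>2" for k
  have v: "(\<integral>\<^sup>+x. ennreal ((Z k x - exp (- 1))\<^sup>2) \<partial>\<mu>) = ennreal (v k)" for k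
  proof -
    have int: "integrable \<mu> (\<lambda>x. Z k x ^ i)" for i
      by (rule integrable_const_bound[where B = 1]) (auto simp: Z_def intro!: power_le_one)
    have "(\<integral>\<^sup>+x. ennreal ((Z k x - exp (- 1))\<^sup>2) \<partial>\<mu>) = (\<integral>\<^sup>+x. ennreal (Z k x ^ 2 - 2 * exp (- 1) * Z k x ^ 1 + (exp (- 1))\<^sup>2) \<partial>\<mu>)"
      by (intro nn_integral_cong) (simp add: power2_diff algebra_simps)
    also have "\<dots> = ennreal (\<integral>x. Z k x ^ 2 - 2 * exp (- 1) * Z k x ^ 1 + (exp (- 1))\<^sup>2 \<partial>\<mu>)"
    proof (rule nn_integral_eq_integral)
      show "integrable \<mu> (\<lambda>x. Z k x ^ 2 - 2 * exp (- 1) * Z k x ^ 1 + (exp (- 1))\<^sup>2)"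
        by (intro Bochner_Integration.integrable_add Bochner_Integration.integrable_diff integrable_mult_right int) simp
      have "Z k x ^ 2 - 2 * exp (- 1) * Z k x ^ 1 + (exp (- 1))\<^sup>2 = (Z k x - exp (- 1))\<^sup>2" for x
        by (simp add: power2_diff algebra_simps)
      then show "AE x in \<mu>. 0 \<le> Z k x ^ 2 - 2 * exp (- 1) * Z k x ^ 1 + (exp (- 1))\<^sup>2" by simp
    qed
    also have "(\<integral>x. Z k x ^ 2 - 2 * exp (- 1) * Z k x ^ 1 + (exp (- 1))\<^sup>2 \<partial>\<mu>)
      = (\<integral>x. Z k x ^ 2 \<partial>\<mu>) - 2 * exp (- 1) * (\<integral>x. Z k x ^ 1 \<partial>\<mu>) + (exp (- 1))\<^sup>2"
      using int[of 2] int[of 1] prob_space by simp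
    also have "\<dots> = v k" unfolding Zmom v_def by simp
    finally show ?thesis .
  qed
  \<comment> \<open>With \<open>exp (- 2)\<close> factored out both exponents tend to 0 and the
    constant terms \<open>1 - 2 + 1\<close> cancel, leaving order
    \<open>1 / (k + 1)^2\<close>.\<close>
  have v_eq: "v k = exp (- 2) * (exp (2 - (real (Suc k))\<^sup>2 * (1 - exp (- (2 / (real (Suc k))\<^sup>2))))
      - 2 * exp (1 - (real (Suc k))\<^sup>2 * (1 - exp (- (1 / (real (Suc k))\<^sup>2)))) + 1)" for k
  proof -
    have "exp (- p) - 2 * exp (- 1) * exp (- q) + (exp (- 1))\<^sup>2 = exp (- 2) * (exp (2 - p) - 2 * exp (1 - q) + 1)" for p q :: real
    proof -
      have "exp (- 2) * exp (2 - p) = exp (- p)" "exp (- 2) * exp (1 - q) = exp (- 1) * exp (- q)" "(exp (- 1))\<^sup>2 = exp (- (2::real))"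
        by (simp_all add: power2_eq_square flip: exp_add)
      then show ?thesis by (simp add: distrib_left right_diff_distrib mult.left_commute mult.assoc)
    qed
    then show ?thesis unfolding v_def .
  qed
  have "(\<lambda>k. exp (2 - (real (Suc k))\<^sup>2 * (1 - exp (- (2 / (real (Suc k))\<^sup>2))))
      - 2 * exp (1 - (real (Suc k))\<^sup>2 * (1 - exp (- (1 / (real (Suc k))\<^sup>2)))) + 1) \<in> O(\<lambda>k. 1 / real (Suc k) ^ 2)"
    by real_asymp
  then have "v \<in> O(\<lambda>k. 1 / real (Suc k) ^ 2)"
    unfolding v_eq by simp
  then have vO: "(\<lambda>k. \<bar>v k\<bar>) \<in> O(\<lambda>k. 1 / real (Suc k) ^ 2)" by (rule landau_o.big.abs_in_iff[THEN iffD2])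
  have "summable (\<lambda>k. 1 / real k ^ 2)"
    using inverse_power_summable[of 2, where 'a = real] by (simp add: inverse_eq_divide)
  then have "summable (\<lambda>k. 1 / real (Suc k) ^ 2)" by (rule summable_Suc_iff[THEN iffD2])
  then have "summable (\<lambda>k. norm (1 / real (Suc k) ^ 2))" by (simp only: real_norm_def abs_of_nonneg zero_le_divide_1_iff zero_le_power2)
  from summable_comparison_test_bigo[OF this vO] have "summable (\<lambda>k. \<bar>v k\<bar>)" .
  then have "(\<Sum>k. ennreal \<bar>v k\<bar>) < \<top>"
    by (subst suminf_ennreal2) simp_all
  then have "(\<Sum>k. \<integral>\<^sup>+x. ennreal ((Z k x - exp (- 1))\<^sup>2) \<partial>\<mu>) < \<top>"
    unfolding v by (rule le_less_trans[rotated]) (auto intro!: suminf_le ennreal_leI)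
  then have "AE x in \<mu>. (\<lambda>k. Z k x - exp (- 1)) \<longlonglongrightarrow> 0"
    by (intro AE_tendsto_0_of_square_summable) simp_all
  then show ?thesis using AE_regular
  proof eventually_elim
    case (elim x)
    have t: "tame x" by (rule regular_seqD(6)[OF elim(2)])
    have "(\<lambda>k. Z k x) \<longlonglongrightarrow> exp (- 1)" using elim(1) by (simp add: LIM_zero_iff)
    then have "(\<lambda>k. - ln (Z k x)) \<longlonglongrightarrow> - ln (exp (- 1))"
      by (intro tendsto_intros) auto
    moreover have "- ln (Z k x) = tail_count x (a k) / (real (Suc k))\<^sup>2" for k
      unfolding Z_def point_count_eq_tail_count[OF t a(1)]
      by (simp add: ennreal_mult[symmetric] tail_count_nonneg)
    ultimately have "(\<lambda>k. tail_count x (a k) / (real (Suc k))\<^sup>2) \<longlonglongrightarrow> 1" by simp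
    from tendsto_mult_left[OF this, of C] have lim: "(\<lambda>k. a k powr \<gamma> * tail_count x (a k)) \<longlonglongrightarrow> C"
      by (simp add: a(2))
    show ?case unfolding C_def[symmetric]
    proof (rule regular_variation_from_sequence[OF _ _ _ _ _ _ lim])
      show "decseq a"
        unfolding decseq_def a_def using C index by (auto intro!: powr_mono2 divide_left_mono power_mono)
      have "(\<lambda>k. C / (real (Suc k))\<^sup>2) \<longlonglongrightarrow> 0" by real_asymp
      then have "(\<lambda>k. (C / (real (Suc k))\<^sup>2) powr (1 / \<gamma>)) \<longlonglongrightarrow> 0 powr (1 / \<gamma>)"
        using C index by (intro tendsto_powr') auto
      then show "a \<longlonglongrightarrow> 0" by (simp add: a_def[abs_def])
      have "(\<lambda>k. ((real (Suc k))\<^sup>2 / (real (Suc (Suc k)))\<^sup>2) powr (1 / \<gamma>)) \<longlonglongrightarrow> 1 powr (1 / \<gamma>)"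
        by (intro tendsto_powr) (real_asymp | simp)+
      moreover have "a (Suc k) / a k = ((real (Suc k))\<^sup>2 / (real (Suc (Suc k)))\<^sup>2) powr (1 / \<gamma>)" for k
        using C by (simp add: a_def powr_divide[symmetric] del: of_nat_Suc)
      ultimately show "(\<lambda>k. a (Suc k) / a k) \<longlonglongrightarrow> 1" by simp
    qed (use index a(1) t in \<open>auto intro: tail_count_antimono tail_count_nonneg\<close>)
  qed
qed

section \<open>Distinct values in a sample\<close>

locale index_sampling =
  fixes p :: "nat \<Rightarrow> real"
  assumes p: "regular_seq p" and sum_p: "suminf p = 1"
begin

lemma p_bounds: "0 < p i" "p i \<le> 1"
  using regular_seqD(1)[OF p] sum_le_suminf[of p "{i}"] regular_seqD(1,3)[OF p] sum_p by (auto intro: less_imp_le)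

lemma p_pair_le: "i \<noteq> j \<Longrightarrow> p i + p j \<le> 1"
  using sum_le_suminf[of p "{i, j}"] regular_seqD(1,3)[OF p] sum_p by (auto intro: less_imp_le)

lemma sets_index_law [measurable_cong, simp]: "sets (index_law p) = sets (count_space UNIV)"
  and space_index_law [simp]: "space (index_law p) = UNIV"
  by (simp_all add: index_law_def)

lemma measurable_index_law [simp]: "measurable (index_law p) N = measurable (count_space UNIV) N"
  by (rule measurable_cong_sets) simp_all

lemma emeasure_index_law: "emeasure (index_law p) I = (\<Sum>i. ennreal (p i) * indicator I i)"
  by (simp add: index_law_def emeasure_density nn_integral_count_space_nat)

sublocale law: prob_space "index_law p"
  by (rule prob_spaceI) (simp add: emeasure_index_law regular_seqD(5)[OF p] sum_p)

lemma measure_index_law_compl: "finite I \<Longrightarrow> measure (index_law p) (- I) = 1 - (\<Sum>i\<in>I. p i)"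
proof -
  assume I: "finite I"
  have "emeasure (index_law p) I = (\<Sum>i\<in>I. ennreal (p i) * indicator I i)"
    unfolding emeasure_index_law using I by (intro suminf_finite) auto
  also have "\<dots> = ennreal (\<Sum>i\<in>I. p i)"
    using p_bounds by (simp add: sum_ennreal less_imp_le)
  finally have "measure (index_law p) I = (\<Sum>i\<in>I. p i)"
    using p_bounds by (simp add: measure_def sum_nonneg less_imp_le)
  then show ?thesis using law.prob_compl[of I] by (simp add: Compl_eq_Diff_UNIV)
qed

definition samples :: "(nat \<Rightarrow> nat) measure" where
  "samples = PiM UNIV (\<lambda>_::nat. index_law p)"

sublocale samples: prob_space samples
  unfolding samples_def by (rule prob_space_PiM) unfold_locales

lemma sample_measurable [measurable]: "(\<lambda>x. x j) \<in> measurable samples (count_space UNIV)"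
proof -
  have "(\<lambda>x. x j) \<in> measurable samples (index_law p)"
    unfolding samples_def by measurable
  then show ?thesis using measurable_cong_sets[OF refl sets_index_law, of samples] by simp
qed

text \<open>The indicator that the first \<open>n\<close> samples avoid \<open>I\<close>, written as
  a product so that independence evaluates its mean.\<close>

definition miss :: "nat set \<Rightarrow> nat \<Rightarrow> (nat \<Rightarrow> nat) \<Rightarrow> real" where
  "miss I n x = (\<Prod>j<n. indicator (- I) (x j))"

lemma miss_measurable [measurable]: "miss I n \<in> borel_measurable samples"
  unfolding miss_def[abs_def] by measurable

lemma miss_bounds: "0 \<le> miss I n x" "miss I n x \<le> 1"
  unfolding miss_def by (auto intro!: prod_nonneg prod_le_1)

lemma integrable_miss: "integrable samples (miss I n)"
  using miss_bounds by (intro samples.integrable_const_bound[where B = 1]) auto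

lemma integral_miss:
  assumes "finite I" "(\<Sum>i\<in>I. p i) \<le> 1"
  shows "(\<integral>x. miss I n x \<partial>samples) = (1 - (\<Sum>i\<in>I. p i)) ^ n"
proof -
  have "ennreal (\<integral>x. miss I n x \<partial>samples) = (\<integral>\<^sup>+x. ennreal (miss I n x) \<partial>samples)"
    using integrable_miss miss_bounds by (intro nn_integral_eq_integral[symmetric]) auto
  also have "\<dots> = (\<integral>\<^sup>+x. (\<Prod>j<n. indicator (- I) (x j)) \<partial>samples)"
    unfolding miss_def by (simp add: prod_ennreal[symmetric] ennreal_indicator)
  also have "\<dots> = (\<Prod>j<n. \<integral>\<^sup>+z. indicator (- I) z \<partial>index_law p)"
    unfolding samples_def by (rule nn_integral_PiM_prod) (auto intro: law.prob_space_axioms)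
  also have "\<dots> = ennreal ((1 - (\<Sum>i\<in>I. p i)) ^ n)"
    using assms by (simp add: law.emeasure_eq_measure measure_index_law_compl ennreal_power)
  finally show ?thesis
    using assms by (subst (asm) ennreal_inj) (auto intro!: integral_nonneg_AE simp: miss_bounds)
qed

definition distinct_values :: "nat \<Rightarrow> (nat \<Rightarrow> nat) \<Rightarrow> real" where
  "distinct_values n x = real (card (x ` {..<n}))"

definition hit_prob :: "nat \<Rightarrow> nat \<Rightarrow> real" where
  "hit_prob n i = 1 - (1 - p i) ^ n"

lemma hit_prob_bounds: "0 \<le> hit_prob n i" "hit_prob n i \<le> 1"
  using p_bounds[of i] by (auto simp: hit_prob_def intro!: power_le_one)

lemma ennreal_distinct_values: "ennreal (distinct_values n x) = (\<Sum>i. ennreal (1 - miss {i} n x))"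
proof -
  have "1 - miss {i} n x = indicator (x ` {..<n}) i" for i
  proof (cases "i \<in> x ` {..<n}")
    case True
    then obtain j where "j < n" "x j = i" by auto
    then have "miss {i} n x = 0" unfolding miss_def by (intro prod_zero bexI[of _ j]) auto
    then show ?thesis using True by simp
  next
    case False
    then have "miss {i} n x = 1" unfolding miss_def by (intro prod.neutral) (auto simp: indicator_def)
    then show ?thesis using False by simp
  qed
  then have "(\<Sum>i. ennreal (1 - miss {i} n x)) = (\<integral>\<^sup>+i. indicator (x ` {..<n}) i \<partial>count_space UNIV)"
    by (simp add: nn_integral_count_space_nat ennreal_indicator)
  then show ?thesis by (simp add: distinct_values_def emeasure_count_space ennreal_of_nat_eq_real_of_nat)
qed

lemma distinct_values_bounds: "0 \<le> distinct_values n x" "distinct_values n x \<le> real n"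
  using card_image_le[of "{..<n}" x] by (auto simp: distinct_values_def)

lemma distinct_values_measurable [measurable]: "distinct_values n \<in> borel_measurable samples"
proof -
  have "(\<lambda>x. enn2real (\<Sum>i. ennreal (1 - miss {i} n x))) \<in> borel_measurable samples" by measurable
  then show ?thesis by (simp add: ennreal_distinct_values[symmetric] distinct_values_bounds)
qed

lemma nn_integral_hit: "(\<integral>\<^sup>+x. ennreal (1 - miss {i} n x) \<partial>samples) = ennreal (hit_prob n i)"
proof -
  have "(\<integral>\<^sup>+x. ennreal (1 - miss {i} n x) \<partial>samples) = ennreal (\<integral>x. 1 - miss {i} n x \<partial>samples)"
    using integrable_miss miss_bounds by (intro nn_integral_eq_integral) auto
  then show ?thesis
    using p_bounds[of i] integrable_miss[of "{i}" n] samples.prob_space by (simp add: integral_miss hit_prob_def)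
qed

text \<open>Hits of two different values are negatively correlated, because
  \<open>1 - p i - p j \<le> (1 - p i) * (1 - p j)\<close>.\<close>

lemma nn_integral_hit_pair:
  assumes ij: "i \<noteq> j"
  shows "(\<integral>\<^sup>+x. ennreal (1 - miss {i} n x) * ennreal (1 - miss {j} n x) \<partial>samples) \<le> ennreal (hit_prob n i * hit_prob n j)"
proof -
  have m: "miss {i} n x * miss {j} n x = miss {i, j} n x" for x
    unfolding miss_def prod.distrib[symmetric] by (intro prod.cong) (auto simp: indicator_def)
  have "(\<integral>\<^sup>+x. ennreal (1 - miss {i} n x) * ennreal (1 - miss {j} n x) \<partial>samples) = (\<integral>\<^sup>+x. ennreal (1 - miss {i} n x - miss {j} n x + miss {i, j} n x) \<partial>samples)"
    by (intro nn_integral_cong) (simp add: ennreal_mult[symmetric] miss_bounds m[symmetric] algebra_simps)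
  also have "\<dots> = ennreal (\<integral>x. 1 - miss {i} n x - miss {j} n x + miss {i, j} n x \<partial>samples)"
  proof (rule nn_integral_eq_integral)
    have "1 - miss {i} n x - miss {j} n x + miss {i, j} n x = (1 - miss {i} n x) * (1 - miss {j} n x)" for x
      unfolding m[symmetric] by (simp add: algebra_simps)
    then show "AE x in samples. 0 \<le> 1 - miss {i} n x - miss {j} n x + miss {i, j} n x"
      using miss_bounds by (intro AE_I2) (metis diff_ge_0_iff_ge mult_nonneg_nonneg)
  qed (use integrable_miss in auto)
  also have "(\<integral>x. 1 - miss {i} n x - miss {j} n x + miss {i, j} n x \<partial>samples) = 1 - (1 - p i) ^ n - (1 - p j) ^ n + (1 - (p i + p j)) ^ n"
    using integrable_miss samples.prob_space ij p_bounds p_pair_le[OF ij] by (simp add: integral_miss)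
  also have "\<dots> \<le> hit_prob n i * hit_prob n j"
  proof -
    have "(1 - (p i + p j)) ^ n \<le> ((1 - p i) * (1 - p j)) ^ n"
      using p_bounds[of i] p_bounds[of j] p_pair_le[OF ij] by (intro power_mono) (auto simp: algebra_simps)
    then have "(1 - (p i + p j)) ^ n \<le> (1 - p i) ^ n * (1 - p j) ^ n" by (simp only: power_mult_distrib)
    then show ?thesis by (simp add: hit_prob_def left_diff_distrib right_diff_distrib)
  qed
  finally show ?thesis by (simp add: ennreal_leI)
qed

definition mean_distinct :: "nat \<Rightarrow> real" where
  "mean_distinct n = (\<integral>x. distinct_values n x \<partial>samples)"

lemma integrable_distinct: "integrable samples (distinct_values n)"
  using distinct_values_bounds by (intro samples.integrable_const_bound[where B = "real n"]) auto

lemma mean_distinct_nonneg: "0 \<le> mean_distinct n"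
  unfolding mean_distinct_def using distinct_values_bounds by (intro integral_nonneg_AE) auto

lemma ennreal_mean_distinct: "ennreal (mean_distinct n) = (\<Sum>i. ennreal (hit_prob n i))"
proof -
  have "ennreal (mean_distinct n) = (\<integral>\<^sup>+x. ennreal (distinct_values n x) \<partial>samples)"
    unfolding mean_distinct_def using integrable_distinct distinct_values_bounds
    by (intro nn_integral_eq_integral[symmetric]) auto
  then show ?thesis
    by (simp add: ennreal_distinct_values nn_integral_suminf nn_integral_hit)
qed

text \<open>Expand the square over pairs of values: off the diagonal, negative correlation bounds
  each term by the product of the means, and the diagonal contributes at most the mean
  itself.\<close>

lemma variance_distinct_le:
  "(\<integral>\<^sup>+x. ennreal ((distinct_values n x - mean_distinct n)\<^sup>2) \<partial>samples) \<le> ennreal (mean_distinct n)"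
proof -
  let ?h = "\<lambda>i x. ennreal (1 - miss {i} n x)" and ?w = "\<lambda>i. ennreal (hit_prob n i)" and ?m = "mean_distinct n"
  have int2: "integrable samples (\<lambda>x. (distinct_values n x)\<^sup>2)"
    using distinct_values_bounds by (intro samples.integrable_const_bound[where B = "(real n)\<^sup>2"]) (auto intro!: power_mono)
  have "ennreal (\<integral>x. (distinct_values n x)\<^sup>2 \<partial>samples) = (\<integral>\<^sup>+x. ennreal ((distinct_values n x)\<^sup>2) \<partial>samples)"
    using int2 by (intro nn_integral_eq_integral[symmetric]) auto
  also have "\<dots> = (\<integral>\<^sup>+x. (\<Sum>i. \<Sum>j. ?h i x * ?h j x) \<partial>samples)"
    by (intro nn_integral_cong) (simp add: power2_eq_square ennreal_mult distinct_values_bounds ennreal_distinct_values)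
  also have "\<dots> = (\<Sum>i. \<Sum>j. \<integral>\<^sup>+x. ?h i x * ?h j x \<partial>samples)"
    by (simp add: nn_integral_suminf del: ennreal_suminf_cmult)
  also have "\<dots> \<le> (\<Sum>i. \<Sum>j. ?w i * ?w j + (if j = i then ?w i else 0))"
  proof (intro suminf_le summableI)
    fix i j
    show "(\<integral>\<^sup>+x. ?h i x * ?h j x \<partial>samples) \<le> ?w i * ?w j + (if j = i then ?w i else 0)"
    proof (cases "j = i")
      case True
      have "(\<integral>\<^sup>+x. ?h i x * ?h i x \<partial>samples) \<le> (\<integral>\<^sup>+x. ?h i x \<partial>samples)"
        using miss_bounds by (intro nn_integral_mono) (auto simp: ennreal_mult[symmetric] intro!: ennreal_leI mult_left_le)
      also have "\<dots> \<le> ?w i * ?w i + ?w i" by (simp add: nn_integral_hit)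
      finally show ?thesis using True by simp
    next
      case False
      then show ?thesis
        using nn_integral_hit_pair[of i j n] hit_prob_bounds by (auto simp: ennreal_mult)
    qed
  qed
  also have "\<dots> = (\<Sum>i. ?w i * ennreal ?m + ?w i)"
  proof (intro arg_cong[where f = suminf] ext)
    fix i
    have "(\<Sum>j. if j = i then ?w i else 0) = (\<Sum>j\<in>{i}. if j = i then ?w i else 0)"
      by (rule suminf_finite) auto
    then show "(\<Sum>j. ?w i * ?w j + (if j = i then ?w i else 0)) = ?w i * ennreal ?m + ?w i"
      by (subst suminf_add[symmetric]) (auto simp: ennreal_mean_distinct)
  qed
  also have "(\<Sum>i. ?w i * ennreal ?m + ?w i) = ennreal (?m\<^sup>2 + ?m)"
  proof -
    have "(\<Sum>i. ?w i * ennreal ?m + ?w i) = (\<Sum>i. ?w i * ennreal ?m) + (\<Sum>i. ?w i)"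
      by (rule suminf_add[symmetric]) auto
    also have "(\<Sum>i. ?w i * ennreal ?m) = (\<Sum>i. ?w i) * ennreal ?m" by (rule ennreal_suminf_multc)
    also have "(\<Sum>i. ?w i) = ennreal ?m" by (rule ennreal_mean_distinct[symmetric])
    finally show ?thesis by (simp add: power2_eq_square ennreal_mult[symmetric] mean_distinct_nonneg)
  qed
  finally have le: "(\<integral>x. (distinct_values n x)\<^sup>2 \<partial>samples) \<le> ?m\<^sup>2 + ?m"
    using mean_distinct_nonneg by (subst (asm) ennreal_le_iff) auto
  have "(\<integral>\<^sup>+x. ennreal ((distinct_values n x - ?m)\<^sup>2) \<partial>samples) = (\<integral>\<^sup>+x. ennreal ((distinct_values n x)\<^sup>2 - 2 * ?m * distinct_values n x + ?m\<^sup>2) \<partial>samples)"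
    by (intro nn_integral_cong) (simp add: power2_diff algebra_simps)
  also have "\<dots> = ennreal (\<integral>x. (distinct_values n x)\<^sup>2 - 2 * ?m * distinct_values n x + ?m\<^sup>2 \<partial>samples)"
  proof (rule nn_integral_eq_integral)
    have "(distinct_values n x)\<^sup>2 - 2 * ?m * distinct_values n x + ?m\<^sup>2 = (distinct_values n x - ?m)\<^sup>2" for x
      by (simp add: power2_diff algebra_simps)
    then show "AE x in samples. 0 \<le> (distinct_values n x)\<^sup>2 - 2 * ?m * distinct_values n x + ?m\<^sup>2" by simp
  qed (use int2 integrable_distinct in auto)
  also have "(\<integral>x. (distinct_values n x)\<^sup>2 - 2 * ?m * distinct_values n x + ?m\<^sup>2 \<partial>samples) = (\<integral>x. (distinct_values n x)\<^sup>2 \<partial>samples) - ?m\<^sup>2"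
    using int2 integrable_distinct samples.prob_space by (simp add: mean_distinct_def[symmetric] power2_eq_square)
  finally show ?thesis using le by (simp add: ennreal_leI)
qed

text \<open>Karlin's computation: \<open>1 - (1 - p i)^n\<close> is the integral of
  \<open>n * (1 - s)^(n - 1)\<close> over \<open>s\<close> up to \<open>p i\<close>, so summing over
  \<open>i\<close> produces the tail count. After \<open>s = w / n\<close> and rescaling, the
  integrand tends to \<open>c * exp (- w) * w powr (- \<alpha>)\<close>, whose integral is the Gamma
  value.\<close>

lemma mean_distinct_asymptotics:
  assumes \<alpha>: "0 < \<alpha>" "\<alpha> < 1"
    and rv: "((\<lambda>s. s powr \<alpha> * tail_count p s) \<longlongrightarrow> c) (at_right 0)"
  shows "(\<lambda>n. real n powr (- \<alpha>) * mean_distinct n) \<longlonglongrightarrow> c * Gamma (1 - \<alpha>)"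
proof -
  have t: "tame p" by (rule regular_seqD(6)[OF p])
  let ?N = "tail_count p"
  have c0: "0 \<le> c"
    by (rule tendsto_lowerbound[OF rv]) (auto simp: tail_count_nonneg)
  have [measurable]: "?N \<in> borel_measurable borel"
  proof -
    have "(\<lambda>s. enn2real (\<Sum>i. indicator {(s, x). s \<le> x} (s, p i))) \<in> borel_measurable borel"
      by measurable
    then show ?thesis
      by (simp add: tail_count_def[abs_def] point_count_nn_integral nn_integral_count_space_nat indicator_def of_bool_def)
  qed
  \<comment> \<open>Regular variation gives the bound near 0, and monotonicity of the tail count
    gives it on the rest of the unit interval.\<close>
  obtain B where B: "\<And>s. 0 < s \<Longrightarrow> s \<le> 1 \<Longrightarrow> s powr \<alpha> * ?N s \<le> B"
  proof -
    have "eventually (\<lambda>s. s powr \<alpha> * ?N s < c + 1) (at_right 0)"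
      by (rule order_tendstoD[OF rv]) simp
    then obtain d where d: "0 < d" "\<And>s. 0 < s \<Longrightarrow> s < d \<Longrightarrow> s powr \<alpha> * ?N s < c + 1"
      by (auto simp: eventually_at_right_field)
    have "s powr \<alpha> * ?N s \<le> max (c + 1) (?N d)" if s: "0 < s" "s \<le> 1" for s
    proof (cases "s < d")
      case False
      have "s powr \<alpha> \<le> 1 powr \<alpha>" using s \<alpha> by (intro powr_mono2) auto
      then have "s powr \<alpha> * ?N s \<le> 1 * ?N d"
        using False d(1) t tail_count_nonneg by (intro mult_mono tail_count_antimono) auto
      then show ?thesis by simp
    qed (use d(2)[OF s(1)] in \<open>auto simp: le_max_iff_disj intro: less_imp_le\<close>)
    then show thesis using that by blast
  qed
  have B0: "0 \<le> B" using B[of 1] tail_count_nonneg[of p 1] by simp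
  \<comment> \<open>The sample size is \<open>n + 1\<close>, so that the exponent of
    \<open>1 - s\<close> is \<open>n\<close> without a subtraction.\<close>
  define f where "f n w = real (Suc n) powr (- \<alpha>) * ((1 - w / real (Suc n)) ^ n * ?N (w / real (Suc n))) * indicator {0<..real (Suc n)} w" for n w
  have f_meas [measurable]: "f n \<in> borel_measurable borel" for n unfolding f_def[abs_def] by measurable
  have f_eq: "ennreal (real (Suc n) powr (- \<alpha>) * mean_distinct (Suc n)) = (\<integral>\<^sup>+w. ennreal (f n w) \<partial>lborel)" for n
  proof -
    let ?n = "real (Suc n)"
    have "ennreal (hit_prob (Suc n) i) = (\<integral>\<^sup>+s. ennreal (?n * (1 - s) ^ n) * indicator {0<..1} s * indicator {s..} (p i) \<partial>lborel)" for i
    proof -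
      have "ennreal (hit_prob (Suc n) i) = ennreal (- ((1 - p i) ^ Suc n) - (- ((1 - 0) ^ Suc n)))"
        by (simp add: hit_prob_def)
      also have "\<dots> = (\<integral>\<^sup>+s. ennreal (?n * (1 - s) ^ n) * indicator {0..p i} s \<partial>lborel)"
        using p_bounds[of i]
        by (intro nn_integral_FTC_Icc[symmetric]) (auto intro!: derivative_eq_intros simp del: power_Suc)
      also have "\<dots> = (\<integral>\<^sup>+s. ennreal (?n * (1 - s) ^ n) * indicator {0<..1} s * indicator {s..} (p i) \<partial>lborel)"
        using AE_lborel_singleton[of 0] p_bounds[of i]
        by (intro nn_integral_cong_AE) (auto elim!: eventually_mono simp: indicator_def)
      finally show ?thesis .
    qed
    then have "ennreal (mean_distinct (Suc n)) = (\<integral>\<^sup>+s. (\<Sum>i. ennreal (?n * (1 - s) ^ n) * indicator {0<..1} s * indicator {s..} (p i)) \<partial>lborel)"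
      unfolding ennreal_mean_distinct by (subst nn_integral_suminf) (auto simp: indicator_def)
    also have "\<dots> = (\<integral>\<^sup>+s. ennreal (?n * (1 - s) ^ n) * indicator {0<..1} s * ennreal (?N s) \<partial>lborel)"
      using point_count_eq_tail_count[OF t, symmetric]
      by (intro nn_integral_cong) (auto simp: point_count_nn_integral nn_integral_count_space_nat indicator_def)
    also have "\<dots> = ennreal (1 / ?n) * (\<integral>\<^sup>+w. ennreal (?n * (1 - w / ?n) ^ n) * indicator {0<..1} (w / ?n) * ennreal (?N (w / ?n)) \<partial>lborel)"
      by (subst nn_integral_real_affine[where c = "1 / ?n" and t = 0]) auto
    also have "\<dots> = (\<integral>\<^sup>+w. ennreal (1 / ?n) * (ennreal (?n * (1 - w / ?n) ^ n) * indicator {0<..1} (w / ?n) * ennreal (?N (w / ?n))) \<partial>lborel)"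
      by (rule nn_integral_cmult[symmetric]) simp
    finally have "ennreal (?n powr (- \<alpha>) * mean_distinct (Suc n)) = ennreal (?n powr (- \<alpha>)) *
       (\<integral>\<^sup>+w. ennreal (1 / ?n) * (ennreal (?n * (1 - w / ?n) ^ n) * indicator {0<..1} (w / ?n) * ennreal (?N (w / ?n))) \<partial>lborel)"
      by (simp add: ennreal_mult mean_distinct_nonneg)
    also have "\<dots> = (\<integral>\<^sup>+w. ennreal (?n powr (- \<alpha>)) * (ennreal (1 / ?n) * (ennreal (?n * (1 - w / ?n) ^ n) * indicator {0<..1} (w / ?n) * ennreal (?N (w / ?n)))) \<partial>lborel)"
      by (rule nn_integral_cmult[symmetric]) simp
    also have "\<dots> = (\<integral>\<^sup>+w. ennreal (f n w) \<partial>lborel)"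
    proof (rule nn_integral_cong)
      fix w :: real
      show "ennreal (?n powr (- \<alpha>)) * (ennreal (1 / ?n) * (ennreal (?n * (1 - w / ?n) ^ n) * indicator {0<..1} (w / ?n) * ennreal (?N (w / ?n)))) = ennreal (f n w)"
      proof (cases "0 < w \<and> w \<le> ?n")
        case True
        then have "0 \<le> (1 - w / ?n) ^ n" by simp
        then show ?thesis
          using True tail_count_nonneg[of p "w / ?n"]
          by (simp add: f_def ennreal_mult[symmetric] zero_less_divide_iff del: of_nat_Suc)
      next
        case False
        then have "\<not> (0 < w / ?n \<and> w / ?n \<le> 1)" by (auto simp: zero_less_divide_iff)
        with False show ?thesis by (auto simp: f_def indicator_def)
      qed
    qed
    finally show ?thesis .
  qed
  have GI: "(\<integral>\<^sup>+w. ennreal (exp (- w) * w powr (- \<alpha>)) * indicator {0<..} w \<partial>lborel) = ennreal (Gamma (1 - \<alpha>))"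
  proof -
    have "0 < 1 - \<alpha>" using \<alpha> by simp
    from Gamma_conv_nn_integral_real[OF this] show ?thesis
      by (simp, intro nn_integral_cong_AE)
         (use AE_lborel_singleton[of 0] in \<open>auto elim!: eventually_mono simp: indicator_def exp_minus divide_inverse mult.commute\<close>)
  qed
  have "(\<lambda>n. \<integral>\<^sup>+w. ennreal (f n w) \<partial>lborel) \<longlonglongrightarrow> (\<integral>\<^sup>+w. ennreal (c * (exp (- w) * w powr (- \<alpha>))) * indicator {0<..} w \<partial>lborel)"
  proof (rule nn_integral_dominated_convergence[where w = "\<lambda>w. ennreal (exp 1 * B * (exp (- w) * w powr (- \<alpha>))) * indicator {0<..} w"])
    have "(\<integral>\<^sup>+w. ennreal (exp 1 * B * (exp (- w) * w powr (- \<alpha>))) * indicator {0<..} w \<partial>lborel)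
      = (\<integral>\<^sup>+w. ennreal (exp 1 * B) * (ennreal (exp (- w) * w powr (- \<alpha>)) * indicator {0<..} w) \<partial>lborel)"
      using B0 by (intro nn_integral_cong) (simp add: ennreal_mult' mult.assoc)
    also have "\<dots> = ennreal (exp 1 * B) * ennreal (Gamma (1 - \<alpha>))"
      by (simp add: nn_integral_cmult GI)
    also have "\<dots> < \<infinity>" by (simp add: ennreal_mult_less_top)
    finally show "(\<integral>\<^sup>+w. ennreal (exp 1 * B * (exp (- w) * w powr (- \<alpha>))) * indicator {0<..} w \<partial>lborel) < \<infinity>" .
    have f_split: "f n w = (1 - w / real (Suc n)) ^ n * (w powr (- \<alpha>) * ((w / real (Suc n)) powr \<alpha> * ?N (w / real (Suc n)))) * indicator {0<..real (Suc n)} w" if "0 < w" for n w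
    proof -
      have "real (Suc n) powr (- \<alpha>) = w powr (- \<alpha>) * (w / real (Suc n)) powr \<alpha>"
        using that by (simp add: powr_divide powr_minus field_simps)
      then show ?thesis by (simp add: f_def mult_ac)
    qed
    show "AE w in lborel. ennreal (f n w) \<le> ennreal (exp 1 * B * (exp (- w) * w powr (- \<alpha>))) * indicator {0<..} w" for n
    proof (intro AE_I2)
      fix w :: real
      show "ennreal (f n w) \<le> ennreal (exp 1 * B * (exp (- w) * w powr (- \<alpha>))) * indicator {0<..} w"
      proof (cases "0 < w \<and> w \<le> real (Suc n)")
        case True
        let ?n = "real (Suc n)"
        have q: "0 \<le> 1 - w / ?n" "0 < w / ?n" "w / ?n \<le> 1" using True by (auto simp: zero_less_divide_iff)
        \<comment> \<open>The exponent \<open>n\<close> is one short of the sample size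
          \<open>n + 1\<close>, which costs the factor \<open>exp 1\<close> since
          \<open>w / ?n \<le> 1\<close>.\<close>
        have "(1 - w / ?n) ^ n \<le> exp (- (w / ?n)) ^ n"
          using exp_ge_add_one_self[of "- (w / ?n)"] q(1) by (intro power_mono) auto
        also have "\<dots> = exp (- (real n * (w / ?n)))" by (simp add: exp_of_nat_mult[symmetric])
        also have "\<dots> = exp (- w + w / ?n)" by (simp add: field_simps)
        also have "\<dots> \<le> exp (- w + 1)" using q by simp
        finally have "(1 - w / ?n) ^ n \<le> exp 1 * exp (- w)" by (simp add: exp_add[symmetric])
        moreover have "w powr (- \<alpha>) * ((w / ?n) powr \<alpha> * ?N (w / ?n)) \<le> w powr (- \<alpha>) * B"
          by (rule mult_left_mono[OF B[OF q(2,3)]]) simp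
        ultimately have "(1 - w / ?n) ^ n * (w powr (- \<alpha>) * ((w / ?n) powr \<alpha> * ?N (w / ?n))) \<le> (exp 1 * exp (- w)) * (w powr (- \<alpha>) * B)"
          by (rule mult_mono) (simp_all add: tail_count_nonneg)
        then have "f n w \<le> (exp 1 * exp (- w)) * (w powr (- \<alpha>) * B)"
          using True by (simp add: f_split del: of_nat_Suc)
        then show ?thesis using True by (auto intro!: ennreal_leI simp: mult_ac)
      qed (auto simp: f_def indicator_def)
    qed
    show "AE w in lborel. (\<lambda>n. ennreal (f n w)) \<longlonglongrightarrow> ennreal (c * (exp (- w) * w powr (- \<alpha>))) * indicator {0<..} w"
    proof (intro AE_I2)
      fix w :: real
      show "(\<lambda>n. ennreal (f n w)) \<longlonglongrightarrow> ennreal (c * (exp (- w) * w powr (- \<alpha>))) * indicator {0<..} w"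
      proof (cases "0 < w")
        case True
        have 1: "(\<lambda>n. (1 - w / real (Suc n)) ^ n) \<longlonglongrightarrow> exp (- w)" using True by real_asymp
        have "filterlim (\<lambda>n. w / real (Suc n)) (at_right 0) sequentially" using True by real_asymp
        from filterlim_compose[OF rv this]
        have 2: "(\<lambda>n. (w / real (Suc n)) powr \<alpha> * ?N (w / real (Suc n))) \<longlonglongrightarrow> c" .
        have "eventually (\<lambda>n. w \<le> real (Suc n)) sequentially" by real_asymp
        then have 3: "(\<lambda>n. indicator {0<..real (Suc n)} w :: real) \<longlonglongrightarrow> 1"
          using True by (intro tendsto_eventually) (auto elim!: eventually_mono)
        have "(\<lambda>n. f n w) \<longlonglongrightarrow> exp (- w) * (w powr (- \<alpha>) * c) * 1"
          unfolding f_split[OF True] by (intro tendsto_mult tendsto_const 1 2 3)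
        then show ?thesis using True by (auto intro!: tendsto_ennrealI simp: mult_ac)
      qed (simp add: f_def)
    qed
  qed auto
  also have "(\<integral>\<^sup>+w. ennreal (c * (exp (- w) * w powr (- \<alpha>))) * indicator {0<..} w \<partial>lborel) = ennreal (c * Gamma (1 - \<alpha>))"
  proof -
    have "(\<integral>\<^sup>+w. ennreal (c * (exp (- w) * w powr (- \<alpha>))) * indicator {0<..} w \<partial>lborel)
      = (\<integral>\<^sup>+w. ennreal c * (ennreal (exp (- w) * w powr (- \<alpha>)) * indicator {0<..} w) \<partial>lborel)"
      by (simp only: ennreal_mult'[OF c0] mult.assoc)
    also have "\<dots> = ennreal c * ennreal (Gamma (1 - \<alpha>))"
      by (subst nn_integral_cmult) (simp_all only: GI, simp)
    finally show ?thesis by (simp only: ennreal_mult'[OF c0])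
  qed
  finally have "(\<lambda>n. ennreal (real (Suc n) powr (- \<alpha>) * mean_distinct (Suc n))) \<longlonglongrightarrow> ennreal (c * Gamma (1 - \<alpha>))"
    unfolding f_eq .
  then have "(\<lambda>n. real (Suc n) powr (- \<alpha>) * mean_distinct (Suc n)) \<longlonglongrightarrow> c * Gamma (1 - \<alpha>)"
    using c0 \<alpha> by (subst (asm) tendsto_ennreal_iff) (auto simp: mean_distinct_nonneg Gamma_real_pos less_imp_le)
  then show ?thesis by (rule LIMSEQ_imp_Suc)
qed

text \<open>A second moment argument along the sparse sample sizes \<open>(k + 1)^r\<close>, where a
  variance bounded by the mean gives summable errors; between them the number of distinct values is
  monotone in the sample size.\<close>

theorem AE_distinct_values_asymptotics:
  assumes \<alpha>: "0 < \<alpha>" "\<alpha> < 1"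
    and rv: "((\<lambda>s. s powr \<alpha> * tail_count p s) \<longlongrightarrow> c) (at_right 0)"
  shows "AE x in samples. (\<lambda>n. real n powr (- \<alpha>) * distinct_values n x) \<longlonglongrightarrow> c * Gamma (1 - \<alpha>)"
proof -
  let ?l = "c * Gamma (1 - \<alpha>)"
  note mean = mean_distinct_asymptotics[OF assms]
  \<comment> \<open>The rescaled variance is of order \<open>d k powr (- \<alpha>)\<close>, so
    \<open>r * \<alpha> \<ge> 2\<close> makes it summable, while a fixed power keeps the ratio of
    consecutive sample sizes tending to 1.\<close>
  define r where "r = nat \<lceil>2 / \<alpha>\<rceil>"
  have r: "2 \<le> real r * \<alpha>" "0 < r"
  proof -
    have "2 / \<alpha> \<le> real r" unfolding r_def by linarith
    then show "2 \<le> real r * \<alpha>" using \<alpha> by (simp add: pos_divide_le_eq)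
    then show "0 < r" by (cases r) auto
  qed
  define d where "d k = Suc k ^ r" for k
  have d_pos: "0 < d k" for k by (simp add: d_def)
  have d_lim: "filterlim d sequentially sequentially"
  proof (rule filterlim_at_top_mono[of Suc])
    show "filterlim Suc sequentially sequentially" by (rule filterlim_Suc)
    show "eventually (\<lambda>k. Suc k \<le> d k) sequentially"
      using r(2) by (auto simp: d_def intro!: always_eventually self_le_power)
  qed
  have mean_d: "(\<lambda>k. real (d k) powr (- \<alpha>) * mean_distinct (d k)) \<longlonglongrightarrow> ?l"
    by (rule filterlim_compose[OF mean d_lim])
  then have "Bseq (\<lambda>k. real (d k) powr (- \<alpha>) * mean_distinct (d k))"
    by (rule convergent_imp_Bseq[OF convergentI])
  then obtain b where "0 < b" "\<forall>k. norm (real (d k) powr (- \<alpha>) * mean_distinct (d k)) \<le> b"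
    by (rule BseqE)
  then have b: "0 < b" "\<And>k. norm (real (d k) powr (- \<alpha>) * mean_distinct (d k)) \<le> b" by blast+
  define X where "X k x = real (d k) powr (- \<alpha>) * (distinct_values (d k) x - mean_distinct (d k))" for k x
  have "(\<integral>\<^sup>+x. ennreal ((X k x)\<^sup>2) \<partial>samples) \<le> ennreal (b * (1 / real (Suc k) ^ 2))" for k
  proof -
    have "(\<integral>\<^sup>+x. ennreal ((X k x)\<^sup>2) \<partial>samples) = (\<integral>\<^sup>+x. ennreal ((real (d k) powr (- \<alpha>))\<^sup>2) * ennreal ((distinct_values (d k) x - mean_distinct (d k))\<^sup>2) \<partial>samples)"
      unfolding X_def by (intro nn_integral_cong) (simp add: power_mult_distrib ennreal_mult)
    also have "\<dots> = ennreal ((real (d k) powr (- \<alpha>))\<^sup>2) * (\<integral>\<^sup>+x. ennreal ((distinct_values (d k) x - mean_distinct (d k))\<^sup>2) \<partial>samples)"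
      by (rule nn_integral_cmult) simp
    also have "\<dots> \<le> ennreal ((real (d k) powr (- \<alpha>))\<^sup>2) * ennreal (mean_distinct (d k))"
      by (intro mult_left_mono variance_distinct_le) simp
    also have "\<dots> = ennreal ((real (d k) powr (- \<alpha>) * mean_distinct (d k)) * real (d k) powr (- \<alpha>))"
      by (simp add: ennreal_mult[symmetric] mean_distinct_nonneg power2_eq_square mult_ac)
    also have "\<dots> \<le> ennreal (b * (1 / real (Suc k) ^ 2))"
    proof (intro ennreal_leI mult_mono)
      show "real (d k) powr (- \<alpha>) * mean_distinct (d k) \<le> b" using b(2)[of k] by simp
      have "real (d k) powr (- \<alpha>) = real (Suc k) powr (- (real r * \<alpha>))"
        by (simp add: d_def powr_realpow[symmetric] powr_powr del: of_nat_Suc)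
      also have "\<dots> \<le> real (Suc k) powr (- 2)" using r by (intro powr_mono) auto
      also have "\<dots> = 1 / real (Suc k) ^ 2" by (simp add: powr_minus_divide powr_numeral del: of_nat_Suc)
      finally show "real (d k) powr (- \<alpha>) \<le> 1 / real (Suc k) ^ 2" .
    qed (use b in auto)
    finally show ?thesis .
  qed
  then have "(\<Sum>k. \<integral>\<^sup>+x. ennreal ((X k x)\<^sup>2) \<partial>samples) \<le> (\<Sum>k. ennreal (b * (1 / real (Suc k) ^ 2)))"
    by (intro suminf_le) auto
  also have "\<dots> < \<top>"
  proof -
    have "summable (\<lambda>k. 1 / real k ^ 2)"
      using inverse_power_summable[of 2, where 'a = real] by (simp add: inverse_eq_divide)
    then have "summable (\<lambda>k. 1 / real (Suc k) ^ 2)" by (rule summable_Suc_iff[THEN iffD2])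
    then have "summable (\<lambda>k. b * (1 / real (Suc k) ^ 2))" by (rule summable_mult)
    then show ?thesis using b(1) by (subst suminf_ennreal2) auto
  qed
  finally have "AE x in samples. (\<lambda>k. X k x) \<longlonglongrightarrow> 0"
    by (intro AE_tendsto_0_of_square_summable) (auto simp: X_def[abs_def])
  then show ?thesis
  proof eventually_elim
    case (elim x)
    \<comment> \<open>With \<open>s = 1 / n\<close> the number of distinct values becomes a
      decreasing function of a level, so the interpolation used for tail counts applies; the floor
      extends it to all levels.\<close>
    let ?K = "\<lambda>s. distinct_values (nat \<lfloor>1 / s\<rfloor>) x"
    have mono: "distinct_values m x \<le> distinct_values n x" if "m \<le> n" for m n
      using that by (auto simp: distinct_values_def intro!: card_mono image_mono)
    have "(\<lambda>k. X k x + real (d k) powr (- \<alpha>) * mean_distinct (d k)) \<longlonglongrightarrow> 0 + ?l"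
      by (intro tendsto_add elim mean_d)
    then have lim: "(\<lambda>k. (1 / real (d k)) powr \<alpha> * ?K (1 / real (d k))) \<longlonglongrightarrow> ?l"
      by (simp add: X_def algebra_simps powr_divide powr_minus_divide)
    have "((\<lambda>s. s powr \<alpha> * ?K s) \<longlongrightarrow> ?l) (at_right 0)"
    proof (rule regular_variation_from_sequence[OF _ _ _ _ _ _ lim])
      show "?K t \<le> ?K s" if "0 < s" "s \<le> t" for s t
        using that by (intro mono nat_mono floor_mono) (simp add: frac_le)
      show "decseq (\<lambda>k. 1 / real (d k))"
        unfolding decseq_def using d_pos by (auto simp: d_def intro!: divide_left_mono power_mono)
      have "filterlim (\<lambda>k. real (d k)) at_top sequentially"
        by (rule filterlim_compose[OF filterlim_real_sequentially d_lim])
      then show "(\<lambda>k. 1 / real (d k)) \<longlonglongrightarrow> 0"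
        by (intro tendsto_divide_0[OF tendsto_const] filterlim_at_top_imp_at_infinity)
      have "(\<lambda>k. (real (Suc k) / real (Suc (Suc k))) ^ r) \<longlonglongrightarrow> 1 ^ r"
        by (intro tendsto_power) real_asymp
      then show "(\<lambda>k. 1 / real (d (Suc k)) / (1 / real (d k))) \<longlonglongrightarrow> 1"
        by (simp add: d_def power_divide del: of_nat_Suc)
    qed (use d_pos \<alpha> in \<open>auto simp: distinct_values_bounds\<close>)
    moreover have "filterlim (\<lambda>n. 1 / real n) (at_right 0) sequentially" by real_asymp
    ultimately have "(\<lambda>n. (1 / real n) powr \<alpha> * ?K (1 / real n)) \<longlonglongrightarrow> ?l"
      by (rule filterlim_compose)
    then show ?case by (simp add: powr_divide powr_minus_divide)
  qed
qed

end

section \<open>Mittag-Leffler function and Poisson-Kingman laws\<close>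

text \<open>Restrict the Gamma integral to \<open>t \<ge> A\<close>, where \<open>t powr x\<close>
  is at least \<open>A powr x\<close>.\<close>

lemma Gamma_ge_powr:
  fixes A x :: real
  assumes "0 \<le> A" "0 \<le> x"
  shows "A powr x * exp (- A) \<le> Gamma (x + 1)"
proof -
  have "ennreal (A powr x * exp (- A)) = ennreal (A powr x) * ennreal (0 - (- exp (- A)))"
    by (simp add: ennreal_mult)
  also have "ennreal (0 - (- exp (- A))) = (\<integral>\<^sup>+t. ennreal (exp (- t)) * indicator {A..} t \<partial>lborel)"
  proof (rule nn_integral_FTC_atLeast[symmetric])
    have "((\<lambda>t::real. exp (- t)) \<longlongrightarrow> 0) at_top" by real_asymp
    from tendsto_minus[OF this] show "((\<lambda>t::real. - exp (- t)) \<longlongrightarrow> 0) at_top" by simp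
  qed (auto intro!: derivative_eq_intros)
  also have "ennreal (A powr x) * (\<integral>\<^sup>+t. ennreal (exp (- t)) * indicator {A..} t \<partial>lborel) = (\<integral>\<^sup>+t. ennreal (A powr x) * (ennreal (exp (- t)) * indicator {A..} t) \<partial>lborel)"
    by (rule nn_integral_cmult[symmetric]) simp
  also have "\<dots> \<le> (\<integral>\<^sup>+t. ennreal (indicator {0..} t * t powr (x + 1 - 1) / exp t) \<partial>lborel)"
  proof (rule nn_integral_mono)
    fix t :: real
    have "A powr x * exp (- t) \<le> t powr x / exp t" if "A \<le> t"
      using powr_mono2[OF assms(2,1) that] by (simp add: exp_minus divide_inverse mult_right_mono)
    then show "ennreal (A powr x) * (ennreal (exp (- t)) * indicator {A..} t) \<le> ennreal (indicator {0..} t * t powr (x + 1 - 1) / exp t)"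
      using assms by (auto simp: indicator_def ennreal_mult[symmetric] intro!: ennreal_leI)
  qed
  also have "\<dots> = ennreal (Gamma (x + 1))"
    using assms by (intro Gamma_conv_nn_integral_real[symmetric]) auto
  finally show ?thesis using assms by (subst (asm) ennreal_le_iff) (auto intro!: less_imp_le Gamma_real_pos)
qed

text \<open>With \<open>A powr \<delta> = 2 * \<bar>z\<bar> + 1\<close> the lower bound on Gamma
  grows geometrically with a ratio above \<open>2 * \<bar>z\<bar>\<close>, so the terms are
  dominated by powers of \<open>1 / 2\<close>.\<close>

lemma summable_mittag_leffler:
  fixes z \<delta> :: real
  assumes "0 < \<delta>"
  shows "summable (\<lambda>l. norm (z ^ l / Gamma (\<delta> * real l + 1)))"
proof (rule summable_comparison_test)
  define b where "b = 2 * \<bar>z\<bar> + 1"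
  define A where "A = b powr (1 / \<delta>)"
  have b: "0 < b" by (simp add: b_def)
  have "norm (norm (z ^ l / Gamma (\<delta> * real l + 1))) \<le> exp A * (1 / 2) ^ l" for l
  proof -
    have G: "0 < Gamma (\<delta> * real l + 1)" using assms by (intro Gamma_real_pos) (simp add: add_nonneg_pos)
    have "A powr (\<delta> * real l) = b ^ l"
      using b assms by (simp add: A_def powr_powr powr_realpow)
    then have ge: "b ^ l * exp (- A) \<le> Gamma (\<delta> * real l + 1)"
      using Gamma_ge_powr[of A "\<delta> * real l"] assms by (simp add: A_def)
    have "\<bar>z\<bar> ^ l / Gamma (\<delta> * real l + 1) \<le> \<bar>z\<bar> ^ l / (b ^ l * exp (- A))"
      using G b ge by (intro divide_left_mono mult_pos_pos) auto
    also have "\<dots> = exp A * (\<bar>z\<bar> / b) ^ l" by (simp add: exp_minus power_divide field_simps)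
    also have "\<dots> \<le> exp A * (1 / 2) ^ l"
      using b by (intro mult_left_mono power_mono) (auto simp: b_def field_simps)
    finally show ?thesis using G by (simp add: power_abs)
  qed
  then show "\<exists>N. \<forall>l\<ge>N. norm (norm (z ^ l / Gamma (\<delta> * real l + 1))) \<le> exp A * (1 / 2) ^ l" by blast
  show "summable (\<lambda>l. exp A * (1 / 2) ^ l :: real)" by (intro summable_mult summable_geometric) simp
qed

text \<open>The \<open>l\<close>-th moment of \<open>X powr (- \<delta>)\<close> is
  \<open>fact l / Gamma (\<delta> * l + 1)\<close>, so integrating the exponential series term by
  term yields the Mittag-Leffler series; its absolute convergence justifies the exchange. Positivity
  holds because the value is the mean of a positive variable.\<close>

lemma mittag_leffler_eq_laplace:
  assumes M: "prob_space M" and [measurable]: "X \<in> borel_measurable M" and pos: "AE \<omega> in M. 0 < X \<omega>"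
    and lap: "\<And>s. 0 \<le> s \<Longrightarrow> (\<integral>\<^sup>+\<omega>. ennreal (exp (- (s * X \<omega>))) \<partial>M) = ennreal (exp (- (s powr \<delta>)))"
    and \<delta>: "0 < \<delta>" and z: "0 \<le> z"
  shows "(\<integral>\<^sup>+\<omega>. ennreal (exp (- z * X \<omega> powr (- \<delta>))) \<partial>M) = ennreal (mittag_leffler \<delta> (- z))"
    and "0 < mittag_leffler \<delta> (- z)"
proof -
  interpret prob_space M by fact
  define Y where "Y \<omega> = X \<omega> powr (- \<delta>)" for \<omega>
  have Y [measurable]: "Y \<in> borel_measurable M" and Y0: "0 \<le> Y \<omega>" for \<omega> unfolding Y_def[abs_def] by auto
  have mom: "(\<integral>\<^sup>+\<omega>. ennreal (Y \<omega> ^ l) \<partial>M) = ennreal (fact l / Gamma (\<delta> * real l + 1))" for l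
  \<comment> \<open>The negative moment formula concerns positive orders only; for
    \<open>l = 0\<close> the moment is the total mass 1.\<close>
  proof (cases "l = 0")
    case True
    then show ?thesis by (simp add: emeasure_space_1)
  next
    case False
    then have l: "0 < real l" "0 < \<delta> * real l" using \<delta> by auto
    have "(\<integral>\<^sup>+\<omega>. ennreal (Y \<omega> ^ l) \<partial>M) = (\<integral>\<^sup>+\<omega>. ennreal (X \<omega> powr (- (\<delta> * real l))) \<partial>M)"
      by (rule nn_integral_cong_AE, use pos in eventually_elim) (use False in \<open>simp add: Y_def powr_power mult.commute\<close>)
    also have "\<dots> = ennreal (Gamma (\<delta> * real l / \<delta>) / (\<delta> * Gamma (\<delta> * real l)))"
      using l by (intro negative_moment_of_laplace[OF M _ pos lap \<delta>]) auto
    also have "Gamma (\<delta> * real l / \<delta>) / (\<delta> * Gamma (\<delta> * real l)) = fact l / Gamma (\<delta> * real l + 1)"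
    proof -
      have "Gamma (\<delta> * real l + 1) = \<delta> * real l * Gamma (\<delta> * real l)"
        using l by (intro Gamma_plus1) (auto elim!: nonpos_Ints_cases)
      moreover have "fact l = real l * Gamma (real l)"
      proof -
        have "Gamma (real l + 1) = real l * Gamma (real l)"
          using l by (intro Gamma_plus1) (auto elim!: nonpos_Ints_cases)
        then show ?thesis using Gamma_fact[of l, where 'a = real] by (simp add: add.commute)
      qed
      moreover have "0 < Gamma (\<delta> * real l)" using l by (intro Gamma_real_pos)
      ultimately show ?thesis using l \<delta> by simp
    qed
    finally show ?thesis .
  qed
  have G: "0 < Gamma (\<delta> * real l + 1)" for l using \<delta> by (intro Gamma_real_pos) (simp add: add_nonneg_pos)
  have intY: "integrable M (\<lambda>\<omega>. Y \<omega> ^ l)" for l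
    using mom[of l] Y0 by (intro integrableI_nonneg) auto
  have EY: "(\<integral>\<omega>. Y \<omega> ^ l \<partial>M) = fact l / Gamma (\<delta> * real l + 1)" for l
    using mom[of l] Y0 G[of l] by (subst integral_eq_nn_integral) (auto simp: less_imp_le)
  let ?f = "\<lambda>l \<omega>. (- z) ^ l / fact l * Y \<omega> ^ l"
  have exp_term: "(w * y) ^ l /\<^sub>R fact l = w ^ l / fact l * y ^ l" for w y :: real and l
    by (simp add: power_mult_distrib field_simps)
  have expY: "(\<lambda>l. ?f l \<omega>) sums exp (- z * Y \<omega>)" for \<omega>
    using exp_converges[of "- z * Y \<omega>"] unfolding exp_term .
  have int_f: "integrable M (?f l)" for l using intY by simp
  have Ef: "(\<integral>\<omega>. ?f l \<omega> \<partial>M) = (- z) ^ l / Gamma (\<delta> * real l + 1)" for l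
    by (simp add: EY)
  have "(\<integral>\<omega>. (\<Sum>l. ?f l \<omega>) \<partial>M) = (\<Sum>l. \<integral>\<omega>. ?f l \<omega> \<partial>M)"
  proof (rule integral_suminf[OF int_f])
    show "AE \<omega> in M. summable (\<lambda>l. norm (?f l \<omega>))"
    proof (intro AE_I2)
      fix \<omega>
      have "summable (\<lambda>l. norm ((- z * Y \<omega>) ^ l /\<^sub>R fact l))" by (rule summable_norm_exp)
      then show "summable (\<lambda>l. norm (?f l \<omega>))" unfolding exp_term .
    qed
    have "(\<integral>\<omega>. norm (?f l \<omega>) \<partial>M) = norm ((- z) ^ l / Gamma (\<delta> * real l + 1))" for l
    proof -
      have "norm (?f l \<omega>) = norm ((- z) ^ l / fact l) * Y \<omega> ^ l" for \<omega>
        using Y0[of \<omega>] by (simp only: real_norm_def abs_mult[of _ "Y \<omega> ^ l"] power_abs abs_of_nonneg zero_le_power)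
      then have "(\<integral>\<omega>. norm (?f l \<omega>) \<partial>M) = norm ((- z) ^ l / fact l) * (\<integral>\<omega>. Y \<omega> ^ l \<partial>M)"
        by (simp only: integral_mult_right_zero)
      then show ?thesis using G[of l] by (simp add: EY abs_mult)
    qed
    then show "summable (\<lambda>l. \<integral>\<omega>. norm (?f l \<omega>) \<partial>M)"
      using summable_mittag_leffler[OF \<delta>, of "- z"] by simp
  qed
  moreover have "(\<Sum>l. ?f l \<omega>) = exp (- z * Y \<omega>)" for \<omega> using expY[of \<omega>] by (rule sums_unique[symmetric])
  ultimately have E: "(\<integral>\<omega>. exp (- z * Y \<omega>) \<partial>M) = mittag_leffler \<delta> (- z)"
    unfolding mittag_leffler_def Ef by simp
  have int: "integrable M (\<lambda>\<omega>. exp (- z * Y \<omega>))"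
    using z Y0 by (intro integrable_const_bound[where B = 1]) auto
  show eq: "(\<integral>\<^sup>+\<omega>. ennreal (exp (- z * X \<omega> powr (- \<delta>))) \<partial>M) = ennreal (mittag_leffler \<delta> (- z))"
    unfolding E[symmetric] Y_def[symmetric] using int by (intro nn_integral_eq_integral) auto
  show "0 < mittag_leffler \<delta> (- z)"
  proof (rule ccontr)
    assume "\<not> 0 < mittag_leffler \<delta> (- z)"
    then have "(\<integral>\<^sup>+\<omega>. ennreal (exp (- z * X \<omega> powr (- \<delta>))) \<partial>M) = 0" unfolding eq by (simp add: ennreal_neg)
    then have "AE \<omega> in M. False" by (subst (asm) nn_integral_0_iff_AE) auto
    then show False by simp
  qed
qed

lemma mittag_leffler_measurable [measurable]: "mittag_leffler \<delta> \<in> borel_measurable borel"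
  unfolding mittag_leffler_def[abs_def] by measurable

section \<open>From Poisson processes and conditional laws to laws on sequences\<close>

lemma stable_law_of_ranked_stable_points:
  assumes J: "ranked_stable_points \<gamma> N J" and \<gamma>: "0 < \<gamma>" "\<gamma> < 1"
  shows "stable_law \<gamma> (distr N seq_space (\<lambda>\<omega> i. J i \<omega>))"
proof -
  have pp: "poisson_process N (stable_intensity \<gamma>) J" and dec: "AE \<omega> in N. \<forall>i. J (Suc i) \<omega> < J i \<omega>"
    using J by (auto simp: ranked_stable_points_def)
  interpret prob_space N using pp by (simp add: poisson_process_def)
  have [measurable]: "J i \<in> borel_measurable N" for i using pp by (simp add: poisson_process_def)
  have Jm [measurable]: "(\<lambda>\<omega> i. J i \<omega>) \<in> measurable N seq_space"
    by (rule measurable_PiM_single') auto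
  \<comment> \<open>The intensity is null on \<open>{..0}\<close>, so the count there is a Poisson
    variable of mean 0 and almost surely no point is nonpositive.\<close>
  have pos: "AE \<omega> in N. \<forall>i. 0 < J i \<omega>"
  proof -
    have z: "emeasure (stable_intensity \<gamma>) {..0} = 0"
    proof -
      have "emeasure (stable_intensity \<gamma>) {..0} = (\<integral>\<^sup>+y. indicator {..0} y \<partial>stable_intensity \<gamma>)" by simp
      also have "\<dots> = (\<integral>\<^sup>+y. ennreal (\<gamma> / Gamma (1 - \<gamma>) * y powr (- \<gamma> - 1)) * indicator {..0} y * indicator {0<..} y \<partial>lborel)"
        by (rule nn_integral_stable_intensity) simp
      also have "\<dots> = (\<integral>\<^sup>+y. 0 \<partial>(lborel :: real measure))"
        by (rule nn_integral_cong) (auto simp: indicator_def)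
      finally show ?thesis by simp
    qed
    have "measure N {\<omega> \<in> space N. point_count (\<lambda>i. J i \<omega>) {..0} = of_nat 0} = 1"
    proof -
      have "\<forall>k::nat. measure N {\<omega> \<in> space N. point_count (\<lambda>i. J i \<omega>) {..0} = of_nat k}
        = exp (- measure (stable_intensity \<gamma>) {..0}) * measure (stable_intensity \<gamma>) {..0} ^ k / fact k"
        using pp z unfolding poisson_process_def by auto
      from this[rule_format, of 0] show ?thesis using z by (simp add: measure_def)
    qed
    from AE_prob_1[OF this] show ?thesis
    proof eventually_elim
      case (elim \<omega>)
      then have "finite {i. J i \<omega> \<in> {..0}}" "{i. J i \<omega> \<in> {..0}} = {}"
        by (auto simp: point_count_def emeasure_count_space split: if_splits)
      then show ?case by (auto simp: not_le[symmetric])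
    qed
  qed
  show ?thesis
  proof (rule stable_law.intro)
    show "prob_space (distr N seq_space (\<lambda>\<omega> i. J i \<omega>))" by (rule prob_space_distr) fact
    have "Measurable.pred seq_space (\<lambda>x::nat \<Rightarrow> real. \<forall>i. 0 < x i)"
      by (intro pred_intros_countable) (simp add: pred_def borel_measurable_less)
    then show "AE x in distr N seq_space (\<lambda>\<omega> i. J i \<omega>). \<forall>i. 0 < x i"
      using pos by (subst AE_distr_iff) (auto simp: pred_def)
    have "Measurable.pred seq_space (\<lambda>x::nat \<Rightarrow> real. decseq x)"
      unfolding decseq_Suc_iff by (intro pred_intros_countable) (simp add: pred_def borel_measurable_le)
    moreover have "AE \<omega> in N. decseq (\<lambda>i. J i \<omega>)"
      using dec by eventually_elim (auto simp: decseq_Suc_iff less_imp_le)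
    ultimately show "AE x in distr N seq_space (\<lambda>\<omega> i. J i \<omega>). decseq x"
      by (subst AE_distr_iff) (auto simp: pred_def)
    fix g :: "real \<Rightarrow> ennreal" assume [measurable]: "g \<in> borel_measurable borel"
    \<comment> \<open>An exhaustion of the whole line by sets of finite intensity: infinite mass
      accumulates only to the right of 0, so the null set \<open>{..0}\<close> is included from the
      start.\<close>
    define S where "S n = {..0} \<union> {1 / real (Suc n)..}" for n
    have "(\<integral>\<^sup>+x. ennreal (nexp (\<Sum>i. g (x i))) \<partial>distr N seq_space (\<lambda>\<omega> i. J i \<omega>)) = (\<integral>\<^sup>+\<omega>. ennreal (nexp (\<integral>\<^sup>+i. g (J i \<omega>) \<partial>count_space UNIV)) \<partial>N)"
      by (subst nn_integral_distr) (simp_all add: nn_integral_count_space_nat)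
    also have "\<dots> = ennreal (nexp (\<integral>\<^sup>+y. ennreal (1 - nexp (g y)) \<partial>stable_intensity \<gamma>))"
    proof (rule poisson_process_laplace_functional[OF pp])
      show "incseq S"
        unfolding incseq_Suc_iff S_def by (auto simp: frac_le intro: order_trans[rotated])
      show "(\<Union>n. S n) = UNIV"
      proof safe
        fix x :: real
        show "x \<in> (\<Union>n. S n)"
        proof (cases "0 < x")
          case True
          then obtain n where "1 / real (Suc n) < x" using nat_approx_posE by blast
          then show ?thesis by (auto simp: S_def intro: less_imp_le)
        qed (auto simp: S_def)
      qed simp
      show "S n \<in> sets borel" for n by (simp add: S_def)
      show "emeasure (stable_intensity \<gamma>) (S n) < \<infinity>" for n
      proof -
        have "emeasure (stable_intensity \<gamma>) (S n) = (\<integral>\<^sup>+y. indicator (S n) y \<partial>stable_intensity \<gamma>)" by (simp add: S_def)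
        also have "\<dots> = (\<integral>\<^sup>+y. indicator {1 / real (Suc n)..} y \<partial>stable_intensity \<gamma>)"
          unfolding S_def
          by (subst (1 2) nn_integral_stable_intensity) (auto intro!: nn_integral_cong simp: indicator_def)
        also have "\<dots> < \<infinity>"
          using emeasure_stable_intensity_atLeast[OF \<gamma>, of "1 / real (Suc n)"] by simp
        finally show ?thesis .
      qed
    qed simp_all
    finally show "(\<integral>\<^sup>+x. ennreal (nexp (\<Sum>i. g (x i))) \<partial>distr N seq_space (\<lambda>\<omega> i. J i \<omega>))
      = ennreal (nexp (\<integral>\<^sup>+y. ennreal (1 - nexp (g y)) \<partial>stable_intensity \<gamma>))" .
  qed (use \<gamma> in simp_all)
qed

text \<open>The definition of the regular conditional law is the case of an indicator
  \<open>G\<close>. Read as an equality of two measures on the line of total masses, it extends to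
  every nonnegative \<open>G\<close>.\<close>

lemma nn_integral_regular_conditional:
  fixes J :: "nat \<Rightarrow> 'a \<Rightarrow> real"
  assumes K: "regular_conditional_PD N J K" and "prob_space N" and Jm: "\<And>i. J i \<in> borel_measurable N"
    and A: "A \<in> sets seq_space" and [measurable]: "G \<in> borel_measurable borel"
  shows "(\<integral>\<^sup>+t. emeasure (K t) A * G t \<partial>distr N borel (total_mass J))
    = (\<integral>\<^sup>+\<omega>. indicator A (normalized J \<omega>) * G (total_mass J \<omega>) \<partial>N)"
proof -
  note [measurable] = Jm A
  have Kalg: "K \<in> measurable borel (subprob_algebra seq_space)"
    using K by (auto simp: regular_conditional_PD_def intro: measurable_prob_algebraD)
  have [measurable]: "(\<lambda>t. emeasure (K t) A) \<in> borel_measurable borel"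
    by (rule measurable_emeasure_kernel[OF Kalg A])
  have [measurable]: "total_mass J \<in> borel_measurable N" unfolding total_mass_def[abs_def] by measurable
  have [measurable]: "normalized J \<in> measurable N seq_space"
    by (rule measurable_PiM_single') (auto simp: normalized_def)
  have "density (distr N borel (total_mass J)) (\<lambda>t. emeasure (K t) A) = distr (density N (\<lambda>\<omega>. indicator A (normalized J \<omega>))) borel (total_mass J)"
  proof (rule measure_eqI)
    fix B assume "B \<in> sets (density (distr N borel (total_mass J)) (\<lambda>t. emeasure (K t) A))"
    then have B [measurable]: "B \<in> sets borel" by simp
    have "emeasure (density (distr N borel (total_mass J)) (\<lambda>t. emeasure (K t) A)) B = emeasure N {\<omega> \<in> space N. normalized J \<omega> \<in> A \<and> total_mass J \<omega> \<in> B}"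
      using K A B by (simp add: emeasure_density regular_conditional_PD_def)
    also have "\<dots> = (\<integral>\<^sup>+\<omega>. indicator {\<omega> \<in> space N. normalized J \<omega> \<in> A \<and> total_mass J \<omega> \<in> B} \<omega> \<partial>N)"
      by (rule nn_integral_indicator[symmetric]) measurable
    also have "\<dots> = (\<integral>\<^sup>+\<omega>. indicator A (normalized J \<omega>) * indicator (total_mass J -` B \<inter> space N) \<omega> \<partial>N)"
      by (rule nn_integral_cong) (auto split: split_indicator)
    also have "\<dots> = emeasure (distr (density N (\<lambda>\<omega>. indicator A (normalized J \<omega>))) borel (total_mass J)) B"
      by (subst emeasure_distr) (simp_all add: emeasure_density)
    finally show "emeasure (density (distr N borel (total_mass J)) (\<lambda>t. emeasure (K t) A)) B
      = emeasure (distr (density N (\<lambda>\<omega>. indicator A (normalized J \<omega>))) borel (total_mass J)) B" .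
  qed simp
  then have "(\<integral>\<^sup>+t. G t \<partial>density (distr N borel (total_mass J)) (\<lambda>t. emeasure (K t) A))
     = (\<integral>\<^sup>+t. G t \<partial>distr (density N (\<lambda>\<omega>. indicator A (normalized J \<omega>))) borel (total_mass J))" by simp
  then show ?thesis by (simp add: nn_integral_density nn_integral_distr)
qed

lemma density_of_total_mass_measurable:
  assumes "density_of_total_mass N J f"
  shows "f \<in> borel_measurable borel"
proof -
  have [measurable]: "(\<lambda>t. ennreal (f t)) \<in> borel_measurable lborel" and f: "\<And>t. 0 \<le> f t"
    using assms by (auto simp: density_of_total_mass_def distributed_def)
  have "(\<lambda>t. enn2real (ennreal (f t))) \<in> borel_measurable lborel" by measurable
  then show ?thesis by (simp add: f)
qed

text \<open>Conditioning on the total and then mixing with the weight \<open>h\<close> amounts to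
  reweighting the unconditioned points by \<open>h\<close> of their total. This eliminates the
  conditional kernel, and with it the choice of a version.\<close>

lemma PK_eq_distr:
  fixes J :: "nat \<Rightarrow> 'a \<Rightarrow> real"
  assumes J: "ranked_stable_points \<gamma> N J" and \<gamma>: "0 < \<gamma>" "\<gamma> < 1"
    and f: "density_of_total_mass N J f" and K: "regular_conditional_PD N J K"
    and [measurable]: "h \<in> borel_measurable borel" and h: "\<And>t. 0 < t \<Longrightarrow> 0 \<le> h t"
  shows "PK K f h = distr (density (distr N seq_space (\<lambda>\<omega> i. J i \<omega>)) (\<lambda>x. ennreal (h (suminf x)))) seq_space normalize_seq"
proof (rule measure_eqI)
  interpret stable_law \<gamma> "distr N seq_space (\<lambda>\<omega> i. J i \<omega>)"
    by (rule stable_law_of_ranked_stable_points[OF J \<gamma>])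
  have "prob_space N" and Jm [measurable]: "\<And>i. J i \<in> borel_measurable N"
    using J by (auto simp: ranked_stable_points_def poisson_process_def)
  have [measurable]: "(\<lambda>\<omega> i. J i \<omega>) \<in> measurable N seq_space" by (rule measurable_PiM_single') auto
  have [measurable]: "total_mass J \<in> borel_measurable N" unfolding total_mass_def[abs_def] by measurable
  have [measurable]: "f \<in> borel_measurable borel" by (rule density_of_total_mass_measurable[OF f])
  have f0: "0 \<le> f t" for t using f by (simp add: density_of_total_mass_def)
  have law: "distr N borel (total_mass J) = density lborel (\<lambda>t. ennreal (f t))"
    using f by (auto simp: density_of_total_mass_def distributed_def distr_def)
  have Kalg: "K \<in> measurable borel (subprob_algebra seq_space)"
    using K by (auto simp: regular_conditional_PD_def intro: measurable_prob_algebraD)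
  define d where "d t = ennreal (indicator {0<..} t * (h t * f t))" for t
  have [measurable]: "d \<in> borel_measurable borel" unfolding d_def[abs_def] by measurable
  have Kalg': "K \<in> measurable (density lborel d) (subprob_algebra seq_space)"
    using Kalg by (simp cong: measurable_cong_sets)
  have PK: "PK K f h = bind (density lborel d) K" unfolding PK_def d_def ..
  have sets_PK: "sets (PK K f h) = sets seq_space"
    unfolding PK by (rule sets_bind[OF sets_kernel[OF Kalg']]) simp_all
  show "sets (PK K f h) = sets (distr (density (distr N seq_space (\<lambda>\<omega> i. J i \<omega>)) (\<lambda>x. ennreal (h (suminf x)))) seq_space normalize_seq)"
    by (simp add: sets_PK)
  fix A assume "A \<in> sets (PK K f h)"
  then have A [measurable]: "A \<in> sets seq_space" by (simp add: sets_PK)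
  have [measurable]: "(\<lambda>t. emeasure (K t) A) \<in> borel_measurable borel"
    by (rule measurable_emeasure_kernel[OF Kalg A])
  have "emeasure (PK K f h) A = (\<integral>\<^sup>+t. emeasure (K t) A \<partial>density lborel d)"
    unfolding PK by (rule emeasure_bind[OF _ Kalg' A]) simp
  also have "\<dots> = (\<integral>\<^sup>+t. ennreal (f t) * (emeasure (K t) A * (ennreal (h t) * indicator {0<..} t)) \<partial>lborel)"
    by (subst nn_integral_density) (auto intro!: nn_integral_cong simp: d_def indicator_def ennreal_mult h f0 mult_ac)
  also have "\<dots> = (\<integral>\<^sup>+t. emeasure (K t) A * (ennreal (h t) * indicator {0<..} t) \<partial>distr N borel (total_mass J))"
    unfolding law by (subst nn_integral_density) auto
  also have "\<dots> = (\<integral>\<^sup>+\<omega>. indicator A (normalized J \<omega>) * (ennreal (h (total_mass J \<omega>)) * indicator {0<..} (total_mass J \<omega>)) \<partial>N)"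
    by (rule nn_integral_regular_conditional[OF K \<open>prob_space N\<close> Jm A]) simp
  also have "\<dots> = (\<integral>\<^sup>+x. indicator A (normalize_seq x) * (ennreal (h (suminf x)) * indicator {0<..} (suminf x)) \<partial>distr N seq_space (\<lambda>\<omega> i. J i \<omega>))"
  proof -
    have "normalized J \<omega> = normalize_seq (\<lambda>i. J i \<omega>)" "total_mass J \<omega> = suminf (\<lambda>i. J i \<omega>)" for \<omega>
      by (simp_all add: normalized_def normalize_seq_def total_mass_def)
    then show ?thesis by (subst nn_integral_distr) (simp_all only: measurable_\<mu>, measurable)
  qed
  also have "\<dots> = (\<integral>\<^sup>+x. ennreal (h (suminf x)) * indicator A (normalize_seq x) \<partial>distr N seq_space (\<lambda>\<omega> i. J i \<omega>))"
    by (rule nn_integral_cong_AE, use AE_regular in eventually_elim) (simp add: regular_seqD(4) mult.commute)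
  also have "\<dots> = emeasure (distr (density (distr N seq_space (\<lambda>\<omega> i. J i \<omega>)) (\<lambda>x. ennreal (h (suminf x)))) seq_space normalize_seq) A"
  proof -
    have "normalize_seq -` A \<in> sets seq_space"
      using measurable_sets[OF normalize_seq_measurable A] by (simp add: space_PiM)
    then show ?thesis by (subst emeasure_distr) (simp_all add: emeasure_density space_PiM indicator_vimage)
  qed
  finally show "emeasure (PK K f h) A = emeasure (distr (density (distr N seq_space (\<lambda>\<omega> i. J i \<omega>)) (\<lambda>x. ennreal (h (suminf x)))) seq_space normalize_seq) A" .
qed

section \<open>Fragmentation of Poisson-Kingman laws\<close>

lemma distr_PiM_componentwise:
  assumes M: "\<And>i. prob_space (M i)" and [measurable]: "\<And>i. \<phi> i \<in> measurable (M i) (N i)"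
  shows "distr (PiM UNIV M) (PiM UNIV N) (\<lambda>y j. \<phi> j (y j)) = PiM UNIV (\<lambda>j. distr (M j) (N j) (\<phi> j))"
proof -
  have D: "prob_space (distr (M j) (N j) (\<phi> j))" for j by (rule prob_space.prob_space_distr[OF M]) simp
  interpret D: product_prob_space "\<lambda>j. distr (M j) (N j) (\<phi> j)" UNIV
    by (intro product_prob_spaceI D)
  have \<phi>m [measurable]: "(\<lambda>y j. \<phi> j (y j)) \<in> measurable (PiM UNIV M) (PiM UNIV N)"
    by (rule measurable_PiM_single') (auto simp: space_PiM PiE_iff intro!: measurable_space[OF assms(2)])
  show ?thesis
  proof (rule D.PiM_eq)
    show "sets (distr (PiM UNIV M) (PiM UNIV N) (\<lambda>y j. \<phi> j (y j))) = sets (PiM UNIV (\<lambda>j. distr (M j) (N j) (\<phi> j)))"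
      by (simp, intro sets_PiM_cong) auto
    fix F A assume F: "finite F" "F \<subseteq> UNIV" and A: "\<And>j. j \<in> F \<Longrightarrow> A j \<in> sets (distr (M j) (N j) (\<phi> j))"
    have A' [measurable]: "A j \<in> sets (N j)" if "j \<in> F" for j using A[OF that] by simp
    have emb: "prod_emb UNIV (\<lambda>j. distr (M j) (N j) (\<phi> j)) F (Pi\<^sub>E F A) = prod_emb UNIV N F (Pi\<^sub>E F A)"
      by (simp add: prod_emb_def)
    have "emeasure (distr (PiM UNIV M) (PiM UNIV N) (\<lambda>y j. \<phi> j (y j))) (prod_emb UNIV N F (Pi\<^sub>E F A))
      = emeasure (PiM UNIV M) ((\<lambda>y j. \<phi> j (y j)) -` prod_emb UNIV N F (Pi\<^sub>E F A) \<inter> space (PiM UNIV M))"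
      using F A' by (intro emeasure_distr) (auto intro!: sets_PiM_I)
    also have "(\<lambda>y j. \<phi> j (y j)) -` prod_emb UNIV N F (Pi\<^sub>E F A) \<inter> space (PiM UNIV M) = prod_emb UNIV M F (\<Pi>\<^sub>E j\<in>F. \<phi> j -` A j \<inter> space (M j))"
      using measurable_space[OF assms(2)] by (auto simp: prod_emb_def space_PiM PiE_iff)
    also have "emeasure (PiM UNIV M) \<dots> = (\<Prod>j\<in>F. emeasure (M j) (\<phi> j -` A j \<inter> space (M j)))"
      using F A' by (intro emeasure_PiM_emb M) (auto intro!: measurable_sets[OF assms(2)])
    also have "\<dots> = (\<Prod>j\<in>F. emeasure (distr (M j) (N j) (\<phi> j)) (A j))"
      using A' by (intro prod.cong refl) (simp add: emeasure_distr)
    finally show "emeasure (distr (PiM UNIV M) (PiM UNIV N) (\<lambda>y j. \<phi> j (y j))) (prod_emb UNIV (\<lambda>j. distr (M j) (N j) (\<phi> j)) F (Pi\<^sub>E F A))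
      = (\<Prod>j\<in>F. emeasure (distr (M j) (N j) (\<phi> j)) (A j))" unfolding emb .
  qed
qed

text \<open>
  A functional recovering the \<open>\<alpha>\<close>-diversity from the atoms: by Karlin's theorem the number of
  distinct values in a sample is governed by the number of atoms above a small level.
\<close>

definition diversity_of :: "real \<Rightarrow> (nat \<Rightarrow> real) \<Rightarrow> real" where
  "diversity_of \<alpha> p = Gamma (1 - \<alpha>) * lim (\<lambda>m. (1 / real (Suc m)) powr \<alpha> * tail_count p (1 / real (Suc m)))"

text \<open>A Cauchy condition along the levels \<open>1 / (m + 1)\<close> encodes convergence as a
  measurable event, which can be carried from one random partition to another of the same
  law.\<close>

definition regularly_varying_seq :: "real \<Rightarrow> (nat \<Rightarrow> real) \<Rightarrow> bool" where
  "regularly_varying_seq \<alpha> p \<longleftrightarrow> regular_seq p \<and> suminf p = 1 \<and>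
     Cauchy (\<lambda>m. (1 / real (Suc m)) powr \<alpha> * tail_count p (1 / real (Suc m)))"

lemma diversity_of_measurable [measurable]: "diversity_of \<alpha> \<in> borel_measurable seq_space"
  unfolding diversity_of_def[abs_def] by measurable

lemma pred_regularly_varying_seq [measurable]: "Measurable.pred seq_space (regularly_varying_seq \<alpha>)"
proof -
  have [measurable]: "Measurable.pred seq_space (\<lambda>p. Cauchy (\<lambda>m. (1 / real (Suc m)) powr \<alpha> * tail_count p (1 / real (Suc m))))"
    unfolding pred_def by (rule sets_Collect_Cauchy) simp
  show ?thesis unfolding regularly_varying_seq_def[abs_def] by measurable
qed

text \<open>Convergence along the levels \<open>1 / (m + 1)\<close> extends to all small levels by
  monotonicity; the sampling theorem then gives the limit, whose factor
  \<open>Gamma (1 - \<alpha>)\<close> is built into \<open>diversity_of\<close>.\<close>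

lemma regularly_varying_diversity:
  assumes "regularly_varying_seq \<alpha> p" and \<alpha>: "0 < \<alpha>" "\<alpha> < 1"
  shows "AE x in PiM UNIV (\<lambda>_::nat. index_law p). (\<lambda>n. real n powr (- \<alpha>) * real (card (x ` {..<n}))) \<longlonglongrightarrow> diversity_of \<alpha> p"
proof -
  interpret index_sampling p using assms by unfold_locales (auto simp: regularly_varying_seq_def)
  let ?c = "lim (\<lambda>m. (1 / real (Suc m)) powr \<alpha> * tail_count p (1 / real (Suc m)))"
  have "(\<lambda>m. (1 / real (Suc m)) powr \<alpha> * tail_count p (1 / real (Suc m))) \<longlonglongrightarrow> ?c"
    using assms(1) by (simp add: regularly_varying_seq_def Cauchy_convergent_iff convergent_LIMSEQ_iff)
  then have "((\<lambda>s. s powr \<alpha> * tail_count p s) \<longlongrightarrow> ?c) (at_right 0)"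
  proof (rule regular_variation_from_sequence[rotated 6])
    show "decseq (\<lambda>m. 1 / real (Suc m))" by (auto simp: decseq_def frac_le)
    show "(\<lambda>m. 1 / real (Suc m)) \<longlonglongrightarrow> 0" by real_asymp
    show "(\<lambda>m. 1 / real (Suc (Suc m)) / (1 / real (Suc m))) \<longlonglongrightarrow> 1" by real_asymp
  qed (use \<alpha> regular_seqD(6)[OF p] in \<open>auto intro: tail_count_antimono tail_count_nonneg\<close>)
  from AE_distinct_values_asymptotics[OF \<alpha> this] show ?thesis
    unfolding samples_def distinct_values_def diversity_of_def by (simp only: mult.commute)
qed

context stable_law
begin

text \<open>Normalizing by the total \<open>T\<close> moves the level \<open>s\<close> to
  \<open>s * T\<close>, which multiplies the limit of the scaled counts by
  \<open>T powr (- \<gamma>)\<close>. The constant \<open>1 / Gamma (1 - \<gamma>)\<close> of the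
  strong law is cancelled by the factor in \<open>diversity_of\<close>.\<close>

lemma AE_diversity_of_normalize:
  "AE x in \<mu>. regularly_varying_seq \<gamma> (normalize_seq x) \<and> diversity_of \<gamma> (normalize_seq x) = suminf x powr (- \<gamma>)"
  using AE_regular AE_tail_count
proof eventually_elim
  case (elim x)
  let ?T = "suminf x" and ?C = "1 / Gamma (1 - \<gamma>)"
  have T: "0 < ?T" by (rule regular_seqD(4)[OF elim(1)])
  have tc: "tail_count (normalize_seq x) s = tail_count x (s * ?T)" for s
  proof -
    have "{i. normalize_seq x i \<in> {s..}} = {i. x i \<in> {s * ?T..}}"
      using T by (auto simp: normalize_seq_def pos_le_divide_eq)
    then show ?thesis by (simp add: tail_count_def point_count_def)
  qed
  have "filterlim (\<lambda>m. 1 / real (Suc m) * t) (at_right 0) sequentially" if "0 < t" for t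
    using that by real_asymp
  note this[OF T]
  from tendsto_mult_left[OF filterlim_compose[OF elim(2) this], of "?T powr (- \<gamma>)"]
  have "(\<lambda>m. ?T powr (- \<gamma>) * ((1 / real (Suc m) * ?T) powr \<gamma> * tail_count x (1 / real (Suc m) * ?T))) \<longlonglongrightarrow> ?T powr (- \<gamma>) * ?C" .
  moreover have "?T powr (- \<gamma>) * ((1 / real (Suc m) * ?T) powr \<gamma> * tail_count x (1 / real (Suc m) * ?T))
    = (1 / real (Suc m)) powr \<gamma> * tail_count (normalize_seq x) (1 / real (Suc m))" for m
  proof -
    have "(1 / real (Suc m) * ?T) powr \<gamma> = (1 / real (Suc m)) powr \<gamma> * ?T powr \<gamma>"
      using T by (intro powr_mult)
    moreover have "?T powr (- \<gamma>) * ?T powr \<gamma> = 1" using T by (simp add: powr_add[symmetric])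
    ultimately show ?thesis unfolding tc by (simp add: mult_ac)
  qed
  ultimately have lim: "(\<lambda>m. (1 / real (Suc m)) powr \<gamma> * tail_count (normalize_seq x) (1 / real (Suc m))) \<longlonglongrightarrow> ?T powr (- \<gamma>) * ?C"
    by simp
  have G: "0 < Gamma (1 - \<gamma>)" using index by (simp add: Gamma_real_pos)
  show ?case
    using normalize_seq_regular[OF elim(1)] LIMSEQ_imp_Cauchy[OF lim] limI[OF lim] G
    by (simp add: regularly_varying_seq_def diversity_of_def)
qed

text \<open>The substitution \<open>t = s powr (- 1 / \<gamma>)\<close> has exactly the Jacobian
  contained in \<open>g_dens\<close>, and carries the weight \<open>h\<close> along.\<close>

lemma distr_inverse_power:
  fixes f h :: "real \<Rightarrow> real"
  assumes law: "distr \<mu> borel suminf = density lborel (\<lambda>t. ennreal (f t))" and f0: "\<And>t. 0 \<le> f t"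
    and [measurable]: "f \<in> borel_measurable borel" "h \<in> borel_measurable borel" and h: "\<And>t. 0 < t \<Longrightarrow> 0 \<le> h t"
  shows "distr (density \<mu> (\<lambda>x. ennreal (h (suminf x)))) borel (\<lambda>x. suminf x powr (- \<gamma>))
    = density lborel (\<lambda>s. ennreal (h (s powr (- 1 / \<gamma>)) * g_dens \<gamma> f s))"
proof (rule measure_eqI)
  fix B assume "B \<in> sets (distr (density \<mu> (\<lambda>x. ennreal (h (suminf x)))) borel (\<lambda>x. suminf x powr (- \<gamma>)))"
  then have B [measurable]: "B \<in> sets borel" by simp
  have [measurable]: "g_dens \<gamma> f \<in> borel_measurable borel" unfolding g_dens_def[abs_def] by measurable
  let ?F = "\<lambda>t. ennreal (h t) * indicator B (t powr (- \<gamma>))"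
  have "emeasure (distr (density \<mu> (\<lambda>x. ennreal (h (suminf x)))) borel (\<lambda>x. suminf x powr (- \<gamma>))) B
    = (\<integral>\<^sup>+x. ?F (suminf x) \<partial>\<mu>)"
  proof -
    have "(\<lambda>x. suminf x powr (- \<gamma>)) -` B \<in> sets seq_space"
      using measurable_sets[of "\<lambda>x. suminf x powr (- \<gamma>)" seq_space borel B] by (simp add: space_PiM)
    then show ?thesis by (subst emeasure_distr) (simp_all add: emeasure_density indicator_vimage)
  qed
  also have "\<dots> = (\<integral>\<^sup>+x. ?F (suminf x) * indicator {0<..} (suminf x) \<partial>\<mu>)"
    by (rule nn_integral_cong_AE, use AE_regular in eventually_elim) (simp add: regular_seqD(4))
  also have "\<dots> = (\<integral>\<^sup>+t. ?F t * indicator {0<..} t \<partial>distr \<mu> borel suminf)"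
    by (subst nn_integral_distr) simp_all
  also have "\<dots> = (\<integral>\<^sup>+t. (ennreal (f t) * ?F t) * indicator {0<..} t \<partial>lborel)"
    unfolding law by (subst nn_integral_density) (simp_all add: mult.assoc)
  also have "\<dots> = (\<integral>\<^sup>+s. (ennreal (f (s powr (- 1 / \<gamma>))) * ?F (s powr (- 1 / \<gamma>))) * (ennreal (\<bar>- 1 / \<gamma>\<bar> * s powr (- 1 / \<gamma> - 1)) * indicator {0<..} s) \<partial>lborel)"
    using index by (intro nn_integral_powr_substitution) auto
  also have "\<dots> = (\<integral>\<^sup>+s. ennreal (h (s powr (- 1 / \<gamma>)) * g_dens \<gamma> f s) * indicator B s \<partial>lborel)"
  proof (rule nn_integral_cong)
    fix s :: real
    show "(ennreal (f (s powr (- 1 / \<gamma>))) * ?F (s powr (- 1 / \<gamma>))) * (ennreal (\<bar>- 1 / \<gamma>\<bar> * s powr (- 1 / \<gamma> - 1)) * indicator {0<..} s)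
      = ennreal (h (s powr (- 1 / \<gamma>)) * g_dens \<gamma> f s) * indicator B s"
    proof (cases "0 < s")
      case True
      define u k where "u = s powr (- 1 / \<gamma>)" and "k = \<bar>- 1 / \<gamma>\<bar> * s powr (- 1 / \<gamma> - 1)"
      have u: "u powr (- \<gamma>) = s" "0 < u" "0 \<le> k" using True index by (simp_all add: u_def k_def powr_powr)
      have "h u * g_dens \<gamma> f s = f u * h u * k"
        using True index by (simp add: g_dens_def u_def k_def)
      then have "ennreal (h u * g_dens \<gamma> f s) = ennreal (f u * h u * k)" by (simp only:)
      also have "\<dots> = ennreal (f u) * ennreal (h u) * ennreal k"
        using u f0[of u] h[OF u(2)] by (simp add: ennreal_mult)
      finally have "ennreal (h u * g_dens \<gamma> f s) = ennreal (f u) * ennreal (h u) * ennreal k" .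
      then show ?thesis
        using True unfolding u_def[symmetric] k_def[symmetric] u(1) by (simp add: mult_ac)
    qed (simp add: g_dens_def)
  qed
  also have "\<dots> = emeasure (density lborel (\<lambda>s. ennreal (h (s powr (- 1 / \<gamma>)) * g_dens \<gamma> f s))) B"
    by (subst emeasure_density) simp_all
  finally show "emeasure (distr (density \<mu> (\<lambda>x. ennreal (h (suminf x)))) borel (\<lambda>x. suminf x powr (- \<gamma>))) B
    = emeasure (density lborel (\<lambda>s. ennreal (h (s powr (- 1 / \<gamma>)) * g_dens \<gamma> f s))) B" .
qed simp

end

section \<open>Transfer to an arbitrary probability space\<close>

lemma frag_operator_indep_product:
  assumes M: "prob_space M" and FO: "frag_operator_indep M \<alpha> \<theta> V Q"
  shows "distr M (seq_space \<Otimes>\<^sub>M PiM UNIV (\<lambda>_. seq_space)) (\<lambda>\<omega>. (V \<omega>, \<lambda>j. Q j \<omega>))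
      = distr M seq_space V \<Otimes>\<^sub>M distr M (PiM UNIV (\<lambda>_. seq_space)) (\<lambda>\<omega> j. Q j \<omega>)"
    and "prob_space.indep_vars M (\<lambda>_. seq_space) Q UNIV"
proof -
  interpret prob_space M by fact
  let ?X = "case_option V Q" and ?P = "PiM UNIV (\<lambda>_::nat. seq_space)"
  have ind: "indep_vars (\<lambda>_. seq_space) ?X UNIV" using FO by (simp add: frag_operator_indep_def)
  have Xm: "?X i \<in> measurable M seq_space" for i using ind by (simp add: indep_vars_def)
  have [measurable]: "V \<in> measurable M seq_space" "Q j \<in> measurable M seq_space" for j
    using Xm[of None] Xm[of "Some j"] by auto
  have [measurable]: "(\<lambda>\<omega> j. Q j \<omega>) \<in> measurable M ?P" "(\<lambda>\<omega> _. V \<omega>) \<in> measurable M ?P"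
    by (rule measurable_PiM_single'; auto simp: space_PiM)+
  have "indep_vars (\<lambda>j. PiM {Some j} (\<lambda>_. seq_space)) (\<lambda>j \<omega>. restrict (\<lambda>i. ?X i \<omega>) {Some j}) (UNIV :: nat set)"
    by (rule indep_vars_restrict[OF ind]) (auto simp: disjoint_family_on_def)
  from indep_vars_compose2[OF this, of "\<lambda>j u. u (Some j)" "\<lambda>_. seq_space"]
  show "indep_vars (\<lambda>_. seq_space) Q UNIV" by simp
  \<comment> \<open>\<open>V\<close> and the whole sequence \<open>Q\<close> are independent as two
    groups of one independent family. Since \<open>indep_var\<close> relates variables of one value
    type, \<open>V\<close> is represented as a constant sequence of partitions and recovered at
    index 0.\<close>
  have "indep_var (PiM {None} (\<lambda>_. seq_space)) (\<lambda>\<omega>. restrict (\<lambda>i. ?X i \<omega>) {None})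
      (PiM (range Some) (\<lambda>_. seq_space)) (\<lambda>\<omega>. restrict (\<lambda>i. ?X i \<omega>) (range Some))"
    by (rule indep_var_restrict[OF ind]) auto
  moreover have "(\<lambda>u _. u None) \<in> measurable (PiM {None} (\<lambda>_. seq_space)) ?P"
    by (rule measurable_PiM_single') (auto simp: space_PiM intro: measurable_component_singleton)
  moreover have "(\<lambda>u j. u (Some j)) \<in> measurable (PiM (range Some) (\<lambda>_. seq_space)) ?P"
    by (rule measurable_PiM_single') (auto simp: space_PiM intro: measurable_component_singleton)
  ultimately have "indep_var ?P ((\<lambda>u _. u None) \<circ> (\<lambda>\<omega>. restrict (\<lambda>i. ?X i \<omega>) {None})) ?P ((\<lambda>u j. u (Some j)) \<circ> (\<lambda>\<omega>. restrict (\<lambda>i. ?X i \<omega>) (range Some)))"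
    by (rule indep_var_compose)
  then have "indep_var ?P (\<lambda>\<omega> _. V \<omega>) ?P (\<lambda>\<omega> j. Q j \<omega>)"
    by (simp add: comp_def)
  then have eq: "distr M ?P (\<lambda>\<omega> _. V \<omega>) \<Otimes>\<^sub>M distr M ?P (\<lambda>\<omega> j. Q j \<omega>) = distr M (?P \<Otimes>\<^sub>M ?P) (\<lambda>\<omega>. ((\<lambda>_. V \<omega>), \<lambda>j. Q j \<omega>))"
    by (simp add: indep_var_distribution_eq)
  interpret DQ: prob_space "distr M ?P (\<lambda>\<omega> j. Q j \<omega>)" by (rule prob_space_distr) simp
  have V: "distr M seq_space V = distr (distr M ?P (\<lambda>\<omega> _. V \<omega>)) seq_space (\<lambda>u. u 0)"
    by (subst distr_distr) (auto simp: comp_def)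
  have Q: "distr M ?P (\<lambda>\<omega> j. Q j \<omega>) = distr (distr M ?P (\<lambda>\<omega> j. Q j \<omega>)) ?P (\<lambda>u. u)"
    by (subst distr_distr) (auto simp: comp_def)
  have "distr M seq_space V \<Otimes>\<^sub>M distr M ?P (\<lambda>\<omega> j. Q j \<omega>)
    = distr (distr M ?P (\<lambda>\<omega> _. V \<omega>) \<Otimes>\<^sub>M distr M ?P (\<lambda>\<omega> j. Q j \<omega>)) (seq_space \<Otimes>\<^sub>M ?P) (\<lambda>(u, q). (u 0, q))"
    unfolding V by (subst (1) Q, rule pair_measure_distr) (auto simp flip: Q intro: DQ.sigma_finite_measure_axioms)
  also have "\<dots> = distr M (seq_space \<Otimes>\<^sub>M ?P) (\<lambda>\<omega>. (V \<omega>, \<lambda>j. Q j \<omega>))"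
    unfolding eq by (subst distr_distr) (auto simp: comp_def split_beta' intro!: measurable_Pair measurable_compose[OF measurable_fst measurable_component_singleton])
  finally show "distr M (seq_space \<Otimes>\<^sub>M ?P) (\<lambda>\<omega>. (V \<omega>, \<lambda>j. Q j \<omega>)) = distr M seq_space V \<Otimes>\<^sub>M distr M ?P (\<lambda>\<omega> j. Q j \<omega>)" ..
qed

context fragmentation
begin

text \<open>On \<open>M\<close> the variables \<open>V\<close> and \<open>W\<close> have the joint
  law of the normalized \<beta>-points and of functions of independent marks, under the weight
  \<open>w\<close>. It serves twice: for the fragmenting partitions with \<open>\<phi>\<close> the
  normalization, and for the Mittag-Leffler variables with \<open>\<phi>\<close> the power
  \<open>- \<alpha>\<close> of the total.\<close>

lemma nn_integral_marked_transfer: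
  fixes W :: "nat \<Rightarrow> 'w \<Rightarrow> 'c"
  assumes M: "prob_space M" and V: "V \<in> measurable M seq_space"
    and ind: "distr M (seq_space \<Otimes>\<^sub>M PiM UNIV (\<lambda>_. S)) (\<lambda>\<omega>. (V \<omega>, \<lambda>j. W j \<omega>))
      = distr M seq_space V \<Otimes>\<^sub>M distr M (PiM UNIV (\<lambda>_. S)) (\<lambda>\<omega> j. W j \<omega>)"
    and indW: "prob_space.indep_vars M (\<lambda>_. S) W UNIV"
    and lawW: "\<And>j. distr M S (W j) = distr mark_law S \<phi>" and \<phi> [measurable]: "\<phi> \<in> measurable seq_space S"
    and w [measurable]: "w \<in> borel_measurable seq_space"
    and lawV: "distr M seq_space V = distr (density \<mu>\<^sub>\<beta> w) seq_space normalize_seq"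
    and \<Phi> [measurable]: "\<Phi> \<in> borel_measurable (seq_space \<Otimes>\<^sub>M PiM UNIV (\<lambda>_::nat. S))"
  shows "(\<integral>\<^sup>+\<omega>. \<Phi> (V \<omega>, \<lambda>j. W j \<omega>) \<partial>M) = (\<integral>\<^sup>+\<omega>. w (fst \<omega>) * \<Phi> (normalize_seq (fst \<omega>), \<lambda>j. \<phi> (snd \<omega> j)) \<partial>marked)"
proof -
  interpret M: prob_space M by fact
  let ?P = "PiM UNIV (\<lambda>_::nat. S)"
  have Wm: "W j \<in> measurable M S" for j using indW by (simp add: M.indep_vars_def)
  have Wm' [measurable]: "(\<lambda>\<omega> j. W j \<omega>) \<in> measurable M ?P" using Wm
    by (intro measurable_PiM_single') (auto simp: space_PiM PiE_iff dest: measurable_space)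
  note [measurable] = V
  have "distr M ?P (\<lambda>\<omega> j. W j \<omega>) = PiM UNIV (\<lambda>j. distr M S (W j))"
    using M.indep_vars_iff_distr_eq_PiM[of UNIV W "\<lambda>_. S"] Wm indW by (simp add: restrict_UNIV)
  also have "\<dots> = PiM UNIV (\<lambda>_. distr mark_law S \<phi>)" by (simp add: lawW)
  also have "\<dots> = distr marks ?P (\<lambda>y j. \<phi> (y j))"
    unfolding marks_def by (rule distr_PiM_componentwise[symmetric]) (auto intro: prob_space_mark_law)
  finally have W: "distr M ?P (\<lambda>\<omega> j. W j \<omega>) = distr marks ?P (\<lambda>y j. \<phi> (y j))" .
  have mm [measurable]: "(\<lambda>y j. \<phi> (y j)) \<in> measurable (PiM UNIV (\<lambda>_::nat. seq_space)) ?P"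
  proof (rule measurable_PiM_single')
    fix j
    have "(\<lambda>y. y j) \<in> measurable (PiM UNIV (\<lambda>_::nat. seq_space)) seq_space" by simp
    then show "(\<lambda>y. \<phi> (y j)) \<in> measurable (PiM UNIV (\<lambda>_::nat. seq_space)) S"
      by (rule measurable_compose[OF _ \<phi>])
  next
    have "\<phi> x \<in> space S" for x using measurable_space[OF \<phi>, of x] by (simp add: space_PiM)
    then show "(\<lambda>y j. \<phi> (y j)) \<in> space (PiM UNIV (\<lambda>_::nat. seq_space)) \<rightarrow> (\<Pi>\<^sub>E j\<in>UNIV. space S)"
      by (auto simp: PiE_iff)
  qed
  have \<Phi>\<phi>: "(\<lambda>z. \<Phi> (fst z, \<lambda>j. \<phi> (snd z j))) \<in> borel_measurable (seq_space \<Otimes>\<^sub>M PiM UNIV (\<lambda>_::nat. seq_space))"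
    by (rule measurable_compose[OF _ \<Phi>]) (intro measurable_Pair measurable_fst measurable_compose[OF measurable_snd mm])
  interpret W: prob_space "distr M ?P (\<lambda>\<omega> j. W j \<omega>)" by (rule M.prob_space_distr) simp
  have "(\<integral>\<^sup>+\<omega>. \<Phi> (V \<omega>, \<lambda>j. W j \<omega>) \<partial>M) = (\<integral>\<^sup>+z. \<Phi> z \<partial>distr M (seq_space \<Otimes>\<^sub>M ?P) (\<lambda>\<omega>. (V \<omega>, \<lambda>j. W j \<omega>)))"
    by (subst nn_integral_distr) simp_all
  also have "\<dots> = (\<integral>\<^sup>+z. \<Phi> z \<partial>(distr M seq_space V \<Otimes>\<^sub>M distr M ?P (\<lambda>\<omega> j. W j \<omega>)))"
    unfolding ind ..
  also have "\<dots> = (\<integral>\<^sup>+v. \<integral>\<^sup>+z. \<Phi> (v, z) \<partial>distr M ?P (\<lambda>\<omega> j. W j \<omega>) \<partial>distr M seq_space V)"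
    by (rule W.nn_integral_fst[symmetric]) (simp cong: measurable_cong_sets sets_pair_measure_cong)
  also have "\<dots> = (\<integral>\<^sup>+v. (\<integral>\<^sup>+y. \<Phi> (v, \<lambda>j. \<phi> (y j)) \<partial>marks) \<partial>distr (density \<mu>\<^sub>\<beta> w) seq_space normalize_seq)"
    unfolding lawV W by (intro nn_integral_cong nn_integral_distr) (auto simp: space_PiM)
  also have "\<dots> = (\<integral>\<^sup>+x. w x * (\<integral>\<^sup>+y. \<Phi> (normalize_seq x, \<lambda>j. \<phi> (y j)) \<partial>marks) \<partial>\<mu>\<^sub>\<beta>)"
  proof -
    have pc: "measurable (seq_space \<Otimes>\<^sub>M marks) N = measurable (seq_space \<Otimes>\<^sub>M PiM UNIV (\<lambda>_. seq_space)) N" for N :: "'z measure"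
      by (intro measurable_cong_sets sets_pair_measure_cong) auto
    have [measurable]: "(\<lambda>v. \<integral>\<^sup>+y. \<Phi> (v, \<lambda>j. \<phi> (y j)) \<partial>marks) \<in> borel_measurable seq_space"
      by (rule marks.borel_measurable_nn_integral)
         (unfold split_beta' pc, rule \<Phi>\<phi>)
    show ?thesis by (subst nn_integral_distr, simp, simp, subst nn_integral_density) simp_all
  qed
  also have "\<dots> = (\<integral>\<^sup>+x. \<integral>\<^sup>+y. w x * \<Phi> (normalize_seq x, \<lambda>j. \<phi> (y j)) \<partial>marks \<partial>\<mu>\<^sub>\<beta>)"
    by (intro nn_integral_cong nn_integral_cmult[symmetric])
       (auto simp: space_PiM intro!: measurable_compose[OF _ \<Phi>] measurable_Pair mm)
  also have "\<dots> = (\<integral>\<^sup>+\<omega>. w (fst \<omega>) * \<Phi> (normalize_seq (fst \<omega>), \<lambda>j. \<phi> (snd \<omega> j)) \<partial>marked)"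
    unfolding marked_def
  proof (subst marks.nn_integral_fst[symmetric])
    have "(\<lambda>\<omega>. \<Phi> (normalize_seq (fst \<omega>), \<lambda>j. \<phi> (snd \<omega> j))) \<in> borel_measurable (seq_space \<Otimes>\<^sub>M PiM UNIV (\<lambda>_::nat. seq_space))"
      by (rule measurable_compose[OF _ \<Phi>])
         (intro measurable_Pair measurable_compose[OF measurable_fst normalize_seq_measurable] measurable_compose[OF measurable_snd mm])
    then show "(\<lambda>\<omega>. w (fst \<omega>) * \<Phi> (normalize_seq (fst \<omega>), \<lambda>j. \<phi> (snd \<omega> j))) \<in> borel_measurable (\<mu>\<^sub>\<beta> \<Otimes>\<^sub>M marks)"
      by (simp flip: marked_def)
  qed simp
  finally show ?thesis .
qed

text \<open>The power \<open>- \<beta>\<close> of \<open>time powr (1 / \<alpha>) * v\<close>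
  separates into \<open>time powr (- (\<beta> / \<alpha>))\<close> and
  \<open>v powr (- \<beta>)\<close>; the mean over the stable time of index
  \<open>\<beta> / \<alpha>\<close> is then a Mittag-Leffler value.\<close>

lemma nn_integral_mittag_leffler_tilt:
  assumes lam: "0 \<le> lam" and c: "0 < c" and v: "0 < v"
  shows "(\<integral>\<^sup>+\<omega>. ennreal (exp (- lam * (time \<omega> powr (1 / \<alpha>) * v) powr (- \<beta>)) / c) \<partial>marked)
    = ennreal (mittag_leffler (\<beta> / \<alpha>) (- lam * v powr (- \<beta>)) / c)"
proof -
  have tm: "time \<in> borel_measurable marked" by simp
  have pos: "AE \<omega> in marked. 0 < time \<omega>" using AE_time by eventually_elim simp
  have "(\<integral>\<^sup>+\<omega>. ennreal (exp (- lam * (time \<omega> powr (1 / \<alpha>) * v) powr (- \<beta>)) / c) \<partial>marked)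
    = (\<integral>\<^sup>+\<omega>. ennreal (1 / c) * ennreal (exp (- (lam * v powr (- \<beta>)) * time \<omega> powr (- (\<beta> / \<alpha>)))) \<partial>marked)"
  proof (rule nn_integral_cong_AE, use pos in eventually_elim)
    case (elim \<omega>)
    have "(time \<omega> powr (1 / \<alpha>) * v) powr (- \<beta>) = time \<omega> powr (- (\<beta> / \<alpha>)) * v powr (- \<beta>)"
      using elim v by (simp add: powr_mult powr_powr)
    then show ?case using c by (simp add: ennreal_mult[symmetric] mult_ac)
  qed
  also have "\<dots> = ennreal (1 / c) * ennreal (mittag_leffler (\<beta> / \<alpha>) (- (lam * v powr (- \<beta>))))"
    using mittag_leffler_eq_laplace(1)[OF marked.prob_space_axioms tm pos time_laplace indices(6), of "lam * v powr (- \<beta>)"] lam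
    by (subst nn_integral_cmult) simp_all
  also have "\<dots> = ennreal (mittag_leffler (\<beta> / \<alpha>) (- lam * v powr (- \<beta>)) / c)"
    using mittag_leffler_eq_laplace(2)[OF marked.prob_space_axioms tm pos time_laplace indices(6), of "lam * v powr (- \<beta>)"] lam c
    by (simp add: ennreal_mult[symmetric])
  finally show ?thesis .
qed

lemma mittag_leffler_nonneg:
  assumes "0 \<le> z"
  shows "0 \<le> mittag_leffler (\<beta> / \<alpha>) (- z)"
proof -
  have tm: "time \<in> borel_measurable marked" by simp
  have pos: "AE \<omega> in marked. 0 < time \<omega>" using AE_time by eventually_elim simp
  show ?thesis
    using mittag_leffler_eq_laplace(2)[OF marked.prob_space_axioms tm pos time_laplace indices(6) assms] by simp
qed

end

lemma frag_measurable [measurable]: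
  "(\<lambda>z. frag (fst z) (snd z)) \<in> measurable (seq_space \<Otimes>\<^sub>M PiM UNIV (\<lambda>_::nat. seq_space)) seq_space"
proof -
  have [measurable]: "(\<lambda>z. snd z i l) \<in> borel_measurable (seq_space \<Otimes>\<^sub>M PiM UNIV (\<lambda>_::nat. seq_space))" for i l
  proof -
    have "(\<lambda>z. snd z i) \<in> measurable (seq_space \<Otimes>\<^sub>M PiM UNIV (\<lambda>_::nat. seq_space)) seq_space"
      by (rule measurable_compose[OF measurable_snd measurable_component_singleton]) simp
    then show ?thesis by (rule measurable_compose) simp
  qed
  show ?thesis unfolding frag_def
    by (rule measurable_ranked) (auto simp: finite_prod split: prod.split)
qed

context fragmentation
begin

text \<open>A test function of the first component yields the law of the fragmented partition, one
  of the second component the law of the series.\<close>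

lemma nn_integral_frag_tilt:
  assumes lam: "0 \<le> lam" and c: "0 < c"
    and \<Phi>: "\<Phi> \<in> borel_measurable (seq_space \<Otimes>\<^sub>M borel)"
  shows "(\<integral>\<^sup>+\<omega>. ennreal (exp (- lam * suminf (fst \<omega>) powr (- \<beta>)) / c)
      * \<Phi> (frag (normalize_seq (fst \<omega>)) (\<lambda>j. normalize_seq (snd \<omega> j)), local_time_sum \<omega>) \<partial>marked)
    = (\<integral>\<^sup>+x. ennreal (mittag_leffler (\<beta> / \<alpha>) (- lam * suminf x powr (- \<beta>)) / c)
      * \<Phi> (normalize_seq x, suminf x powr (- \<alpha>)) \<partial>\<mu>\<^sub>\<alpha>)"
  using frag_local_time_law[OF _ \<Phi>, of "\<lambda>t. ennreal (exp (- lam * t powr (- \<beta>)) / c)"]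
    nn_integral_mittag_leffler_tilt[OF lam c]
  by (simp, intro nn_integral_cong_AE, use A.AE_regular in eventually_elim) (simp add: regular_seqD(4))

text \<open>In the variable \<open>s = T powr (- \<alpha>)\<close> the tilt
  \<open>T powr \<beta>\<close> becomes \<open>s powr (- \<beta> / \<alpha>)\<close>, and its
  normalizing moment is the integral in the denominator of
  \<open>mittag_leffler_dens\<close>.\<close>

lemma distr_mark_local_time:
  assumes f: "distr \<mu>\<^sub>\<alpha> borel suminf = density lborel (\<lambda>t. ennreal (f t))"
    and f0: "\<And>t. 0 \<le> f t" and [measurable]: "f \<in> borel_measurable borel"
  shows "distr mark_law borel (\<lambda>y. suminf y powr (- \<alpha>)) = density lborel (\<lambda>s. ennreal (mittag_leffler_dens \<alpha> (- \<beta>) f s))"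
proof -
  define m where "m = (LBINT t:{0<..}. t powr (- (- \<beta>)) * f t)"
  have "A.moment (- \<beta>) = (\<integral>\<^sup>+x. ennreal (suminf x powr \<beta>) * indicator {0<..} (suminf x) \<partial>\<mu>\<^sub>\<alpha>)"
    unfolding A.moment_def
    by (rule nn_integral_cong_AE, use A.AE_regular in eventually_elim) (simp add: regular_seqD(4))
  also have "\<dots> = (\<integral>\<^sup>+t. ennreal (t powr \<beta>) * indicator {0<..} t \<partial>distr \<mu>\<^sub>\<alpha> borel suminf)"
    by (subst nn_integral_distr) simp_all
  also have "\<dots> = (\<integral>\<^sup>+t. ennreal (indicator {0<..} t * (t powr (- (- \<beta>)) * f t)) \<partial>lborel)"
    unfolding f by (subst nn_integral_density) (auto intro!: nn_integral_cong simp: indicator_def ennreal_mult f0 mult_ac)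
  finally have mom: "A.moment (- \<beta>) = (\<integral>\<^sup>+t. ennreal (indicator {0<..} t * (t powr (- (- \<beta>)) * f t)) \<partial>lborel)" .
  have "integrable lborel (\<lambda>t. indicator {0<..} t * (t powr (- (- \<beta>)) * f t))"
    using moment_bounds(2) unfolding mom by (intro integrableI_nonneg) (auto simp: f0 indicator_def)
  then have mm: "A.moment (- \<beta>) = ennreal m"
    unfolding mom m_def set_lebesgue_integral_def
    by (subst nn_integral_eq_integral) (auto simp: f0 indicator_def)
  have m: "0 < m" using moment_bounds(1) unfolding mm by (simp add: ennreal_less_zero_iff)
  have "mark_law = density \<mu>\<^sub>\<alpha> (\<lambda>x. ennreal (suminf x powr \<beta> / m))"
    unfolding mark_law_def mm using m by (simp add: divide_ennreal)
  then have "distr mark_law borel (\<lambda>y. suminf y powr (- \<alpha>)) = density lborel (\<lambda>s. ennreal ((s powr (- 1 / \<alpha>)) powr \<beta> / m * g_dens \<alpha> f s))"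
    using A.distr_inverse_power[OF f f0, of "\<lambda>t. t powr \<beta> / m"] m by simp
  also have "(\<lambda>s. (s powr (- 1 / \<alpha>)) powr \<beta> / m * g_dens \<alpha> f s) = mittag_leffler_dens \<alpha> (- \<beta>) f"
    unfolding mittag_leffler_dens_def[abs_def] m_def[symmetric] by (simp add: powr_powr fun_eq_iff)
  finally show ?thesis by simp
qed

end

text \<open>The space \<open>M\<close> is arbitrary, so it is compared with the marked points
  through laws only. \<open>L\<close> is fixed before \<open>Z\<close>: the diversity is determined
  by the fragmented partition, and the series matches it in law for every admissible
  \<open>Z\<close>.\<close>

theorem proposition4p6:
  fixes \<alpha> \<beta> lam :: real
    and N\<^sub>\<alpha> :: "'a measure" and J\<^sub>\<alpha> :: "nat \<Rightarrow> 'a \<Rightarrow> real"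
    and f\<^sub>\<alpha> :: "real \<Rightarrow> real" and K\<^sub>\<alpha> :: "real \<Rightarrow> (nat \<Rightarrow> real) measure"
    and N\<^sub>\<beta> :: "'b measure" and J\<^sub>\<beta> :: "nat \<Rightarrow> 'b \<Rightarrow> real"
    and f\<^sub>\<beta> :: "real \<Rightarrow> real" and K\<^sub>\<beta> :: "real \<Rightarrow> (nat \<Rightarrow> real) measure"
    and M :: "'w measure" and V :: "'w \<Rightarrow> nat \<Rightarrow> real" and Q :: "nat \<Rightarrow> 'w \<Rightarrow> nat \<Rightarrow> real"
  assumes "0 < \<beta>" "\<beta> < \<alpha>" "\<alpha> < 1" "0 < lam"
    and "ranked_stable_points \<alpha> N\<^sub>\<alpha> J\<^sub>\<alpha>" "density_of_total_mass N\<^sub>\<alpha> J\<^sub>\<alpha> f\<^sub>\<alpha>"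
        "regular_conditional_PD N\<^sub>\<alpha> J\<^sub>\<alpha> K\<^sub>\<alpha>"
    and "ranked_stable_points \<beta> N\<^sub>\<beta> J\<^sub>\<beta>" "density_of_total_mass N\<^sub>\<beta> J\<^sub>\<beta> f\<^sub>\<beta>"
        "regular_conditional_PD N\<^sub>\<beta> J\<^sub>\<beta> K\<^sub>\<beta>"
    and "prob_space M" "V \<in> measurable M seq_space"
    and "distr M seq_space V
           = PK K\<^sub>\<beta> f\<^sub>\<beta> (\<lambda>t. exp (- lam * t powr (- \<beta>)) / mittag_leffler \<beta> (- lam))"
    and "frag_operator_indep M \<alpha> (- \<beta>) V Q"
  shows
    "(distr M seq_space (\<lambda>\<omega>. frag (V \<omega>) (\<lambda>i. Q i \<omega>))
       = PK K\<^sub>\<alpha> f\<^sub>\<alpha> (\<lambda>v. mittag_leffler (\<beta> / \<alpha>) (- lam * v powr (- \<beta>)) / mittag_leffler \<beta> (- lam)))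
     \<and>
     (\<exists>L. diversity M \<alpha> (\<lambda>\<omega>. frag (V \<omega>) (\<lambda>i. Q i \<omega>)) L \<and>
         distributed M lborel L
           (\<lambda>s. ennreal (mittag_leffler (\<beta> / \<alpha>) (- lam * s powr (\<beta> / \<alpha>)) * g_dens \<alpha> f\<^sub>\<alpha> s
                          / mittag_leffler \<beta> (- lam))) \<and>
         (\<forall>Z :: nat \<Rightarrow> 'w \<Rightarrow> real.
            (\<forall>j. distributed M lborel (Z j) (\<lambda>s. ennreal (mittag_leffler_dens \<alpha> (- \<beta>) f\<^sub>\<alpha> s))) \<longrightarrow>
            prob_space.indep_vars M (\<lambda>_. borel) Z UNIV \<longrightarrow>
            prob_space.indep_var M seq_space V seq_space (\<lambda>\<omega> j. Z j \<omega>) \<longrightarrow>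
            (AE \<omega> in M. summable (\<lambda>j. V \<omega> j powr \<alpha> * Z j \<omega>)) \<and>
            distr M borel L = distr M borel (\<lambda>\<omega>. \<Sum>j. V \<omega> j powr \<alpha> * Z j \<omega>)))"
proof -
  define \<mu>\<^sub>\<alpha> \<mu>\<^sub>\<beta> where "\<mu>\<^sub>\<alpha> = distr N\<^sub>\<alpha> seq_space (\<lambda>\<omega> i. J\<^sub>\<alpha> i \<omega>)" and "\<mu>\<^sub>\<beta> = distr N\<^sub>\<beta> seq_space (\<lambda>\<omega> i. J\<^sub>\<beta> i \<omega>)"
  interpret F: fragmentation \<alpha> \<beta> \<mu>\<^sub>\<alpha> \<mu>\<^sub>\<beta>
    unfolding \<mu>\<^sub>\<alpha>_def \<mu>\<^sub>\<beta>_def using assms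
    by (intro fragmentation.intro fragmentation_axioms.intro stable_law_of_ranked_stable_points) auto
  interpret prob_space M by fact
  note [measurable] = \<open>V \<in> measurable M seq_space\<close>
  define c where "c = mittag_leffler \<beta> (- lam)"
  define h where "h v = mittag_leffler (\<beta> / \<alpha>) (- lam * v powr (- \<beta>)) / c" for v
  have c: "0 < c"
    unfolding c_def
    by (rule mittag_leffler_eq_laplace(2)[OF F.B.prob_space_axioms, of suminf])
       (use F.B.AE_regular F.B.laplace_suminf assms(1,4) in \<open>auto elim!: eventually_mono intro: regular_seqD(4)\<close>)
  have h0: "0 \<le> h v" for v
    using F.mittag_leffler_nonneg[of "lam * v powr (- \<beta>)"] assms(4) c by (simp add: h_def)
  have hm [measurable]: "h \<in> borel_measurable borel"
    unfolding h_def[abs_def] by measurable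

  have lawV: "distr M seq_space V
    = distr (density \<mu>\<^sub>\<beta> (\<lambda>x. ennreal (exp (- lam * suminf x powr (- \<beta>)) / c))) seq_space normalize_seq"
    unfolding assms(13) \<mu>\<^sub>\<beta>_def c_def[symmetric] using c assms(1-3)
    by (intro PK_eq_distr[OF assms(8) _ _ assms(9,10)]) auto

  \<comment> \<open>Part (i): the law of the fragmented partition\<close>
  let ?P = "\<lambda>\<omega>. frag (V \<omega>) (\<lambda>i. Q i \<omega>)"
  let ?D = "density \<mu>\<^sub>\<alpha> (\<lambda>x. ennreal (h (suminf x)))"
  note indQ = frag_operator_indep_product[OF prob_space_axioms assms(14)]
  have Qm: "Q j \<in> measurable M seq_space" for j using indQ(2) by (simp add: indep_vars_def)
  have Qm' [measurable]: "(\<lambda>\<omega> j. Q j \<omega>) \<in> measurable M (PiM UNIV (\<lambda>_. seq_space))"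
    using Qm by (intro measurable_PiM_single') (auto simp: space_PiM)
  have Pm [measurable]: "?P \<in> measurable M seq_space"
    using measurable_compose[OF measurable_Pair[OF assms(12) Qm'] frag_measurable] by simp
  have lawQ: "distr M seq_space (Q j) = distr F.mark_law seq_space normalize_seq" for j
    using assms(14) by (simp add: frag_operator_indep_def F.distr_mark_law)
  \<comment> \<open>Moved to the marked points, the tilt of \<open>V\<close> is a function of the
    \<beta>-stable total; averaging out the time turns it into the weight \<open>h\<close> on the
    \<alpha>-stable points.\<close>
  have fragment: "(\<integral>\<^sup>+\<omega>. \<Psi> (?P \<omega>) \<partial>M) = (\<integral>\<^sup>+x. ennreal (h (suminf x)) * \<Psi> (normalize_seq x) \<partial>\<mu>\<^sub>\<alpha>)"
    if [measurable]: "\<Psi> \<in> borel_measurable seq_space" for \<Psi>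
    using F.nn_integral_marked_transfer[OF prob_space_axioms assms(12) indQ lawQ normalize_seq_measurable _ lawV, of "\<lambda>z. \<Psi> (frag (fst z) (snd z))"]
      F.nn_integral_frag_tilt[of lam c "\<lambda>z. \<Psi> (fst z)"] assms(4) c
    by (simp add: h_def)
  have lawP: "distr M seq_space ?P = distr ?D seq_space normalize_seq"
  proof (rule measure_eqI)
    fix A assume "A \<in> sets (distr M seq_space ?P)"
    then have A [measurable]: "A \<in> sets seq_space" by simp
    have "emeasure (distr M seq_space ?P) A = (\<integral>\<^sup>+p. indicator A p \<partial>distr M seq_space ?P)" by simp
    also have "\<dots> = (\<integral>\<^sup>+\<omega>. indicator A (?P \<omega>) \<partial>M)"
      by (rule nn_integral_distr) simp_all
    also have "\<dots> = (\<integral>\<^sup>+x. ennreal (h (suminf x)) * indicator A (normalize_seq x) \<partial>\<mu>\<^sub>\<alpha>)"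
      by (rule fragment) simp
    also have "\<dots> = (\<integral>\<^sup>+x. indicator A (normalize_seq x) \<partial>?D)"
      by (rule nn_integral_density[symmetric]) simp_all
    also have "\<dots> = (\<integral>\<^sup>+p. indicator A p \<partial>distr ?D seq_space normalize_seq)"
      by (rule nn_integral_distr[symmetric]) simp_all
    finally show "emeasure (distr M seq_space ?P) A = emeasure (distr ?D seq_space normalize_seq) A" by simp
  qed simp
  have i: "distr M seq_space ?P = PK K\<^sub>\<alpha> f\<^sub>\<alpha> (\<lambda>v. mittag_leffler (\<beta> / \<alpha>) (- lam * v powr (- \<beta>)) / mittag_leffler \<beta> (- lam))"
    unfolding lawP \<mu>\<^sub>\<alpha>_def c_def[symmetric] h_def[symmetric] using assms(1-3)
    by (intro PK_eq_distr[OF assms(5) _ _ assms(6,7), symmetric]) (auto simp: h0)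

  \<comment> \<open>The diversity of the fragmented partition and its density\<close>
  have f0: "0 \<le> f\<^sub>\<alpha> t" for t using assms(6) by (simp add: density_of_total_mass_def)
  have fm [measurable]: "f\<^sub>\<alpha> \<in> borel_measurable borel" by (rule density_of_total_mass_measurable[OF assms(6)])
  have law_total: "distr \<mu>\<^sub>\<alpha> borel suminf = density lborel (\<lambda>t. ennreal (f\<^sub>\<alpha> t))"
  proof -
    have "(\<lambda>\<omega> i. J\<^sub>\<alpha> i \<omega>) \<in> measurable N\<^sub>\<alpha> seq_space"
      using assms(5) by (intro measurable_PiM_single') (auto simp: ranked_stable_points_def poisson_process_def)
    then have "distr \<mu>\<^sub>\<alpha> borel suminf = distr N\<^sub>\<alpha> borel (total_mass J\<^sub>\<alpha>)"
      unfolding \<mu>\<^sub>\<alpha>_def by (subst distr_distr) (simp_all add: comp_def total_mass_def[abs_def])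
    also have "\<dots> = density lborel (\<lambda>t. ennreal (f\<^sub>\<alpha> t))"
      using assms(6) by (auto simp: density_of_total_mass_def distributed_def distr_def)
    finally show ?thesis .
  qed

  \<comment> \<open>As a measurable functional of the partition, the diversity inherits both its
    almost sure meaning and its law from the law of \<open>?P\<close> found in part (i).\<close>
  define L where "L \<omega> = diversity_of \<alpha> (?P \<omega>)" for \<omega>
  have Lm [measurable]: "L \<in> borel_measurable M" unfolding L_def[abs_def] by measurable
  have AE_D: "AE x in ?D. regularly_varying_seq \<alpha> (normalize_seq x) \<and> diversity_of \<alpha> (normalize_seq x) = suminf x powr (- \<alpha>)"
    by (subst AE_density, simp, use F.A.AE_diversity_of_normalize in eventually_elim) simp
  have "AE p in distr ?D seq_space normalize_seq. regularly_varying_seq \<alpha> p"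
    by (subst AE_distr_iff) (use AE_D in \<open>auto elim!: eventually_mono\<close>)
  then have "AE \<omega> in M. regularly_varying_seq \<alpha> (?P \<omega>)"
    unfolding lawP[symmetric] by (subst (asm) AE_distr_iff) auto
  then have div: "diversity M \<alpha> ?P L"
    unfolding diversity_def L_def[abs_def] using assms(1-3)
    by (auto elim!: eventually_mono intro: regularly_varying_diversity)

  have "distr M borel L = distr (distr M seq_space ?P) borel (diversity_of \<alpha>)"
    by (subst distr_distr) (simp_all add: comp_def L_def[abs_def])
  also have "\<dots> = distr ?D borel (\<lambda>x. diversity_of \<alpha> (normalize_seq x))"
    unfolding lawP by (subst distr_distr) (simp_all add: comp_def)
  also have "\<dots> = distr ?D borel (\<lambda>x. suminf x powr (- \<alpha>))"
    by (rule distr_cong_AE) (use AE_D in \<open>auto elim!: eventually_mono\<close>)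
  finally have lawL: "distr M borel L = distr ?D borel (\<lambda>x. suminf x powr (- \<alpha>))" .
  also have "\<dots> = density lborel (\<lambda>s. ennreal (h (s powr (- 1 / \<alpha>)) * g_dens \<alpha> f\<^sub>\<alpha> s))"
    by (rule F.A.distr_inverse_power[OF law_total f0]) (simp_all add: h0)
  also have "(\<lambda>s. h (s powr (- 1 / \<alpha>)) * g_dens \<alpha> f\<^sub>\<alpha> s)
    = (\<lambda>s. mittag_leffler (\<beta> / \<alpha>) (- lam * s powr (\<beta> / \<alpha>)) * g_dens \<alpha> f\<^sub>\<alpha> s / mittag_leffler \<beta> (- lam))"
    by (simp add: h_def c_def powr_powr fun_eq_iff)
  finally have "distributed M lborel L
      (\<lambda>s. ennreal (mittag_leffler (\<beta> / \<alpha>) (- lam * s powr (\<beta> / \<alpha>)) * g_dens \<alpha> f\<^sub>\<alpha> s / mittag_leffler \<beta> (- lam)))"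
    by (auto simp: distributed_def distr_def g_dens_def)

  \<comment> \<open>The series representation of the diversity\<close>
  moreover have "(AE \<omega> in M. summable (\<lambda>j. V \<omega> j powr \<alpha> * Z j \<omega>)) \<and>
      distr M borel L = distr M borel (\<lambda>\<omega>. \<Sum>j. V \<omega> j powr \<alpha> * Z j \<omega>)"
    if Z: "\<And>j. distributed M lborel (Z j) (\<lambda>s. ennreal (mittag_leffler_dens \<alpha> (- \<beta>) f\<^sub>\<alpha> s))"
      and indZ: "indep_vars (\<lambda>_. borel) Z UNIV"
      and indVZ: "indep_var seq_space V seq_space (\<lambda>\<omega> j. Z j \<omega>)" for Z
  proof -
    have [measurable]: "Z j \<in> borel_measurable M" for j using indZ by (simp add: indep_vars_def)
    have lawZ: "distr M borel (Z j) = distr F.mark_law borel (\<lambda>y. suminf y powr (- \<alpha>))" for j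
      using Z[of j] F.distr_mark_local_time[OF law_total f0 fm] by (auto simp: distributed_def distr_def)
    have ind: "distr M (seq_space \<Otimes>\<^sub>M seq_space) (\<lambda>\<omega>. (V \<omega>, \<lambda>j. Z j \<omega>)) = distr M seq_space V \<Otimes>\<^sub>M distr M seq_space (\<lambda>\<omega> j. Z j \<omega>)"
      using indVZ by (simp add: indep_var_distribution_eq)
    have VZ [measurable]: "(\<lambda>\<omega>. (V \<omega>, \<lambda>j. Z j \<omega>)) \<in> measurable M (seq_space \<Otimes>\<^sub>M seq_space)"
      by (intro measurable_Pair assms(12) measurable_PiM_single') auto
    let ?S = "\<lambda>z j. fst z j powr \<alpha> * snd z j"
    have sm [measurable]: "Measurable.pred (seq_space \<Otimes>\<^sub>M seq_space) (\<lambda>z. summable (?S z))"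
      unfolding summable_iff_convergent Cauchy_convergent_iff[symmetric] pred_def
      by (rule sets_Collect_Cauchy) measurable
    \<comment> \<open>Here the marks enter only through the power \<open>- \<alpha>\<close> of their
      totals, which has the law of each \<open>Z j\<close>.\<close>
    have transfer: "(\<integral>\<^sup>+\<omega>. \<Psi> (V \<omega>, \<lambda>j. Z j \<omega>) \<partial>M)
      = (\<integral>\<^sup>+\<omega>. ennreal (exp (- lam * suminf (fst \<omega>) powr (- \<beta>)) / c) * \<Psi> (normalize_seq (fst \<omega>), \<lambda>j. suminf (snd \<omega> j) powr (- \<alpha>)) \<partial>F.marked)"
      if "\<Psi> \<in> borel_measurable (seq_space \<Otimes>\<^sub>M seq_space)" for \<Psi>
      by (rule F.nn_integral_marked_transfer[OF prob_space_axioms assms(12) ind indZ lawZ _ _ lawV that]) simp_all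
    \<comment> \<open>Almost sure summability is transferred as the vanishing of an integral:
      divergence is a measurable event, and on the marked points it is null because the clock is
      finite.\<close>
    have ns [measurable]: "{z. \<not> summable (?S z)} \<in> sets (seq_space \<Otimes>\<^sub>M seq_space)"
      using sets.sets_Collect_neg[OF sm[unfolded pred_def]] by (simp add: space_pair_measure space_PiM)
    have "(\<integral>\<^sup>+\<omega>. indicator {z. \<not> summable (?S z)} (V \<omega>, \<lambda>j. Z j \<omega>) \<partial>M)
      = (\<integral>\<^sup>+\<omega>. ennreal (exp (- lam * suminf (fst \<omega>) powr (- \<beta>)) / c) * indicator {z. \<not> summable (?S z)} (normalize_seq (fst \<omega>), \<lambda>j. suminf (snd \<omega> j) powr (- \<alpha>)) \<partial>F.marked)"
      by (rule transfer) simp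
    also have "\<dots> = (\<integral>\<^sup>+\<omega>. 0 \<partial>F.marked)"
      by (rule nn_integral_cong_AE, use F.AE_local_time_sum in eventually_elim) simp
    finally have "(\<integral>\<^sup>+\<omega>. indicator {z. \<not> summable (?S z)} (V \<omega>, \<lambda>j. Z j \<omega>) \<partial>M) = 0" by simp
    then have "AE \<omega> in M. indicator {z. \<not> summable (?S z)} (V \<omega>, \<lambda>j. Z j \<omega>) = (0 :: ennreal)"
      by (subst (asm) nn_integral_0_iff_AE) (auto intro!: measurable_compose[OF VZ])
    then have AE: "AE \<omega> in M. summable (\<lambda>j. V \<omega> j powr \<alpha> * Z j \<omega>)"
      by eventually_elim (simp split: split_indicator_asm)
    have "distr M borel (\<lambda>\<omega>. \<Sum>j. V \<omega> j powr \<alpha> * Z j \<omega>) = distr ?D borel (\<lambda>x. suminf x powr (- \<alpha>))"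
    proof (rule measure_eqI)
      fix A assume "A \<in> sets (distr M borel (\<lambda>\<omega>. \<Sum>j. V \<omega> j powr \<alpha> * Z j \<omega>))"
      then have A [measurable]: "A \<in> sets borel" by simp
      have "emeasure (distr M borel (\<lambda>\<omega>. \<Sum>j. V \<omega> j powr \<alpha> * Z j \<omega>)) A
        = (\<integral>\<^sup>+s. indicator A s \<partial>distr M borel (\<lambda>\<omega>. \<Sum>j. V \<omega> j powr \<alpha> * Z j \<omega>))" by simp
      also have "\<dots> = (\<integral>\<^sup>+\<omega>. indicator A (suminf (?S (V \<omega>, \<lambda>j. Z j \<omega>))) \<partial>M)"
        by (subst nn_integral_distr) simp_all
      also have "\<dots> = (\<integral>\<^sup>+\<omega>. ennreal (exp (- lam * suminf (fst \<omega>) powr (- \<beta>)) / c) * indicator A (F.local_time_sum \<omega>) \<partial>F.marked)"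
        by (subst transfer) (simp_all add: F.local_time_sum_def)
      also have "\<dots> = (\<integral>\<^sup>+x. ennreal (h (suminf x)) * indicator A (suminf x powr (- \<alpha>)) \<partial>\<mu>\<^sub>\<alpha>)"
        using F.nn_integral_frag_tilt[of lam c "\<lambda>z. indicator A (snd z)"] assms(4) c by (simp add: h_def)
      also have "\<dots> = (\<integral>\<^sup>+x. indicator A (suminf x powr (- \<alpha>)) \<partial>?D)"
        by (rule nn_integral_density[symmetric]) simp_all
      also have "\<dots> = (\<integral>\<^sup>+s. indicator A s \<partial>distr ?D borel (\<lambda>x. suminf x powr (- \<alpha>)))"
        by (rule nn_integral_distr[symmetric]) simp_all
      finally show "emeasure (distr M borel (\<lambda>\<omega>. \<Sum>j. V \<omega> j powr \<alpha> * Z j \<omega>)) A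
        = emeasure (distr ?D borel (\<lambda>x. suminf x powr (- \<alpha>))) A" by simp
    qed simp
    then show ?thesis using AE lawL by simp
  qed
  ultimately show ?thesis using i div by blast
qed

end
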